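(* Let $L>0$ and let $V$, $f$, $u_0$, $u_1$ satisfy the assumptions (A0)–(A3) on $[0,L]$ listed in the context. Then the problem $$\begin{cases} V(x)u_{tt}(x,t)-u_{xx}(x,t)=0, & x\in[0,L],\ t\in[0,\infty),\\ u_x(0,t)=(f(u_t(0,t)))_t, & t\in[0,\infty),\\ u(x,0)=u_0(x),\quad u_t(x,0)=u_1(x), & x\in[0,L],\\ u(L,t)=0, & t\in[0,\infty)\end{cases}$$ admits a unique and global $C^1$-solution $u$. Moreover, the energy $$E(u,t)=\tfrac12\int_0^L\left(V(x)u_t(x,t)^2+u_x(x,t)^2\right)\mathrm{d}x+F(u_t(0,t)),\qquad F(s)=sf(s)-\int_0^sf(\sigma)\,\mathrm{d}\sigma,$$ is time-invariant.
   Context: All functions are real-valued. For a closed interval $I\subseteq\mathbb{R}$, a function $\phi:I\to\mathbb{R}$ is piecewise $C^k$, written $\phi\in PC^k(I)$, if there is a discrete set $D\subseteq I$ with $\phi\in C^k(I\setminus D)$ such that the one-sided limits $\phi^{(j)}(x-)$, $\phi^{(j)}(x+)$ exist for all $x\in D$, $0\le j\le k$ (they need not coincide); if $I$ is bounded from below (above), also $\phi^{(j)}(\min I+)$ (resp. $\phi^{(j)}(\max I-)$) is required to exist for $0\le j\le k$. $D(\phi)$ denotes the set of discontinuities of $\phi$. Assumptions (adapted to $[0,L]$): (A0) $u_0\in C^1([0,L])$, $u_1\in C([0,L])$. (A1) $V\in PC^1([0,L])$, $V,V'\in L^\infty$, $\inf V>0$. (A2) $\inf\{|d_1-d_2| :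 d_1,d_2\in D(V)\cup\{0\},\ d_1\neq d_2\}>0$. (A3) $f:\mathbb{R}\to\mathbb{R}$ is an increasing homeomorphism. Put $c(x)=1/\sqrt{V(x)}$. A global $C^1$-solution is a function $u\in C^1([0,L]\times[0,\infty))$ such that: (i) for all $(x,t)\in[0,L]\times[0,\infty)$ with $x\notin D(c)\cup D(c')$, $(\partial_t-c(x)\partial_x)(u_t+c(x)u_x)(x,t)=-c(x)c'(x)u_x(x,t)$, where the outer operator is understood as a directional derivative; (ii) $(f(u_t(0,t)))_t=u_x(0,t)$ for all $t\ge0$; (iii) $u(x,0)=u_0(x)$ and $u_t(x,0)=u_1(x)$ for all $x\in[0,L]$; (iv) $u(L,t)=0$ for all $t\ge0$.
   Formalization: The compatibility conditions u_0(L)=0 and u_1(L)=0, necessary for a C^1-solution with u(L,t)=0 (u_0=1 is a counterexample), are added as hypotheses; the directional derivative in (i) is taken along the characteristics of ∂_t-c(x)∂_x. *)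

theory Defs
  imports "HOL-Analysis.Analysis"
begin

text \<open>Derivatives on a closed interval are taken within the interval, so that they are
  one-sided at its end points.\<close>

definition deriv_on :: "real set \<Rightarrow> (real \<Rightarrow> real) \<Rightarrow> real \<Rightarrow> real" where
  "deriv_on A \<phi> x = vector_derivative \<phi> (at x within A)"

definition Ck_on :: "nat \<Rightarrow> real set \<Rightarrow> (real \<Rightarrow> real) \<Rightarrow> bool" where
  "Ck_on k A \<phi> \<longleftrightarrow>
     (\<forall>j<k. \<forall>x\<in>A. (deriv_on A ^^ j) \<phi> differentiable (at x within A)) \<and>
     (\<forall>j\<le>k. continuous_on A ((deriv_on A ^^ j) \<phi>))"

text \<open>The one-sided limits are limits within \<open>I - D\<close>. At \<open>Min I\<close> the left limit, and at \<open>Max I\<close> the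
  right limit, is a limit along the trivial filter, so nothing is required of it.\<close>

definition PCk :: "nat \<Rightarrow> real set \<Rightarrow> (real \<Rightarrow> real) \<Rightarrow> bool" where
  "PCk k I \<phi> \<longleftrightarrow>
     (\<exists>D\<subseteq>I. discrete D \<and> Ck_on k (I - D) \<phi> \<and>
        (\<forall>x \<in> D \<union> {x\<in>I. (\<forall>y\<in>I. x \<le> y) \<or> (\<forall>y\<in>I. y \<le> x)}. \<forall>j\<le>k.
           (\<exists>l. ((deriv_on (I - D) ^^ j) \<phi> \<longlongrightarrow> l) (at x within (I - D) \<inter> {..<x})) \<and>
           (\<exists>r. ((deriv_on (I - D) ^^ j) \<phi> \<longlongrightarrow> r) (at x within (I - D) \<inter> {x<..}))))"

definition discont :: "real set \<Rightarrow> (real \<Rightarrow> real) \<Rightarrow> real set" where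
  "discont I \<phi> = {x\<in>I. \<not> continuous (at x within I) \<phi>}"

text \<open>The set of discontinuities of the derivative, a function defined only on the points of
  differentiability; points where it is undefined count as discontinuities.\<close>

definition discont_deriv :: "real set \<Rightarrow> (real \<Rightarrow> real) \<Rightarrow> real set" where
  "discont_deriv I \<phi> =
     {x\<in>I. \<not> (\<phi> differentiable (at x within I) \<and>
             continuous (at x within {y\<in>I. \<phi> differentiable (at y within I)}) (deriv_on I \<phi>))}"

definition Linf_on :: "real set \<Rightarrow> (real \<Rightarrow> real) \<Rightarrow> bool" where
  "Linf_on I g \<longleftrightarrow> g \<in> borel_measurable (lebesgue_on I) \<and> (\<exists>M. AE x in lebesgue_on I. \<bar>g x\<bar> \<le> M)"

definition A0 :: "real \<Rightarrow> (real \<Rightarrow> real) \<Rightarrow> (real \<Rightarrow> real) \<Rightarrow> bool" where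
  "A0 L u0 u1 \<longleftrightarrow> Ck_on 1 {0..L} u0 \<and> continuous_on {0..L} u1"

definition A1 :: "real \<Rightarrow> (real \<Rightarrow> real) \<Rightarrow> bool" where
  "A1 L V \<longleftrightarrow> PCk 1 {0..L} V \<and> Linf_on {0..L} V \<and> Linf_on {0..L} (deriv_on {0..L} V) \<and>
     (\<exists>m>0. \<forall>x\<in>{0..L}. m \<le> V x)"

definition A2 :: "real \<Rightarrow> (real \<Rightarrow> real) \<Rightarrow> bool" where
  "A2 L V \<longleftrightarrow> (\<exists>\<delta>>0. \<forall>d1 \<in> discont {0..L} V \<union> {0}. \<forall>d2 \<in> discont {0..L} V \<union> {0}.
     d1 \<noteq> d2 \<longrightarrow> \<delta> \<le> \<bar>d1 - d2\<bar>)"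

definition A3 :: "(real \<Rightarrow> real) \<Rightarrow> bool" where
  "A3 f \<longleftrightarrow> strict_mono f \<and> (\<exists>g. homeomorphism UNIV UNIV f g)"

definition dx :: "real \<Rightarrow> (real \<Rightarrow> real \<Rightarrow> real) \<Rightarrow> real \<Rightarrow> real \<Rightarrow> real" where
  "dx L u x t = deriv_on {0..L} (\<lambda>y. u y t) x"

definition dt :: "(real \<Rightarrow> real \<Rightarrow> real) \<Rightarrow> real \<Rightarrow> real \<Rightarrow> real" where
  "dt u x t = deriv_on {0..} (\<lambda>s. u x s) t"

definition C1_strip :: "real \<Rightarrow> (real \<Rightarrow> real \<Rightarrow> real) \<Rightarrow> bool" where
  "C1_strip L u \<longleftrightarrow>
     (\<forall>x\<in>{0..L}. \<forall>t\<in>{0..}. (\<lambda>y. u y t) differentiable (at x within {0..L}) \<and>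
                          (\<lambda>s. u x s) differentiable (at t within {0..})) \<and>
     continuous_on ({0..L} \<times> {0..}) (\<lambda>(x, t). u x t) \<and>
     continuous_on ({0..L} \<times> {0..}) (\<lambda>(x, t). dx L u x t) \<and>
     continuous_on ({0..L} \<times> {0..}) (\<lambda>(x, t). dt u x t)"

text \<open>
  The derivative at \<open>p\<close> of a function \<open>w\<close> on \<open>S\<close> in the direction of the vector field \<open>X\<close>, that is,
  along the integral curves of \<open>X\<close> in \<open>S\<close> through \<open>p\<close>. For the field \<open>\<partial>\<^sub>t - c \<partial>\<^sub>x\<close> these are the
  characteristics. They cannot be replaced by their tangent lines: \<open>w = u\<^sub>t + c u\<^sub>x\<close> is merely
  continuous, a tangent deviates from its characteristic by a quadratic term if \<open>c' \<noteq> 0\<close>, and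
  the difference quotients of \<open>w\<close> along it need not converge.

  At a point \<open>p\<close> on the boundary of \<open>S\<close> the derivative is one-sided (and at a corner which no
  nontrivial curve reaches there is no condition), since the interval \<open>J\<close> is only required to
  contain 0. Elsewhere the condition is not vacuous for \<open>X = (- c, 1)\<close>: where \<open>c\<close> is positive and
  continuous, integral curves exist.\<close>

definition has_deriv_along ::
  "(real \<times> real \<Rightarrow> real \<times> real) \<Rightarrow> (real \<times> real) set \<Rightarrow> (real \<times> real \<Rightarrow> real) \<Rightarrow>
   real \<Rightarrow> real \<times> real \<Rightarrow> bool" where
  "has_deriv_along X S w d p \<longleftrightarrow>
     (\<forall>\<gamma> J. is_interval J \<and> 0 \<in> J \<and> \<gamma> 0 = p \<and>
        (\<forall>s\<in>J. \<gamma> s \<in> S \<and> (\<gamma> has_vector_derivative X (\<gamma> s)) (at s within J))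
        \<longrightarrow> ((\<lambda>s. w (\<gamma> s)) has_real_derivative d) (at 0 within J))"

definition speed :: "(real \<Rightarrow> real) \<Rightarrow> real \<Rightarrow> real" where
  "speed V x = 1 / sqrt (V x)"

definition global_C1_solution ::
  "real \<Rightarrow> (real \<Rightarrow> real) \<Rightarrow> (real \<Rightarrow> real) \<Rightarrow> (real \<Rightarrow> real) \<Rightarrow> (real \<Rightarrow> real) \<Rightarrow>
   (real \<Rightarrow> real \<Rightarrow> real) \<Rightarrow> bool" where
  "global_C1_solution L V f u0 u1 u \<longleftrightarrow>
     (let c = speed V in
      C1_strip L u \<and>
      (\<forall>x\<in>{0..L} - (discont {0..L} c \<union> discont_deriv {0..L} c). \<forall>t\<in>{0..}.
         has_deriv_along (\<lambda>(y, s). (- c y, 1)) ({0..L} \<times> {0..})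
           (\<lambda>(y, s). dt u y s + c y * dx L u y s)
           (- c x * deriv_on {0..L} c x * dx L u x t) (x, t)) \<and>
      (\<forall>t\<in>{0..}. ((\<lambda>s. f (dt u 0 s)) has_real_derivative dx L u 0 t) (at t within {0..})) \<and>
      (\<forall>x\<in>{0..L}. u x 0 = u0 x \<and> dt u x 0 = u1 x) \<and>
      (\<forall>t\<in>{0..}. u L t = 0))"

definition boundary_energy :: "(real \<Rightarrow> real) \<Rightarrow> real \<Rightarrow> real" where
  "boundary_energy f s = s * f s - (LBINT \<sigma>=0..s. f \<sigma>)"

definition energy ::
  "real \<Rightarrow> (real \<Rightarrow> real) \<Rightarrow> (real \<Rightarrow> real) \<Rightarrow> (real \<Rightarrow> real \<Rightarrow> real) \<Rightarrow> real \<Rightarrow> real" where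
  "energy L V f u t =
     1 / 2 * (LBINT x=0..L. V x * (dt u x t)\<^sup>2 + (dx L u x t)\<^sup>2) + boundary_energy f (dt u 0 t)"

end

theory Submission
  imports Defs
begin

text \<open>In the travel time coordinate \<open>z = \<integral> dx / c\<close> the Riemann invariants \<open>u\<^sub>t \<plusminus> c u\<^sub>x\<close> move
  with speed one, so that on each layer between two jumps of \<open>c\<close> the pair \<open>(u\<^sub>t, u\<^sub>x)\<close> is determined
  by integral equations along characteristics, coupled by scattering at the jumps.

  The boundary condition contains a time derivative, and it is removed by passing to potentials: the
  function \<open>\<psi>\<close> with \<open>\<psi>\<^sub>t = u\<^sub>x\<close>, \<open>\<psi>\<^sub>x = V u\<^sub>t\<close> and \<open>\<psi>(0,t) = f(u\<^sub>t(0,t))\<close> makes \<open>(u, \<psi>)\<close> another solution of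
  the same system as \<open>(u\<^sub>t, u\<^sub>x)\<close>, now with the boundary condition \<open>u\<^sub>t = f\<^sup>-\<^sup>1(\<psi>)\<close>. In terms of the
  incoming invariant \<open>A = u + c \<psi>\<close> this is the ordinary differential equation
  \<open>v' = f\<^sup>-\<^sup>1((A - v) / c)\<close> for \<open>v = u(0, \<cdot>)\<close>, whose right-hand side decreases in \<open>v\<close>; hence its
  solution operator \<open>A \<mapsto> v\<close> exists for merely continuous \<open>f\<^sup>-\<^sup>1\<close> and is nonexpansive in the supremum norm.

  The potentials are then the fixed point of a contraction in an exponentially weighted supremum norm.
  Their trace \<open>u\<^sub>t(0, \<cdot>) = f\<^sup>-\<^sup>1(\<psi>(0, \<cdot>))\<close> is continuous, and the linear problem with this Dirichlet
  trace yields continuous \<open>u\<^sub>t\<close> and \<open>u\<^sub>x\<close>. Uniqueness follows from that of the potentials. The energy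
  identity holds for the time difference quotients of \<open>(u, \<psi>)\<close>, which are classical, and passes to
  the limit.\<close>

section \<open>Analytic preliminaries\<close>

text \<open>Three features of the data shape the proof. The exceptional points of V are isolated but
  may accumulate, and only its jumps are finite in number, by \<open>A2\<close>. Layers are
  therefore cut at the jumps alone; inside a layer c' is just bounded and continuous off a countable
  set, which calls for calculus modulo countable sets and for integral equations with a bounded
  Borel weight. Next, u_t and u_x are merely continuous. Balance laws for them are stated for time
  integrals, since moving along a characteristic turns a shift in space into a shift of the time
  interval. Finally, a solution is subject to an equation for u_t + c u_x only. Its companion for
  u_t - c u_x is replaced by the symmetry of mixed derivatives, which holds in integrated form
  because u_t and u_x come from one function u. The conditions u0 L = 0 and u1 L = 0 express that u
  = 0 at x = L fits continuously with the initial data at the corner.\<close>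

lemma complete_bcontfun: "complete (UNIV :: ('a::topological_space \<Rightarrow>\<^sub>C 'b::complete_space) set)"
  unfolding complete_def
proof (intro allI impI)
  fix F :: "nat \<Rightarrow> ('a \<Rightarrow>\<^sub>C 'b)" assume "(\<forall>n. F n \<in> UNIV) \<and> Cauchy F"
  then have C: "Cauchy F" by simp
  have "uniformly_Cauchy_on UNIV (\<lambda>n. apply_bcontfun (F n))"
  proof (rule uniformly_Cauchy_onI)
    fix e :: real assume "0 < e"
    then obtain M where "\<And>m n. m \<ge> M \<Longrightarrow> n \<ge> M \<Longrightarrow> dist (F m) (F n) < e"
      using C unfolding Cauchy_def by blast
    then show "\<exists>M. \<forall>x\<in>UNIV. \<forall>m\<ge>M. \<forall>n\<ge>M. dist (apply_bcontfun (F m) x) (apply_bcontfun (F n) x) < e"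
      by (intro exI[of _ M]) (simp add: dist_fun_lt_imp_dist_val_lt)
  qed
  from Cauchy_uniformly_convergent[OF this]
  obtain g where g: "uniform_limit UNIV (\<lambda>n. apply_bcontfun (F n)) g sequentially"
    unfolding uniformly_convergent_on_def by blast
  from uniform_limit_bcontfunE[OF g sequentially_bot] obtain l where "F \<longlonglongrightarrow> l" .
  then show "\<exists>l\<in>UNIV. F \<longlonglongrightarrow> l" by blast
qed

text \<open>Division by \<rho> carries the weighted supremum norm to the ordinary one, and the
  bounds \<open>e\<close> and \<open>C\<close> on \<rho> keep functions bounded in both directions.
  The contraction is stated pointwise with an arbitrary factor M, so that uses of the lemma never
  mention a norm on functions.\<close>

lemma weighted_fixpoint:
  fixes \<Phi> :: "('a::topological_space \<Rightarrow> 'b::banach) \<Rightarrow> 'a \<Rightarrow> 'b" and \<rho> :: "'a \<Rightarrow> real"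
  assumes \<rho>: "continuous_on UNIV \<rho>" "0 < e" "\<And>s. e \<le> \<rho> s" "\<And>s. \<rho> s \<le> C"
    and wd: "\<And>x. continuous_on UNIV x \<Longrightarrow> bounded (range x) \<Longrightarrow>
               continuous_on UNIV (\<Phi> x) \<and> bounded (range (\<Phi> x))"
    and contr: "\<And>x y M s. continuous_on UNIV x \<Longrightarrow> bounded (range x) \<Longrightarrow> continuous_on UNIV y \<Longrightarrow>
               bounded (range y) \<Longrightarrow> 0 \<le> M \<Longrightarrow> (\<And>s. norm (x s - y s) \<le> M * \<rho> s) \<Longrightarrow>
               norm (\<Phi> x s - \<Phi> y s) \<le> M / 2 * \<rho> s"
  shows "\<exists>x. continuous_on UNIV x \<and> bounded (range x) \<and> \<Phi> x = x \<and>
            (\<forall>y. continuous_on UNIV y \<longrightarrow> bounded (range y) \<longrightarrow> \<Phi> y = y \<longrightarrow> y = x)"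
proof -
  have \<rho>0: "0 < \<rho> s" for s using \<rho>(2) \<rho>(3)[of s] by linarith
  have C0: "0 < C" using \<rho>0 \<rho>(4) less_le_trans by blast
  define up where "up X = (\<lambda>s. \<rho> s *\<^sub>R apply_bcontfun X s)" for X :: "'a \<Rightarrow>\<^sub>C 'b"
  define dn where "dn x = (\<lambda>s. (1 / \<rho> s) *\<^sub>R x s)" for x :: "'a \<Rightarrow> 'b"
  have up: "continuous_on UNIV (up X)" "bounded (range (up X))" for X
  proof -
    show "continuous_on UNIV (up X)" unfolding up_def by (intro continuous_intros \<rho>(1) continuous_on_apply_bcontfun)
    obtain B where B: "\<And>s. norm (apply_bcontfun X s) \<le> B"
      using bounded_apply_bcontfun[of X] by (auto simp: bounded_iff)
    have "norm (up X s) \<le> C * B" for s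
      unfolding up_def using \<rho>0[of s] \<rho>(4)[of s] B[of s] C0
      by (auto intro!: mult_mono simp: less_imp_le)
    then show "bounded (range (up X))" by (auto simp: bounded_iff)
  qed
  have dn: "dn x \<in> bcontfun" if x: "continuous_on UNIV x" "bounded (range x)" for x
  proof -
    obtain B where B: "\<And>s. norm (x s) \<le> B" using x(2) by (auto simp: bounded_iff)
    have "norm (dn x s) \<le> B / e" for s
    proof -
      have "norm (dn x s) = norm (x s) / \<rho> s" unfolding dn_def using \<rho>0[of s] by (simp add: divide_simps)
      also have "\<dots> \<le> B / e" using \<rho>(2) \<rho>(3)[of s] B[of s] by (intro frac_le) (auto intro: order_trans[OF norm_ge_zero])
      finally show ?thesis .
    qed
    moreover have "continuous_on UNIV (dn x)" unfolding dn_def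
      using \<rho>0 by (intro continuous_intros \<rho>(1) x(1)) (metis less_irrefl)
    ultimately show ?thesis by (rule bcontfun_normI[rotated])
  qed
  define F where "F X = Bcontfun (dn (\<Phi> (up X)))" for X
  have F_app: "apply_bcontfun (F X) = dn (\<Phi> (up X))" for X
    unfolding F_def using dn wd up by (simp add: Bcontfun_inverse)
  have updn: "up (Bcontfun (dn x)) = x" if "continuous_on UNIV x" "bounded (range x)" for x
    unfolding up_def using dn[OF that] \<rho>0 by (auto simp: Bcontfun_inverse dn_def fun_eq_iff less_imp_neq[THEN not_sym])
  have "\<exists>!X\<in>UNIV. F X = X"
  proof (rule Banach_fix[OF complete_bcontfun, where c = "1/2"])
      fix X Y
      have *: "norm (up X s - up Y s) \<le> dist X Y * \<rho> s" for s
      proof -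
        have "norm (up X s - up Y s) = \<rho> s * dist (apply_bcontfun X s) (apply_bcontfun Y s)"
          unfolding up_def using \<rho>0[of s] by (simp add: scaleR_diff_right[symmetric] dist_norm)
        also have "\<dots> \<le> \<rho> s * dist X Y"
          using \<rho>0[of s] dist_bounded[of X s Y] by (intro mult_left_mono) auto
        finally show ?thesis by (simp add: mult.commute)
      qed
      show "dist (F X) (F Y) \<le> 1 / 2 * dist X Y"
      proof (rule dist_bound)
        fix s
        have "norm (\<Phi> (up X) s - \<Phi> (up Y) s) \<le> dist X Y / 2 * \<rho> s"
          by (rule contr) (use up * in auto)
        then show "dist (apply_bcontfun (F X) s) (apply_bcontfun (F Y) s) \<le> 1 / 2 * dist X Y"
          unfolding F_app dn_def dist_norm scaleR_diff_right[symmetric] using \<rho>0[of s]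
          by (simp add: divide_simps)
      qed
  qed auto
  then obtain X where X: "F X = X" and Xu: "\<And>Y. F Y = Y \<Longrightarrow> Y = X" by auto
  have "up X = up (Bcontfun (dn (\<Phi> (up X))))" using X unfolding F_def by simp
  also have "\<dots> = \<Phi> (up X)" using wd up by (simp add: updn)
  finally have fx: "\<Phi> (up X) = up X" by simp
  show ?thesis
  proof (intro exI[of _ "up X"] conjI allI impI)
    fix y assume y: "continuous_on UNIV y" "bounded (range y)" "\<Phi> y = y"
    have "F (Bcontfun (dn y)) = Bcontfun (dn y)" unfolding F_def by (simp add: updn y)
    then show "y = up X" using Xu updn y by metis
  qed (use up fx in auto)
qed

text \<open>The derivatives are compared only where U exceeds W. If U t > W t, let r be the last
  time before t with U r \<le> W r; after r the difference U - W is nonincreasing, so it cannot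
  become positive.\<close>

lemma comparison_principle:
  fixes U W U' W' :: "real \<Rightarrow> real"
  assumes U: "\<And>t. t \<in> {0..T} \<Longrightarrow> (U has_real_derivative U' t) (at t within {0..T})"
    and W: "\<And>t. t \<in> {0..T} \<Longrightarrow> (W has_real_derivative W' t) (at t within {0..T})"
    and le: "\<And>t. t \<in> {0..T} \<Longrightarrow> W t < U t \<Longrightarrow> U' t \<le> W' t"
    and init: "U 0 \<le> W 0" and t: "t \<in> {0..T}"
  shows "U t \<le> W t"
proof (rule ccontr)
  assume neg: "\<not> U t \<le> W t"
  define D where "D s = U s - W s" for s
  have Dd: "(D has_real_derivative U' s - W' s) (at s within {0..T})" if "s \<in> {0..T}" for s
    unfolding D_def using that by (intro derivative_intros U W)
  have Dc: "continuous_on {0..t} D"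
  proof -
    have "continuous_on {0..T} D" using Dd DERIV_continuous continuous_on_eq_continuous_within by blast
    then show ?thesis by (rule continuous_on_subset) (use t in auto)
  qed
  define S where "S = {s \<in> {0..t}. D s \<le> 0}"
  have "closed S" unfolding S_def
    using continuous_closed_preimage[OF Dc closed_real_atLeastAtMost, of "{..0}"]
    by (simp add: vimage_def Int_def conj_commute)
  moreover have "bounded S" unfolding S_def by (rule bounded_subset[of "{0..t}"]) auto
  ultimately have cS: "compact S" by (simp add: compact_eq_bounded_closed)
  have "0 \<in> S" unfolding S_def D_def using init t by simp
  then have "S \<noteq> {}" by blast
  from compact_attains_sup[OF cS this] obtain r where r: "r \<in> S" "\<And>s. s \<in> S \<Longrightarrow> s \<le> r"
    by blast
  have rt: "0 \<le> r" "r \<le> t" "D r \<le> 0" using r unfolding S_def by auto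
  have "r < t" using rt neg unfolding D_def by (cases "r = t") auto
  have "D t \<le> D r"
  proof (rule DERIV_nonpos_imp_decreasing_open[of r t])
    show "r \<le> t" using \<open>r < t\<close> by simp
    show "continuous_on {r..t} D" using Dc rt continuous_on_subset by (metis atLeastatMost_subset_iff order_refl)
    fix s assume s: "r < s" "s < t"
    then have "s \<notin> S" using r(2) by fastforce
    then have "0 < D s" using s rt unfolding S_def by auto
    then have "U' s - W' s \<le> 0" using le[of s] s rt t unfolding D_def by simp
    moreover have "at s within {0..T} = at s"
      by (rule at_within_interior) (use s rt t in simp)
    then have "(D has_real_derivative U' s - W' s) (at s)"
      using Dd[of s] s rt t by simp
    ultimately show "\<exists>y. (D has_real_derivative y) (at s) \<and> y \<le> 0" by blast
  qed
  then show False using neg rt unfolding D_def by simp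
qed

lemma exp_weight_integral:
  fixes l t :: real
  assumes "0 < l" "0 \<le> t"
  shows "((\<lambda>s. exp (l * s)) has_integral (exp (l * t) - 1) / l) {0..t}"
proof -
  have "((\<lambda>s. exp (l * s)) has_integral (exp (l * t) / l - exp (l * 0) / l)) {0..t}"
    by (rule fundamental_theorem_of_calculus)
       (use assms in \<open>auto intro!: derivative_eq_intros simp: has_real_derivative_iff_has_vector_derivative[symmetric]\<close>)
  then show ?thesis by (simp add: diff_divide_distrib)
qed

text \<open>Picard iteration in the weight exp (l t): integrating the weight gains 1 / l, and l = 2
  K + 1 makes K / l at most 1/2. Time is clamped by \<open>ct\<close> because the fixed point
  theorem concerns functions on the whole line.\<close>

lemma lipschitz_integral_equation:
  fixes h A :: "real \<Rightarrow> real"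
  assumes T: "0 \<le> T" and K: "0 \<le> K" and lip: "\<And>x y. \<bar>h x - h y\<bar> \<le> K * \<bar>x - y\<bar>"
    and A: "continuous_on {0..T} A"
  shows "\<exists>U. continuous_on {0..T} U \<and> (\<forall>t\<in>{0..T}. U t = U0 + integral {0..t} (\<lambda>s. h (A s - U s)))"
proof -
  define ct where "ct t = max 0 (min T t)" for t
  have ctin: "ct t \<in> {0..T}" for t unfolding ct_def using T by auto
  have ct_id: "ct t = t" if "t \<in> {0..T}" for t unfolding ct_def using that by auto
  have ct_cont: "continuous_on UNIV ct" unfolding ct_def by (intro continuous_intros)
  define l where "l = 2 * K + 1"
  have l: "0 < l" unfolding l_def using K by simp
  have hc: "continuous_on UNIV h"
  proof (rule continuous_onI)
    fix x e :: real assume "0 < e"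
    show "\<exists>d>0. \<forall>y\<in>UNIV. dist y x < d \<longrightarrow> dist (h y) (h x) \<le> e"
    proof (intro exI[of _ "e / (K + 1)"] conjI ballI impI)
      show "0 < e / (K + 1)" using \<open>0 < e\<close> K by simp
      fix y assume "dist y x < e / (K + 1)"
      then have "(K + 1) * \<bar>y - x\<bar> < e" using K by (simp add: dist_real_def field_simps)
      moreover have "K * \<bar>y - x\<bar> \<le> (K + 1) * \<bar>y - x\<bar>" by (simp add: mult_right_mono)
      ultimately show "dist (h y) (h x) \<le> e" using lip[of y x] by (simp add: dist_real_def)
    qed
  qed
  define \<Phi> where "\<Phi> x t = U0 + integral {0..ct t} (\<lambda>s. h (A s - x s))" for x :: "real \<Rightarrow> real" and t
  have hx: "continuous_on {0..T} (\<lambda>s. h (A s - x s))" if "continuous_on UNIV x" for x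
    by (rule continuous_on_compose2[OF hc]) (use that A in \<open>auto intro!: continuous_intros intro: continuous_on_subset\<close>)
  have hi: "(\<lambda>s. h (A s - x s)) integrable_on {0..t}" if "continuous_on UNIV x" "t \<le> T" for x t
    by (rule integrable_continuous_real, rule continuous_on_subset[OF hx[OF that(1)]]) (use that in auto)
  have "\<exists>x. continuous_on UNIV x \<and> bounded (range x) \<and> \<Phi> x = x \<and>
            (\<forall>y. continuous_on UNIV y \<longrightarrow> bounded (range y) \<longrightarrow> \<Phi> y = y \<longrightarrow> y = x)"
  proof (rule weighted_fixpoint[where \<rho> = "\<lambda>t. exp (l * ct t)" and e = 1 and C = "exp (l * T)"])
    show "continuous_on UNIV (\<lambda>t. exp (l * ct t))" by (intro continuous_intros ct_cont)
    show "1 \<le> exp (l * ct s)" for s using ctin[of s] l by simp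
    show "exp (l * ct s) \<le> exp (l * T)" for s using ctin[of s] l by simp
  next
    fix x :: "real \<Rightarrow> real" assume x: "continuous_on UNIV x" "bounded (range x)"
    have ic: "continuous_on {0..T} (\<lambda>t. U0 + integral {0..t} (\<lambda>s. h (A s - x s)))"
      by (intro continuous_intros indefinite_integral_continuous_1 hi x) simp
    have "continuous_on UNIV (\<Phi> x)" unfolding \<Phi>_def
      by (rule continuous_on_compose2[OF ic ct_cont]) (use ctin in auto)
    moreover have "range (\<Phi> x) \<subseteq> (\<lambda>t. U0 + integral {0..t} (\<lambda>s. h (A s - x s))) ` {0..T}"
      unfolding \<Phi>_def using ctin by auto
    then have "bounded (range (\<Phi> x))"
      using compact_imp_bounded[OF compact_continuous_image[OF ic compact_Icc]] bounded_subset by blast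
    ultimately show "continuous_on UNIV (\<Phi> x) \<and> bounded (range (\<Phi> x))" by simp
  next
    fix x y :: "real \<Rightarrow> real" and M s
    assume x: "continuous_on UNIV x" and y: "continuous_on UNIV y" and M: "0 \<le> M"
      and d: "\<And>s. norm (x s - y s) \<le> M * exp (l * ct s)"
    let ?t = "ct s"
    have t: "0 \<le> ?t" "?t \<le> T" using ctin[of s] by auto
    have "norm (\<Phi> x s - \<Phi> y s) = norm (integral {0..?t} (\<lambda>s. h (A s - x s) - h (A s - y s)))"
      unfolding \<Phi>_def using hi[OF x t(2)] hi[OF y t(2)] by (simp add: integral_diff)
    also have "\<dots> \<le> integral {0..?t} (\<lambda>s. K * M * exp (l * s))"
    proof (rule integral_norm_bound_integral)
      show "(\<lambda>s. h (A s - x s) - h (A s - y s)) integrable_on {0..?t}"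
        using hi[OF x t(2)] hi[OF y t(2)] by (rule integrable_diff)
      show "(\<lambda>s. K * M * exp (l * s)) integrable_on {0..?t}"
        by (intro integrable_continuous_real continuous_intros)
      fix r assume "r \<in> {0..?t}"
      then have r: "ct r = r" using t by (intro ct_id) auto
      have "norm (h (A r - x r) - h (A r - y r)) \<le> K * \<bar>x r - y r\<bar>"
        using lip[of "A r - x r" "A r - y r"] by (simp add: abs_minus_commute)
      also have "\<dots> \<le> K * (M * exp (l * r))" using d[of r] K by (intro mult_left_mono) (auto simp: r)
      finally show "norm (h (A r - x r) - h (A r - y r)) \<le> K * M * exp (l * r)" by (simp add: mult.assoc)
    qed
    also have "\<dots> = K * M * ((exp (l * ?t) - 1) / l)"
      using exp_weight_integral[OF l t(1)] by (simp add: integral_unique)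
    also have "\<dots> \<le> K * M * (exp (l * ?t) / l)"
      using l K M by (intro mult_left_mono divide_right_mono) auto
    also have "\<dots> = (K / l) * (M * exp (l * ?t))" by simp
    also have "\<dots> \<le> (1/2) * (M * exp (l * ?t))"
      using M K by (intro mult_right_mono) (auto simp: l_def field_simps)
    finally show "norm (\<Phi> x s - \<Phi> y s) \<le> M / 2 * exp (l * ct s)" by simp
  qed auto
  then obtain x where x: "continuous_on UNIV x" "\<Phi> x = x" by blast
  show ?thesis
  proof (intro exI[of _ x] conjI ballI)
    show "continuous_on {0..T} x" using x(1) continuous_on_subset by blast
    fix t assume "t \<in> {0..T}"
    then show "x t = U0 + integral {0..t} (\<lambda>s. h (A s - x s))"
      using fun_cong[OF x(2), of t] by (simp add: \<Phi>_def ct_id)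
  qed
qed

lemma integral_equation_has_derivative:
  fixes h A U :: "real \<Rightarrow> real"
  assumes h: "continuous_on UNIV h" and A: "continuous_on {0..T} A" and U: "continuous_on {0..T} U"
    and eq: "\<forall>t\<in>{0..T}. U t = U0 + integral {0..t} (\<lambda>s. h (A s - U s))" and t: "t \<in> {0..T}"
  shows "(U has_real_derivative h (A t - U t)) (at t within {0..T})"
proof -
  have hx: "continuous_on {0..T} (\<lambda>s. h (A s - U s))"
    by (rule continuous_on_compose2[OF h]) (use A U in \<open>auto intro!: continuous_intros\<close>)
  have "((\<lambda>t. U0 + integral {0..t} (\<lambda>s. h (A s - U s))) has_real_derivative 0 + h (A t - U t)) (at t within {0..T})"
    by (intro derivative_intros integral_has_real_derivative hx t)
  then have "((\<lambda>t. U0 + integral {0..t} (\<lambda>s. h (A s - U s))) has_real_derivative h (A t - U t)) (at t within {0..T})"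
    by simp
  then show ?thesis
    by (rule has_field_derivative_transform_within[OF _ zero_less_one t]) (use eq in simp)
qed

text \<open>Take for k the mean of h over [x, x + r], written as a difference quotient of an
  antiderivative. Its derivative (h (x + r) - h x) / r is nonnegative by monotonicity and at most 2
  B / r, and uniform continuity keeps the mean close to h x.\<close>

lemma mono_lipschitz_approx:
  fixes h :: "real \<Rightarrow> real"
  assumes mono: "mono h" and uc: "uniformly_continuous_on UNIV h" and B: "\<And>x. \<bar>h x\<bar> \<le> B" and e: "0 < e"
  shows "\<exists>k K. mono k \<and> 0 \<le> K \<and> (\<forall>x y. \<bar>k x - k y\<bar> \<le> K * \<bar>x - y\<bar>) \<and> (\<forall>x. \<bar>k x - h x\<bar> \<le> e)"
proof -
  have hc: "isCont h x" for x
    using uniformly_continuous_imp_continuous[OF uc] by (simp add: continuous_on_eq_continuous_at)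
  obtain H where "\<forall>x. - \<infinity> < ereal x \<longrightarrow> ereal x < \<infinity> \<longrightarrow> (H has_vector_derivative h x) (at x)"
    using einterval_antiderivative[of "-\<infinity>" "\<infinity>" h] hc by auto
  then have H: "(H has_real_derivative h x) (at x)" for x
    by (simp add: has_real_derivative_iff_has_vector_derivative)
  obtain \<eta> where \<eta>: "0 < \<eta>" "\<And>x y. \<bar>x - y\<bar> < \<eta> \<Longrightarrow> \<bar>h x - h y\<bar> < e"
    using uc e unfolding uniformly_continuous_on_def dist_real_def by (metis UNIV_I abs_minus_commute)
  have B0: "0 \<le> B" using B[of 0] by simp
  define r where "r = \<eta> / 2"
  have r: "0 < r" "r < \<eta>" unfolding r_def using \<eta> by auto
  define k where "k x = (H (x + r) - H x) / r" for x
  have Hs: "((\<lambda>x. H (x + r)) has_real_derivative h (x + r)) (at x)" for x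
    using H[of "x + r"] by (simp add: DERIV_shift)
  have kd: "(k has_real_derivative (h (x + r) - h x) / r) (at x)" for x
    unfolding k_def by (rule DERIV_cdivide) (intro derivative_intros Hs H)
  show ?thesis
  proof (intro exI[of _ k] exI[of _ "2 * B / r"] conjI allI)
    show "mono k"
    proof (rule monoI)
      fix x y :: real assume "x \<le> y"
      then show "k x \<le> k y"
      proof (rule DERIV_nonneg_imp_nondecreasing)
        fix z show "\<exists>y. (k has_real_derivative y) (at z) \<and> 0 \<le> y"
          using kd[of z] monoD[OF mono, of z "z + r"] r by (intro exI[of _ "(h (z + r) - h z) / r"]) auto
      qed
    qed
    show "0 \<le> 2 * B / r" using B0 r by simp
  next
    fix x y :: real
    have "norm (k x - k y) \<le> 2 * B / r * norm (x - y)"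
    proof (rule field_differentiable_bound[of UNIV k "\<lambda>x. (h (x + r) - h x) / r"])
      fix z :: real
      have "\<bar>h (z + r) - h z\<bar> \<le> 2 * B" using B[of "z + r"] B[of z] by linarith
      then show "norm ((h (z + r) - h z) / r) \<le> 2 * B / r" using r by (simp add: divide_right_mono)
    qed (use kd in auto)
    then show "\<bar>k x - k y\<bar> \<le> 2 * B / r * \<bar>x - y\<bar>" by simp
  next
    fix x :: real
    obtain z where z: "x < z" "z < x + r" "H (x + r) - H x = (x + r - x) * h z"
      using MVT2[of x "x + r" H h] r H by auto
    then have "k x = h z" unfolding k_def using r by simp
    moreover have "\<bar>h z - h x\<bar> < e" by (rule \<eta>(2)) (use z r in auto)
    ultimately show "\<bar>k x - h x\<bar> \<le> e" by simp
  qed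
qed

section \<open>Monotone boundary equations\<close>

text \<open>Where U1 exceeds U2 + m, the argument A1 - U1 lies below A2 - U2, so monotonicity of h
  orders the derivatives as the comparison principle requires. This is one half of the
  nonexpansiveness of the solution operator.\<close>

lemma monotone_ode_stable:
  fixes h A1 A2 U1 U2 :: "real \<Rightarrow> real"
  assumes mono: "mono h"
    and U1: "\<And>t. t \<in> {0..T} \<Longrightarrow> (U1 has_real_derivative h (A1 t - U1 t)) (at t within {0..T})"
    and U2: "\<And>t. t \<in> {0..T} \<Longrightarrow> (U2 has_real_derivative h (A2 t - U2 t)) (at t within {0..T})"
    and A: "\<And>t. t \<in> {0..T} \<Longrightarrow> A1 t \<le> A2 t + m" and init: "U1 0 \<le> U2 0 + m" and t: "t \<in> {0..T}"
  shows "U1 t \<le> U2 t + m"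
proof (rule comparison_principle[where U = U1 and W = "\<lambda>t. U2 t + m" and t = t and U' = "\<lambda>t. h (A1 t - U1 t)" and W' = "\<lambda>t. h (A2 t - U2 t)" and T = T])
  show "((\<lambda>t. U2 t + m) has_real_derivative h (A2 t - U2 t)) (at t within {0..T})" if "t \<in> {0..T}" for t
    using U2[OF that] by (auto intro!: derivative_eq_intros)
  show "h (A1 t - U1 t) \<le> h (A2 t - U2 t)" if "t \<in> {0..T}" "U2 t + m < U1 t" for t
    using A[OF that(1)] that(2) by (intro monoD[OF mono]) linarith
qed (use init t U1 in auto)

text \<open>Replace h by Lipschitz functions k n within \<epsilon> n of it. Their Lipschitz
  constants may blow up, so a Gronwall estimate would be useless; comparison with the barrier U j +
  (\<epsilon> i + \<epsilon> j) t gives a distance of at most (\<epsilon> i + \<epsilon> j) T,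
  independent of these constants. Hence the solutions converge uniformly and the integral equation
  passes to the limit.\<close>

lemma bounded_monotone_ode:
  fixes h A :: "real \<Rightarrow> real"
  assumes T: "0 \<le> T" and mono: "mono h" and uc: "uniformly_continuous_on UNIV h"
    and B: "\<And>x. \<bar>h x\<bar> \<le> B" and A: "continuous_on {0..T} A"
  shows "\<exists>U. continuous_on {0..T} U \<and> (\<forall>t\<in>{0..T}. U t = U0 + integral {0..t} (\<lambda>s. h (A s - U s)))"
proof -
  define \<epsilon> where "\<epsilon> n = inverse (real (Suc n))" for n
  have \<epsilon>: "0 < \<epsilon> n" for n unfolding \<epsilon>_def by simp
  have \<epsilon>0: "\<epsilon> \<longlonglongrightarrow> 0" unfolding \<epsilon>_def by (rule LIMSEQ_inverse_real_of_nat)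
  define P where "P n k U \<longleftrightarrow> mono k \<and> continuous_on UNIV k \<and> (\<forall>x. \<bar>k x - h x\<bar> \<le> \<epsilon> n) \<and>
     continuous_on {0..T} U \<and> (\<forall>t\<in>{0..T}. U t = U0 + integral {0..t} (\<lambda>s. k (A s - U s)))" for n k U
  have "\<exists>k U. P n k U" for n
  proof -
    obtain k K where k: "mono k" "0 \<le> K" "\<And>x y. \<bar>k x - k y\<bar> \<le> K * \<bar>x - y\<bar>" "\<And>x. \<bar>k x - h x\<bar> \<le> \<epsilon> n"
      using mono_lipschitz_approx[OF mono uc B \<epsilon>[of n]] by blast
    have "K-lipschitz_on UNIV k" using k by (auto simp: lipschitz_on_def dist_real_def)
    then have "continuous_on UNIV k" by (rule lipschitz_on_continuous_on)
    then show ?thesis unfolding P_def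
      using lipschitz_integral_equation[OF T k(2,3) A, of U0] k(1,4) by blast
  qed
  then obtain k U where "\<And>n. P n (k n) (U n)" by metis
  then have k: "\<And>n. mono (k n)" "\<And>n. continuous_on UNIV (k n)"
      "\<And>n x. \<bar>k n x - h x\<bar> \<le> \<epsilon> n"
    and U: "\<And>n. continuous_on {0..T} (U n)"
      "\<And>n. \<forall>t\<in>{0..T}. U n t = U0 + integral {0..t} (\<lambda>s. k n (A s - U n s))"
    unfolding P_def by auto
  have Ud: "(U n has_real_derivative k n (A t - U n t)) (at t within {0..T})" if "t \<in> {0..T}" for n t
    by (rule integral_equation_has_derivative[OF k(2) A U that])
  have U0: "U n 0 = U0" for n using U(2)[of n] T by simp
  have close: "U i t \<le> U j t + (\<epsilon> i + \<epsilon> j) * T" if t: "t \<in> {0..T}" for i j t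
  proof -
    have "U i t \<le> U j t + (\<epsilon> i + \<epsilon> j) * t"
    proof (rule comparison_principle[where U = "U i" and W = "\<lambda>t. U j t + (\<epsilon> i + \<epsilon> j) * t" and t = t and U' = "\<lambda>t. k i (A t - U i t)" and T = T
          and W' = "\<lambda>t. k j (A t - U j t) + (\<epsilon> i + \<epsilon> j)"])
      fix s assume s: "s \<in> {0..T}"
      show "((\<lambda>t. U j t + (\<epsilon> i + \<epsilon> j) * t) has_real_derivative k j (A s - U j s) + (\<epsilon> i + \<epsilon> j)) (at s within {0..T})"
        using Ud[OF s, of j] by (auto intro!: derivative_eq_intros)
      assume lt: "U j s + (\<epsilon> i + \<epsilon> j) * s < U i s"
      have "0 \<le> (\<epsilon> i + \<epsilon> j) * s" using \<epsilon>[of i] \<epsilon>[of j] s by simp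
      then have "k i (A s - U i s) \<le> k i (A s - U j s)"
        using lt by (intro monoD[OF k(1)]) linarith
      then show "k i (A s - U i s) \<le> k j (A s - U j s) + (\<epsilon> i + \<epsilon> j)"
        using k(3)[of i "A s - U j s"] k(3)[of j "A s - U j s"] by linarith
    qed (use t U0 Ud in auto)
    moreover have "(\<epsilon> i + \<epsilon> j) * t \<le> (\<epsilon> i + \<epsilon> j) * T"
      using t \<epsilon>[of i] \<epsilon>[of j] by (intro mult_left_mono) auto
    ultimately show ?thesis by linarith
  qed
  have "uniformly_Cauchy_on {0..T} U"
  proof (rule uniformly_Cauchy_onI)
    fix e :: real assume e: "0 < e"
    define d where "d = e / (2 * (T + 1))"
    have d: "0 < d" unfolding d_def using e T by simp
    obtain M where M: "\<And>n. n \<ge> M \<Longrightarrow> \<epsilon> n < d"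
      using \<epsilon>0 d \<epsilon> unfolding LIMSEQ_iff by (metis abs_of_pos diff_zero real_norm_def)
    show "\<exists>M. \<forall>x\<in>{0..T}. \<forall>m\<ge>M. \<forall>n\<ge>M. dist (U m x) (U n x) < e"
    proof (intro exI[of _ M] ballI allI impI)
      fix t m n assume t: "t \<in> {0..T}" and mn: "m \<ge> M" "n \<ge> M"
      have "(\<epsilon> m + \<epsilon> n) * T \<le> (d + d) * T" using M[OF mn(1)] M[OF mn(2)] T by (intro mult_right_mono) auto
      also have "\<dots> < (d + d) * (T + 1)" using d by simp
      also have "\<dots> = d * (2 * (T + 1))" by (simp add: algebra_simps)
      also have "\<dots> = e" unfolding d_def using T by simp
      finally have "(\<epsilon> m + \<epsilon> n) * T < e" .
      then show "dist (U m t) (U n t) < e"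
        using close[OF t, of m n] close[OF t, of n m] by (auto simp: dist_real_def add.commute)
    qed
  qed
  then obtain V where V: "uniform_limit {0..T} U V sequentially"
    using Cauchy_uniformly_convergent uniformly_convergent_on_def by blast
  have Vc: "continuous_on {0..T} V"
    by (rule uniform_limit_theorem[OF _ V]) (use U in auto)
  have hc: "continuous_on UNIV h" by (rule uniformly_continuous_imp_continuous[OF uc])
  have lim: "uniform_limit {0..T} (\<lambda>n s. k n (A s - U n s)) (\<lambda>s. h (A s - V s)) sequentially"
  proof (rule uniform_limitI)
    fix e :: real assume e: "0 < e"
    obtain d where d: "0 < d" "\<And>x y. \<bar>x - y\<bar> < d \<Longrightarrow> \<bar>h x - h y\<bar> < e / 2"
      using uc e unfolding uniformly_continuous_on_def dist_real_def
      by (metis UNIV_I abs_minus_commute half_gt_zero)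
    have "\<forall>\<^sub>F n in sequentially. \<epsilon> n < e / 2" using \<epsilon>0 e order_tendstoD(2) half_gt_zero by blast
    moreover have "\<forall>\<^sub>F n in sequentially. \<forall>t\<in>{0..T}. dist (U n t) (V t) < d"
      using uniform_limitD[OF V d(1)] .
    ultimately show "\<forall>\<^sub>F n in sequentially. \<forall>t\<in>{0..T}. dist (k n (A t - U n t)) (h (A t - V t)) < e"
    proof eventually_elim
      case (elim n)
      show ?case
      proof
        fix t assume "t \<in> {0..T}"
        then have "\<bar>h (A t - U n t) - h (A t - V t)\<bar> < e / 2"
          using elim(2) by (intro d(2)) (auto simp: dist_real_def abs_minus_commute)
        then show "dist (k n (A t - U n t)) (h (A t - V t)) < e"
          using k(3)[of n "A t - U n t"] elim(1) unfolding dist_real_def by linarith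
      qed
    qed
  qed
  show ?thesis
  proof (intro exI[of _ V] conjI ballI Vc)
    fix t assume t: "t \<in> {0..T}"
    have sub: "{0..t} \<subseteq> {0..T}" using t by auto
    have kc: "continuous_on {0..t} (\<lambda>s. k n (A s - U n s))" for n
      by (rule continuous_on_compose2[OF k(2)[of n]])
         (use U(1)[of n] A sub in \<open>auto intro!: continuous_intros intro: continuous_on_subset\<close>)
    obtain I J where I: "\<And>n. ((\<lambda>s. k n (A s - U n s)) has_integral I n) {0..t}"
      and J: "((\<lambda>s. h (A s - V s)) has_integral J) {0..t}" and IJ: "I \<longlonglongrightarrow> J"
      using uniform_limit_integral[OF uniform_limit_on_subset[OF lim sub] kc] by auto
    have "U n t = U0 + I n" for n using U(2)[of n] t integral_unique[OF I[of n]] by simp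
    then have "(\<lambda>n. U n t) \<longlonglongrightarrow> U0 + J" using IJ by (auto intro!: tendsto_intros)
    moreover have "(\<lambda>n. U n t) \<longlonglongrightarrow> V t" using tendsto_uniform_limitI[OF V t] .
    ultimately show "V t = U0 + integral {0..t} (\<lambda>s. h (A s - V s))"
      using LIMSEQ_unique integral_unique[OF J] by metis
  qed
qed

text \<open>Truncating the argument of h to [-M, M] makes it bounded and uniformly continuous. A
  bound for the solution of the truncated equation then shows that the truncation is never
  active.\<close>

lemma monotone_ode:
  fixes h A :: "real \<Rightarrow> real"
  assumes T: "0 \<le> T" and mono: "mono h" and hc: "continuous_on UNIV h" and A: "continuous_on {0..T} A"
  shows "\<exists>U. continuous_on {0..T} U \<and> (\<forall>t\<in>{0..T}. U t = U0 + integral {0..t} (\<lambda>s. h (A s - U s)))"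
proof -
  obtain a where a: "\<And>s. s \<in> {0..T} \<Longrightarrow> \<bar>A s\<bar> \<le> a"
    using compact_imp_bounded[OF compact_continuous_image[OF A compact_Icc]] by (fastforce simp: bounded_iff)
  have a0: "0 \<le> a" using a[of 0] T by simp
  \<comment> \<open>As \<bar>A\<bar> \<le> a and h is monotone, the right-hand side is at most h (a
    - U0) where U is above U0, and at least h (- a - U0) where U is below. So \<kappa> bounds the
    growth of U away from U0, and M bounds every argument A - U up to time T.\<close>
  define \<kappa> where "\<kappa> = \<bar>h (a - U0)\<bar> + \<bar>h (- a - U0)\<bar>"
  define M where "M = a + \<bar>U0\<bar> + \<kappa> * T"
  have \<kappa>: "0 \<le> \<kappa>" unfolding \<kappa>_def by simp
  have M: "0 \<le> M" unfolding M_def using a0 \<kappa> T by simp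
  have Mb: "\<bar>a - U0\<bar> \<le> M" "\<bar>- a - U0\<bar> \<le> M"
    using mult_nonneg_nonneg[OF \<kappa> T] a0 unfolding M_def by linarith+
  define cl where "cl v = max (- M) (min M v)" for v
  have clc: "continuous_on UNIV cl" unfolding cl_def by (intro continuous_intros)
  define k where "k v = h (cl v)" for v
  have cl_id: "cl v = v" if "\<bar>v\<bar> \<le> M" for v unfolding cl_def using that by auto
  have cl_in: "cl v \<in> {-M..M}" for v unfolding cl_def using M by auto
  have km: "mono k" unfolding k_def cl_def by (intro monoI monoD[OF mono]) auto
  have uc: "uniformly_continuous_on UNIV k"
  proof -
    have "uniformly_continuous_on {-M..M} h"
      by (rule compact_uniformly_continuous) (use hc continuous_on_subset in auto)
    moreover have "uniformly_continuous_on UNIV cl"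
      unfolding uniformly_continuous_on_def dist_real_def
    proof (intro allI impI)
      fix e :: real assume "0 < e"
      moreover have "\<bar>cl y - cl x\<bar> \<le> \<bar>y - x\<bar>" for x y unfolding cl_def by (simp add: max_def min_def)
      ultimately show "\<exists>d>0. \<forall>x\<in>UNIV. \<forall>x'\<in>UNIV. \<bar>x' - x\<bar> < d \<longrightarrow> \<bar>cl x' - cl x\<bar> < e"
        by (meson le_less_trans)
    qed
    moreover have "cl ` UNIV \<subseteq> {-M..M}" using cl_in by auto
    ultimately have "uniformly_continuous_on UNIV (h \<circ> cl)"
      unfolding uniformly_continuous_on_def o_def by (metis UNIV_I image_subset_iff)
    then show ?thesis by (simp add: k_def[abs_def] o_def)
  qed
  have "\<bar>k x\<bar> \<le> \<bar>h M\<bar> + \<bar>h (- M)\<bar>" for x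
    unfolding k_def using monoD[OF mono, of "- M" "cl x"] monoD[OF mono, of "cl x" M] cl_in[of x] by auto
  from bounded_monotone_ode[OF T km uc this A, of U0]
  obtain U where U: "continuous_on {0..T} U"
    "\<forall>t\<in>{0..T}. U t = U0 + integral {0..t} (\<lambda>s. k (A s - U s))" by blast
  have kc: "continuous_on UNIV k" by (rule uniformly_continuous_imp_continuous[OF uc])
  have Ud: "(U has_real_derivative k (A t - U t)) (at t within {0..T})" if "t \<in> {0..T}" for t
    by (rule integral_equation_has_derivative[OF kc A U that])
  have Ui: "U 0 = U0" using U(2) T by simp
  have \<kappa>T: "0 \<le> \<kappa> * t" "\<kappa> * t \<le> \<kappa> * T" if "t \<in> {0..T}" for t
    using that \<kappa> by (auto intro: mult_left_mono)
  have up: "U t \<le> U0 + \<kappa> * t" if t: "t \<in> {0..T}" for t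
  proof (rule comparison_principle[where U = U and W = "\<lambda>t. U0 + \<kappa> * t" and t = t and U' = "\<lambda>t. k (A t - U t)" and T = T and W' = "\<lambda>_. \<kappa>"])
    fix s assume s: "s \<in> {0..T}" "U0 + \<kappa> * s < U s"
    then have "k (A s - U s) \<le> k (a - U0)"
      using a[of s] \<kappa>T[of s] by (intro monoD[OF km]) (auto simp: abs_le_iff)
    also have "\<dots> \<le> \<kappa>" unfolding k_def
      using Mb by (subst cl_id) (auto simp: \<kappa>_def)
    finally show "k (A s - U s) \<le> \<kappa>" .
  qed (use t Ui Ud in \<open>auto intro!: derivative_eq_intros\<close>)
  have lo: "U0 - \<kappa> * t \<le> U t" if t: "t \<in> {0..T}" for t
  proof (rule comparison_principle[where W = U and U = "\<lambda>t. U0 - \<kappa> * t" and t = t and W' = "\<lambda>t. k (A t - U t)" and T = T and U' = "\<lambda>_. - \<kappa>"])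
    fix s assume s: "s \<in> {0..T}" "U s < U0 - \<kappa> * s"
    then have "k (- a - U0) \<le> k (A s - U s)"
      using a[of s] \<kappa>T[of s] by (intro monoD[OF km]) (auto simp: abs_le_iff)
    moreover have "- \<kappa> \<le> k (- a - U0)" unfolding k_def
      using Mb by (subst cl_id) (auto simp: \<kappa>_def)
    ultimately show "- \<kappa> \<le> k (A s - U s)" by simp
  qed (use t Ui Ud in \<open>auto intro!: derivative_eq_intros\<close>)
  have "k (A s - U s) = h (A s - U s)" if s: "s \<in> {0..T}" for s
  proof -
    have "\<bar>A s - U s\<bar> \<le> M"
      unfolding M_def using a[OF s] up[OF s] lo[OF s] \<kappa>T[OF s] by linarith
    then show ?thesis unfolding k_def by (simp add: cl_id)
  qed
  then have "integral {0..t} (\<lambda>s. k (A s - U s)) = integral {0..t} (\<lambda>s. h (A s - U s))" if "t \<in> {0..T}" for t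
    using that by (intro integral_cong) auto
  then show ?thesis using U by auto
qed

lemma nonincreasing_off_countable:
  fixes f :: "real \<Rightarrow> real"
  assumes ab: "a \<le> b" and S: "countable S" and f: "continuous_on {a..b} f"
    and d: "\<And>x. x \<in> {a<..<b} - S \<Longrightarrow> \<exists>d\<le>0. (f has_real_derivative d) (at x)"
  shows "f b \<le> f a"
proof (rule ccontr)
  assume neg: "\<not> f b \<le> f a"
  then have ab: "a < b" using ab by (cases "a = b") auto
  define \<kappa> where "\<kappa> = (f b - f a) / (2 * (b - a))"
  have \<kappa>: "0 < \<kappa>" unfolding \<kappa>_def using ab neg by simp
  define g where "g x = f x - \<kappa> * x" for x
  have "\<kappa> * (b - a) = (f b - f a) / 2" unfolding \<kappa>_def using ab by (simp add: field_simps)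
  then have gab: "g a < g b" unfolding g_def using neg by (simp add: algebra_simps)
  have gc: "continuous_on {a..b} g" unfolding g_def by (intro continuous_intros f)
  have "uncountable ({g a<..<g b} - g ` S)"
    using S gab by (intro uncountable_minus_countable countable_image) (simp add: uncountable_open_interval)
  then obtain y where y: "g a < y" "y < g b" "y \<notin> g ` S"
    by (metis DiffE countable_empty equals0I greaterThanLessThan_iff)
  define X where "X = {x \<in> {a..b}. g x \<le> y}"
  have "closed X" unfolding X_def
    using continuous_closed_preimage[OF gc closed_real_atLeastAtMost, of "{..y}"]
    by (simp add: vimage_def Int_def conj_commute)
  moreover have "bounded X" unfolding X_def by (rule bounded_subset[of "{a..b}"]) auto
  ultimately have cX: "compact X" by (simp add: compact_eq_bounded_closed)
  have "a \<in> X" unfolding X_def using y ab by simp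
  then have "X \<noteq> {}" by blast
  from compact_attains_sup[OF cX this] obtain r where r: "r \<in> X" "\<And>s. s \<in> X \<Longrightarrow> s \<le> r" by blast
  have rb: "a \<le> r" "r \<le> b" "g r \<le> y" using r unfolding X_def by auto
  have "r < b" using rb y by (cases "r = b") auto
  have "g r = y"
  proof (rule ccontr)
    assume "g r \<noteq> y"
    then have "g r \<le> y" "y \<le> g b" using rb y by auto
    then obtain x where x: "r \<le> x" "x \<le> b" "g x = y"
      using IVT'[of g r y b] rb gc continuous_on_subset[of "{a..b}" g "{r..b}"] by auto
    then have "x \<in> X" unfolding X_def using rb by auto
    then show False using r(2)[of x] x \<open>g r \<noteq> y\<close> by auto
  qed
  then have "r \<in> {a<..<b} - S" using rb y \<open>r < b\<close> by (cases "a = r") auto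
  then obtain d where d: "d \<le> 0" "(f has_real_derivative d) (at r)" using d by blast
  have "(g has_real_derivative d - \<kappa>) (at r)" unfolding g_def
    using d(2) by (auto intro!: derivative_eq_intros)
  from DERIV_neg_dec_right[OF this] obtain e where e: "0 < e" "\<And>h. 0 < h \<Longrightarrow> h < e \<Longrightarrow> g (r + h) < g r"
    using d \<kappa> by auto
  define h where "h = min (e / 2) (b - r)"
  have "0 < h" "h < e" "r + h \<le> b" unfolding h_def using e(1) \<open>r < b\<close> by auto
  then have "r + h \<in> X" using e(2)[of h] rb \<open>g r = y\<close> unfolding X_def by auto
  then show False using r(2)[of "r + h"] \<open>0 < h\<close> by simp
qed

text \<open>On S the values of f' carry no information. The indefinite integral F of f' has the same
  derivative as f off S, hence f - F and F - f are both nonincreasing.\<close>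

lemma ftc_off_countable:
  fixes f f' :: "real \<Rightarrow> real"
  assumes ab: "a \<le> b" and S: "countable S" and f: "continuous_on {a..b} f"
    and d: "\<And>x. x \<in> {a<..<b} - S \<Longrightarrow> (f has_real_derivative f' x) (at x)"
    and c: "\<And>x. x \<in> {a<..<b} - S \<Longrightarrow> (f' \<longlongrightarrow> f' x) (at x within {a..b} - S)"
    and i: "f' integrable_on {a..b}"
  shows "(f' has_integral f b - f a) {a..b}"
proof -
  define F where "F x = integral {a..x} f'" for x
  have Fc: "continuous_on {a..b} F" unfolding F_def by (rule indefinite_integral_continuous_1[OF i])
  have nS: "negligible S" using negligible_countable_Union[of "(\<lambda>x. {x}) ` S"] S by auto
  have Fd: "(F has_real_derivative f' x) (at x)" if x: "x \<in> {a<..<b} - S" for x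
  proof -
    \<comment> \<open>For a fixed x outside S, overwriting f' on S by the value f' x makes it
      continuous at x within the whole interval and leaves all integrals unchanged.\<close>
    define \<phi> where "\<phi> y = (if y \<in> S then f' x else f' y)" for y
    have \<phi>i: "\<phi> integrable_on {a..b}"
      by (rule integrable_spike[OF i nS]) (auto simp: \<phi>_def)
    have F\<phi>: "F = (\<lambda>u. integral {a..u} \<phi>)" unfolding F_def
      by (intro ext integral_spike[OF nS]) (auto simp: \<phi>_def)
    have "(\<phi> \<longlongrightarrow> \<phi> x) (at x within {a..b})"
    proof (rule tendstoI)
      fix e :: real assume "0 < e"
      then have "\<forall>\<^sub>F y in at x within {a..b} - S. dist (f' y) (f' x) < e" using tendstoD[OF c[OF x]] by blast
      then show "\<forall>\<^sub>F y in at x within {a..b}. dist (\<phi> y) (\<phi> x) < e"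
        unfolding eventually_at_filter \<phi>_def using x \<open>0 < e\<close> by (auto elim: eventually_mono)
    qed
    then have "continuous (at x within {a..b}) \<phi>" by (simp add: continuous_within)
    from integral_has_vector_derivative_continuous_at[OF \<phi>i _ finite.emptyI, of x] this
    have "(F has_vector_derivative \<phi> x) (at x within {a..b})" using x unfolding F\<phi> by auto
    moreover have "at x within {a..b} = at x" by (rule at_within_interior) (use x in simp)
    ultimately show ?thesis using x by (simp add: \<phi>_def has_real_derivative_iff_has_vector_derivative)
  qed
  have "f b - F b \<le> f a - F a"
    by (rule nonincreasing_off_countable[OF ab S])
       (use Fd d in \<open>auto intro!: continuous_intros f Fc exI[of _ 0] derivative_eq_intros\<close>)
  moreover have "F b - f b \<le> F a - f a"
    by (rule nonincreasing_off_countable[OF ab S])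
       (use Fd d in \<open>auto intro!: continuous_intros f Fc exI[of _ 0] derivative_eq_intros\<close>)
  ultimately have "f b - f a = integral {a..b} f'" unfolding F_def by simp
  then show ?thesis using i by (simp add: has_integral_integral)
qed

section \<open>Integrals with a bounded Borel weight\<close>

lemma integrable_mult_bounded_borel:
  fixes b f :: "real \<Rightarrow> real"
  assumes b: "b \<in> borel_measurable borel" and bd: "\<And>y. \<bar>b y\<bar> \<le> \<beta>" and f: "continuous_on {a..c} f"
  shows "(\<lambda>y. b y * f y) integrable_on {a..c}"
proof (rule measurable_bounded_by_integrable_imp_integrable_real)
  have "b \<in> borel_measurable (lebesgue_on {a..c})"
    using b by (intro measurable_restrict_space1) (simp add: measurable_completion)
  moreover have "f \<in> borel_measurable (lebesgue_on {a..c})"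
    by (rule continuous_imp_measurable_on_sets_lebesgue[OF f]) simp
  ultimately show "(\<lambda>y. b y * f y) \<in> borel_measurable (lebesgue_on {a..c})" by simp
  show "(\<lambda>y. \<beta> * \<bar>f y\<bar>) integrable_on {a..c}"
    by (intro integrable_continuous_real continuous_intros f)
  show "\<bar>b y * f y\<bar> \<le> \<beta> * \<bar>f y\<bar>" if "y \<in> {a..c}" for y
    using bd[of y] by (simp add: abs_mult mult_right_mono)
qed simp

lemma integral_mult_bounded_borel_bound:
  fixes b f :: "real \<Rightarrow> real"
  assumes b: "b \<in> borel_measurable borel" and bd: "\<And>y. \<bar>b y\<bar> \<le> \<beta>" and f: "continuous_on {a..c} f"
    and h: "continuous_on {a..c} h" and fh: "\<And>y. y \<in> {a..c} \<Longrightarrow> \<bar>f y\<bar> \<le> h y"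
  shows "\<bar>integral {a..c} (\<lambda>y. b y * f y)\<bar> \<le> \<beta> * integral {a..c} h"
proof -
  have "\<bar>integral {a..c} (\<lambda>y. b y * f y)\<bar> \<le> integral {a..c} (\<lambda>y. \<beta> * h y)"
    unfolding real_norm_def[symmetric]
  proof (rule integral_norm_bound_integral)
    show "(\<lambda>y. b y * f y) integrable_on {a..c}" by (rule integrable_mult_bounded_borel[OF b bd f])
    show "(\<lambda>y. \<beta> * h y) integrable_on {a..c}" by (intro integrable_continuous_real continuous_intros h)
    have "0 \<le> \<beta>" using bd[of 0] by simp
    then show "norm (b y * f y) \<le> \<beta> * h y" if "y \<in> {a..c}" for y
      using bd[of y] fh[OF that] by (simp add: abs_mult mult_mono)
  qed
  then show ?thesis by simp
qed

text \<open>All continuity comes from f, as the weight b is only bounded. Changing the parameter at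
  a fixed end point costs at most \<beta> times the uniform change d of f over the compact interval;
  changing the end point by r costs at most \<beta> M r. The constants d and r give \<epsilon> / 2
  each.\<close>

lemma continuous_on_param_integral_upper:
  fixes b :: "real \<Rightarrow> real" and f :: "real \<Rightarrow> 'x::metric_space \<Rightarrow> real"
  assumes b: "b \<in> borel_measurable borel" and bd: "\<And>y. \<bar>b y\<bar> \<le> \<beta>"
    and f: "continuous_on (S \<times> {lo..hi}) (\<lambda>(x, y). f y x)"
    and e: "continuous_on S e" and e_in: "\<And>x. x \<in> S \<Longrightarrow> e x \<in> {lo..hi}"
  shows "continuous_on S (\<lambda>x. integral {lo..e x} (\<lambda>y. b y * f y x))"
proof (rule continuous_onI)
  fix x0 \<epsilon> assume x0: "x0 \<in> S" and \<epsilon>: "(0::real) < \<epsilon>"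
  have \<beta>: "0 \<le> \<beta>" using bd[of 0] by simp
  have fx: "continuous_on {lo..hi} (\<lambda>y. f y x)" if "x \<in> S" for x
    by (rule continuous_on_compose2[OF f, of _ "\<lambda>y. (x, y)", simplified]) (use that in \<open>auto intro!: continuous_intros\<close>)
  have bi: "(\<lambda>y. b y * f y x) integrable_on {u..v}" if "x \<in> S" "lo \<le> u" "v \<le> hi" for x u v
    by (rule integrable_mult_bounded_borel[OF b bd continuous_on_subset[OF fx[OF that(1)]]]) (use that in auto)
  obtain M where M: "\<And>y. y \<in> {lo..hi} \<Longrightarrow> \<bar>f y x0\<bar> \<le> M"
    using compact_imp_bounded[OF compact_continuous_image[OF fx[OF x0] compact_Icc]] by (fastforce simp: bounded_iff)
  define d where "d = \<epsilon> / (2 * (\<beta> + 1) * (\<bar>hi - lo\<bar> + 1))"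
  have d: "0 < d" unfolding d_def using \<epsilon> \<beta> by (simp add: add_nonneg_pos)
  obtain X0 where X0: "x0 \<in> X0" "open X0"
      "\<And>x y. x \<in> X0 \<inter> S \<Longrightarrow> y \<in> {lo..hi} \<Longrightarrow> \<bar>f y x - f y x0\<bar> \<le> d"
  proof -
    obtain X0 where "x0 \<in> X0" "open X0"
      "\<forall>x\<in>X0 \<inter> S. \<forall>y\<in>{lo..hi}. dist (case (x, y) of (x, y) \<Rightarrow> f y x) (case (x0, y) of (x, y) \<Rightarrow> f y x) \<le> d"
      using continuous_on_prod_compactE[OF f compact_Icc x0 d] .
    then show thesis using that[of X0] by (simp add: dist_real_def)
  qed
  obtain d1 where d1: "0 < d1" "ball x0 d1 \<subseteq> X0" using X0 openE by blast
  define r where "r = \<epsilon> / (2 * (\<beta> * \<bar>M\<bar> + 1))"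
  have r: "0 < r" unfolding r_def using \<epsilon> \<beta> by (simp add: add_nonneg_pos)
  obtain d2 where d2: "0 < d2" "\<And>x. x \<in> S \<Longrightarrow> dist x x0 < d2 \<Longrightarrow> \<bar>e x - e x0\<bar> < r"
    using e x0 r unfolding continuous_on_iff dist_real_def by metis
  show "\<exists>d>0. \<forall>x\<in>S. dist x x0 < d \<longrightarrow> dist (integral {lo..e x} (\<lambda>y. b y * f y x)) (integral {lo..e x0} (\<lambda>y. b y * f y x0)) \<le> \<epsilon>"
  proof (intro exI[of _ "min d1 d2"] conjI ballI impI)
    fix x assume x: "x \<in> S" "dist x x0 < min d1 d2"
    have xX: "x \<in> X0 \<inter> S" using x d1 by (auto simp: dist_commute)
    have ex: "lo \<le> e x" "e x \<le> hi" "lo \<le> e x0" "e x0 \<le> hi" using e_in[OF x(1)] e_in[OF x0] by auto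
    have "integral {lo..e x} (\<lambda>y. b y * f y x) - integral {lo..e x} (\<lambda>y. b y * f y x0)
        = integral {lo..e x} (\<lambda>y. b y * (f y x - f y x0))"
      using bi[OF x(1), of lo "e x"] bi[OF x0, of lo "e x"] ex
      by (simp add: integral_diff[symmetric] right_diff_distrib)
    also have "\<bar>\<dots>\<bar> \<le> \<beta> * integral {lo..e x} (\<lambda>_. d)"
    proof (rule integral_mult_bounded_borel_bound[OF b bd])
      show "continuous_on {lo..e x} (\<lambda>y. f y x - f y x0)"
        by (intro continuous_intros continuous_on_subset[OF fx[OF x(1)]] continuous_on_subset[OF fx[OF x0]]) (use ex in auto)
      show "\<bar>f y x - f y x0\<bar> \<le> d" if "y \<in> {lo..e x}" for y using X0(3)[OF xX, of y] that ex by auto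
    qed simp
    also have "\<dots> = \<beta> * (d * (e x - lo))" using ex by simp
    also have "\<dots> \<le> (\<beta> + 1) * (d * (\<bar>hi - lo\<bar> + 1))"
      using \<beta> d ex by (intro mult_mono) auto
    also have "\<dots> = \<epsilon> / 2"
    proof -
      have "d * (2 * (\<beta> + 1) * (\<bar>hi - lo\<bar> + 1)) = \<epsilon>"
        unfolding d_def using \<beta> by (simp add: add_nonneg_eq_0_iff)
      then show ?thesis by (simp add: algebra_simps)
    qed
    finally have 1: "\<bar>integral {lo..e x} (\<lambda>y. b y * f y x) - integral {lo..e x} (\<lambda>y. b y * f y x0)\<bar> \<le> \<epsilon> / 2" .
    have seg: "\<bar>integral {lo..v} (\<lambda>y. b y * f y x0) - integral {lo..u} (\<lambda>y. b y * f y x0)\<bar> \<le> \<beta> * \<bar>M\<bar> * (v - u)"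
      if uv: "lo \<le> u" "u \<le> v" "v \<le> hi" for u v
    proof -
      have "integral {lo..v} (\<lambda>y. b y * f y x0) - integral {lo..u} (\<lambda>y. b y * f y x0) = integral {u..v} (\<lambda>y. b y * f y x0)"
        using Henstock_Kurzweil_Integration.integral_combine[OF uv(1,2) bi[OF x0 _ uv(3)]] by simp
      also have "\<bar>\<dots>\<bar> \<le> \<beta> * integral {u..v} (\<lambda>_. \<bar>M\<bar>)"
      proof (rule integral_mult_bounded_borel_bound[OF b bd])
        show "\<bar>f y x0\<bar> \<le> \<bar>M\<bar>" if "y \<in> {u..v}" for y using M[of y] that uv by auto
      qed (use uv in \<open>auto intro: continuous_on_subset[OF fx[OF x0]]\<close>)
      also have "\<dots> = \<beta> * \<bar>M\<bar> * (v - u)" using uv by simp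
      finally show ?thesis .
    qed
    have "\<bar>integral {lo..e x} (\<lambda>y. b y * f y x0) - integral {lo..e x0} (\<lambda>y. b y * f y x0)\<bar> \<le> \<beta> * \<bar>M\<bar> * \<bar>e x - e x0\<bar>"
      using seg[of "e x" "e x0"] seg[of "e x0" "e x"] ex by (cases "e x \<le> e x0") (auto simp: abs_minus_commute)
    also have "\<dots> \<le> (\<beta> * \<bar>M\<bar> + 1) * r"
      using d2(2)[OF x(1)] x \<beta> r by (intro mult_mono) auto
    also have "\<dots> = \<epsilon> / 2"
    proof -
      have "\<beta> * \<bar>M\<bar> + 1 \<noteq> 0" using \<beta> by (metis add_nonneg_pos abs_ge_zero less_irrefl mult_nonneg_nonneg zero_less_one)
      then show ?thesis unfolding r_def by (simp add: field_simps)
    qed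
    finally show "dist (integral {lo..e x} (\<lambda>y. b y * f y x)) (integral {lo..e x0} (\<lambda>y. b y * f y x0)) \<le> \<epsilon>"
      using 1 unfolding dist_real_def by linarith
  qed (use d1 d2 in auto)
qed

lemma continuous_on_param_integral:
  fixes b :: "real \<Rightarrow> real" and f :: "real \<Rightarrow> 'x::metric_space \<Rightarrow> real"
  assumes b: "b \<in> borel_measurable borel" and bd: "\<And>y. \<bar>b y\<bar> \<le> \<beta>"
    and f: "continuous_on (S \<times> {lo..hi}) (\<lambda>(x, y). f y x)"
    and e: "continuous_on S e" and a: "continuous_on S a"
    and ae: "\<And>x. x \<in> S \<Longrightarrow> lo \<le> a x \<and> a x \<le> e x \<and> e x \<le> hi"
  shows "continuous_on S (\<lambda>x. integral {a x..e x} (\<lambda>y. b y * f y x))"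
proof -
  have "continuous_on S (\<lambda>x. integral {lo..e x} (\<lambda>y. b y * f y x) - integral {lo..a x} (\<lambda>y. b y * f y x))"
    by (intro continuous_on_diff continuous_on_param_integral_upper[OF b bd f] e a) (use ae in fastforce)+
  moreover have "integral {lo..e x} (\<lambda>y. b y * f y x) - integral {lo..a x} (\<lambda>y. b y * f y x)
      = integral {a x..e x} (\<lambda>y. b y * f y x)" if x: "x \<in> S" for x
  proof -
    have "continuous_on {lo..e x} (\<lambda>y. f y x)"
      by (rule continuous_on_compose2[OF f, of _ "\<lambda>y. (x, y)", simplified]) (use x ae[OF x] in \<open>auto intro!: continuous_intros\<close>)
    from Henstock_Kurzweil_Integration.integral_combine[OF _ _ integrable_mult_bounded_borel[OF b bd this], of "a x"] ae[OF x]
    show ?thesis by simp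
  qed
  ultimately show ?thesis by (simp cong: continuous_on_cong)
qed

text \<open>The slices {k} \<times> UNIV are open, so finitely many layers can be packed into a
  single continuous function whose first argument is the layer index.\<close>

lemma continuous_on_nat_prod:
  fixes F :: "nat \<Rightarrow> 'a::topological_space \<Rightarrow> 'b::topological_space"
  assumes "\<And>k. continuous_on UNIV (F k)"
  shows "continuous_on UNIV (\<lambda>x. F (fst x) (snd x))"
proof -
  have "continuous_on (\<Union>k. {k} \<times> UNIV) (\<lambda>x. F (fst x) (snd x))"
  proof (rule continuous_on_open_UN)
    show "open ({k} \<times> (UNIV :: 'a set))" for k :: nat by (intro open_Times open_discrete open_UNIV)
    fix k
    have "continuous_on ({k} \<times> UNIV) (\<lambda>x. F k (snd x))"
      by (rule continuous_on_compose2[OF assms[of k]]) (auto intro!: continuous_intros)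
    then show "continuous_on ({k} \<times> UNIV) (\<lambda>x. F (fst x) (snd x))"
      by (rule continuous_on_cong[THEN iffD1, rotated -1]) auto
  qed
  moreover have "(\<Union>k. {k} \<times> UNIV) = (UNIV :: (nat \<times> 'a) set)" by auto
  ultimately show ?thesis by simp
qed

text \<open>The function w is known to vary regularly in the direction (\<sigma>, 1) only, at rate
  F. Comparing the time integral at z with the one at z + \<sigma> s over the shifted interval
  [t1 + s, t2 + s] uses just that, and undoing the shift costs the values at the end points. In this
  way a derivative along a characteristic becomes a balance law in z, although w may lack partial
  derivatives. The margins 0 < t1 and t2 < T leave room for the shift.\<close>

lemma time_integral_deriv:
  fixes w :: "real \<Rightarrow> real \<Rightarrow> real"
  assumes w: "continuous_on (S \<times> {0..T}) (\<lambda>(z, t). w z t)" and z: "z \<in> S"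
    and t: "0 < t1" "t1 \<le> t2" "t2 < T" and \<sigma>: "\<bar>\<sigma>\<bar> = 1" and F: "continuous_on {t1..t2} F"
    and q: "\<And>\<epsilon>. 0 < \<epsilon> \<Longrightarrow> \<exists>\<eta>>0. \<forall>s t. \<bar>s\<bar> < \<eta> \<longrightarrow> z + \<sigma> * s \<in> S \<longrightarrow> t \<in> {t1..t2} \<longrightarrow> t + s \<in> {0..T} \<longrightarrow>
              \<bar>w (z + \<sigma> * s) (t + s) - w z t - s * F t\<bar> \<le> \<epsilon> * \<bar>s\<bar>"
  shows "((\<lambda>y. integral {t1..t2} (w y)) has_real_derivative
          \<sigma> * (integral {t1..t2} F - (w z t2 - w z t1))) (at z within S)"
proof -
  have \<sigma>2: "\<sigma> * \<sigma> = 1" using \<sigma> by (metis abs_mult_self_eq mult_1)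
  have wy: "continuous_on {0..T} (w y)" if "y \<in> S" for y
    by (rule continuous_on_compose2[OF w, of _ "\<lambda>t. (y, t)", simplified]) (use that in \<open>auto intro!: continuous_intros\<close>)
  have wz: "\<exists>d>0. \<forall>y t. y \<in> S \<longrightarrow> t \<in> {0..T} \<longrightarrow> \<bar>y - z\<bar> < d \<longrightarrow> \<bar>t - t0\<bar> < d \<longrightarrow> \<bar>w y t - w z t0\<bar> < \<epsilon>"
    if eps: "0 < \<epsilon>" and t0: "t0 \<in> {0..T}" for t0 \<epsilon>
  proof -
    have "(z, t0) \<in> S \<times> {0..T}" using z t0 by simp
    from w[unfolded continuous_on_iff, rule_format, OF this eps]
    obtain d where d: "0 < d" "\<And>y t. y \<in> S \<Longrightarrow> t \<in> {0..T} \<Longrightarrow> dist (y, t) (z, t0) < d \<Longrightarrow>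
        dist (w y t) (w z t0) < \<epsilon>"
      by auto
    show ?thesis
    proof (intro exI[of _ "d / 2"] conjI allI impI)
      fix y t assume *: "y \<in> S" "t \<in> {0..T}" "\<bar>y - z\<bar> < d / 2" "\<bar>t - t0\<bar> < d / 2"
      have "dist (y, t) (z, t0) \<le> \<bar>y - z\<bar> + \<bar>t - t0\<bar>"
        unfolding dist_prod_def dist_real_def by (simp add: sqrt_sum_squares_le_sum_abs)
      then show "\<bar>w y t - w z t0\<bar> < \<epsilon>" using d(2)[of y t] * by (simp add: dist_real_def)
    qed (use d in simp)
  qed
  define \<omega> where "\<omega> y t = integral {0..t} (w y)" for y t
  have \<omega>d: "(\<omega> y has_real_derivative w y t) (at t within {0..T})" if "y \<in> S" "t \<in> {0..T}" for y t
    unfolding \<omega>_def by (rule integral_has_real_derivative[OF wy[OF that(1)] that(2)])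
  have \<omega>i: "\<omega> y v - \<omega> y u = integral {u..v} (w y)" if "y \<in> S" "0 \<le> u" "u \<le> v" "v \<le> T" for y u v
  proof -
    have "w y integrable_on {0..v}"
      by (rule integrable_continuous_real, rule continuous_on_subset[OF wy[OF that(1)]]) (use that in auto)
    from Henstock_Kurzweil_Integration.integral_combine[OF that(2,3) this] show ?thesis unfolding \<omega>_def by simp
  qed
  let ?D = "integral {t1..t2} F - (w z t2 - w z t1)"
  show ?thesis unfolding has_field_derivative_def has_derivative_within_alt2
  proof (intro conjI allI impI)
    show "bounded_linear ((*) (\<sigma> * ?D))" by (rule bounded_linear_mult_right)
    fix e :: real assume e: "0 < e"
    define \<epsilon> where "\<epsilon> = e / (t2 - t1 + 2)"
    have \<epsilon>: "0 < \<epsilon>" "\<epsilon> * (t2 - t1 + 2) = e" unfolding \<epsilon>_def using e t by auto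
    obtain \<eta> where \<eta>: "0 < \<eta>" "\<And>s t. \<bar>s\<bar> < \<eta> \<Longrightarrow> z + \<sigma> * s \<in> S \<Longrightarrow> t \<in> {t1..t2} \<Longrightarrow> t + s \<in> {0..T} \<Longrightarrow>
              \<bar>w (z + \<sigma> * s) (t + s) - w z t - s * F t\<bar> \<le> \<epsilon> * \<bar>s\<bar>"
      using q[OF \<epsilon>(1)] by blast
    obtain d1 where d1: "0 < d1" "\<And>y t. y \<in> S \<Longrightarrow> t \<in> {0..T} \<Longrightarrow> \<bar>y - z\<bar> < d1 \<Longrightarrow> \<bar>t - t1\<bar> < d1 \<Longrightarrow> \<bar>w y t - w z t1\<bar> < \<epsilon>"
      using wz[OF \<epsilon>(1), of t1] t by auto
    obtain d2 where d2: "0 < d2" "\<And>y t. y \<in> S \<Longrightarrow> t \<in> {0..T} \<Longrightarrow> \<bar>y - z\<bar> < d2 \<Longrightarrow> \<bar>t - t2\<bar> < d2 \<Longrightarrow> \<bar>w y t - w z t2\<bar> < \<epsilon>"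
      using wz[OF \<epsilon>(1), of t2] t by auto
    define r where "r = Min {\<eta>, d1, d2, t1, T - t2}"
    have r: "0 < r" "r \<le> \<eta>" "r \<le> d1" "r \<le> d2" "r \<le> t1" "r \<le> T - t2"
      unfolding r_def using \<eta> d1 d2 t by auto
    have main: "\<bar>integral {t1..t2} (w y) - integral {t1..t2} (w z) - \<sigma> * ?D * (y - z)\<bar> \<le> e * \<bar>y - z\<bar>"
      if y: "y \<in> S" "\<bar>y - z\<bar> < r" for y
    proof -
      define s where "s = \<sigma> * (y - z)"
      have s: "\<bar>s\<bar> = \<bar>y - z\<bar>" "z + \<sigma> * s = y" "\<sigma> * (y - z) = s"
        unfolding s_def using \<sigma> \<sigma>2 by (auto simp: abs_mult mult.assoc[symmetric])
      have ts: "t + s \<in> {0<..<T}" if "t \<in> {t1..t2}" for t using that s(1) y(2) r by auto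
      have near: "\<bar>\<omega> y (t0 + s) - \<omega> y t0 - s * w z t0\<bar> \<le> \<epsilon> * \<bar>s\<bar>"
        if t0: "t0 \<in> {t1..t2}" "\<And>y t. y \<in> S \<Longrightarrow> t \<in> {0..T} \<Longrightarrow> \<bar>y - z\<bar> < r \<Longrightarrow> \<bar>t - t0\<bar> < r \<Longrightarrow> \<bar>w y t - w z t0\<bar> < \<epsilon>" for t0
      proof -
        let ?I = "{min t0 (t0 + s)..max t0 (t0 + s)}"
        have sub: "?I \<subseteq> {0..T}" using ts[OF t0(1)] t0(1) t by auto
        have "norm ((\<omega> y (t0 + s) - (t0 + s) * w z t0) - (\<omega> y t0 - t0 * w z t0)) \<le> \<epsilon> * norm ((t0 + s) - t0)"
        proof (rule field_differentiable_bound[of ?I "\<lambda>t. \<omega> y t - t * w z t0" "\<lambda>t. w y t - w z t0"])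
          fix \<tau> assume \<tau>: "\<tau> \<in> ?I"
          then have \<tau>T: "\<tau> \<in> {0..T}" using sub by blast
          have "(\<omega> y has_real_derivative w y \<tau>) (at \<tau> within ?I)"
            by (rule DERIV_subset[OF \<omega>d[OF y(1) \<tau>T] sub])
          then show "((\<lambda>t. \<omega> y t - t * w z t0) has_field_derivative w y \<tau> - w z t0) (at \<tau> within ?I)"
            by (auto intro!: derivative_eq_intros)
          have "\<bar>\<tau> - t0\<bar> \<le> \<bar>s\<bar>" using \<tau> by (auto simp: min_def max_def split: if_splits)
          then show "norm (w y \<tau> - w z t0) \<le> \<epsilon>"
            using t0(2)[OF y(1) \<tau>T y(2)] s(1) y(2) by simp
        qed auto
        then show ?thesis by (simp add: algebra_simps)
      qed
      have n1: "\<bar>\<omega> y (t1 + s) - \<omega> y t1 - s * w z t1\<bar> \<le> \<epsilon> * \<bar>s\<bar>"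
        by (rule near) (use t d1 r in auto)
      have n2: "\<bar>\<omega> y (t2 + s) - \<omega> y t2 - s * w z t2\<bar> \<le> \<epsilon> * \<bar>s\<bar>"
        by (rule near) (use t d2 r in auto)
      have shift: "((\<lambda>t. w y (t + s)) has_integral \<omega> y (t2 + s) - \<omega> y (t1 + s)) {t1..t2}"
      proof (rule fundamental_theorem_of_calculus[OF t(2)])
        fix \<tau> assume \<tau>: "\<tau> \<in> {t1..t2}"
        have "at (\<tau> + s) within {0..T} = at (\<tau> + s)" by (rule at_within_interior) (use ts[OF \<tau>] in simp)
        then have "(\<omega> y has_real_derivative w y (\<tau> + s)) (at (\<tau> + s))"
          using \<omega>d[OF y(1), of "\<tau> + s"] ts[OF \<tau>] by simp
        then have "((\<lambda>t. \<omega> y (t + s)) has_real_derivative w y (\<tau> + s)) (at \<tau>)"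
          by (simp add: DERIV_shift)
        then show "((\<lambda>t. \<omega> y (t + s)) has_vector_derivative w y (\<tau> + s)) (at \<tau> within {t1..t2})"
          using has_field_derivative_at_within has_real_derivative_iff_has_vector_derivative by blast
      qed
      have wzi: "(w z has_integral integral {t1..t2} (w z)) {t1..t2}"
        by (rule integrable_integral, rule integrable_continuous_real, rule continuous_on_subset[OF wy[OF z]])
           (use t in auto)
      have Fi: "(F has_integral integral {t1..t2} F) {t1..t2}"
        by (rule integrable_integral, rule integrable_continuous_real[OF F])
      have hi: "((\<lambda>t. w y (t + s) - w z t - s * F t) has_integral
          (\<omega> y (t2 + s) - \<omega> y (t1 + s)) - integral {t1..t2} (w z) - s * integral {t1..t2} F) {t1..t2}"
        by (intro has_integral_diff shift wzi has_integral_mult_right Fi)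
      have n3: "\<bar>(\<omega> y (t2 + s) - \<omega> y (t1 + s)) - integral {t1..t2} (w z) - s * integral {t1..t2} F\<bar>
          \<le> \<epsilon> * \<bar>s\<bar> * (t2 - t1)"
      proof -
        have "norm (w y (t + s) - w z t - s * F t) \<le> \<epsilon> * \<bar>s\<bar>" if "t \<in> {t1..t2} - {}" for t
          using \<eta>(2)[of s t] s y r ts[of t] that by simp
        from has_integral_bound_real[OF _ finite.emptyI hi this] show ?thesis using \<epsilon> t by simp
      qed
      have "\<omega> y t2 - \<omega> y t1 = integral {t1..t2} (w y)" using \<omega>i[OF y(1)] t by simp
      then have "integral {t1..t2} (w y) - integral {t1..t2} (w z) - s * ?D
        = ((\<omega> y (t2 + s) - \<omega> y (t1 + s)) - integral {t1..t2} (w z) - s * integral {t1..t2} F)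
          - (\<omega> y (t2 + s) - \<omega> y t2 - s * w z t2) + (\<omega> y (t1 + s) - \<omega> y t1 - s * w z t1)"
        by (simp add: algebra_simps)
      then have "\<bar>integral {t1..t2} (w y) - integral {t1..t2} (w z) - s * ?D\<bar> \<le> \<epsilon> * \<bar>s\<bar> * (t2 - t1) + \<epsilon> * \<bar>s\<bar> + \<epsilon> * \<bar>s\<bar>"
        using n1 n2 n3 by linarith
      also have "\<dots> = (\<epsilon> * (t2 - t1 + 2)) * \<bar>s\<bar>" by (simp add: algebra_simps)
      also have "\<dots> = e * \<bar>y - z\<bar>" using \<epsilon>(2) s(1) by simp
      finally have *: "\<bar>integral {t1..t2} (w y) - integral {t1..t2} (w z) - s * ?D\<bar> \<le> e * \<bar>y - z\<bar>" .
      have "\<sigma> * ?D * (y - z) = s * ?D" unfolding s(3)[symmetric] by (simp only: mult_ac)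
      then show ?thesis using * by metis
    qed
    show "\<forall>\<^sub>F y in at z within S. norm (integral {t1..t2} (w y) - integral {t1..t2} (w z) - \<sigma> * ?D * (y - z)) \<le> e * norm (y - z)"
      unfolding eventually_at by (intro exI[of _ r]) (use main r in \<open>auto simp: dist_real_def\<close>)
  qed
qed

section \<open>First-order systems in layered media\<close>

text \<open>The boundary condition at \<open>0\<close> expresses a trace as \<open>B A\<close>, where \<open>A\<close> is the invariant arriving
  at the boundary. Both a prescribed trace and the solution operator of the boundary equation are
  causal.\<close>

definition causal where
  "causal B T \<longleftrightarrow> (\<forall>A. continuous_on {0..T} A \<longrightarrow> continuous_on {0..T} (B A)) \<and>
     (\<forall>A1 A2 t d. continuous_on {0..T} A1 \<longrightarrow> continuous_on {0..T} A2 \<longrightarrow> t \<in> {0..T} \<longrightarrow>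
        (\<forall>s\<in>{0..t}. \<bar>A1 s - A2 s\<bar> \<le> d) \<longrightarrow> \<bar>B A1 t - B A2 t\<bar> \<le> d)" for B :: "(real \<Rightarrow> real) \<Rightarrow> real \<Rightarrow> real" and T :: real

definition "clt T t = max 0 (min T t)" for T t :: real

text \<open>The system is \<open>P\<^sub>t = \<gamma> Q\<^sub>z\<close>, \<open>\<gamma> Q\<^sub>t = P\<^sub>z\<close>, with invariants \<open>P \<plusminus> \<gamma> Q\<close>; \<open>\<gamma> k\<close> is the coefficient on
  layer \<open>k\<close>, including its one-sided limits at the nodes, and \<open>b\<close> is the derivative of \<open>\<gamma>\<close>.\<close>

locale layered =
  fixes N :: nat and \<zeta> :: "nat \<Rightarrow> real" and \<gamma> :: "nat \<Rightarrow> real \<Rightarrow> real" and b :: "real \<Rightarrow> real"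
    and E :: "real set" and m \<beta> :: real
  assumes N: "0 < N" and \<zeta>0: "\<zeta> 0 = 0" and \<zeta>_less: "\<And>k. k < N \<Longrightarrow> \<zeta> k < \<zeta> (Suc k)"
    and \<gamma>_cont: "\<And>k. k < N \<Longrightarrow> continuous_on {\<zeta> k..\<zeta> (Suc k)} (\<gamma> k)"
    and m: "0 < m" and \<gamma>_ge: "\<And>k z. k < N \<Longrightarrow> z \<in> {\<zeta> k..\<zeta> (Suc k)} \<Longrightarrow> m \<le> \<gamma> k z"
    and b_meas: "b \<in> borel_measurable borel" and b_bd: "\<And>z. \<bar>b z\<bar> \<le> \<beta>"
    and E: "countable E"
    and \<gamma>_deriv: "\<And>k z. k < N \<Longrightarrow> z \<in> {\<zeta> k<..<\<zeta> (Suc k)} - E \<Longrightarrow> (\<gamma> k has_real_derivative b z) (at z)"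
    and b_cont: "\<And>z. z \<in> {0..\<zeta> N} - E \<Longrightarrow> (b \<longlongrightarrow> b z) (at z within {0..\<zeta> N} - E)"
begin

lemma \<gamma>_pos: "k < N \<Longrightarrow> z \<in> {\<zeta> k..\<zeta> (Suc k)} \<Longrightarrow> 0 < \<gamma> k z"
  using \<gamma>_ge m by (meson less_le_trans)

lemma \<beta>_nonneg: "0 \<le> \<beta>" using b_bd[of 0] by simp

lemma \<zeta>_mono: "i \<le> j \<Longrightarrow> j \<le> N \<Longrightarrow> \<zeta> i \<le> \<zeta> j"
proof (induction j)
  case (Suc j)
  show ?case
  proof (cases "i = Suc j")
    case False
    then have "\<zeta> i \<le> \<zeta> j" using Suc by auto
    then show ?thesis using \<zeta>_less[of j] Suc.prems by simp
  qed simp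
qed simp

lemma \<zeta>_strict: "i < j \<Longrightarrow> j \<le> N \<Longrightarrow> \<zeta> i < \<zeta> j"
  using \<zeta>_less[of i] \<zeta>_mono[of "Suc i" j] by simp

lemma piece_in: "k < N \<Longrightarrow> z \<in> {\<zeta> k..\<zeta> (Suc k)} \<Longrightarrow> z \<in> {0..\<zeta> N}"
  using \<zeta>_mono[of 0 k] \<zeta>_mono[of "Suc k" N] \<zeta>0 by auto

lemma Z_pos: "0 < \<zeta> N" using \<zeta>_strict[of 0 N] \<zeta>0 N by simp

lemma piece_ex: "z \<in> {0..\<zeta> N} \<Longrightarrow> \<exists>k<N. z \<in> {\<zeta> k..\<zeta> (Suc k)}"
proof -
  assume z: "z \<in> {0..\<zeta> N}"
  have "\<exists>k<n. z \<in> {\<zeta> k..\<zeta> (Suc k)}" if "0 < n" "n \<le> N" "z \<le> \<zeta> n" for n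
    using that
  proof (induction n)
    case (Suc n)
    show ?case
    proof (cases "\<zeta> n \<le> z")
      case True then show ?thesis using Suc.prems by auto
    next
      case False
      then have "n \<noteq> 0" using z \<zeta>0 by (cases n) auto
      then show ?thesis using Suc False by (metis Suc_leD less_Suc_eq linear neq0_conv)
    qed
  qed simp
  then show ?thesis using N z by auto
qed

text \<open>In the fixed point map \<open>step\<close>, the unknown \<open>w (k, z, t)\<close> is the pair of invariants
  \<open>(P + \<gamma> Q, P - \<gamma> Q)\<close> on layer \<open>k\<close>. The differences \<open>G \<dots> - G 0\<close> keep the iterates continuous across the
  characteristics from the corners before the corner data match. Clamping by \<open>clz\<close> and
  \<open>clt\<close> extends the iterates to all arguments, as bounded continuous functions must be total.\<close>

definition Qf :: "(nat \<times> real \<times> real \<Rightarrow> real \<times> real) \<Rightarrow> nat \<Rightarrow> real \<Rightarrow> real \<Rightarrow> real" where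
  "Qf w k y s = (fst (w (k, y, s)) - snd (w (k, y, s))) / (2 * \<gamma> k y)"

text \<open>Along z + t = const the invariant P + \<gamma> Q changes at rate - b Q. Traced back in
  time, the line leaves the layer at e: on the initial line if e = z + t, otherwise through the
  right end, where G is the entering trace. \<open>arrM\<close> is the mirror image for P - \<gamma>
  Q.\<close>

definition arrP where
  "arrP p0 q0 k G w z t = (let e = min (\<zeta> (Suc k)) (z + t) in
     p0 e + \<gamma> k e * q0 e + G (max 0 (z + t - \<zeta> (Suc k))) - G 0
     - integral {z..e} (\<lambda>y. b y * Qf w k y (z + t - y)))"

definition arrM where
  "arrM p0 q0 k G w z t = (let e = max (\<zeta> k) (z - t) in
     p0 e - \<gamma> k e * q0 e + G (max 0 (t - (z - \<zeta> k))) - G 0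
     - integral {e..z} (\<lambda>y. b y * Qf w k y (t - z + y)))"

text \<open>The trace arriving at one end of a layer is fed with the iterate's own trace at the
  other end, not with \<open>outP\<close> or \<open>outM\<close>. A scattered trace thus depends on
  the iterate only with a delay of one layer's travel time or under an integral, and this is why
  \<open>step\<close> contracts.\<close>

definition "inP p0 q0 w k t = arrP p0 q0 k (\<lambda>s. fst (w (k, \<zeta> (Suc k), s))) w (\<zeta> k) t"
definition "inM p0 q0 w k t = arrM p0 q0 k (\<lambda>s. snd (w (k, \<zeta> k, s))) w (\<zeta> (Suc k)) t"

text \<open>P and Q are continuous at a node, so wR = P + cR Q and wL = P - cL Q determine both, and
  the fraction is P + cL Q. At the outer end P = 0 reflects the invariant with the opposite sign. In
  \<open>outM\<close> the fraction is P - cR Q, and at 0 the boundary operator supplies P.\<close>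

definition outP where
  "outP p0 q0 w k t = (if Suc k = N then - inM p0 q0 w k t else
     (let cL = \<gamma> k (\<zeta> (Suc k)); cR = \<gamma> (Suc k) (\<zeta> (Suc k)); wR = inP p0 q0 w (Suc k) t; wL = inM p0 q0 w k t
      in (2 * cL * wR + (cR - cL) * wL) / (cL + cR)))"

definition outM where
  "outM p0 q0 B w k t = (if k = 0 then 2 * B (inP p0 q0 w 0) t - inP p0 q0 w 0 t else
     (let cL = \<gamma> (k - 1) (\<zeta> k); cR = \<gamma> k (\<zeta> k); wR = inP p0 q0 w k t; wL = inM p0 q0 w (k - 1) t
      in ((cL - cR) * wR + 2 * cR * wL) / (cL + cR)))"

definition "clz k z = max (\<zeta> k) (min (\<zeta> (Suc k)) z)"
definition stepk where
  "stepk p0 q0 B T w k z t = (if k < N then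
     (arrP p0 q0 k (outP p0 q0 w k) w (clz k z) (clt T t), arrM p0 q0 k (outM p0 q0 B w k) w (clz k z) (clt T t))
     else 0)"

definition step where "step p0 q0 B T w = (\<lambda>x. stepk p0 q0 B T w (fst x) (fst (snd x)) (snd (snd x)))"

lemma clz_in: "k < N \<Longrightarrow> clz k z \<in> {\<zeta> k..\<zeta> (Suc k)}"
  unfolding clz_def using \<zeta>_less[of k] by auto
lemma clz_id: "z \<in> {\<zeta> k..\<zeta> (Suc k)} \<Longrightarrow> clz k z = z" unfolding clz_def by auto
lemma clt_in: "0 \<le> T \<Longrightarrow> clt T t \<in> {0..T}" unfolding clt_def by auto
lemma clt_id: "t \<in> {0..T} \<Longrightarrow> clt T t = t" unfolding clt_def by auto

lemma Qf_cont:
  assumes w: "continuous_on UNIV w" and k: "k < N"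
  shows "continuous_on ({\<zeta> k..\<zeta> (Suc k)} \<times> UNIV) (\<lambda>(y, s). Qf w k y s)"
proof -
  have 1: "continuous_on ({\<zeta> k..\<zeta> (Suc k)} \<times> UNIV) (\<lambda>x. w (k, fst x, snd x))"
    by (rule continuous_on_compose2[OF w]) (auto intro!: continuous_intros)
  have 2: "continuous_on ({\<zeta> k..\<zeta> (Suc k)} \<times> UNIV) (\<lambda>x :: real \<times> real. \<gamma> k (fst x))"
    by (rule continuous_on_compose2[OF \<gamma>_cont[OF k]]) (auto intro!: continuous_intros)
  show ?thesis unfolding Qf_def split_beta
    by (intro continuous_intros 1 2) (use \<gamma>_pos[OF k] in force)
qed

lemma Qf_cont_line:
  assumes w: "continuous_on UNIV w" and k: "k < N" and S: "S \<subseteq> {\<zeta> k..\<zeta> (Suc k)}" and h: "continuous_on S h"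
  shows "continuous_on S (\<lambda>y. Qf w k y (h y))"
  by (rule continuous_on_compose2[OF Qf_cont[OF w k], of _ "\<lambda>y. (y, h y)", simplified])
     (use S h in \<open>auto intro!: continuous_intros\<close>)

end

text \<open>\<open>p0_right\<close> and \<open>B_init\<close> are the compatibility conditions at
  the corners. They make the outgoing traces start at the initial data, so that at a fixed point the
  corrections by G 0 in \<open>arrP\<close> and \<open>arrM\<close> cancel.\<close>

locale layered_data = layered +
  fixes p0 q0 :: "real \<Rightarrow> real" and T :: real and B :: "(real \<Rightarrow> real) \<Rightarrow> real \<Rightarrow> real"
  assumes T: "0 \<le> T" and p0: "continuous_on {0..\<zeta> N} p0" and q0: "continuous_on {0..\<zeta> N} q0"
    and B: "causal B T" and p0_right: "p0 (\<zeta> N) = 0"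
    and B_init: "\<And>A. continuous_on {0..T} A \<Longrightarrow> A 0 = p0 0 + \<gamma> 0 0 * q0 0 \<Longrightarrow> B A 0 = p0 0"
begin

lemma piece_cont: "k < N \<Longrightarrow> continuous_on {\<zeta> k..\<zeta> (Suc k)} p0 \<and> continuous_on {\<zeta> k..\<zeta> (Suc k)} q0"
  using p0 q0 piece_in by (meson continuous_on_subset subsetI)

lemma arrP_cont:
  assumes w: "continuous_on UNIV w" and k: "k < N" and G: "continuous_on {0..T} G"
  shows "continuous_on ({\<zeta> k..\<zeta> (Suc k)} \<times> {0..T}) (\<lambda>(z, t). arrP p0 q0 k G w z t)"
proof -
  let ?S = "{\<zeta> k..\<zeta> (Suc k)} \<times> {0..T}"
  have e: "continuous_on ?S (\<lambda>x. min (\<zeta> (Suc k)) (fst x + snd x))" by (intro continuous_intros)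
  have em: "(\<lambda>x. min (\<zeta> (Suc k)) (fst x + snd x)) ` ?S \<subseteq> {\<zeta> k..\<zeta> (Suc k)}" by auto
  have i: "continuous_on ?S (\<lambda>x. integral {fst x..min (\<zeta> (Suc k)) (fst x + snd x)} (\<lambda>y. b y * Qf w k y (fst x + snd x - y)))"
  proof (rule continuous_on_param_integral[OF b_meas b_bd _ e])
    show "continuous_on (?S \<times> {\<zeta> k..\<zeta> (Suc k)}) (\<lambda>(x, y). Qf w k y (fst x + snd x - y))"
      unfolding split_beta
      by (rule continuous_on_compose2[OF Qf_cont[OF w k], of _ "\<lambda>v. (snd v, fst (fst v) + snd (fst v) - snd v)", simplified])
         (auto intro!: continuous_intros)
  qed (auto intro!: continuous_intros)
  have g: "continuous_on ?S (\<lambda>x. G (max 0 (fst x + snd x - \<zeta> (Suc k))))"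
    by (rule continuous_on_compose2[OF G]) (auto intro!: continuous_intros)
  show ?thesis unfolding arrP_def Let_def split_beta
    by (intro continuous_intros i g continuous_on_compose2[OF conjunct1[OF piece_cont[OF k]] e em]
         continuous_on_compose2[OF conjunct2[OF piece_cont[OF k]] e em] continuous_on_compose2[OF \<gamma>_cont[OF k] e em])
qed

lemma arrM_cont:
  assumes w: "continuous_on UNIV w" and k: "k < N" and G: "continuous_on {0..T} G"
  shows "continuous_on ({\<zeta> k..\<zeta> (Suc k)} \<times> {0..T}) (\<lambda>(z, t). arrM p0 q0 k G w z t)"
proof -
  let ?S = "{\<zeta> k..\<zeta> (Suc k)} \<times> {0..T}"
  have e: "continuous_on ?S (\<lambda>x. max (\<zeta> k) (fst x - snd x))" by (intro continuous_intros)
  have em: "(\<lambda>x. max (\<zeta> k) (fst x - snd x)) ` ?S \<subseteq> {\<zeta> k..\<zeta> (Suc k)}" using \<zeta>_less[OF k] by auto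
  have i: "continuous_on ?S (\<lambda>x. integral {max (\<zeta> k) (fst x - snd x)..fst x} (\<lambda>y. b y * Qf w k y (snd x - fst x + y)))"
  proof (rule continuous_on_param_integral[OF b_meas b_bd _ _ e])
    show "continuous_on (?S \<times> {\<zeta> k..\<zeta> (Suc k)}) (\<lambda>(x, y). Qf w k y (snd x - fst x + y))"
      unfolding split_beta
      by (rule continuous_on_compose2[OF Qf_cont[OF w k], of _ "\<lambda>v. (snd v, snd (fst v) - fst (fst v) + snd v)", simplified])
         (auto intro!: continuous_intros)
  qed (auto intro!: continuous_intros)
  have g: "continuous_on ?S (\<lambda>x. G (max 0 (snd x - (fst x - \<zeta> k))))"
    by (rule continuous_on_compose2[OF G]) (auto intro!: continuous_intros)
  show ?thesis unfolding arrM_def Let_def split_beta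
    by (intro continuous_intros i g continuous_on_compose2[OF conjunct1[OF piece_cont[OF k]] e em]
         continuous_on_compose2[OF conjunct2[OF piece_cont[OF k]] e em] continuous_on_compose2[OF \<gamma>_cont[OF k] e em])
qed

lemma w_slice_cont:
  assumes w: "continuous_on UNIV w"
  shows "continuous_on S (\<lambda>s. fst (w (k, z, s)))" "continuous_on S (\<lambda>s. snd (w (k, z, s)))"
  by (intro continuous_intros continuous_on_compose2[OF w]; auto)+

lemma in_cont:
  assumes w: "continuous_on UNIV w" and k: "k < N"
  shows "continuous_on {0..T} (inP p0 q0 w k)" "continuous_on {0..T} (inM p0 q0 w k)"
proof -
  show "continuous_on {0..T} (inP p0 q0 w k)" unfolding inP_def[abs_def]
    by (rule continuous_on_compose2[OF arrP_cont[OF w k w_slice_cont(1)[OF w]], of _ "\<lambda>t. (\<zeta> k, t)", simplified])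
       (use \<zeta>_less[OF k] in \<open>auto intro!: continuous_intros\<close>)
  show "continuous_on {0..T} (inM p0 q0 w k)" unfolding inM_def[abs_def]
    by (rule continuous_on_compose2[OF arrM_cont[OF w k w_slice_cont(2)[OF w]], of _ "\<lambda>t. (\<zeta> (Suc k), t)", simplified])
       (use \<zeta>_less[OF k] in \<open>auto intro!: continuous_intros\<close>)
qed

lemma node_pos: "Suc k < N \<Longrightarrow> 0 < \<gamma> k (\<zeta> (Suc k)) \<and> 0 < \<gamma> (Suc k) (\<zeta> (Suc k))"
  using \<gamma>_pos[of k "\<zeta> (Suc k)"] \<gamma>_pos[of "Suc k" "\<zeta> (Suc k)"] \<zeta>_less[of k] \<zeta>_less[of "Suc k"] by auto

lemma outP_cont:
  assumes w: "continuous_on UNIV w" and k: "k < N"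
  shows "continuous_on {0..T} (outP p0 q0 w k)"
proof (cases "Suc k = N")
  case True
  have "outP p0 q0 w k = (\<lambda>t. - inM p0 q0 w k t)" unfolding outP_def[abs_def] using True by simp
  then show ?thesis by (auto intro!: continuous_intros in_cont w k)
next
  case False
  then have k': "Suc k < N" using k by simp
  show ?thesis unfolding outP_def[abs_def] Let_def using False node_pos[OF k']
    by (auto intro!: continuous_intros in_cont w k k')
qed

lemma outM_cont:
  assumes w: "continuous_on UNIV w" and k: "k < N"
  shows "continuous_on {0..T} (outM p0 q0 B w k)"
proof (cases "k = 0")
  case True
  have "outM p0 q0 B w k = (\<lambda>t. 2 * B (inP p0 q0 w 0) t - inP p0 q0 w 0 t)"
    unfolding outM_def[abs_def] using True by simp
  moreover have "continuous_on {0..T} (B (inP p0 q0 w 0))"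
    using B in_cont(1)[OF w N] unfolding causal_def by blast
  ultimately show ?thesis using N by (auto intro!: continuous_intros in_cont w)
next
  case False
  then obtain j where j: "k = Suc j" by (cases k) auto
  show ?thesis unfolding outM_def[abs_def] Let_def using node_pos[of j] k unfolding j
    by (auto intro!: continuous_intros in_cont w)
qed

lemma step_wd:
  assumes w: "continuous_on UNIV w"
  shows "continuous_on UNIV (step p0 q0 B T w) \<and> bounded (range (step p0 q0 B T w))"
proof
  let ?J = "\<lambda>k. {\<zeta> k..\<zeta> (Suc k)} \<times> {0..T}"
  define F where "F k zt = (arrP p0 q0 k (outP p0 q0 w k) w (fst zt) (snd zt), arrM p0 q0 k (outM p0 q0 B w k) w (fst zt) (snd zt))"
    for k and zt :: "real \<times> real"
  have F: "continuous_on (?J k) (F k)" if k: "k < N" for k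
    unfolding F_def
    using arrP_cont[OF w k outP_cont[OF w k]] arrM_cont[OF w k outM_cont[OF w k]]
    by (intro continuous_on_Pair) (simp_all add: split_beta)
  define cl where "cl k zt = (clz k (fst zt), clt T (snd zt))" for k and zt :: "real \<times> real"
  have cl: "continuous_on UNIV (cl k)" for k unfolding cl_def clz_def clt_def by (intro continuous_intros)
  have cl_in: "cl k zt \<in> ?J k" if "k < N" for k zt unfolding cl_def using clz_in[OF that] clt_in[OF T] by auto
  have sk: "step p0 q0 B T w = (\<lambda>x. (\<lambda>k zt. if k < N then F k (cl k zt) else 0) (fst x) (snd x))"
    unfolding step_def stepk_def F_def cl_def by (auto simp: fun_eq_iff)
  have "continuous_on UNIV (\<lambda>zt. if k < N then F k (cl k zt) else 0)" for k
  proof (cases "k < N")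
    case True
    then show ?thesis using continuous_on_compose2[OF F[OF True] cl[of k]] cl_in[OF True] by (simp add: image_subset_iff)
  qed simp
  then show "continuous_on UNIV (step p0 q0 B T w)" unfolding sk by (rule continuous_on_nat_prod)
  have "range (step p0 q0 B T w) \<subseteq> {0} \<union> (\<Union>k<N. F k ` ?J k)" unfolding sk using cl_in by fastforce
  moreover have "bounded ({0} \<union> (\<Union>k<N. F k ` ?J k))"
    by (auto intro!: bounded_UN compact_imp_bounded compact_continuous_image F compact_Times)
  ultimately show "bounded (range (step p0 q0 B T w))" using bounded_subset by blast
qed

end

section \<open>Contraction estimate for the fixed point map\<close>

lemma exp_kernel_bound:
  fixes l c :: real
  assumes l: "0 < l" and ze: "z \<le> e"
  shows "integral {z..e} (\<lambda>y. exp (l * (c - y))) \<le> exp (l * (c - z)) / l"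
    and "integral {z..e} (\<lambda>y. exp (l * (c + y))) \<le> exp (l * (c + e)) / l"
proof -
  have "((\<lambda>y. exp (l * (c - y))) has_integral (- exp (l * (c - e)) / l - (- exp (l * (c - z)) / l))) {z..e}"
    by (rule fundamental_theorem_of_calculus[OF ze])
       (use l in \<open>auto intro!: derivative_eq_intros simp: has_real_derivative_iff_has_vector_derivative[symmetric]\<close>)
  then show "integral {z..e} (\<lambda>y. exp (l * (c - y))) \<le> exp (l * (c - z)) / l"
    using l by (simp add: integral_unique)
  have "((\<lambda>y. exp (l * (c + y))) has_integral (exp (l * (c + e)) / l - (exp (l * (c + z)) / l))) {z..e}"
    by (rule fundamental_theorem_of_calculus[OF ze])
       (use l in \<open>auto intro!: derivative_eq_intros simp: has_real_derivative_iff_has_vector_derivative[symmetric]\<close>)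
  then show "integral {z..e} (\<lambda>y. exp (l * (c + y))) \<le> exp (l * (c + e)) / l"
    using l by (simp add: integral_unique)
qed

text \<open>The absolute values of 2 cL and cR - cL sum to at most 3 (cL + cR). The bound on
  scattering is therefore independent of the size of the jump.\<close>

lemma abs_scatter_le:
  fixes cL cR wR wL X :: real
  assumes "0 < cL" "0 < cR" "\<bar>wR - wR'\<bar> \<le> X" "\<bar>wL - wL'\<bar> \<le> X"
  shows "\<bar>(2 * cL * wR + (cR - cL) * wL) / (cL + cR) - (2 * cL * wR' + (cR - cL) * wL') / (cL + cR)\<bar> \<le> 3 * X"
    and "\<bar>((cL - cR) * wR + 2 * cR * wL) / (cL + cR) - ((cL - cR) * wR' + 2 * cR * wL') / (cL + cR)\<bar> \<le> 3 * X"
proof -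
  have X: "0 \<le> X" using assms(3) by linarith
  have "\<bar>2 * cL * (wR - wR') + (cR - cL) * (wL - wL')\<bar> \<le> \<bar>2 * cL\<bar> * \<bar>wR - wR'\<bar> + \<bar>cR - cL\<bar> * \<bar>wL - wL'\<bar>"
    by (metis abs_mult abs_triangle_ineq)
  also have "\<dots> \<le> \<bar>2 * cL\<bar> * X + \<bar>cR - cL\<bar> * X" using assms by (intro add_mono mult_left_mono) auto
  also have "\<dots> = (\<bar>2 * cL\<bar> + \<bar>cR - cL\<bar>) * X" by (simp add: distrib_right)
  also have "\<dots> \<le> (3 * (cL + cR)) * X" using assms X by (intro mult_right_mono) auto
  finally show "\<bar>(2 * cL * wR + (cR - cL) * wL) / (cL + cR) - (2 * cL * wR' + (cR - cL) * wL') / (cL + cR)\<bar> \<le> 3 * X"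
    using assms(1,2) by (simp add: diff_divide_distrib[symmetric] pos_divide_le_eq abs_divide algebra_simps)
  have "\<bar>(cL - cR) * (wR - wR') + 2 * cR * (wL - wL')\<bar> \<le> \<bar>cL - cR\<bar> * \<bar>wR - wR'\<bar> + \<bar>2 * cR\<bar> * \<bar>wL - wL'\<bar>"
    by (metis abs_mult abs_triangle_ineq)
  also have "\<dots> \<le> \<bar>cL - cR\<bar> * X + \<bar>2 * cR\<bar> * X" using assms by (intro add_mono mult_left_mono) auto
  also have "\<dots> = (\<bar>cL - cR\<bar> + \<bar>2 * cR\<bar>) * X" by (simp add: distrib_right)
  also have "\<dots> \<le> (3 * (cL + cR)) * X" using assms X by (intro mult_right_mono) auto
  finally show "\<bar>((cL - cR) * wR + 2 * cR * wL) / (cL + cR) - ((cL - cR) * wR' + 2 * cR * wL') / (cL + cR)\<bar> \<le> 3 * X"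
    using assms(1,2) by (simp add: diff_divide_distrib[symmetric] pos_divide_le_eq abs_divide algebra_simps)
qed

lemma norm_proj_le: "\<bar>fst d\<bar> \<le> norm d" "\<bar>snd d\<bar> \<le> norm d" for d :: "real \<times> real"
  using norm_fst_le[of "fst d" "snd d"] norm_snd_le[of "snd d" "fst d"] by auto

context layered_data
begin

lemma Qf_diff:
  assumes "norm (w (k, y, s) - w' (k, y, s)) \<le> X" "k < N" "y \<in> {\<zeta> k..\<zeta> (Suc k)}"
  shows "\<bar>Qf w k y s - Qf w' k y s\<bar> \<le> X / m"
proof -
  let ?d = "w (k, y, s) - w' (k, y, s)"
  have g: "m \<le> \<gamma> k y" using \<gamma>_ge assms by blast
  have X: "0 \<le> X" using assms(1) norm_ge_zero order_trans by blast
  have "Qf w k y s - Qf w' k y s = (fst ?d - snd ?d) / (2 * \<gamma> k y)"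
    unfolding Qf_def by (simp add: diff_divide_distrib[symmetric] algebra_simps)
  also have "\<bar>\<dots>\<bar> = \<bar>fst ?d - snd ?d\<bar> / (2 * \<gamma> k y)" using g m by simp
  also have "\<dots> \<le> (2 * X) / (2 * m)"
  proof (rule frac_le)
    show "\<bar>fst ?d - snd ?d\<bar> \<le> 2 * X"
      using norm_proj_le[of ?d] assms(1) by linarith
  qed (use X g m in auto)
  finally show ?thesis by simp
qed

text \<open>An entering trace is felt with a delay equal to the distance from the end where it
  enters, hence the shifted exponent; its factor 2 comes from the correction G - G 0. The interior
  term gains 1 / l by integrating the weight along the characteristic.\<close>

lemma arr_diff:
  assumes w: "continuous_on UNIV w" and w': "continuous_on UNIV w'" and k: "k < N" and l: "0 < l"
    and d: "\<And>x. norm (w x - w' x) \<le> M * exp (l * clt T (snd (snd x)))"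
    and G: "\<And>s. s \<in> {0..T} \<Longrightarrow> \<bar>G s - G' s\<bar> \<le> D * exp (l * s)"
    and z: "z \<in> {\<zeta> k..\<zeta> (Suc k)}" and t: "t \<in> {0..T}"
  shows "\<bar>arrP p0 q0 k G w z t - arrP p0 q0 k G' w' z t\<bar> \<le> 2 * D * exp (l * (t - (\<zeta> (Suc k) - z))) + \<beta> / m * M / l * exp (l * t)"
    and "\<bar>arrM p0 q0 k G w z t - arrM p0 q0 k G' w' z t\<bar> \<le> 2 * D * exp (l * (t - (z - \<zeta> k))) + \<beta> / m * M / l * exp (l * t)"
proof -
  have D: "0 \<le> D" using G[of 0] T by simp
  have M: "0 \<le> M"
    using order_trans[OF norm_ge_zero d[of undefined]] by (metis exp_gt_zero zero_le_mult_iff linorder_not_less)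
  \<comment> \<open>Before a signal from the end has arrived the retarded time is negative, and max
    0 makes both differences vanish.\<close>
  have Gd: "\<bar>(G (max 0 s) - G 0) - (G' (max 0 s) - G' 0)\<bar> \<le> 2 * D * exp (l * s)" if "s \<le> T" for s
  proof (cases "s \<le> 0")
    case True then show ?thesis using D by (simp add: max_def)
  next
    case False
    have "D * 1 \<le> D * exp (l * s)" using D l False by (intro mult_left_mono) auto
    then show ?thesis using G[of s] G[of 0] T False that by (simp add: max_def)
  qed
  have key: "\<bar>integral {u..v} (\<lambda>y. b y * Qf w k y (h y)) - integral {u..v} (\<lambda>y. b y * Qf w' k y (h y))\<bar>
      \<le> \<beta> / m * M * integral {u..v} (\<lambda>y. exp (l * h y))"
    if uv: "{u..v} \<subseteq> {\<zeta> k..\<zeta> (Suc k)}" and h: "continuous_on {u..v} h" "\<And>y. y \<in> {u..v} \<Longrightarrow> h y \<in> {0..T}" for u v h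
  proof -
    note c = Qf_cont_line[OF w k uv h(1)] Qf_cont_line[OF w' k uv h(1)]
    have "integral {u..v} (\<lambda>y. b y * Qf w k y (h y)) - integral {u..v} (\<lambda>y. b y * Qf w' k y (h y))
        = integral {u..v} (\<lambda>y. b y * (Qf w k y (h y) - Qf w' k y (h y)))"
      using integrable_mult_bounded_borel[OF b_meas b_bd c(1)] integrable_mult_bounded_borel[OF b_meas b_bd c(2)]
      by (simp add: integral_diff[symmetric] right_diff_distrib)
    also have "\<bar>\<dots>\<bar> \<le> \<beta> * integral {u..v} (\<lambda>y. M * exp (l * h y) / m)"
    proof (rule integral_mult_bounded_borel_bound[OF b_meas b_bd])
      show "\<bar>Qf w k y (h y) - Qf w' k y (h y)\<bar> \<le> M * exp (l * h y) / m" if y: "y \<in> {u..v}" for y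
        using Qf_diff[of w k y "h y" w'] d[of "(k, y, h y)"] uv k y clt_id[OF h(2)[OF y]] by auto
    qed (use c h m in \<open>auto intro!: continuous_intros\<close>)
    also have "(\<lambda>y. M * exp (l * h y) / m) = (\<lambda>y. (M / m) * exp (l * h y))" by (simp add: fun_eq_iff)
    also have "\<beta> * integral {u..v} (\<lambda>y. (M / m) * exp (l * h y)) = \<beta> / m * M * integral {u..v} (\<lambda>y. exp (l * h y))"
      by simp
    finally show ?thesis .
  qed
  have c0: "0 \<le> \<beta> / m * M" using \<beta>_nonneg m M by simp
  have zz: "\<zeta> k \<le> z" "z \<le> \<zeta> (Suc k)" "0 \<le> t" "t \<le> T" using z t by auto
  let ?e = "min (\<zeta> (Suc k)) (z + t)"
  have "\<bar>integral {z..?e} (\<lambda>y. b y * Qf w k y (z + t - y)) - integral {z..?e} (\<lambda>y. b y * Qf w' k y (z + t - y))\<bar>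
      \<le> \<beta> / m * M * integral {z..?e} (\<lambda>y. exp (l * (z + t - y)))"
    by (rule key) (use zz in \<open>auto intro!: continuous_intros\<close>)
  also have "\<dots> \<le> \<beta> / m * M * (exp (l * (z + t - z)) / l)"
    using exp_kernel_bound(1)[OF l, of z ?e "z + t"] zz by (intro mult_left_mono c0) auto
  finally have 1: "\<bar>integral {z..?e} (\<lambda>y. b y * Qf w k y (z + t - y)) - integral {z..?e} (\<lambda>y. b y * Qf w' k y (z + t - y))\<bar>
      \<le> \<beta> / m * M / l * exp (l * t)" by simp
  have 2: "\<bar>(G (max 0 (z + t - \<zeta> (Suc k))) - G 0) - (G' (max 0 (z + t - \<zeta> (Suc k))) - G' 0)\<bar> \<le> 2 * D * exp (l * (t - (\<zeta> (Suc k) - z)))"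
    using Gd[of "z + t - \<zeta> (Suc k)"] zz by (simp add: algebra_simps)
  show "\<bar>arrP p0 q0 k G w z t - arrP p0 q0 k G' w' z t\<bar> \<le> 2 * D * exp (l * (t - (\<zeta> (Suc k) - z))) + \<beta> / m * M / l * exp (l * t)"
    using 1 2 unfolding arrP_def Let_def by linarith
  let ?f = "max (\<zeta> k) (z - t)"
  have "\<bar>integral {?f..z} (\<lambda>y. b y * Qf w k y (t - z + y)) - integral {?f..z} (\<lambda>y. b y * Qf w' k y (t - z + y))\<bar>
      \<le> \<beta> / m * M * integral {?f..z} (\<lambda>y. exp (l * (t - z + y)))"
    by (rule key) (use zz in \<open>auto intro!: continuous_intros\<close>)
  also have "\<dots> \<le> \<beta> / m * M * (exp (l * (t - z + z)) / l)"
    using exp_kernel_bound(2)[OF l, of ?f z "t - z"] zz by (intro mult_left_mono c0) auto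
  finally have 3: "\<bar>integral {?f..z} (\<lambda>y. b y * Qf w k y (t - z + y)) - integral {?f..z} (\<lambda>y. b y * Qf w' k y (t - z + y))\<bar>
      \<le> \<beta> / m * M / l * exp (l * t)" by simp
  have 4: "\<bar>(G (max 0 (t - (z - \<zeta> k))) - G 0) - (G' (max 0 (t - (z - \<zeta> k))) - G' 0)\<bar> \<le> 2 * D * exp (l * (t - (z - \<zeta> k)))"
    by (rule Gd) (use zz in auto)
  show "\<bar>arrM p0 q0 k G w z t - arrM p0 q0 k G' w' z t\<bar> \<le> 2 * D * exp (l * (t - (z - \<zeta> k))) + \<beta> / m * M / l * exp (l * t)"
    using 3 4 unfolding arrM_def Let_def by linarith
qed

text \<open>A scattered trace depends on the iterate at another end of a layer only after a travel
  time of at least \<delta>, which yields a factor exp (- l \<delta>), and on interior values only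
  under an integral, which yields 1 / l. Both are small for large l, uniformly in T.\<close>

lemma step_contraction:
  obtains l where "0 < l"
    "\<And>w w' M x. continuous_on UNIV w \<Longrightarrow> continuous_on UNIV w' \<Longrightarrow> 0 \<le> M \<Longrightarrow>
       (\<And>x. norm (w x - w' x) \<le> M * exp (l * clt T (snd (snd x)))) \<Longrightarrow>
       norm (step p0 q0 B T w x - step p0 q0 B T w' x) \<le> M / 2 * exp (l * clt T (snd (snd x)))"
proof -
  define \<delta> where "\<delta> = Min ((\<lambda>k. \<zeta> (Suc k) - \<zeta> k) ` {..<N})"
  have \<delta>: "0 < \<delta>" "\<And>k. k < N \<Longrightarrow> \<delta> \<le> \<zeta> (Suc k) - \<zeta> k"
  proof -
    have ne: "finite ((\<lambda>k. \<zeta> (Suc k) - \<zeta> k) ` {..<N})" "(\<lambda>k. \<zeta> (Suc k) - \<zeta> k) ` {..<N} \<noteq> {}"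
      using N by auto
    show "0 < \<delta>" unfolding \<delta>_def Min_gr_iff[OF ne] using \<zeta>_less by auto
    show "\<delta> \<le> \<zeta> (Suc k) - \<zeta> k" if "k < N" for k unfolding \<delta>_def by (rule Min_le[OF ne(1)]) (use that in auto)
  qed
  \<comment> \<open>28 = 4 * 7. Scattering (3) and the doubling in \<open>arr_diff\<close> (2) give
    6 \<epsilon>, the interior term gives one more \<epsilon>, and each of the two components may
    use M / 4. Since exp (- l \<delta>) \<le> 1 / (l \<delta>), one has \<epsilon> l \<le> 2 /
    \<delta> + \<beta> / m.\<close>
  define l where "l = 28 * (2 / \<delta> + \<beta> / m) + 1"
  have l: "0 < l" unfolding l_def using \<delta> m \<beta>_nonneg by (simp add: add_nonneg_pos)
  define \<epsilon> where "\<epsilon> = 2 * exp (- (l * \<delta>)) + \<beta> / m / l"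
  have \<epsilon>0: "0 \<le> \<epsilon>" unfolding \<epsilon>_def using \<beta>_nonneg m l by simp
  have "exp (- (l * \<delta>)) \<le> 1 / (l * \<delta>)"
  proof -
    have "l * \<delta> \<le> exp (l * \<delta>)" using exp_ge_add_one_self[of "l * \<delta>"] by linarith
    then show ?thesis using l \<delta> by (simp add: exp_minus field_simps)
  qed
  then have el: "\<epsilon> * l \<le> 2 / \<delta> + \<beta> / m" unfolding \<epsilon>_def using l \<delta> by (simp add: field_simps)
  have "28 * (\<epsilon> * l) \<le> 28 * (2 / \<delta> + \<beta> / m)" by (rule mult_left_mono[OF el]) simp
  also have "\<dots> \<le> l" unfolding l_def by simp
  finally have "28 * (\<epsilon> * l) \<le> l" .
  then have \<epsilon>: "28 * \<epsilon> \<le> 1" using mult_right_le_imp_le[of "28 * \<epsilon>" l 1] l by (simp add: mult.assoc)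
  show thesis
  proof (rule that[OF l])
    fix w w' :: "nat \<times> real \<times> real \<Rightarrow> real \<times> real" and M :: real and x :: "nat \<times> real \<times> real"
    assume w: "continuous_on UNIV w" and w': "continuous_on UNIV w'" and M: "0 \<le> M"
      and d: "\<And>x. norm (w x - w' x) \<le> M * exp (l * clt T (snd (snd x)))"
    have slice: "\<bar>fst (w (k, z, s)) - fst (w' (k, z, s))\<bar> \<le> M * exp (l * s)"
                "\<bar>snd (w (k, z, s)) - snd (w' (k, z, s))\<bar> \<le> M * exp (l * s)" if "s \<in> {0..T}" for k z s
      using d[of "(k, z, s)"] clt_id[OF that] norm_proj_le[of "w (k, z, s) - w' (k, z, s)"] by auto
    have far: "exp (l * (t - a)) \<le> exp (- (l * \<delta>)) * exp (l * t)" if "\<delta> \<le> a" for t a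
      using that l by (simp add: exp_add[symmetric] algebra_simps)
    have inb: "\<bar>inP p0 q0 w k t - inP p0 q0 w' k t\<bar> \<le> \<epsilon> * M * exp (l * t)"
              "\<bar>inM p0 q0 w k t - inM p0 q0 w' k t\<bar> \<le> \<epsilon> * M * exp (l * t)" if k: "k < N" and t: "t \<in> {0..T}" for k t
    proof -
      have zin: "\<zeta> k \<in> {\<zeta> k..\<zeta> (Suc k)}" "\<zeta> (Suc k) \<in> {\<zeta> k..\<zeta> (Suc k)}" using \<zeta>_less[OF k] by auto
      have f: "2 * M * exp (l * (t - (\<zeta> (Suc k) - \<zeta> k))) + \<beta> / m * M / l * exp (l * t) \<le> \<epsilon> * M * exp (l * t)"
      proof -
        have "2 * M * exp (l * (t - (\<zeta> (Suc k) - \<zeta> k))) \<le> 2 * M * (exp (- (l * \<delta>)) * exp (l * t))"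
          using far[OF \<delta>(2)[OF k]] M by (intro mult_left_mono) auto
        then show ?thesis unfolding \<epsilon>_def by (simp add: algebra_simps)
      qed
      show "\<bar>inP p0 q0 w k t - inP p0 q0 w' k t\<bar> \<le> \<epsilon> * M * exp (l * t)" unfolding inP_def
        by (rule order_trans[OF arr_diff(1)[OF w w' k l d slice(1) zin(1) t] f])
      show "\<bar>inM p0 q0 w k t - inM p0 q0 w' k t\<bar> \<le> \<epsilon> * M * exp (l * t)" unfolding inM_def
        by (rule order_trans[OF arr_diff(2)[OF w w' k l d slice(2) zin(2) t] f])
    qed
    have outb: "\<bar>outP p0 q0 w k t - outP p0 q0 w' k t\<bar> \<le> 3 * (\<epsilon> * M) * exp (l * t)"
               "\<bar>outM p0 q0 B w k t - outM p0 q0 B w' k t\<bar> \<le> 3 * (\<epsilon> * M) * exp (l * t)" if k: "k < N" and t: "t \<in> {0..T}" for k t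
    proof -
      have X0: "0 \<le> \<epsilon> * M * exp (l * t)" using \<epsilon>0 M by simp
      show "\<bar>outP p0 q0 w k t - outP p0 q0 w' k t\<bar> \<le> 3 * (\<epsilon> * M) * exp (l * t)"
      proof (cases "Suc k = N")
        case True
        then show ?thesis using inb(2)[OF k t] X0 by (simp add: outP_def)
      next
        case False
        then have k': "Suc k < N" using k by simp
        from abs_scatter_le(1)[OF conjunct1[OF node_pos[OF k']] conjunct2[OF node_pos[OF k']] inb(1)[OF k' t] inb(2)[OF k t]]
        show ?thesis using False by (simp add: outP_def Let_def mult.assoc)
      qed
      show "\<bar>outM p0 q0 B w k t - outM p0 q0 B w' k t\<bar> \<le> 3 * (\<epsilon> * M) * exp (l * t)"
      proof (cases "k = 0")
        case True
        have "\<bar>B (inP p0 q0 w 0) t - B (inP p0 q0 w' 0) t\<bar> \<le> \<epsilon> * M * exp (l * t)"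
        proof -
          have "\<bar>inP p0 q0 w 0 s - inP p0 q0 w' 0 s\<bar> \<le> \<epsilon> * M * exp (l * t)" if s: "s \<in> {0..t}" for s
          proof -
            have "\<epsilon> * M * exp (l * s) \<le> \<epsilon> * M * exp (l * t)" using s l \<epsilon>0 M by (intro mult_left_mono) auto
            then show ?thesis using inb(1)[OF N, of s] s t by auto
          qed
          then show ?thesis
            using B in_cont(1)[OF w N] in_cont(1)[OF w' N] t unfolding causal_def by blast
        qed
        then show ?thesis using inb(1)[OF N t] True unfolding outM_def by simp
      next
        case False
        then obtain j where j: "k = Suc j" by (cases k) auto
        then have j': "Suc j < N" using k by simp
        then have "j < N" by simp
        from abs_scatter_le(2)[OF conjunct1[OF node_pos[OF j']] conjunct2[OF node_pos[OF j']] inb(1)[OF j' t] inb(2)[OF \<open>j < N\<close> t]]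
        show ?thesis by (simp add: outM_def Let_def mult.assoc j)
      qed
    qed
    obtain k z t where x: "x = (k, z, t)" by (cases x) auto
    show "norm (step p0 q0 B T w x - step p0 q0 B T w' x) \<le> M / 2 * exp (l * clt T (snd (snd x)))"
    proof (cases "k < N")
      case False
      then show ?thesis unfolding x step_def stepk_def using M by simp
    next
      case k: True
      let ?z = "clz k z" and ?t = "clt T t"
      note zt = clz_in[OF k, of z] clt_in[OF T, of t]
      have f: "2 * (3 * (\<epsilon> * M)) * exp (l * (?t - a)) + \<beta> / m * M / l * exp (l * ?t) \<le> M / 4 * exp (l * ?t)"
        if a: "0 \<le> a" for a
      proof -
        have "2 * (3 * (\<epsilon> * M)) * exp (l * (?t - a)) \<le> 6 * (\<epsilon> * M) * exp (l * ?t)"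
          using \<epsilon>0 M l a by (simp, intro mult_left_mono) auto
        moreover have "\<beta> / m * M / l * exp (l * ?t) \<le> (\<epsilon> * M) * exp (l * ?t)"
        proof -
          have "\<beta> / m / l \<le> \<epsilon>" unfolding \<epsilon>_def by simp
          from mult_right_mono[OF this M] show ?thesis by (intro mult_right_mono) auto
        qed
        moreover have "7 * (\<epsilon> * M) * exp (l * ?t) \<le> M / 4 * exp (l * ?t)"
        proof -
          have "28 * \<epsilon> * M \<le> 1 * M" by (rule mult_right_mono[OF \<epsilon> M])
          then show ?thesis by (intro mult_right_mono) auto
        qed
        ultimately show ?thesis by linarith
      qed
      have 1: "\<bar>arrP p0 q0 k (outP p0 q0 w k) w ?z ?t - arrP p0 q0 k (outP p0 q0 w' k) w' ?z ?t\<bar> \<le> M / 4 * exp (l * ?t)"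
        by (rule order_trans[OF arr_diff(1)[OF w w' k l d outb(1)[OF k] zt] f]) (use zt in auto)
      have 2: "\<bar>arrM p0 q0 k (outM p0 q0 B w k) w ?z ?t - arrM p0 q0 k (outM p0 q0 B w' k) w' ?z ?t\<bar> \<le> M / 4 * exp (l * ?t)"
        by (rule order_trans[OF arr_diff(2)[OF w w' k l d outb(2)[OF k] zt] f]) (use zt in auto)
      have pair: "norm ((a, c) - (a', c')) \<le> M / 2 * X" if "\<bar>a - a'\<bar> \<le> M / 4 * X" "\<bar>c - c'\<bar> \<le> M / 4 * X"
        for a c a' c' X :: real
        using norm_Pair_le[of "a - a'" "c - c'"] that by (simp add: field_simps)
      show ?thesis unfolding x step_def stepk_def using k pair[OF 1 2] by simp
    qed
  qed
qed

lemma step_fixpoint: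
  "\<exists>w. continuous_on UNIV w \<and> step p0 q0 B T w = w \<and>
     (\<forall>w'. continuous_on UNIV w' \<longrightarrow> bounded (range w') \<longrightarrow> step p0 q0 B T w' = w' \<longrightarrow> w' = w)"
proof -
  obtain l where l: "0 < l" and c: "\<And>w w' M x. continuous_on UNIV w \<Longrightarrow> continuous_on UNIV w' \<Longrightarrow> 0 \<le> M \<Longrightarrow>
       (\<And>x. norm (w x - w' x) \<le> M * exp (l * clt T (snd (snd x)))) \<Longrightarrow>
       norm (step p0 q0 B T w x - step p0 q0 B T w' x) \<le> M / 2 * exp (l * clt T (snd (snd x)))"
    using step_contraction by blast
  have "\<exists>w. continuous_on UNIV w \<and> bounded (range w) \<and> step p0 q0 B T w = w \<and>
     (\<forall>w'. continuous_on UNIV w' \<longrightarrow> bounded (range w') \<longrightarrow> step p0 q0 B T w' = w' \<longrightarrow> w' = w)"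
  proof (rule weighted_fixpoint[where \<Phi> = "step p0 q0 B T" and \<rho> = "\<lambda>x. exp (l * clt T (snd (snd x)))" and e = 1 and C = "exp (l * T)"])
    show "continuous_on UNIV (\<lambda>x. exp (l * clt T (snd (snd x))))" unfolding clt_def by (intro continuous_intros)
    show "1 \<le> exp (l * clt T (snd (snd s)))" for s :: "nat \<times> real \<times> real" using l clt_in[OF T, of "snd (snd s)"] by simp
    show "exp (l * clt T (snd (snd s))) \<le> exp (l * T)" for s :: "nat \<times> real \<times> real" using l clt_in[OF T, of "snd (snd s)"] by simp
  qed (use c step_wd in auto)
  then show ?thesis by blast
qed

end

text \<open>Scattering reproduces the invariants of a pair that already is continuous at the node.
  This serves for the initial data at time 0 and for turning a given solution into a fixed
  point.\<close>

lemma scatter_continuous_trace: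
  fixes cL cR p q :: real
  assumes "0 < cL" "0 < cR"
  shows "(2 * cL * (p + cR * q) + (cR - cL) * (p - cL * q)) / (cL + cR) = p + cL * q"
    and "((cL - cR) * (p + cR * q) + 2 * cR * (p - cL * q)) / (cL + cR) = p - cR * q"
proof -
  have ne: "cL + cR \<noteq> 0" using assms by linarith
  have "2 * cL * (p + cR * q) + (cR - cL) * (p - cL * q) = (p + cL * q) * (cL + cR)" by algebra
  then show "(2 * cL * (p + cR * q) + (cR - cL) * (p - cL * q)) / (cL + cR) = p + cL * q" using ne by simp
  have "(cL - cR) * (p + cR * q) + 2 * cR * (p - cL * q) = (p - cR * q) * (cL + cR)" by algebra
  then show "((cL - cR) * (p + cR * q) + 2 * cR * (p - cL * q)) / (cL + cR) = p - cR * q" using ne by simp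
qed

section \<open>Fixed points and mild solutions\<close>

context layered
begin

text \<open>The characteristic equation of P + \<gamma> Q integrated from (z', t) to (z, t + z' - z)
  inside one layer, which makes sense for P and Q that are only continuous. \<open>mildM\<close> is
  the analogue for the rightgoing invariant P - \<gamma> Q.\<close>

definition mildP where
  "mildP T P Q \<longleftrightarrow> (\<forall>k<N. \<forall>z z' t. \<zeta> k \<le> z \<longrightarrow> z \<le> z' \<longrightarrow> z' \<le> \<zeta> (Suc k) \<longrightarrow> 0 \<le> t \<longrightarrow> t + (z' - z) \<le> T \<longrightarrow>
     P z (t + (z' - z)) + \<gamma> k z * Q z (t + (z' - z)) =
     P z' t + \<gamma> k z' * Q z' t - integral {z..z'} (\<lambda>y. b y * Q y (t + z' - y)))"

definition mildM where
  "mildM T P Q \<longleftrightarrow> (\<forall>k<N. \<forall>z z' t. \<zeta> k \<le> z \<longrightarrow> z \<le> z' \<longrightarrow> z' \<le> \<zeta> (Suc k) \<longrightarrow> 0 \<le> t \<longrightarrow> t + (z' - z) \<le> T \<longrightarrow>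
     P z' (t + (z' - z)) - \<gamma> k z' * Q z' (t + (z' - z)) =
     P z t - \<gamma> k z * Q z t - integral {z..z'} (\<lambda>y. b y * Q y (t - z + y)))"

lemma mildPD:
  assumes "mildP T P Q" "k < N" "\<zeta> k \<le> z" "z \<le> z'" "z' \<le> \<zeta> (Suc k)" "0 \<le> t" "t + (z' - z) \<le> T"
  shows "P z (t + (z' - z)) + \<gamma> k z * Q z (t + (z' - z)) =
     P z' t + \<gamma> k z' * Q z' t - integral {z..z'} (\<lambda>y. b y * Q y (t + z' - y))"
  using assms unfolding mildP_def by blast

lemma mildMD:
  assumes "mildM T P Q" "k < N" "\<zeta> k \<le> z" "z \<le> z'" "z' \<le> \<zeta> (Suc k)" "0 \<le> t" "t + (z' - z) \<le> T"
  shows "P z' (t + (z' - z)) - \<gamma> k z' * Q z' (t + (z' - z)) =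
     P z t - \<gamma> k z * Q z t - integral {z..z'} (\<lambda>y. b y * Q y (t - z + y))"
  using assms unfolding mildM_def by blast

lemma continuous_on_pieces:
  fixes T :: real
  assumes "\<And>k. k < N \<Longrightarrow> continuous_on ({\<zeta> k..\<zeta> (Suc k)} \<times> {0..T}) f"
  shows "continuous_on ({0..\<zeta> N} \<times> {0..T}) f"
proof -
  have "continuous_on (\<Union>k\<in>{..<N}. {\<zeta> k..\<zeta> (Suc k)} \<times> {0..T}) f"
    by (rule continuous_on_closed_Union) (use assms in \<open>auto intro!: closed_Times\<close>)
  moreover have "(\<Union>k\<in>{..<N}. {\<zeta> k..\<zeta> (Suc k)} \<times> {0..T}) = {0..\<zeta> N} \<times> {0..T}"
    using piece_ex piece_in by fastforce
  ultimately show ?thesis by simp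
qed

lemma slice_cont:
  assumes "continuous_on ({0..\<zeta> N} \<times> {0..T}) (\<lambda>(z, t). P z t)" "z \<in> {0..\<zeta> N}"
  shows "continuous_on {0..T} (P z)"
  by (rule continuous_on_compose2[OF assms(1), of _ "\<lambda>t. (z, t)", simplified])
     (use assms(2) in \<open>auto intro!: continuous_intros\<close>)

end

context layered_data
begin

definition solves where
  "solves P Q \<longleftrightarrow> continuous_on ({0..\<zeta> N} \<times> {0..T}) (\<lambda>(z, t). P z t) \<and>
     continuous_on ({0..\<zeta> N} \<times> {0..T}) (\<lambda>(z, t). Q z t) \<and> mildP T P Q \<and> mildM T P Q \<and>
     (\<forall>z\<in>{0..\<zeta> N}. P z 0 = p0 z \<and> Q z 0 = q0 z) \<and>
     (\<forall>t\<in>{0..T}. P (\<zeta> N) t = 0 \<and> P 0 t = B (\<lambda>s. P 0 s + \<gamma> 0 0 * Q 0 s) t)"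

lemma causal_cong:
  assumes "continuous_on {0..T} F" "continuous_on {0..T} G" "\<And>s. s \<in> {0..T} \<Longrightarrow> F s = G s" "t \<in> {0..T}"
  shows "B F t = B G t"
proof -
  have "\<forall>s\<in>{0..t}. \<bar>F s - G s\<bar> \<le> 0" using assms(3,4) by auto
  then have "\<bar>B F t - B G t\<bar> \<le> 0" using B assms(1,2,4) unfolding causal_def by blast
  then show ?thesis by simp
qed

text \<open>A fixed point of \<open>step\<close> provides two invariants layer by layer. The work is
  to show that the corrections built into \<open>step\<close> disappear and that the scattering
  rules make P and Q agree across the nodes.\<close>

lemma solution_exists: "\<exists>P Q. solves P Q"
proof -
  obtain w where w: "continuous_on UNIV w" and fx: "step p0 q0 B T w = w" using step_fixpoint by blast
  have wP: "fst (w (k, z, t)) = arrP p0 q0 k (outP p0 q0 w k) w z t"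
   and wM: "snd (w (k, z, t)) = arrM p0 q0 k (outM p0 q0 B w k) w z t"
    if "k < N" "z \<in> {\<zeta> k..\<zeta> (Suc k)}" "t \<in> {0..T}" for k z t
    using fun_cong[OF fx, of "(k, z, t)"] that clz_id[OF that(2)] clt_id[OF that(3)]
    unfolding step_def stepk_def by (metis fst_conv snd_conv)+
  have zl: "\<zeta> k \<in> {\<zeta> k..\<zeta> (Suc k)}" and zr: "\<zeta> (Suc k) \<in> {\<zeta> k..\<zeta> (Suc k)}" if "k < N" for k
    using \<zeta>_less[OF that] by auto
  have T0: "0 \<in> {0..T}" using T by simp
  have in0: "inP p0 q0 w k 0 = p0 (\<zeta> k) + \<gamma> k (\<zeta> k) * q0 (\<zeta> k)"
            "inM p0 q0 w k 0 = p0 (\<zeta> (Suc k)) - \<gamma> k (\<zeta> (Suc k)) * q0 (\<zeta> (Suc k))" if "k < N" for k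
    using \<zeta>_less[OF that] by (simp_all add: inP_def inM_def arrP_def arrM_def Let_def min_def max_def)
  have rP: "fst (w (k, \<zeta> (Suc k), s)) = p0 (\<zeta> (Suc k)) + \<gamma> k (\<zeta> (Suc k)) * q0 (\<zeta> (Suc k)) + outP p0 q0 w k s - outP p0 q0 w k 0"
   and lM: "snd (w (k, \<zeta> k, s)) = p0 (\<zeta> k) - \<gamma> k (\<zeta> k) * q0 (\<zeta> k) + outM p0 q0 B w k s - outM p0 q0 B w k 0"
    if "k < N" "s \<in> {0..T}" for k s
  proof -
    have "min (\<zeta> (Suc k)) (\<zeta> (Suc k) + s) = \<zeta> (Suc k)" "max 0 (\<zeta> (Suc k) + s - \<zeta> (Suc k)) = s"
      "max (\<zeta> k) (\<zeta> k - s) = \<zeta> k" "max 0 (s - (\<zeta> k - \<zeta> k)) = s" using that(2) by auto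
    then show "fst (w (k, \<zeta> (Suc k), s)) = p0 (\<zeta> (Suc k)) + \<gamma> k (\<zeta> (Suc k)) * q0 (\<zeta> (Suc k)) + outP p0 q0 w k s - outP p0 q0 w k 0"
      "snd (w (k, \<zeta> k, s)) = p0 (\<zeta> k) - \<gamma> k (\<zeta> k) * q0 (\<zeta> k) + outM p0 q0 B w k s - outM p0 q0 B w k 0"
      unfolding wP[OF that(1) zr[OF that(1)] that(2)] wM[OF that(1) zl[OF that(1)] that(2)]
      by (simp_all add: arrP_def arrM_def Let_def)
  qed
  \<comment> \<open>By \<open>rP\<close> and \<open>lM\<close> the traces of w at the ends differ
    from \<open>outP\<close> and \<open>outM\<close> by constants, and \<open>arrP\<close> and
    \<open>arrM\<close> use a trace G only through G - G 0. So feeding them with w or with the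
    scattered traces gives the same result.\<close>
  have inP: "inP p0 q0 w k t = fst (w (k, \<zeta> k, t))" and inM: "inM p0 q0 w k t = snd (w (k, \<zeta> (Suc k), t))"
    if k: "k < N" and t: "t \<in> {0..T}" for k t
  proof -
    have "max 0 (\<zeta> k + t - \<zeta> (Suc k)) \<in> {0..T}" "max 0 (t - (\<zeta> (Suc k) - \<zeta> k)) \<in> {0..T}"
      using \<zeta>_less[OF k] t by auto
    then show "inP p0 q0 w k t = fst (w (k, \<zeta> k, t))" "inM p0 q0 w k t = snd (w (k, \<zeta> (Suc k), t))"
      unfolding wP[OF k zl[OF k] t] wM[OF k zr[OF k] t] unfolding inP_def inM_def arrP_def arrM_def Let_def
      using rP[OF k] rP[OF k T0] lM[OF k] lM[OF k T0] by auto
  qed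
  \<comment> \<open>Continuity of the data at inner nodes and compatibility at the corners make the
    outgoing traces start at the invariants of the initial data, so the constants in
    \<open>rP\<close> and \<open>lM\<close> are zero.\<close>
  have out0P: "outP p0 q0 w k 0 = p0 (\<zeta> (Suc k)) + \<gamma> k (\<zeta> (Suc k)) * q0 (\<zeta> (Suc k))" if k: "k < N" for k
  proof (cases "Suc k = N")
    case True
    then show ?thesis using in0(2)[OF k] p0_right by (simp add: outP_def)
  next
    case False
    then have k': "Suc k < N" using k by simp
    note sc = scatter_continuous_trace(1)[OF conjunct1[OF node_pos[OF k']] conjunct2[OF node_pos[OF k']]]
    show ?thesis using False unfolding outP_def in0(2)[OF k] in0(1)[OF k'] Let_def
      by (simp add: sc)
  qed
  have out0M: "outM p0 q0 B w k 0 = p0 (\<zeta> k) - \<gamma> k (\<zeta> k) * q0 (\<zeta> k)" if k: "k < N" for k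
  proof (cases k)
    case 0
    have "B (inP p0 q0 w 0) 0 = p0 0"
      by (rule B_init[OF in_cont(1)[OF w N]]) (use in0(1)[OF N] \<zeta>0 in simp)
    then show ?thesis using in0(1)[OF N] \<zeta>0 0 by (simp add: outM_def)
  next
    case (Suc j)
    then have k': "Suc j < N" and j: "j < N" using k by auto
    note sc = scatter_continuous_trace(2)[OF conjunct1[OF node_pos[OF k']] conjunct2[OF node_pos[OF k']]]
    show ?thesis using Suc in0(2)[OF j] in0(1)[OF k'] unfolding outM_def Let_def
      by (simp add: sc)
  qed
  have outP: "fst (w (k, \<zeta> (Suc k), t)) = outP p0 q0 w k t" and outM: "snd (w (k, \<zeta> k, t)) = outM p0 q0 B w k t"
    if "k < N" "t \<in> {0..T}" for k t
    using rP[OF that] lM[OF that] out0P[OF that(1)] out0M[OF that(1)] by auto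
  \<comment> \<open>An inner node belongs to two layers. The least index is an arbitrary choice;
    \<open>node\<close> shows that the neighbouring layer gives the same values, and
    \<open>PQ\<close> then permits any layer containing z.\<close>
  define idx where "idx z = (LEAST k. k < N \<and> z \<le> \<zeta> (Suc k))" for z
  define pk where "pk k z t = (fst (w (k, z, t)) + snd (w (k, z, t))) / 2" for k z t
  define P where "P z t = pk (idx z) z t" for z t
  define Q where "Q z t = Qf w (idx z) z t" for z t
  have node: "pk k (\<zeta> (Suc k)) t = pk (Suc k) (\<zeta> (Suc k)) t \<and> Qf w k (\<zeta> (Suc k)) t = Qf w (Suc k) (\<zeta> (Suc k)) t"
    if k': "Suc k < N" and t: "t \<in> {0..T}" for k t
  proof -
    have k: "k < N" using k' by simp
    define cL cR where "cL = \<gamma> k (\<zeta> (Suc k))" and "cR = \<gamma> (Suc k) (\<zeta> (Suc k))"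
    define wR wL where "wR = fst (w (Suc k, \<zeta> (Suc k), t))" and "wL = snd (w (k, \<zeta> (Suc k), t))"
    have c: "0 < cL" "0 < cR" using node_pos[OF k'] unfolding cL_def cR_def by auto
    have 1: "fst (w (k, \<zeta> (Suc k), t)) = (2 * cL * wR + (cR - cL) * wL) / (cL + cR)"
      using outP[OF k t] k' unfolding outP_def Let_def inP[OF k' t] inM[OF k t] cL_def cR_def wR_def wL_def by simp
    have 2: "snd (w (Suc k, \<zeta> (Suc k), t)) = ((cL - cR) * wR + 2 * cR * wL) / (cL + cR)"
      using outM[OF k' t] unfolding outM_def Let_def inP[OF k' t] cL_def cR_def wR_def wL_def
      using inM[OF k t] by simp
    have ne: "cL + cR \<noteq> 0" using c by linarith
    have "(2 * cL * wR + (cR - cL) * wL) / (cL + cR) + wL = wR + ((cL - cR) * wR + 2 * cR * wL) / (cL + cR)"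
      using ne by (simp add: field_simps)
    moreover have "((2 * cL * wR + (cR - cL) * wL) / (cL + cR) - wL) / (2 * cL) = (wR - wL) / (cL + cR)"
    proof -
      have "(2 * cL * wR + (cR - cL) * wL) / (cL + cR) - wL = 2 * cL * (wR - wL) / (cL + cR)"
        using ne by (simp add: field_simps)
      then show ?thesis using c by simp
    qed
    moreover have "(wR - ((cL - cR) * wR + 2 * cR * wL) / (cL + cR)) / (2 * cR) = (wR - wL) / (cL + cR)"
    proof -
      have "wR - ((cL - cR) * wR + 2 * cR * wL) / (cL + cR) = 2 * cR * (wR - wL) / (cL + cR)"
        using ne by (simp add: field_simps)
      then show ?thesis using c by simp
    qed
    ultimately show ?thesis unfolding pk_def Qf_def 1 2
      unfolding wR_def[symmetric] wL_def[symmetric] cL_def[symmetric] cR_def[symmetric] by simp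
  qed
  have PQ: "P z t = pk k z t \<and> Q z t = Qf w k z t" if k: "k < N" and z: "z \<in> {\<zeta> k..\<zeta> (Suc k)}" and t: "t \<in> {0..T}" for k z t
  proof -
    have "k < N \<and> z \<le> \<zeta> (Suc k)" using k z by simp
    then have i: "idx z \<le> k" "idx z < N" "z \<le> \<zeta> (Suc (idx z))"
      unfolding idx_def using Least_le[of "\<lambda>k. k < N \<and> z \<le> \<zeta> (Suc k)"] LeastI[of "\<lambda>k. k < N \<and> z \<le> \<zeta> (Suc k)"] by blast+
    show ?thesis
    proof (cases "idx z = k")
      case True then show ?thesis unfolding P_def Q_def by simp
    next
      case False
      then have "Suc (idx z) \<le> k" using i by simp
      then have "\<zeta> (Suc (idx z)) \<le> \<zeta> k" using \<zeta>_mono k by simp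
      then have ze: "\<zeta> (Suc (idx z)) = \<zeta> k" "z = \<zeta> k" using i z by auto
      have "Suc (idx z) = k"
      proof (rule ccontr)
        assume "Suc (idx z) \<noteq> k"
        then have "\<zeta> (Suc (idx z)) < \<zeta> k" using \<open>Suc (idx z) \<le> k\<close> \<zeta>_strict k by simp
        then show False using ze by simp
      qed
      then show ?thesis unfolding P_def Q_def using node[of "idx z" t] t k ze by simp
    qed
  qed
  have sumP: "P z t + \<gamma> k z * Q z t = fst (w (k, z, t))" and sumM: "P z t - \<gamma> k z * Q z t = snd (w (k, z, t))"
    if "k < N" "z \<in> {\<zeta> k..\<zeta> (Suc k)}" "t \<in> {0..T}" for k z t
    using PQ[OF that] \<gamma>_pos[OF that(1,2)] unfolding pk_def Qf_def by (auto simp: field_simps)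
  have Pc: "continuous_on ({0..\<zeta> N} \<times> {0..T}) (\<lambda>(z, t). P z t)"
  proof (rule continuous_on_pieces)
    fix k assume k: "k < N"
    have "continuous_on ({\<zeta> k..\<zeta> (Suc k)} \<times> {0..T}) (\<lambda>x. pk k (fst x) (snd x))" unfolding pk_def
      by (intro continuous_intros continuous_on_compose2[OF w]) auto
    then show "continuous_on ({\<zeta> k..\<zeta> (Suc k)} \<times> {0..T}) (\<lambda>(z, t). P z t)"
      by (rule continuous_on_cong[THEN iffD1, rotated -1]) (use PQ[OF k] in auto)
  qed
  have Qc: "continuous_on ({0..\<zeta> N} \<times> {0..T}) (\<lambda>(z, t). Q z t)"
  proof (rule continuous_on_pieces)
    fix k assume k: "k < N"
    have "continuous_on ({\<zeta> k..\<zeta> (Suc k)} \<times> {0..T}) (\<lambda>(z, t). Qf w k z t)"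
      by (rule continuous_on_subset[OF Qf_cont[OF w k]]) auto
    then show "continuous_on ({\<zeta> k..\<zeta> (Suc k)} \<times> {0..T}) (\<lambda>(z, t). Q z t)"
      by (rule continuous_on_cong[THEN iffD1, rotated -1]) (use PQ[OF k] in auto)
  qed
  have intQ: "(\<lambda>y. b y * Qf w k y (h y)) integrable_on {u..v}"
    if "k < N" "\<zeta> k \<le> u" "v \<le> \<zeta> (Suc k)" "continuous_on {u..v} h" for k u v h
    by (rule integrable_mult_bounded_borel[OF b_meas b_bd Qf_cont_line[OF w]]) (use that in auto)
  have mP: "mildP T P Q" unfolding mildP_def
  proof (intro allI impI)
    fix k z z' t assume *: "k < N" "\<zeta> k \<le> z" "z \<le> z'" "z' \<le> \<zeta> (Suc k)" "0 \<le> t" "t + (z' - z) \<le> T"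
    let ?e = "min (\<zeta> (Suc k)) (z' + t)"
    have "integral {z..z'} (\<lambda>y. b y * Qf w k y (z' + t - y)) + integral {z'..?e} (\<lambda>y. b y * Qf w k y (z' + t - y))
        = integral {z..?e} (\<lambda>y. b y * Qf w k y (z' + t - y))"
      by (rule Henstock_Kurzweil_Integration.integral_combine[OF _ _ intQ]) (use * in \<open>auto intro!: continuous_intros\<close>)
    moreover have "integral {z..z'} (\<lambda>y. b y * Qf w k y (z' + t - y)) = integral {z..z'} (\<lambda>y. b y * Q y (t + z' - y))"
    proof (rule integral_cong)
      fix y assume "y \<in> {z..z'}"
      then have "Q y (t + z' - y) = Qf w k y (t + z' - y)" using PQ[of k y "t + z' - y"] * by auto
      then show "b y * Qf w k y (z' + t - y) = b y * Q y (t + z' - y)" by (simp add: add.commute)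
    qed
    moreover have "P z (t + (z' - z)) + \<gamma> k z * Q z (t + (z' - z)) = arrP p0 q0 k (outP p0 q0 w k) w z (t + (z' - z))"
      using sumP[of k z "t + (z' - z)"] wP[of k z "t + (z' - z)"] * by auto
    moreover have "P z' t + \<gamma> k z' * Q z' t = arrP p0 q0 k (outP p0 q0 w k) w z' t"
      using sumP[of k z' t] wP[of k z' t] * by auto
    moreover have "z + (t + (z' - z)) = z' + t" by simp
    ultimately show "P z (t + (z' - z)) + \<gamma> k z * Q z (t + (z' - z)) =
       P z' t + \<gamma> k z' * Q z' t - integral {z..z'} (\<lambda>y. b y * Q y (t + z' - y))"
      unfolding arrP_def Let_def by simp
  qed
  have mM: "mildM T P Q" unfolding mildM_def
  proof (intro allI impI)
    fix k z z' t assume *: "k < N" "\<zeta> k \<le> z" "z \<le> z'" "z' \<le> \<zeta> (Suc k)" "0 \<le> t" "t + (z' - z) \<le> T"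
    let ?e = "max (\<zeta> k) (z - t)"
    have "integral {?e..z} (\<lambda>y. b y * Qf w k y (t - z + y)) + integral {z..z'} (\<lambda>y. b y * Qf w k y (t - z + y))
        = integral {?e..z'} (\<lambda>y. b y * Qf w k y (t - z + y))"
      by (rule Henstock_Kurzweil_Integration.integral_combine[OF _ _ intQ]) (use * in \<open>auto intro!: continuous_intros\<close>)
    moreover have "integral {z..z'} (\<lambda>y. b y * Qf w k y (t - z + y)) = integral {z..z'} (\<lambda>y. b y * Q y (t - z + y))"
    proof (rule integral_cong)
      fix y assume "y \<in> {z..z'}"
      then have "Q y (t - z + y) = Qf w k y (t - z + y)" using PQ[of k y "t - z + y"] * by auto
      then show "b y * Qf w k y (t - z + y) = b y * Q y (t - z + y)" by simp
    qed
    moreover have "P z' (t + (z' - z)) - \<gamma> k z' * Q z' (t + (z' - z)) = arrM p0 q0 k (outM p0 q0 B w k) w z' (t + (z' - z))"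
      using sumM[of k z' "t + (z' - z)"] wM[of k z' "t + (z' - z)"] * by auto
    moreover have "P z t - \<gamma> k z * Q z t = arrM p0 q0 k (outM p0 q0 B w k) w z t"
      using sumM[of k z t] wM[of k z t] * by auto
    moreover have "z' - (t + (z' - z)) = z - t" "t + (z' - z) - (z' - \<zeta> k) = t - (z - \<zeta> k)" "t + (z' - z) - z' = t - z" by simp_all
    ultimately show "P z' (t + (z' - z)) - \<gamma> k z' * Q z' (t + (z' - z)) =
       P z t - \<gamma> k z * Q z t - integral {z..z'} (\<lambda>y. b y * Q y (t - z + y))"
      unfolding arrM_def Let_def by simp
  qed
  have init: "P z 0 = p0 z \<and> Q z 0 = q0 z" if z: "z \<in> {0..\<zeta> N}" for z
  proof -
    obtain k where k: "k < N" "z \<in> {\<zeta> k..\<zeta> (Suc k)}" using piece_ex[OF z] by blast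
    have "fst (w (k, z, 0)) = p0 z + \<gamma> k z * q0 z" "snd (w (k, z, 0)) = p0 z - \<gamma> k z * q0 z"
      using k T0 by (auto simp: wP wM arrP_def arrM_def Let_def min_def max_def)
    then show ?thesis using PQ[OF k T0] \<gamma>_pos[OF k] unfolding pk_def Qf_def by simp
  qed
  have bc: "P (\<zeta> N) t = 0 \<and> P 0 t = B (\<lambda>s. P 0 s + \<gamma> 0 0 * Q 0 s) t" if t: "t \<in> {0..T}" for t
  proof
    obtain j where j: "N = Suc j" using N by (cases N) auto
    then have jN: "j < N" by simp
    have "fst (w (j, \<zeta> N, t)) = - snd (w (j, \<zeta> N, t))"
      using outP[OF jN t] inM[OF jN t] j[symmetric] unfolding outP_def by simp
    then show "P (\<zeta> N) t = 0" using PQ[OF jN zr[OF jN] t] j unfolding pk_def by simp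
    have z0: "0 \<in> {\<zeta> 0..\<zeta> (Suc 0)}" using zl[OF N] \<zeta>0 by simp
    have "snd (w (0, 0, t)) = 2 * B (inP p0 q0 w 0) t - fst (w (0, 0, t))"
      using outM[OF N t] inP[OF N t] \<zeta>0 unfolding outM_def by simp
    then have "P 0 t = B (inP p0 q0 w 0) t" using PQ[OF N z0 t] unfolding pk_def by simp
    also have "\<dots> = B (\<lambda>s. P 0 s + \<gamma> 0 0 * Q 0 s) t"
    proof (rule causal_cong[OF in_cont(1)[OF w N] _ _ t])
      have "0 \<in> {0..\<zeta> N}" using Z_pos by simp
      then show "continuous_on {0..T} (\<lambda>s. P 0 s + \<gamma> 0 0 * Q 0 s)"
        by (intro continuous_intros slice_cont[OF Pc] slice_cont[OF Qc])
      show "inP p0 q0 w 0 s = P 0 s + \<gamma> 0 0 * Q 0 s" if "s \<in> {0..T}" for s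
        using inP[OF N that] sumP[OF N z0 that] \<zeta>0 by simp
    qed
    finally show "P 0 t = B (\<lambda>s. P 0 s + \<gamma> 0 0 * Q 0 s) t" .
  qed
  show ?thesis unfolding solves_def using Pc Qc mP mM init bc by blast
qed

text \<open>The converse passage: the invariants of a solution, clamped to the layers and to [0, T],
  form a bounded fixed point of \<open>step\<close>. Uniqueness of solutions is thereby inherited
  from the contraction.\<close>

lemma solution_step:
  assumes s: "solves P Q"
  defines "w \<equiv> (\<lambda>x. if fst x < N then
      (let z = clz (fst x) (fst (snd x)); t = clt T (snd (snd x)) in
        (P z t + \<gamma> (fst x) z * Q z t, P z t - \<gamma> (fst x) z * Q z t)) else 0)"
  shows "continuous_on UNIV w \<and> bounded (range w) \<and> step p0 q0 B T w = w"
proof -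
  have Pc: "continuous_on ({0..\<zeta> N} \<times> {0..T}) (\<lambda>(z, t). P z t)" and Qc: "continuous_on ({0..\<zeta> N} \<times> {0..T}) (\<lambda>(z, t). Q z t)"
    and mP: "mildP T P Q" and mM: "mildM T P Q"
    and init: "\<And>z. z \<in> {0..\<zeta> N} \<Longrightarrow> P z 0 = p0 z" "\<And>z. z \<in> {0..\<zeta> N} \<Longrightarrow> Q z 0 = q0 z"
    and bc: "\<And>t. t \<in> {0..T} \<Longrightarrow> P (\<zeta> N) t = 0" "\<And>t. t \<in> {0..T} \<Longrightarrow> P 0 t = B (\<lambda>s. P 0 s + \<gamma> 0 0 * Q 0 s) t"
    using s unfolding solves_def by auto
  let ?J = "\<lambda>k. {\<zeta> k..\<zeta> (Suc k)} \<times> {0..T}"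
  define F where "F k zt = (P (fst zt) (snd zt) + \<gamma> k (fst zt) * Q (fst zt) (snd zt), P (fst zt) (snd zt) - \<gamma> k (fst zt) * Q (fst zt) (snd zt))"
    for k and zt :: "real \<times> real"
  have F: "continuous_on (?J k) (F k)" if k: "k < N" for k
  proof -
    have sub: "?J k \<subseteq> {0..\<zeta> N} \<times> {0..T}" using piece_in[OF k] by auto
    have 1: "continuous_on (?J k) (\<lambda>x. P (fst x) (snd x))" "continuous_on (?J k) (\<lambda>x. Q (fst x) (snd x))"
      using continuous_on_subset[OF Pc sub] continuous_on_subset[OF Qc sub] by (simp_all add: split_beta)
    have 2: "continuous_on (?J k) (\<lambda>x. \<gamma> k (fst x))"
      by (rule continuous_on_compose2[OF \<gamma>_cont[OF k]]) (auto intro!: continuous_intros)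
    show ?thesis unfolding F_def by (intro continuous_intros 1 2)
  qed
  define cl where "cl k zt = (clz k (fst zt), clt T (snd zt))" for k and zt :: "real \<times> real"
  have cl: "continuous_on UNIV (cl k)" for k unfolding cl_def clz_def clt_def by (intro continuous_intros)
  have cl_in: "cl k zt \<in> ?J k" if "k < N" for k zt unfolding cl_def using clz_in[OF that] clt_in[OF T] by auto
  have sk: "w = (\<lambda>x. (\<lambda>k zt. if k < N then F k (cl k zt) else 0) (fst x) (snd x))"
    unfolding w_def F_def cl_def Let_def by (auto simp: fun_eq_iff)
  have "continuous_on UNIV (\<lambda>zt. if k < N then F k (cl k zt) else 0)" for k
  proof (cases "k < N")
    case True
    then show ?thesis using continuous_on_compose2[OF F[OF True] cl[of k]] cl_in[OF True] by (simp add: image_subset_iff)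
  qed simp
  then have wc: "continuous_on UNIV w" unfolding sk by (rule continuous_on_nat_prod)
  have "range w \<subseteq> {0} \<union> (\<Union>k<N. F k ` ?J k)" unfolding sk using cl_in by fastforce
  moreover have "bounded ({0} \<union> (\<Union>k<N. F k ` ?J k))"
    by (auto intro!: bounded_UN compact_imp_bounded compact_continuous_image F compact_Times)
  ultimately have wb: "bounded (range w)" using bounded_subset by blast
  have wv: "w (k, z, t) = (P z t + \<gamma> k z * Q z t, P z t - \<gamma> k z * Q z t)"
    if "k < N" "z \<in> {\<zeta> k..\<zeta> (Suc k)}" "t \<in> {0..T}" for k z t
    using that clz_id[OF that(2)] clt_id[OF that(3)] unfolding w_def by simp
  have Qw: "Qf w k y t = Q y t" if "k < N" "y \<in> {\<zeta> k..\<zeta> (Suc k)}" "t \<in> {0..T}" for k y t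
    unfolding Qf_def wv[OF that] using \<gamma>_pos[OF that(1,2)] by simp
  have T0: "0 \<in> {0..T}" using T by simp
  have zl: "\<zeta> k \<in> {\<zeta> k..\<zeta> (Suc k)}" and zr: "\<zeta> (Suc k) \<in> {\<zeta> k..\<zeta> (Suc k)}" if "k < N" for k
    using \<zeta>_less[OF that] by auto
  have aP: "arrP p0 q0 k G w z t = P z t + \<gamma> k z * Q z t"
    if k: "k < N" and z: "z \<in> {\<zeta> k..\<zeta> (Suc k)}" and t: "t \<in> {0..T}"
      and G: "\<And>s. s \<in> {0..T} \<Longrightarrow> G s = P (\<zeta> (Suc k)) s + \<gamma> k (\<zeta> (Suc k)) * Q (\<zeta> (Suc k)) s" for k z t G
  proof -
    define e where "e = min (\<zeta> (Suc k)) (z + t)"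
    define \<tau> where "\<tau> = z + t - e"
    have e: "z \<le> e" "e \<le> \<zeta> (Suc k)" "\<zeta> k \<le> z" "0 \<le> \<tau>" "\<tau> + (e - z) = t" "t \<le> T" "\<tau> \<in> {0..T}"
      using z t unfolding e_def \<tau>_def by auto
    have "P z t + \<gamma> k z * Q z t = P e \<tau> + \<gamma> k e * Q e \<tau> - integral {z..e} (\<lambda>y. b y * Q y (\<tau> + e - y))"
      using mildPD[OF mP k e(3) e(1) e(2) e(4)] e by simp
    also have "integral {z..e} (\<lambda>y. b y * Q y (\<tau> + e - y)) = integral {z..e} (\<lambda>y. b y * Qf w k y (z + t - y))"
    proof (rule integral_cong)
      fix y assume y: "y \<in> {z..e}"
      have eq: "\<tau> + e - y = z + t - y" unfolding \<tau>_def by simp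
      have "z + t - y \<in> {0..T}" using y e t unfolding e_def by auto
      then show "b y * Q y (\<tau> + e - y) = b y * Qf w k y (z + t - y)"
        unfolding eq using Qw[OF k, of y "z + t - y"] y e by simp
    qed
    also have "P e \<tau> + \<gamma> k e * Q e \<tau> = p0 e + \<gamma> k e * q0 e + G (max 0 (z + t - \<zeta> (Suc k))) - G 0"
    proof (cases "z + t \<le> \<zeta> (Suc k)")
      case True
      then have "\<tau> = 0" "max 0 (z + t - \<zeta> (Suc k)) = 0" unfolding \<tau>_def e_def by auto
      then show ?thesis using init[of e] piece_in[OF k, of e] e by auto
    next
      case False
      then have ee: "e = \<zeta> (Suc k)" "max 0 (z + t - \<zeta> (Suc k)) = \<tau>" unfolding \<tau>_def e_def by auto
      then show ?thesis using G[OF e(7)] G[OF T0] init[of e] piece_in[OF k zr[OF k]] by simp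
    qed
    finally show ?thesis unfolding arrP_def Let_def e_def by simp
  qed
  have aM: "arrM p0 q0 k G w z t = P z t - \<gamma> k z * Q z t"
    if k: "k < N" and z: "z \<in> {\<zeta> k..\<zeta> (Suc k)}" and t: "t \<in> {0..T}"
      and G: "\<And>s. s \<in> {0..T} \<Longrightarrow> G s = P (\<zeta> k) s - \<gamma> k (\<zeta> k) * Q (\<zeta> k) s" for k z t G
  proof -
    define e where "e = max (\<zeta> k) (z - t)"
    define \<tau> where "\<tau> = t - (z - e)"
    have e: "e \<le> z" "\<zeta> k \<le> e" "z \<le> \<zeta> (Suc k)" "0 \<le> \<tau>" "\<tau> + (z - e) = t" "t \<le> T" "\<tau> \<in> {0..T}"
      using z t unfolding e_def \<tau>_def by auto
    have "P z t - \<gamma> k z * Q z t = P e \<tau> - \<gamma> k e * Q e \<tau> - integral {e..z} (\<lambda>y. b y * Q y (\<tau> - e + y))"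
      using mildMD[OF mM k e(2) e(1) e(3) e(4)] e by simp
    also have "integral {e..z} (\<lambda>y. b y * Q y (\<tau> - e + y)) = integral {e..z} (\<lambda>y. b y * Qf w k y (t - z + y))"
    proof (rule integral_cong)
      fix y assume y: "y \<in> {e..z}"
      have eq: "\<tau> - e + y = t - z + y" unfolding \<tau>_def by simp
      have "t - z + y \<in> {0..T}" using y e t unfolding e_def by auto
      then show "b y * Q y (\<tau> - e + y) = b y * Qf w k y (t - z + y)"
        unfolding eq using Qw[OF k, of y "t - z + y"] y e by simp
    qed
    also have "P e \<tau> - \<gamma> k e * Q e \<tau> = p0 e - \<gamma> k e * q0 e + G (max 0 (t - (z - \<zeta> k))) - G 0"
    proof (cases "\<zeta> k \<le> z - t")
      case True
      then have "\<tau> = 0" "max 0 (t - (z - \<zeta> k)) = 0" unfolding \<tau>_def e_def by auto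
      then show ?thesis using init[of e] piece_in[OF k, of e] e by auto
    next
      case False
      then have ee: "e = \<zeta> k" "max 0 (t - (z - \<zeta> k)) = \<tau>" unfolding \<tau>_def e_def by auto
      then show ?thesis using G[OF e(7)] G[OF T0] init[of e] piece_in[OF k zl[OF k]] by simp
    qed
    finally show ?thesis unfolding arrM_def Let_def e_def by simp
  qed
  have inP: "inP p0 q0 w k t = P (\<zeta> k) t + \<gamma> k (\<zeta> k) * Q (\<zeta> k) t" if "k < N" "t \<in> {0..T}" for k t
    unfolding inP_def by (rule aP[OF that(1) zl[OF that(1)] that(2)]) (simp add: wv[OF that(1) zr[OF that(1)]])
  have inM: "inM p0 q0 w k t = P (\<zeta> (Suc k)) t - \<gamma> k (\<zeta> (Suc k)) * Q (\<zeta> (Suc k)) t" if "k < N" "t \<in> {0..T}" for k t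
    unfolding inM_def by (rule aM[OF that(1) zr[OF that(1)] that(2)]) (simp add: wv[OF that(1) zl[OF that(1)]])
  have outP: "outP p0 q0 w k t = P (\<zeta> (Suc k)) t + \<gamma> k (\<zeta> (Suc k)) * Q (\<zeta> (Suc k)) t" if k: "k < N" and t: "t \<in> {0..T}" for k t
  proof (cases "Suc k = N")
    case True
    then show ?thesis using inM[OF k t] bc(1)[OF t] by (simp add: outP_def)
  next
    case False
    then have k': "Suc k < N" using k by simp
    note sc = scatter_continuous_trace(1)[OF conjunct1[OF node_pos[OF k']] conjunct2[OF node_pos[OF k']]]
    show ?thesis using False unfolding outP_def inM[OF k t] inP[OF k' t] Let_def
      by (simp add: sc)
  qed
  have outM: "outM p0 q0 B w k t = P (\<zeta> k) t - \<gamma> k (\<zeta> k) * Q (\<zeta> k) t" if k: "k < N" and t: "t \<in> {0..T}" for k t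
  proof (cases k)
    case 0
    have z0: "0 \<in> {0..\<zeta> N}" using Z_pos by simp
    have "B (inP p0 q0 w 0) t = B (\<lambda>s. P 0 s + \<gamma> 0 0 * Q 0 s) t"
      by (rule causal_cong[OF in_cont(1)[OF wc N] _ _ t])
         (use inP[OF N] \<zeta>0 z0 in \<open>auto intro!: continuous_intros slice_cont[OF Pc] slice_cont[OF Qc]\<close>)
    then show ?thesis using inP[OF N t] \<zeta>0 0 bc(2)[OF t] by (simp add: outM_def)
  next
    case (Suc j)
    then have k': "Suc j < N" and j: "j < N" using k by auto
    note sc = scatter_continuous_trace(2)[OF conjunct1[OF node_pos[OF k']] conjunct2[OF node_pos[OF k']]]
    show ?thesis using Suc inM[OF j t] inP[OF k' t] unfolding outM_def Let_def
      by (simp add: sc)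
  qed
  have "step p0 q0 B T w x = w x" for x
  proof -
    obtain k z t where x: "x = (k, z, t)" by (cases x) auto
    show ?thesis
    proof (cases "k < N")
      case True
      note zt = clz_in[OF True, of z] clt_in[OF T, of t]
      show ?thesis unfolding step_def stepk_def x using True aP[OF True zt outP[OF True]] aM[OF True zt outM[OF True]]
        by (simp add: w_def Let_def)
    qed (simp add: step_def stepk_def x w_def)
  qed
  then show ?thesis using wc wb by blast
qed

lemma solution_unique:
  assumes "solves P Q" "solves P' Q'" "z \<in> {0..\<zeta> N}" "t \<in> {0..T}"
  shows "P z t = P' z t" and "Q z t = Q' z t"
proof -
  obtain k where k: "k < N" "z \<in> {\<zeta> k..\<zeta> (Suc k)}" using piece_ex[OF assms(3)] by blast
  obtain w where wu: "\<And>w'. continuous_on UNIV w' \<Longrightarrow> bounded (range w') \<Longrightarrow> step p0 q0 B T w' = w' \<Longrightarrow> w' = w"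
    using step_fixpoint by blast
  note e = trans[OF wu wu[symmetric], OF conjunct1[OF solution_step[OF assms(1)]] _ _ conjunct1[OF solution_step[OF assms(2)]]]
  have "(P z t + \<gamma> k z * Q z t, P z t - \<gamma> k z * Q z t) = (P' z t + \<gamma> k z * Q' z t, P' z t - \<gamma> k z * Q' z t)"
    using fun_cong[OF e, of "(k, z, t)"] solution_step[OF assms(1)] solution_step[OF assms(2)] k clz_id[OF k(2)] clt_id[OF assms(4)]
    by simp
  then have "P z t + \<gamma> k z * Q z t = P' z t + \<gamma> k z * Q' z t" "P z t - \<gamma> k z * Q z t = P' z t - \<gamma> k z * Q' z t" by auto
  then have "P z t = P' z t" "\<gamma> k z * Q z t = \<gamma> k z * Q' z t" by linarith+
  then show "P z t = P' z t" "Q z t = Q' z t" using \<gamma>_pos[OF k] by auto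
qed

end

section \<open>Mild and classical solutions\<close>

text \<open>A chain rule along a line without total differentiability: f is differentiated in y only
  at the single time of the base point, while the increment in time is controlled uniformly near y0
  by the mean value theorem, because g is jointly continuous.\<close>

lemma diagonal_deriv:
  fixes f g :: "real \<Rightarrow> real \<Rightarrow> real"
  assumes fs: "\<And>y s. y \<in> S \<Longrightarrow> s \<in> {0..T} \<Longrightarrow> (f y has_real_derivative g y s) (at s within {0..T})"
    and g: "continuous_on (S \<times> {0..T}) (\<lambda>(y, s). g y s)"
    and y0: "y0 \<in> S" and line: "\<And>y. y \<in> S \<Longrightarrow> \<tau> + \<sigma> * y \<in> {0..T}"
    and fy: "((\<lambda>y. f y (\<tau> + \<sigma> * y0)) has_real_derivative d) (at y0 within S)"
  shows "((\<lambda>y. f y (\<tau> + \<sigma> * y)) has_real_derivative d + \<sigma> * g y0 (\<tau> + \<sigma> * y0)) (at y0 within S)"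
proof -
  let ?so = "\<tau> + \<sigma> * y0"
  have "((\<lambda>y. f y (\<tau> + \<sigma> * y) - f y ?so) has_real_derivative \<sigma> * g y0 ?so) (at y0 within S)"
    unfolding has_field_derivative_def has_derivative_within_alt2
  proof (intro conjI allI impI)
    show "bounded_linear ((*) (\<sigma> * g y0 ?so))" by (rule bounded_linear_mult_right)
    fix e :: real assume e: "0 < e"
    define \<epsilon> where "\<epsilon> = e / (\<bar>\<sigma>\<bar> + 1)"
    have \<epsilon>: "0 < \<epsilon>" "\<epsilon> * \<bar>\<sigma>\<bar> \<le> e" unfolding \<epsilon>_def using e by (auto simp: field_simps add_nonneg_pos)
    have "(y0, ?so) \<in> S \<times> {0..T}" using y0 line[OF y0] by simp
    from g[unfolded continuous_on_iff, rule_format, OF this \<epsilon>(1)]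
    obtain r where r: "0 < r" "\<And>y s. y \<in> S \<Longrightarrow> s \<in> {0..T} \<Longrightarrow> dist (y, s) (y0, ?so) < r \<Longrightarrow> \<bar>g y s - g y0 ?so\<bar> < \<epsilon>"
      by (auto simp: dist_real_def)
    define \<eta> where "\<eta> = r / (\<bar>\<sigma>\<bar> + 1)"
    have \<eta>: "0 < \<eta>" "\<eta> * (\<bar>\<sigma>\<bar> + 1) = r" unfolding \<eta>_def using r(1) by (auto simp: add_nonneg_pos add_nonneg_eq_0_iff)
    have main: "\<bar>(f y (\<tau> + \<sigma> * y) - f y ?so) - (f y0 ?so - f y0 ?so) - \<sigma> * g y0 ?so * (y - y0)\<bar> \<le> e * \<bar>y - y0\<bar>"
      if y: "y \<in> S" "\<bar>y - y0\<bar> < \<eta>" for y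
    proof -
      let ?s = "\<tau> + \<sigma> * y"
      let ?I = "{min ?so ?s..max ?so ?s}"
      have ds: "\<bar>?s - ?so\<bar> = \<bar>\<sigma>\<bar> * \<bar>y - y0\<bar>"
      proof -
        have "?s - ?so = \<sigma> * y - \<sigma> * y0" by (rule add_diff_cancel_left)
        also have "\<dots> = \<sigma> * (y - y0)" by (rule right_diff_distrib[symmetric])
        finally show ?thesis by (simp only: abs_mult)
      qed
      have sub: "?I \<subseteq> {0..T}" using line[OF y0] line[OF y(1)] by auto
      have "norm ((f y ?s - ?s * g y0 ?so) - (f y ?so - ?so * g y0 ?so)) \<le> \<epsilon> * norm (?s - ?so)"
      proof (rule field_differentiable_bound[of ?I "\<lambda>s. f y s - s * g y0 ?so" "\<lambda>s. g y s - g y0 ?so"])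
        fix s assume s: "s \<in> ?I"
        then have sT: "s \<in> {0..T}" using sub by blast
        have "(f y has_real_derivative g y s) (at s within ?I)" by (rule DERIV_subset[OF fs[OF y(1) sT] sub])
        then show "((\<lambda>s. f y s - s * g y0 ?so) has_field_derivative g y s - g y0 ?so) (at s within ?I)"
          by (auto intro!: derivative_eq_intros)
        have "\<bar>s - ?so\<bar> \<le> \<bar>?s - ?so\<bar>" using s by (auto simp: min_def max_def split: if_splits)
        also note ds
        finally have "\<bar>s - ?so\<bar> \<le> \<bar>\<sigma>\<bar> * \<bar>y - y0\<bar>" .
        moreover have "dist (y, s) (y0, ?so) \<le> \<bar>y - y0\<bar> + \<bar>s - ?so\<bar>"
          unfolding dist_prod_def dist_real_def by (simp add: sqrt_sum_squares_le_sum_abs)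
        ultimately have "dist (y, s) (y0, ?so) \<le> (\<bar>\<sigma>\<bar> + 1) * \<bar>y - y0\<bar>" by (simp add: algebra_simps)
        also have "\<dots> < r" using y(2) \<eta>(2) by (smt (verit) mult.commute mult_strict_left_mono abs_ge_zero)
        finally show "norm (g y s - g y0 ?so) \<le> \<epsilon>" using r(2)[OF y(1) sT] by simp
      qed auto
      also have "norm (?s - ?so) = \<bar>\<sigma>\<bar> * \<bar>y - y0\<bar>" using ds by simp
      also have "\<epsilon> * (\<bar>\<sigma>\<bar> * \<bar>y - y0\<bar>) \<le> e * \<bar>y - y0\<bar>"
        using mult_right_mono[OF \<epsilon>(2), of "\<bar>y - y0\<bar>"] by (simp add: mult.assoc)
      finally show ?thesis by (simp add: algebra_simps)
    qed
    show "\<forall>\<^sub>F y in at y0 within S. norm (f y (\<tau> + \<sigma> * y) - f y ?so - (f y0 ?so - f y0 ?so) - \<sigma> * g y0 ?so * (y - y0)) \<le> e * norm (y - y0)"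
      unfolding eventually_at by (intro exI[of _ \<eta>]) (use main \<eta> in \<open>auto simp: dist_real_def\<close>)
  qed
  from DERIV_add[OF fy this] show ?thesis by simp
qed

lemma uniform_on_rect:
  fixes Q :: "real \<Rightarrow> real \<Rightarrow> real"
  assumes Q: "continuous_on ({0..Z} \<times> {0..T}) (\<lambda>(z, t). Q z t)" and e: "0 < e"
  shows "\<exists>d>0. \<forall>y z s t. y \<in> {0..Z} \<longrightarrow> z \<in> {0..Z} \<longrightarrow> s \<in> {0..T} \<longrightarrow> t \<in> {0..T} \<longrightarrow>
           \<bar>y - z\<bar> < d \<longrightarrow> \<bar>s - t\<bar> < d \<longrightarrow> \<bar>Q y s - Q z t\<bar> \<le> e"
proof -
  have "uniformly_continuous_on ({0..Z} \<times> {0..T}) (\<lambda>(z, t). Q z t)"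
    by (rule compact_uniformly_continuous[OF Q]) (intro compact_Times compact_Icc)
  then obtain d where d: "0 < d" "\<And>x x'. x \<in> {0..Z} \<times> {0..T} \<Longrightarrow> x' \<in> {0..Z} \<times> {0..T} \<Longrightarrow> dist x' x < d \<Longrightarrow>
      dist ((\<lambda>(z, t). Q z t) x') ((\<lambda>(z, t). Q z t) x) < e"
    using e unfolding uniformly_continuous_on_def by metis
  show ?thesis
  proof (intro exI[of _ "d / 2"] conjI allI impI)
    fix y z s t assume *: "y \<in> {0..Z}" "z \<in> {0..Z}" "s \<in> {0..T}" "t \<in> {0..T}" "\<bar>y - z\<bar> < d / 2" "\<bar>s - t\<bar> < d / 2"
    have "dist (y, s) (z, t) \<le> \<bar>y - z\<bar> + \<bar>s - t\<bar>"
      unfolding dist_prod_def dist_real_def by (simp add: sqrt_sum_squares_le_sum_abs)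
    then show "\<bar>Q y s - Q z t\<bar> \<le> e" using d(2)[of "(z, t)" "(y, s)"] * by (simp add: dist_real_def)
  qed (use d in simp)
qed

lemma bounded_on_rect:
  fixes Q :: "real \<Rightarrow> real \<Rightarrow> real"
  assumes Q: "continuous_on ({0..Z} \<times> {0..T}) (\<lambda>(z, t). Q z t)"
  shows "\<exists>K. \<forall>z t. z \<in> {0..Z} \<longrightarrow> t \<in> {0..T} \<longrightarrow> \<bar>Q z t\<bar> \<le> K"
proof -
  have "bounded ((\<lambda>(z, t). Q z t) ` ({0..Z} \<times> {0..T}))"
    by (intro compact_imp_bounded compact_continuous_image Q compact_Times compact_Icc)
  then obtain K where "\<forall>x\<in>{0..Z} \<times> {0..T}. norm ((\<lambda>(z, t). Q z t) x) \<le> K" by (auto simp: bounded_iff)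
  then show ?thesis by (intro exI[of _ K]) auto
qed

context layered
begin

text \<open>Near z the weight b is close to b z except on the negligible set E, so short averages of
  b * h approach b z * h0. The threshold \<eta> does not depend on h and h0; this makes the
  derivative along characteristics uniform in time.\<close>

lemma b_average:
  assumes z: "z \<in> {0..\<zeta> N} - E" and \<epsilon>: "0 < \<epsilon>"
  shows "\<exists>\<eta>>0. \<forall>z1 z2 h h0. 0 \<le> z1 \<longrightarrow> z1 \<le> z \<longrightarrow> z \<le> z2 \<longrightarrow> z2 \<le> \<zeta> N \<longrightarrow> z2 - z1 < \<eta> \<longrightarrow>
     continuous_on {z1..z2} h \<longrightarrow> \<bar>h0\<bar> \<le> K \<longrightarrow> (\<forall>y\<in>{z1..z2}. \<bar>h y - h0\<bar> \<le> \<eta>) \<longrightarrow>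
     \<bar>integral {z1..z2} (\<lambda>y. b y * h y) - (z2 - z1) * (b z * h0)\<bar> \<le> \<epsilon> * (z2 - z1)"
proof -
  define e where "e = \<epsilon> / (2 * (\<bar>K\<bar> + 1))"
  have e: "0 < e" "e * (\<bar>K\<bar> + 1) = \<epsilon> / 2" unfolding e_def using \<epsilon> by (auto simp: add_nonneg_pos field_simps add_nonneg_eq_0_iff)
  obtain d where d: "0 < d" "\<And>y. y \<in> {0..\<zeta> N} - E \<Longrightarrow> \<bar>y - z\<bar> < d \<Longrightarrow> \<bar>b y - b z\<bar> \<le> e"
  proof -
    from tendstoD[OF b_cont[OF z] e(1)]
    obtain d where "0 < d" "\<forall>y\<in>{0..\<zeta> N} - E. y \<noteq> z \<and> dist y z < d \<longrightarrow> dist (b y) (b z) < e"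
      unfolding eventually_at by blast
    then show thesis using that[of d] e(1) by (metis abs_zero dist_real_def diff_self less_imp_le)
  qed
  define r where "r = \<epsilon> / (2 * (\<beta> + 1))"
  have r: "0 < r" "(\<beta> + 1) * r = \<epsilon> / 2" unfolding r_def using \<epsilon> \<beta>_nonneg by (auto simp: add_nonneg_pos field_simps add_nonneg_eq_0_iff)
  show ?thesis
  proof (intro exI[of _ "min d r"] conjI allI impI)
    fix z1 z2 h h0
    assume *: "0 \<le> z1" "z1 \<le> z" "z \<le> z2" "z2 \<le> \<zeta> N" "z2 - z1 < min d r" "continuous_on {z1..z2} h" "\<bar>h0\<bar> \<le> K"
      "\<forall>y\<in>{z1..z2}. \<bar>h y - h0\<bar> \<le> min d r"
    define \<phi> where "\<phi> y = (if y \<in> E then 0 else b y * h y - b z * h0)" for y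
    have i1: "((\<lambda>y. b y * h y) has_integral integral {z1..z2} (\<lambda>y. b y * h y)) {z1..z2}"
      by (rule integrable_integral, rule integrable_mult_bounded_borel[OF b_meas b_bd *(6)])
    have i2: "((\<lambda>y. b z * h0) has_integral (z2 - z1) * (b z * h0)) {z1..z2}"
      using has_integral_const_real[of "b z * h0" z1 z2] * by simp
    have nE: "negligible E" using negligible_countable_Union[of "(\<lambda>x. {x}) ` E"] E by auto
    have i3: "(\<phi> has_integral integral {z1..z2} (\<lambda>y. b y * h y) - (z2 - z1) * (b z * h0)) {z1..z2}"
      by (rule has_integral_spike[OF nE _ has_integral_diff[OF i1 i2]]) (simp add: \<phi>_def)
    have "norm (\<phi> y) \<le> \<epsilon>" if "y \<in> {z1..z2} - {}" for y
    proof (cases "y \<in> E")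
      case False
      have hy: "\<bar>h y - h0\<bar> \<le> r" using *(8) that by auto
      have by': "\<bar>b y - b z\<bar> \<le> e" by (rule d(2)) (use * that False in auto)
      have "\<phi> y = b y * (h y - h0) + (b y - b z) * h0" unfolding \<phi>_def using False by (simp add: algebra_simps)
      also have "\<bar>\<dots>\<bar> \<le> \<bar>b y\<bar> * \<bar>h y - h0\<bar> + \<bar>b y - b z\<bar> * \<bar>h0\<bar>" by (metis abs_mult abs_triangle_ineq)
      also have "\<dots> \<le> (\<beta> + 1) * r + e * (\<bar>K\<bar> + 1)"
        using b_bd[of y] hy by' *(7) r e \<beta>_nonneg by (intro add_mono mult_mono) auto
      finally show ?thesis using r e by simp
    qed (use \<epsilon> in \<open>simp add: \<phi>_def\<close>)
    from has_integral_bound_real[OF _ finite.emptyI i3 this]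
    show "\<bar>integral {z1..z2} (\<lambda>y. b y * h y) - (z2 - z1) * (b z * h0)\<bar> \<le> \<epsilon> * (z2 - z1)" using \<epsilon> * by simp
  qed (use d r in simp)
qed

text \<open>Differentiates the mild equation at a point z outside E, with \<eta> independent of t as
  \<open>time_integral_deriv\<close> demands. For negative s the mild equation is read from the
  other end of the segment.\<close>

lemma char_deriv_plus:
  assumes mild: "mildP T P Q" and Q: "continuous_on ({0..\<zeta> N} \<times> {0..T}) (\<lambda>(z, t). Q z t)"
    and k: "k < N" and z: "z \<in> {\<zeta> k..\<zeta> (Suc k)}" "z \<notin> E" and \<epsilon>: "0 < \<epsilon>"
  shows "\<exists>\<eta>>0. \<forall>s t. \<bar>s\<bar> < \<eta> \<longrightarrow> z - s \<in> {\<zeta> k..\<zeta> (Suc k)} \<longrightarrow> t \<in> {0..T} \<longrightarrow> t + s \<in> {0..T} \<longrightarrow>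
     \<bar>(P (z - s) (t + s) + \<gamma> k (z - s) * Q (z - s) (t + s)) - (P z t + \<gamma> k z * Q z t) + s * (b z * Q z t)\<bar> \<le> \<epsilon> * \<bar>s\<bar>"
proof -
  have zZ: "z \<in> {0..\<zeta> N} - E" using piece_in[OF k z(1)] z(2) by simp
  obtain K where K: "\<And>z t. z \<in> {0..\<zeta> N} \<Longrightarrow> t \<in> {0..T} \<Longrightarrow> \<bar>Q z t\<bar> \<le> K" using bounded_on_rect[OF Q] by blast
  obtain \<eta> where \<eta>: "0 < \<eta>" "\<And>z1 z2 h h0. 0 \<le> z1 \<Longrightarrow> z1 \<le> z \<Longrightarrow> z \<le> z2 \<Longrightarrow> z2 \<le> \<zeta> N \<Longrightarrow> z2 - z1 < \<eta> \<Longrightarrow>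
     continuous_on {z1..z2} h \<Longrightarrow> \<bar>h0\<bar> \<le> K \<Longrightarrow> (\<forall>y\<in>{z1..z2}. \<bar>h y - h0\<bar> \<le> \<eta>) \<Longrightarrow>
     \<bar>integral {z1..z2} (\<lambda>y. b y * h y) - (z2 - z1) * (b z * h0)\<bar> \<le> \<epsilon> * (z2 - z1)"
    using b_average[OF zZ \<epsilon>, of K] by blast
  obtain d where d: "0 < d" "\<And>y z s t. y \<in> {0..\<zeta> N} \<Longrightarrow> z \<in> {0..\<zeta> N} \<Longrightarrow> s \<in> {0..T} \<Longrightarrow> t \<in> {0..T} \<Longrightarrow>
           \<bar>y - z\<bar> < d \<Longrightarrow> \<bar>s - t\<bar> < d \<Longrightarrow> \<bar>Q y s - Q z t\<bar> \<le> \<eta>"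
    using uniform_on_rect[OF Q \<eta>(1)] by blast
  show ?thesis
  proof (intro exI[of _ "min \<eta> d"] conjI allI impI)
    fix s t assume s: "\<bar>s\<bar> < min \<eta> d" "z - s \<in> {\<zeta> k..\<zeta> (Suc k)}" and t: "t \<in> {0..T}" "t + s \<in> {0..T}"
    define z1 z2 where "z1 = min z (z - s)" and "z2 = max z (z - s)"
    have zz: "z1 \<le> z" "z \<le> z2" "z2 - z1 = \<bar>s\<bar>" "\<zeta> k \<le> z1" "z2 \<le> \<zeta> (Suc k)"
      using s z unfolding z1_def z2_def by auto
    have z12: "0 \<le> z1" "z2 \<le> \<zeta> N" using piece_in[OF k, of z1] piece_in[OF k, of z2] zz by auto
    have line: "y \<in> {0..\<zeta> N}" "t + z - y \<in> {0..T}" "\<bar>y - z\<bar> \<le> \<bar>s\<bar>" if "y \<in> {z1..z2}" for y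
      using that z12 t unfolding z1_def z2_def by (auto simp: min_def max_def split: if_splits)
    have hc: "continuous_on {z1..z2} (\<lambda>y. Q y (t + z - y))"
      by (rule continuous_on_compose2[OF Q, of _ "\<lambda>y. (y, t + z - y)", simplified])
         (use line in \<open>auto intro!: continuous_intros\<close>)
    have av: "\<bar>integral {z1..z2} (\<lambda>y. b y * Q y (t + z - y)) - \<bar>s\<bar> * (b z * Q z t)\<bar> \<le> \<epsilon> * \<bar>s\<bar>"
    proof -
      have "\<forall>y\<in>{z1..z2}. \<bar>Q y (t + z - y) - Q z t\<bar> \<le> \<eta>"
      proof
        fix y assume y: "y \<in> {z1..z2}"
        show "\<bar>Q y (t + z - y) - Q z t\<bar> \<le> \<eta>"
          by (rule d(2)) (use line[OF y] zZ t s in auto)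
      qed
      moreover have "\<bar>Q z t\<bar> \<le> K" using K zZ t by auto
      moreover have "z2 - z1 < \<eta>" using zz(3) s by simp
      ultimately show ?thesis using \<eta>(2)[OF z12(1) zz(1,2) z12(2) _ hc] zz(3) by metis
    qed
    show "\<bar>(P (z - s) (t + s) + \<gamma> k (z - s) * Q (z - s) (t + s)) - (P z t + \<gamma> k z * Q z t) + s * (b z * Q z t)\<bar> \<le> \<epsilon> * \<bar>s\<bar>"
    proof (cases "0 \<le> s")
      case True
      then have e: "z1 = z - s" "z2 = z" "\<bar>s\<bar> = s" unfolding z1_def z2_def by auto
      have "P (z - s) (t + s) + \<gamma> k (z - s) * Q (z - s) (t + s) = P z t + \<gamma> k z * Q z t - integral {z - s..z} (\<lambda>y. b y * Q y (t + z - y))"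
        using mildPD[OF mild k, of "z - s" z t] True s z t by simp
      then show ?thesis using av unfolding e by (simp add: abs_minus_commute)
    next
      case False
      then have e: "z1 = z" "z2 = z - s" "\<bar>s\<bar> = - s" unfolding z1_def z2_def by auto
      have "t + s + (z - s) = t + z" by simp
      then have "P z t + \<gamma> k z * Q z t = P (z - s) (t + s) + \<gamma> k (z - s) * Q (z - s) (t + s) - integral {z..z - s} (\<lambda>y. b y * Q y (t + z - y))"
        using mildPD[OF mild k, of z "z - s" "t + s"] False s z t by simp
      then show ?thesis using av unfolding e by simp
    qed
  qed (use \<eta> d in simp)
qed

lemma char_deriv_minus:
  assumes mild: "mildM T P Q" and Q: "continuous_on ({0..\<zeta> N} \<times> {0..T}) (\<lambda>(z, t). Q z t)"
    and k: "k < N" and z: "z \<in> {\<zeta> k..\<zeta> (Suc k)}" "z \<notin> E" and \<epsilon>: "0 < \<epsilon>"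
  shows "\<exists>\<eta>>0. \<forall>s t. \<bar>s\<bar> < \<eta> \<longrightarrow> z + s \<in> {\<zeta> k..\<zeta> (Suc k)} \<longrightarrow> t \<in> {0..T} \<longrightarrow> t + s \<in> {0..T} \<longrightarrow>
     \<bar>(P (z + s) (t + s) - \<gamma> k (z + s) * Q (z + s) (t + s)) - (P z t - \<gamma> k z * Q z t) + s * (b z * Q z t)\<bar> \<le> \<epsilon> * \<bar>s\<bar>"
proof -
  have zZ: "z \<in> {0..\<zeta> N} - E" using piece_in[OF k z(1)] z(2) by simp
  obtain K where K: "\<And>z t. z \<in> {0..\<zeta> N} \<Longrightarrow> t \<in> {0..T} \<Longrightarrow> \<bar>Q z t\<bar> \<le> K" using bounded_on_rect[OF Q] by blast
  obtain \<eta> where \<eta>: "0 < \<eta>" "\<And>z1 z2 h h0. 0 \<le> z1 \<Longrightarrow> z1 \<le> z \<Longrightarrow> z \<le> z2 \<Longrightarrow> z2 \<le> \<zeta> N \<Longrightarrow> z2 - z1 < \<eta> \<Longrightarrow>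
     continuous_on {z1..z2} h \<Longrightarrow> \<bar>h0\<bar> \<le> K \<Longrightarrow> (\<forall>y\<in>{z1..z2}. \<bar>h y - h0\<bar> \<le> \<eta>) \<Longrightarrow>
     \<bar>integral {z1..z2} (\<lambda>y. b y * h y) - (z2 - z1) * (b z * h0)\<bar> \<le> \<epsilon> * (z2 - z1)"
    using b_average[OF zZ \<epsilon>, of K] by blast
  obtain d where d: "0 < d" "\<And>y z s t. y \<in> {0..\<zeta> N} \<Longrightarrow> z \<in> {0..\<zeta> N} \<Longrightarrow> s \<in> {0..T} \<Longrightarrow> t \<in> {0..T} \<Longrightarrow>
           \<bar>y - z\<bar> < d \<Longrightarrow> \<bar>s - t\<bar> < d \<Longrightarrow> \<bar>Q y s - Q z t\<bar> \<le> \<eta>"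
    using uniform_on_rect[OF Q \<eta>(1)] by blast
  show ?thesis
  proof (intro exI[of _ "min \<eta> d"] conjI allI impI)
    fix s t assume s: "\<bar>s\<bar> < min \<eta> d" "z + s \<in> {\<zeta> k..\<zeta> (Suc k)}" and t: "t \<in> {0..T}" "t + s \<in> {0..T}"
    define z1 z2 where "z1 = min z (z + s)" and "z2 = max z (z + s)"
    have zz: "z1 \<le> z" "z \<le> z2" "z2 - z1 = \<bar>s\<bar>" "\<zeta> k \<le> z1" "z2 \<le> \<zeta> (Suc k)"
      using s z unfolding z1_def z2_def by auto
    have z12: "0 \<le> z1" "z2 \<le> \<zeta> N" using piece_in[OF k, of z1] piece_in[OF k, of z2] zz by auto
    have line: "y \<in> {0..\<zeta> N}" "t - z + y \<in> {0..T}" "\<bar>y - z\<bar> \<le> \<bar>s\<bar>" if "y \<in> {z1..z2}" for y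
      using that z12 t unfolding z1_def z2_def by (auto simp: min_def max_def split: if_splits)
    have hc: "continuous_on {z1..z2} (\<lambda>y. Q y (t - z + y))"
      by (rule continuous_on_compose2[OF Q, of _ "\<lambda>y. (y, t - z + y)", simplified])
         (use line in \<open>auto intro!: continuous_intros\<close>)
    have av: "\<bar>integral {z1..z2} (\<lambda>y. b y * Q y (t - z + y)) - \<bar>s\<bar> * (b z * Q z t)\<bar> \<le> \<epsilon> * \<bar>s\<bar>"
    proof -
      have "\<forall>y\<in>{z1..z2}. \<bar>Q y (t - z + y) - Q z t\<bar> \<le> \<eta>"
      proof
        fix y assume y: "y \<in> {z1..z2}"
        show "\<bar>Q y (t - z + y) - Q z t\<bar> \<le> \<eta>"
          by (rule d(2)) (use line[OF y] zZ t s in auto)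
      qed
      moreover have "\<bar>Q z t\<bar> \<le> K" using K zZ t by auto
      moreover have "z2 - z1 < \<eta>" using zz(3) s by simp
      ultimately show ?thesis using \<eta>(2)[OF z12(1) zz(1,2) z12(2) _ hc] zz(3) by metis
    qed
    show "\<bar>(P (z + s) (t + s) - \<gamma> k (z + s) * Q (z + s) (t + s)) - (P z t - \<gamma> k z * Q z t) + s * (b z * Q z t)\<bar> \<le> \<epsilon> * \<bar>s\<bar>"
    proof (cases "0 \<le> s")
      case True
      then have e: "z1 = z" "z2 = z + s" "\<bar>s\<bar> = s" unfolding z1_def z2_def by auto
      have "P (z + s) (t + s) - \<gamma> k (z + s) * Q (z + s) (t + s) = P z t - \<gamma> k z * Q z t - integral {z..z + s} (\<lambda>y. b y * Q y (t - z + y))"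
        using mildMD[OF mild k, of z "z + s" t] True s z t by simp
      then show ?thesis using av unfolding e by (simp add: abs_minus_commute)
    next
      case False
      then have e: "z1 = z + s" "z2 = z" "\<bar>s\<bar> = - s" unfolding z1_def z2_def by auto
      have "t + s - (z + s) = t - z" by simp
      then have "P z t - \<gamma> k z * Q z t = P (z + s) (t + s) - \<gamma> k (z + s) * Q (z + s) (t + s) - integral {z + s..z} (\<lambda>y. b y * Q y (t - z + y))"
        using mildMD[OF mild k, of "z + s" z "t + s"] False s z t by simp
      then show ?thesis using av unfolding e by simp
    qed
  qed (use \<eta> d in simp)
qed

lemma piece_rect_cont:
  assumes k: "k < N" and P: "continuous_on ({0..\<zeta> N} \<times> {0..T}) (\<lambda>(z, t). P z t)"
  shows "continuous_on ({\<zeta> k..\<zeta> (Suc k)} \<times> {0..T}) (\<lambda>x. P (fst x) (snd x))"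
    and "continuous_on ({\<zeta> k..\<zeta> (Suc k)} \<times> {0..T}) (\<lambda>x. \<gamma> k (fst x))"
proof -
  have "{\<zeta> k..\<zeta> (Suc k)} \<times> {0..T} \<subseteq> {0..\<zeta> N} \<times> {0..T}" using piece_in[OF k] by auto
  from continuous_on_subset[OF P this]
  show "continuous_on ({\<zeta> k..\<zeta> (Suc k)} \<times> {0..T}) (\<lambda>x. P (fst x) (snd x))" by (simp add: split_beta)
  show "continuous_on ({\<zeta> k..\<zeta> (Suc k)} \<times> {0..T}) (\<lambda>x. \<gamma> k (fst x))"
    by (rule continuous_on_compose2[OF \<gamma>_cont[OF k]]) (auto intro!: continuous_intros)
qed

text \<open>\<open>char_deriv_plus\<close> is a derivative of P + \<gamma> Q in the direction (-1,
  1), so \<open>time_integral_deriv\<close> applies with \<sigma> = - 1 and rate - b Q.\<close>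

lemma plus_integral_deriv:
  assumes mild: "mildP T P Q" and P: "continuous_on ({0..\<zeta> N} \<times> {0..T}) (\<lambda>(z, t). P z t)"
    and Q: "continuous_on ({0..\<zeta> N} \<times> {0..T}) (\<lambda>(z, t). Q z t)"
    and k: "k < N" and z: "z \<in> {\<zeta> k<..<\<zeta> (Suc k)}" "z \<notin> E" and t: "0 < t1" "t1 \<le> t2" "t2 < T"
  shows "((\<lambda>y. integral {t1..t2} (P y) + \<gamma> k y * integral {t1..t2} (Q y)) has_real_derivative
     b z * integral {t1..t2} (Q z) + (P z t2 - P z t1) + \<gamma> k z * (Q z t2 - Q z t1)) (at z)"
proof -
  let ?S = "{\<zeta> k..\<zeta> (Suc k)}"
  have z': "z \<in> ?S" using z by auto
  have at: "at z within ?S = at z" by (rule at_within_interior) (use z in simp)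
  define w where "w z t = P z t + \<gamma> k z * Q z t" for z t
  have wc: "continuous_on (?S \<times> {0..T}) (\<lambda>(z, t). w z t)"
    unfolding w_def split_beta by (intro continuous_intros piece_rect_cont[OF k P] piece_rect_cont[OF k Q])
  have Qz: "continuous_on {t1..t2} (Q y)" "continuous_on {t1..t2} (P y)" if "y \<in> ?S" for y
    using slice_cont[OF Q piece_in[OF k that]] slice_cont[OF P piece_in[OF k that]] t
    by (auto intro: continuous_on_subset)
  have "((\<lambda>y. integral {t1..t2} (w y)) has_real_derivative
      (- 1) * (integral {t1..t2} (\<lambda>t. - (b z * Q z t)) - (w z t2 - w z t1))) (at z within ?S)"
  proof (rule time_integral_deriv[OF wc z' t])
    show "continuous_on {t1..t2} (\<lambda>t. - (b z * Q z t))" by (intro continuous_intros Qz z')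
    fix \<epsilon> :: real assume "0 < \<epsilon>"
    from char_deriv_plus[OF mild Q k z' z(2) this] t
    show "\<exists>\<eta>>0. \<forall>s t. \<bar>s\<bar> < \<eta> \<longrightarrow> z + - 1 * s \<in> ?S \<longrightarrow> t \<in> {t1..t2} \<longrightarrow> t + s \<in> {0..T} \<longrightarrow>
       \<bar>w (z + - 1 * s) (t + s) - w z t - s * - (b z * Q z t)\<bar> \<le> \<epsilon> * \<bar>s\<bar>"
      unfolding w_def by (elim exE conjE, intro exI conjI) auto
  qed simp
  then have "((\<lambda>y. integral {t1..t2} (w y)) has_real_derivative
      b z * integral {t1..t2} (Q z) + (P z t2 - P z t1) + \<gamma> k z * (Q z t2 - Q z t1)) (at z within ?S)"
    by (simp add: w_def algebra_simps)
  then show ?thesis unfolding at[symmetric]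
  proof (rule has_field_derivative_transform_within[OF _ zero_less_one z'])
    fix y assume "y \<in> ?S"
    note c = Qz[OF this]
    have "(\<lambda>t. \<gamma> k y * Q y t) integrable_on {t1..t2}" "P y integrable_on {t1..t2}"
      by (auto intro!: integrable_continuous_real continuous_intros c)
    then show "integral {t1..t2} (w y) = integral {t1..t2} (P y) + \<gamma> k y * integral {t1..t2} (Q y)"
      unfolding w_def by (simp add: integral_add)
  qed
qed

lemma minus_integral_deriv:
  assumes mild: "mildM T P Q" and P: "continuous_on ({0..\<zeta> N} \<times> {0..T}) (\<lambda>(z, t). P z t)"
    and Q: "continuous_on ({0..\<zeta> N} \<times> {0..T}) (\<lambda>(z, t). Q z t)"
    and k: "k < N" and z: "z \<in> {\<zeta> k<..<\<zeta> (Suc k)}" "z \<notin> E" and t: "0 < t1" "t1 \<le> t2" "t2 < T"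
  shows "((\<lambda>y. integral {t1..t2} (P y) - \<gamma> k y * integral {t1..t2} (Q y)) has_real_derivative
     - b z * integral {t1..t2} (Q z) - (P z t2 - P z t1) + \<gamma> k z * (Q z t2 - Q z t1)) (at z)"
proof -
  let ?S = "{\<zeta> k..\<zeta> (Suc k)}"
  have z': "z \<in> ?S" using z by auto
  have at: "at z within ?S = at z" by (rule at_within_interior) (use z in simp)
  define w where "w z t = P z t - \<gamma> k z * Q z t" for z t
  have wc: "continuous_on (?S \<times> {0..T}) (\<lambda>(z, t). w z t)"
    unfolding w_def split_beta by (intro continuous_intros piece_rect_cont[OF k P] piece_rect_cont[OF k Q])
  have Qz: "continuous_on {t1..t2} (Q y)" "continuous_on {t1..t2} (P y)" if "y \<in> ?S" for y
    using slice_cont[OF Q piece_in[OF k that]] slice_cont[OF P piece_in[OF k that]] t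
    by (auto intro: continuous_on_subset)
  have "((\<lambda>y. integral {t1..t2} (w y)) has_real_derivative
      1 * (integral {t1..t2} (\<lambda>t. - (b z * Q z t)) - (w z t2 - w z t1))) (at z within ?S)"
  proof (rule time_integral_deriv[OF wc z' t])
    show "continuous_on {t1..t2} (\<lambda>t. - (b z * Q z t))" by (intro continuous_intros Qz z')
    fix \<epsilon> :: real assume "0 < \<epsilon>"
    from char_deriv_minus[OF mild Q k z' z(2) this] t
    show "\<exists>\<eta>>0. \<forall>s t. \<bar>s\<bar> < \<eta> \<longrightarrow> z + 1 * s \<in> ?S \<longrightarrow> t \<in> {t1..t2} \<longrightarrow> t + s \<in> {0..T} \<longrightarrow>
       \<bar>w (z + 1 * s) (t + s) - w z t - s * - (b z * Q z t)\<bar> \<le> \<epsilon> * \<bar>s\<bar>"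
      unfolding w_def by (elim exE conjE, intro exI conjI) auto
  qed simp
  then have "((\<lambda>y. integral {t1..t2} (w y)) has_real_derivative
      - b z * integral {t1..t2} (Q z) - (P z t2 - P z t1) + \<gamma> k z * (Q z t2 - Q z t1)) (at z within ?S)"
    by (simp add: w_def algebra_simps)
  then show ?thesis unfolding at[symmetric]
  proof (rule has_field_derivative_transform_within[OF _ zero_less_one z'])
    fix y assume "y \<in> ?S"
    note c = Qz[OF this]
    have "(\<lambda>t. \<gamma> k y * Q y t) integrable_on {t1..t2}" "P y integrable_on {t1..t2}"
      by (auto intro!: integrable_continuous_real continuous_intros c)
    then show "integral {t1..t2} (w y) = integral {t1..t2} (P y) - \<gamma> k y * integral {t1..t2} (Q y)"
      unfolding w_def by (simp add: integral_diff)
  qed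
qed

text \<open>The companion equation \<open>mildM\<close> is replaced by the strain law
  \<open>Pd\<close>. Subtracting it from the balance law of P + \<gamma> Q leaves the derivative of
  \<gamma> times the integral of Q, and dividing by \<gamma> cancels the term with b, the derivative
  of \<gamma>.\<close>

lemma flux_integral_deriv:
  assumes mild: "mildP T P Q" and P: "continuous_on ({0..\<zeta> N} \<times> {0..T}) (\<lambda>(z, t). P z t)"
    and Q: "continuous_on ({0..\<zeta> N} \<times> {0..T}) (\<lambda>(z, t). Q z t)"
    and k: "k < N" and z: "z \<in> {\<zeta> k<..<\<zeta> (Suc k)}" "z \<notin> E" and t: "0 < t1" "t1 \<le> t2" "t2 < T"
    and Pd: "((\<lambda>y. integral {t1..t2} (P y)) has_real_derivative \<gamma> k z * (Q z t2 - Q z t1)) (at z)"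
  shows "((\<lambda>y. integral {t1..t2} (Q y)) has_real_derivative (P z t2 - P z t1) / \<gamma> k z) (at z)"
proof -
  have g: "0 < \<gamma> k z" using \<gamma>_pos[OF k, of z] z by auto
  have \<gamma>d: "(\<gamma> k has_real_derivative b z) (at z)" by (rule \<gamma>_deriv[OF k]) (use z in simp)
  have "((\<lambda>y. (integral {t1..t2} (P y) + \<gamma> k y * integral {t1..t2} (Q y)) - integral {t1..t2} (P y)) has_real_derivative
     (b z * integral {t1..t2} (Q z) + (P z t2 - P z t1) + \<gamma> k z * (Q z t2 - Q z t1)) - \<gamma> k z * (Q z t2 - Q z t1)) (at z)"
    by (rule DERIV_diff[OF plus_integral_deriv[OF mild P Q k z t] Pd])
  then have 1: "((\<lambda>y. \<gamma> k y * integral {t1..t2} (Q y)) has_real_derivative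
     b z * integral {t1..t2} (Q z) + (P z t2 - P z t1)) (at z)" by simp
  have "((\<lambda>y. (\<gamma> k y * integral {t1..t2} (Q y)) / \<gamma> k y) has_real_derivative
     ((b z * integral {t1..t2} (Q z) + (P z t2 - P z t1)) * \<gamma> k z - (\<gamma> k z * integral {t1..t2} (Q z)) * b z) / (\<gamma> k z * \<gamma> k z)) (at z)"
    by (rule DERIV_divide[OF 1 \<gamma>d]) (use g in simp)
  moreover have "((b z * integral {t1..t2} (Q z) + (P z t2 - P z t1)) * \<gamma> k z - (\<gamma> k z * integral {t1..t2} (Q z)) * b z) / (\<gamma> k z * \<gamma> k z)
     = (P z t2 - P z t1) / \<gamma> k z" using g by (simp add: field_simps)
  ultimately have "((\<lambda>y. (\<gamma> k y * integral {t1..t2} (Q y)) / \<gamma> k y) has_real_derivative (P z t2 - P z t1) / \<gamma> k z) (at z)" by simp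
  then show ?thesis
  proof (rule has_field_derivative_transform_within_open[of _ _ _ "{\<zeta> k<..<\<zeta> (Suc k)}"])
    fix y assume "y \<in> {\<zeta> k<..<\<zeta> (Suc k)}"
    then have "0 < \<gamma> k y" using \<gamma>_pos[OF k, of y] by auto
    then show "\<gamma> k y * integral {t1..t2} (Q y) / \<gamma> k y = integral {t1..t2} (Q y)" by simp
  qed (use z in auto)
qed

lemma mild_integral_deriv:
  assumes mild: "mildP T P Q" "mildM T P Q" and P: "continuous_on ({0..\<zeta> N} \<times> {0..T}) (\<lambda>(z, t). P z t)"
    and Q: "continuous_on ({0..\<zeta> N} \<times> {0..T}) (\<lambda>(z, t). Q z t)"
    and k: "k < N" and z: "z \<in> {\<zeta> k<..<\<zeta> (Suc k)}" "z \<notin> E" and t: "0 < t1" "t1 \<le> t2" "t2 < T"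
  shows "((\<lambda>y. integral {t1..t2} (P y)) has_real_derivative \<gamma> k z * (Q z t2 - Q z t1)) (at z)"
    and "((\<lambda>y. integral {t1..t2} (Q y)) has_real_derivative (P z t2 - P z t1) / \<gamma> k z) (at z)"
proof -
  have "((\<lambda>y. ((integral {t1..t2} (P y) + \<gamma> k y * integral {t1..t2} (Q y)) + (integral {t1..t2} (P y) - \<gamma> k y * integral {t1..t2} (Q y))) / 2)
     has_real_derivative ((b z * integral {t1..t2} (Q z) + (P z t2 - P z t1) + \<gamma> k z * (Q z t2 - Q z t1))
       + (- b z * integral {t1..t2} (Q z) - (P z t2 - P z t1) + \<gamma> k z * (Q z t2 - Q z t1))) / 2) (at z)"
    by (intro DERIV_cdivide DERIV_add plus_integral_deriv[OF mild(1) P Q k z t] minus_integral_deriv[OF mild(2) P Q k z t])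
  then show 1: "((\<lambda>y. integral {t1..t2} (P y)) has_real_derivative \<gamma> k z * (Q z t2 - Q z t1)) (at z)" by simp
  show "((\<lambda>y. integral {t1..t2} (Q y)) has_real_derivative (P z t2 - P z t1) / \<gamma> k z) (at z)"
    by (rule flux_integral_deriv[OF mild(1) P Q k z t 1])
qed

text \<open>The potentials of a \<open>C\<^sup>1\<close> solution solve the same first-order system as its derivatives.\<close>

lemma classical_imp_mild:
  assumes cont: "continuous_on ({0..\<zeta> N} \<times> {0..T}) (\<lambda>(z, t). u z t)" "continuous_on ({0..\<zeta> N} \<times> {0..T}) (\<lambda>(z, t). \<psi> z t)"
      "continuous_on ({0..\<zeta> N} \<times> {0..T}) (\<lambda>(z, t). p z t)" "continuous_on ({0..\<zeta> N} \<times> {0..T}) (\<lambda>(z, t). q z t)"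
    and ut: "\<And>z t. z \<in> {0..\<zeta> N} \<Longrightarrow> t \<in> {0..T} \<Longrightarrow> (u z has_real_derivative p z t) (at t within {0..T})"
    and \<psi>t: "\<And>z t. z \<in> {0..\<zeta> N} \<Longrightarrow> t \<in> {0..T} \<Longrightarrow> (\<psi> z has_real_derivative q z t) (at t within {0..T})"
    and uz: "\<And>k z t. k < N \<Longrightarrow> z \<in> {\<zeta> k<..<\<zeta> (Suc k)} \<Longrightarrow> t \<in> {0..T} \<Longrightarrow> ((\<lambda>y. u y t) has_real_derivative \<gamma> k z * q z t) (at z)"
    and \<psi>z: "\<And>k z t. k < N \<Longrightarrow> z \<in> {\<zeta> k<..<\<zeta> (Suc k)} \<Longrightarrow> t \<in> {0..T} \<Longrightarrow> ((\<lambda>y. \<psi> y t) has_real_derivative p z t / \<gamma> k z) (at z)"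
  shows "mildP T u \<psi>" and "mildM T u \<psi>"
proof -
  \<comment> \<open>Both families of characteristics at once: \<sigma> = - 1 is leftgoing and
    \<sigma> = 1 rightgoing. As \<sigma> * \<sigma> = 1, the derivatives of u and \<psi> cancel
    along the line and only the derivative b of \<gamma> survives.\<close>
  have line: "integral {z..z'} (\<lambda>y. - \<sigma> * (b y * \<psi> y (\<tau> + \<sigma> * y))) =
        (u z' (\<tau> + \<sigma> * z') - \<sigma> * \<gamma> k z' * \<psi> z' (\<tau> + \<sigma> * z')) - (u z (\<tau> + \<sigma> * z) - \<sigma> * \<gamma> k z * \<psi> z (\<tau> + \<sigma> * z))"
    if k: "k < N" and zz: "\<zeta> k \<le> z" "z \<le> z'" "z' \<le> \<zeta> (Suc k)" and \<sigma>: "\<sigma> * \<sigma> = 1"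
      and ln: "\<And>y. y \<in> {z..z'} \<Longrightarrow> \<tau> + \<sigma> * y \<in> {0..T}" for k z z' \<tau> \<sigma>
  proof -
    have pin: "y \<in> {0..\<zeta> N}" if "y \<in> {z..z'}" for y using piece_in[OF k, of y] that zz by auto
    have lc: "continuous_on {z..z'} (\<lambda>y. F y (\<tau> + \<sigma> * y))" if "continuous_on ({0..\<zeta> N} \<times> {0..T}) (\<lambda>(z, t). F z t)" for F
      by (rule continuous_on_compose2[OF that, of _ "\<lambda>y. (y, \<tau> + \<sigma> * y)", simplified])
         (use pin ln in \<open>auto intro!: continuous_intros\<close>)
    have gc: "continuous_on {z..z'} (\<gamma> k)" by (rule continuous_on_subset[OF \<gamma>_cont[OF k]]) (use zz in auto)
    let ?f = "\<lambda>y. u y (\<tau> + \<sigma> * y) - \<sigma> * \<gamma> k y * \<psi> y (\<tau> + \<sigma> * y)"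
    let ?b = "\<lambda>y. - \<sigma> * (b y * \<psi> y (\<tau> + \<sigma> * y))"
    have "(?b has_integral ?f z' - ?f z) {z..z'}"
    proof (rule ftc_off_countable[OF zz(2) E])
      show "continuous_on {z..z'} ?f" by (intro continuous_intros lc cont gc)
      show "?b integrable_on {z..z'}"
        using integrable_cmul[OF integrable_mult_bounded_borel[OF b_meas b_bd lc[OF cont(2)]], of "- \<sigma>"] by simp
      fix y assume y: "y \<in> {z<..<z'} - E"
      have yk: "y \<in> {\<zeta> k<..<\<zeta> (Suc k)}" and yZ: "y \<in> {0..\<zeta> N}" and yl: "\<tau> + \<sigma> * y \<in> {0..T}"
        using y zz pin[of y] ln[of y] by auto
      have at: "at y within {z..z'} = at y" by (rule at_within_interior) (use y in simp)
      have sub: "{z..z'} \<times> {0..T} \<subseteq> {0..\<zeta> N} \<times> {0..T}" using pin by auto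
      have du: "((\<lambda>y. u y (\<tau> + \<sigma> * y)) has_real_derivative \<gamma> k y * q y (\<tau> + \<sigma> * y) + \<sigma> * p y (\<tau> + \<sigma> * y)) (at y)"
        unfolding at[symmetric]
        by (rule diagonal_deriv[OF _ continuous_on_subset[OF cont(3) sub] _ ln])
           (use y pin ut uz[OF k yk yl] at in auto)
      have d\<psi>: "((\<lambda>y. \<psi> y (\<tau> + \<sigma> * y)) has_real_derivative p y (\<tau> + \<sigma> * y) / \<gamma> k y + \<sigma> * q y (\<tau> + \<sigma> * y)) (at y)"
        unfolding at[symmetric]
        by (rule diagonal_deriv[OF _ continuous_on_subset[OF cont(4) sub] _ ln])
           (use y pin \<psi>t \<psi>z[OF k yk yl] at in auto)
      have d\<gamma>: "(\<gamma> k has_real_derivative b y) (at y)" by (rule \<gamma>_deriv[OF k]) (use yk y in simp)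
      have gp: "\<gamma> k y \<noteq> 0" using \<gamma>_pos[OF k, of y] yk by auto
      have "(?f has_real_derivative (\<gamma> k y * q y (\<tau> + \<sigma> * y) + \<sigma> * p y (\<tau> + \<sigma> * y))
         - (\<sigma> * b y * \<psi> y (\<tau> + \<sigma> * y) + (p y (\<tau> + \<sigma> * y) / \<gamma> k y + \<sigma> * q y (\<tau> + \<sigma> * y)) * (\<sigma> * \<gamma> k y))) (at y)"
        by (intro DERIV_diff DERIV_mult du d\<psi> DERIV_cmult d\<gamma>)
      moreover have "(\<gamma> k y * q y (\<tau> + \<sigma> * y) + \<sigma> * p y (\<tau> + \<sigma> * y))
         - (\<sigma> * b y * \<psi> y (\<tau> + \<sigma> * y) + (p y (\<tau> + \<sigma> * y) / \<gamma> k y + \<sigma> * q y (\<tau> + \<sigma> * y)) * (\<sigma> * \<gamma> k y)) = ?b y"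
        using gp \<sigma> by (simp add: field_simps) (simp add: mult.assoc[symmetric] power2_eq_square)?
      ultimately show "(?f has_real_derivative ?b y) (at y)" by simp
      have "(b \<longlongrightarrow> b y) (at y within {z..z'} - E)"
        by (rule tendsto_within_subset[OF b_cont]) (use y yZ pin in auto)
      moreover have "((\<lambda>y. \<psi> y (\<tau> + \<sigma> * y)) \<longlongrightarrow> \<psi> y (\<tau> + \<sigma> * y)) (at y within {z..z'} - E)"
        by (rule tendsto_within_subset[of _ _ _ "{z..z'}"]) (use lc[OF cont(2)] y in \<open>auto simp: continuous_on_def\<close>)
      ultimately show "(?b \<longlongrightarrow> ?b y) (at y within {z..z'} - E)" by (intro tendsto_intros)
    qed
    then show ?thesis by (rule integral_unique)
  qed
  show "mildP T u \<psi>" unfolding mildP_def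
  proof (intro allI impI)
    fix k z z' t assume *: "k < N" "\<zeta> k \<le> z" "z \<le> z'" "z' \<le> \<zeta> (Suc k)" "0 \<le> t" "t + (z' - z) \<le> T"
    have "integral {z..z'} (\<lambda>y. - (- 1) * (b y * \<psi> y (t + z' + - 1 * y))) =
        (u z' (t + z' + - 1 * z') - - 1 * \<gamma> k z' * \<psi> z' (t + z' + - 1 * z')) - (u z (t + z' + - 1 * z) - - 1 * \<gamma> k z * \<psi> z (t + z' + - 1 * z))"
      by (rule line) (use * in auto)
    moreover have "t + z' + - 1 * z = t + (z' - z)" by simp
    ultimately show "u z (t + (z' - z)) + \<gamma> k z * \<psi> z (t + (z' - z)) =
       u z' t + \<gamma> k z' * \<psi> z' t - integral {z..z'} (\<lambda>y. b y * \<psi> y (t + z' - y))" by (simp add: add_diff_eq)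
  qed
  show "mildM T u \<psi>" unfolding mildM_def
  proof (intro allI impI)
    fix k z z' t assume *: "k < N" "\<zeta> k \<le> z" "z \<le> z'" "z' \<le> \<zeta> (Suc k)" "0 \<le> t" "t + (z' - z) \<le> T"
    have "integral {z..z'} (\<lambda>y. - 1 * (b y * \<psi> y (t - z + 1 * y))) =
        (u z' (t - z + 1 * z') - 1 * \<gamma> k z' * \<psi> z' (t - z + 1 * z')) - (u z (t - z + 1 * z) - 1 * \<gamma> k z * \<psi> z (t - z + 1 * z))"
      by (rule line) (use * in auto)
    moreover have "t - z + 1 * z' = t + (z' - z)" by simp
    ultimately show "u z' (t + (z' - z)) - \<gamma> k z' * \<psi> z' (t + (z' - z)) =
       u z t - \<gamma> k z * \<psi> z t - integral {z..z'} (\<lambda>y. b y * \<psi> y (t - z + y))" by (simp add: algebra_simps)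
  qed
qed

end

section \<open>Piecewise regular coefficients\<close>

text \<open>Each point of D is singled out by a member of a countable basis, and distinct points by
  distinct members.\<close>

lemma discrete_countable:
  fixes D :: "'a::second_countable_topology set"
  assumes "discrete D"
  shows "countable D"
proof -
  obtain \<B> :: "'a set set" where \<B>: "countable \<B>" "topological_basis \<B>"
    using ex_countable_basis by auto
  have "\<exists>U\<in>\<B>. U \<inter> D = {x}" if x: "x \<in> D" for x
  proof -
    obtain W where W: "open W" "W \<inter> D = {x}"
      using assms x unfolding discrete_def isolated_in_def by blast
    then obtain U where "U \<in> \<B>" "x \<in> U" "U \<subseteq> W"
      using topological_basisE[OF \<B>(2) W(1), of x] by blast
    then show ?thesis using W x by blast
  qed
  then obtain U where U: "\<And>x. x \<in> D \<Longrightarrow> U x \<in> \<B>" "\<And>x. x \<in> D \<Longrightarrow> U x \<inter> D = {x}" by metis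
  then have "inj_on U D" by (intro inj_onI) (metis singleton_inject)
  moreover have "countable (U ` D)" using countable_subset[OF _ \<B>(1)] U(1) by blast
  ultimately show ?thesis using countable_image_inj_on by blast
qed

lemma discrete_real_nbhd:
  fixes D :: "real set"
  assumes "discrete D" "y \<in> D"
  shows "\<exists>e>0. \<forall>x\<in>D. \<bar>x - y\<bar> < e \<longrightarrow> x = y"
proof -
  obtain W where W: "open W" "W \<inter> D = {y}"
    using assms unfolding discrete_def isolated_in_def by blast
  then obtain e where e: "e > 0" "ball y e \<subseteq> W" using open_contains_ball by (metis Int_iff insertI1)
  show ?thesis
  proof (intro exI[of _ e] conjI ballI impI)
    fix x assume "x \<in> D" "\<bar>x - y\<bar> < e"
    then have "x \<in> W \<inter> D" using e(2) by (auto simp: dist_real_def abs_minus_commute)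
    then show "x = y" using W(2) by blast
  qed (rule e(1))
qed

text \<open>Every nonempty open interval is uncountable, so removing a countable set leaves every
  point of the interval a limit point. Hence derivatives within such sets are unique.\<close>

lemma at_within_Icc_minus_countable:
  fixes L :: real
  assumes L: "0 < L" and D: "countable D" and x: "x \<in> {0..L}"
  shows "at x within ({0..L} - D) \<noteq> bot"
proof -
  have "x islimpt ({0..L} - D)"
  proof (rule islimptI)
    fix W assume "x \<in> W" "open W"
    then obtain e where e: "e > 0" "ball x e \<subseteq> W" using open_contains_ball by blast
    obtain a b where ab: "a < b" "{a<..<b} \<subseteq> ball x e \<inter> {0..L} - {x}"
    proof (cases "x < L")
      case True
      show thesis by (rule that[of x "min L (x + e)"]) (use True e x in \<open>auto simp: dist_real_def\<close>)
    next
      case False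
      show thesis by (rule that[of "max 0 (x - e)" x]) (use False e x L in \<open>auto simp: dist_real_def\<close>)
    qed
    have "uncountable ({a<..<b} - D)"
      using uncountable_minus_countable[OF _ D] ab(1) uncountable_open_interval by blast
    then obtain y where "y \<in> {a<..<b} - D" by (metis countable_empty ex_in_conv)
    then show "\<exists>y\<in>{0..L} - D. y \<in> W \<and> y \<noteq> x" using ab(2) e(2) by blast
  qed
  then show ?thesis by (simp add: trivial_limit_within)
qed

lemma deriv_on_eqI:
  assumes "at x within A \<noteq> bot" "(\<phi> has_real_derivative d) (at x within A)"
  shows "deriv_on A \<phi> x = d"
  unfolding deriv_on_def
  using vector_derivative_within[OF assms(1)] assms(2) has_real_derivative_iff_has_vector_derivative by blast

lemma deriv_on_works:
  "\<phi> differentiable (at x within A) \<Longrightarrow> (\<phi> has_real_derivative deriv_on A \<phi> x) (at x within A)"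
  unfolding deriv_on_def has_real_derivative_iff_has_vector_derivative by (simp add: vector_derivative_works)

lemma real_derivative_differentiable:
  "(\<phi> has_real_derivative d) (at x within A) \<Longrightarrow> \<phi> differentiable (at x within A)"
  unfolding real_differentiable_def by blast

text \<open>If the bound failed at x, continuity along S would make it fail on a one-sided interval
  at x up to countably many points, that is, on a set of positive measure.\<close>

lemma AE_bound_at:
  fixes g :: "real \<Rightarrow> real"
  assumes L: "0 < L" and x: "x \<in> {0..L}" and S: "countable ({0..L} - S)"
    and ae: "AE y in lebesgue_on {0..L}. \<bar>g y\<bar> \<le> M" and lim: "(g \<longlongrightarrow> g x) (at x within S)"
  shows "\<bar>g x\<bar> \<le> M"
proof (rule ccontr)
  assume neg: "\<not> \<bar>g x\<bar> \<le> M"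
  have "((\<lambda>y. \<bar>g y\<bar>) \<longlongrightarrow> \<bar>g x\<bar>) (at x within S)" using lim by (rule tendsto_rabs)
  then have "\<forall>\<^sub>F y in at x within S. M < \<bar>g y\<bar>" using neg order_tendstoD(1) by fastforce
  then obtain d where d: "0 < d" "\<And>y. y \<in> S \<Longrightarrow> y \<noteq> x \<Longrightarrow> dist y x < d \<Longrightarrow> M < \<bar>g y\<bar>"
    unfolding eventually_at by blast
  obtain a b where ab: "a < b" "{a<..<b} \<subseteq> ball x d \<inter> {0..L} - {x}"
  proof (cases "x < L")
    case True
    show thesis by (rule that[of x "min L (x + d)"]) (use True d(1) x in \<open>auto simp: dist_real_def\<close>)
  next
    case False
    show thesis by (rule that[of "max 0 (x - d)" x]) (use False d(1) x L in \<open>auto simp: dist_real_def\<close>)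
  qed
  have "AE y in lebesgue. y \<in> {0..L} \<longrightarrow> \<bar>g y\<bar> \<le> M"
    using ae by (simp add: AE_restrict_space_iff)
  then have n1: "{y \<in> space lebesgue. \<not> (y \<in> {0..L} \<longrightarrow> \<bar>g y\<bar> \<le> M)} \<in> null_sets lebesgue"
    by (simp add: AE_iff_null_sets completion.AE_iff_null_sets completion.complete2 eventually_ae_filter)
       (auto intro: completion.complete2)
  then have n1': "negligible {y. y \<in> {0..L} \<and> M < \<bar>g y\<bar>}"
    by (simp add: negligible_iff_null_sets not_le)
  have n2: "negligible ({0..L} - S)" using negligible_countable_Union[of "(\<lambda>x. {x}) ` ({0..L} - S)"] S by auto
  have "{a<..<b} \<subseteq> {y. y \<in> {0..L} \<and> M < \<bar>g y\<bar>} \<union> ({0..L} - S)"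
  proof
    fix y assume y: "y \<in> {a<..<b}"
    then have "y \<in> {0..L}" "y \<noteq> x" "dist y x < d" using ab(2) by (auto simp: dist_commute)
    then show "y \<in> {y. y \<in> {0..L} \<and> M < \<bar>g y\<bar>} \<union> ({0..L} - S)" using d(2)[of y] by blast
  qed
  then have "negligible {a<..<b}" using negligible_subset[OF negligible_Un[OF n1' n2]] by blast
  then show False using ab(1) open_not_negligible[of "{a<..<b}"] by auto
qed

lemma MVT2_open:
  fixes f f' :: "real \<Rightarrow> real"
  assumes "a < b" "continuous_on {a..b} f" "\<And>x. a < x \<Longrightarrow> x < b \<Longrightarrow> (f has_real_derivative f' x) (at x)"
  shows "\<exists>x. a < x \<and> x < b \<and> f b - f a = (b - a) * f' x"
  using MVT[OF assms(1,2)] assms(3) by (metis DERIV_unique real_differentiable_def)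

lemma lipschitz_off_countable:
  fixes f f' :: "real \<Rightarrow> real"
  assumes "a \<le> b" "countable S" "continuous_on {a..b} f"
    and d: "\<And>x. x \<in> {a<..<b} - S \<Longrightarrow> (f has_real_derivative f' x) (at x) \<and> \<bar>f' x\<bar> \<le> M"
  shows "\<bar>f b - f a\<bar> \<le> M * (b - a)"
proof -
  have "f b - M * b \<le> f a - M * a"
  proof (rule nonincreasing_off_countable[OF assms(1,2)])
    show "continuous_on {a..b} (\<lambda>x. f x - M * x)" by (intro continuous_intros assms)
    fix x assume "x \<in> {a<..<b} - S"
    from d[OF this] show "\<exists>d\<le>0. ((\<lambda>x. f x - M * x) has_real_derivative d) (at x)"
      by (intro exI[of _ "f' x - M"]) (auto intro!: derivative_eq_intros)
  qed
  moreover have "- f b - M * b \<le> - f a - M * a"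
  proof (rule nonincreasing_off_countable[OF assms(1,2)])
    show "continuous_on {a..b} (\<lambda>x. - f x - M * x)" by (intro continuous_intros assms)
    fix x assume "x \<in> {a<..<b} - S"
    from d[OF this] show "\<exists>d\<le>0. ((\<lambda>x. - f x - M * x) has_real_derivative d) (at x)"
      by (intro exI[of _ "- f' x - M"]) (auto intro!: derivative_eq_intros)
  qed
  ultimately show ?thesis by (simp add: algebra_simps abs_le_iff)
qed

section \<open>Regularity of the coefficient\<close>

locale coefficient =
  fixes L :: real and V :: "real \<Rightarrow> real"
  assumes L: "0 < L" and A1: "A1 L V" and A2: "A2 L V"
begin

definition "c = speed V"
definition "I = {0..L}"
text \<open>F consists of the jumps and will be finite. G is the set of points where the wave
  equation is imposed; its complement in I may be infinite but will be countable.\<close>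

definition "F = discont I V"
definition "G = I - (discont I c \<union> discont_deriv I c)"
definition "c' = deriv_on I c"

lemma finite_F: "finite F"
proof -
  obtain \<delta> where \<delta>: "\<delta> > 0" "\<And>x y. x \<in> F \<Longrightarrow> y \<in> F \<Longrightarrow> x \<noteq> y \<Longrightarrow> \<delta> \<le> \<bar>x - y\<bar>"
    using A2 unfolding A2_def F_def I_def by (meson UnI1)
  have "uniform_discrete F" unfolding uniform_discrete_def
    by (intro exI[of _ \<delta>]) (use \<delta> in \<open>force simp: dist_real_def\<close>)
  moreover have "bounded F" unfolding F_def discont_def I_def by (rule bounded_subset[of "{0..L}"]) auto
  ultimately show ?thesis using uniform_discrete_finite_iff by blast
qed

lemma V_lower: obtains \<mu> where "0 < \<mu>" "\<And>x. x \<in> I \<Longrightarrow> \<mu> \<le> V x"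
  using A1 unfolding A1_def I_def by blast

lemma V_pos: "x \<in> I \<Longrightarrow> 0 < V x" using V_lower by (metis less_le_trans)

lemma c_pos: "x \<in> I \<Longrightarrow> 0 < c x" unfolding c_def speed_def using V_pos by simp

lemma V_c: "x \<in> I \<Longrightarrow> V x = 1 / (c x)\<^sup>2"
  unfolding c_def speed_def using V_pos[of x] by (simp add: power_divide)

lemma V_continuous: "x \<in> I \<Longrightarrow> x \<notin> F \<Longrightarrow> continuous (at x within I) V"
  unfolding F_def discont_def by blast

lemma c_continuous:
  assumes "x \<in> I" "x \<notin> F" shows "continuous (at x within I) c"
  unfolding c_def speed_def[abs_def] using V_pos[OF assms(1)] V_continuous[OF assms]
  by (intro continuous_intros) auto

lemma V_diff_iff: 
  assumes x: "x \<in> I"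
  shows "V differentiable (at x within I) \<Longrightarrow> (c has_real_derivative - deriv_on I V x / (2 * V x * sqrt (V x))) (at x within I)"
    and "c differentiable (at x within I) \<Longrightarrow> V differentiable (at x within I)"
proof -
  assume "V differentiable (at x within I)"
  from deriv_on_works[OF this] have "(V has_real_derivative deriv_on I V x) (at x within I)" .
  moreover have "sqrt (V x) * sqrt (V x) = V x" using V_pos[OF x] by simp
  ultimately show "(c has_real_derivative - deriv_on I V x / (2 * V x * sqrt (V x))) (at x within I)"
    unfolding c_def speed_def[abs_def] using V_pos[OF x]
    by (auto intro!: derivative_eq_intros simp: field_simps)
next
  assume "c differentiable (at x within I)"
  from deriv_on_works[OF this] have "((\<lambda>x. 1 / (c x)\<^sup>2) has_real_derivative - (2 * c x * deriv_on I c x) / ((c x)\<^sup>2 * (c x)\<^sup>2)) (at x within I)"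
    using c_pos[OF x] by (auto intro!: derivative_eq_intros)
  then have "(V has_real_derivative - (2 * c x * deriv_on I c x) / ((c x)\<^sup>2 * (c x)\<^sup>2)) (at x within I)"
    by (rule has_field_derivative_transform_within[OF _ zero_less_one x]) (simp add: V_c)
  then show "V differentiable (at x within I)" by (rule real_derivative_differentiable)
qed

lemma nontrivial: "x \<in> I \<Longrightarrow> at x within I \<noteq> bot"
  using at_within_Icc_minus_countable[OF L, of "{}" x] unfolding I_def by simp

text \<open>The derivatives in \<open>A1\<close> are taken within the complement of the exceptional set. They agree with
  derivatives within the interval, since exceptional points are isolated and all but finitely many
  of them are points of continuity.\<close>

lemma V_regular:
  obtains D where "countable D" "\<And>x. x \<in> I - D \<Longrightarrow> x \<notin> F \<and> V differentiable (at x within I) \<and>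
     (deriv_on I V \<longlongrightarrow> deriv_on I V x) (at x within {y \<in> I. V differentiable (at y within I)})"
proof -
  obtain D where D: "D \<subseteq> I" "discrete D" "Ck_on 1 (I - D) V"
    using A1 unfolding A1_def PCk_def I_def by blast
  have cD: "countable D" by (rule discrete_countable[OF D(2)])
  define v where "v = deriv_on (I - D) V"
  have nt: "at x within (I - D) \<noteq> bot" if "x \<in> I" for x
    using at_within_Icc_minus_countable[OF L cD] that unfolding I_def .
  have Vd: "(V has_real_derivative v x) (at x within (I - D))" if "x \<in> I - D" for x
    using D(3) that unfolding Ck_on_def v_def by (intro deriv_on_works) auto
  have vc: "continuous_on (I - D) v" using D(3) unfolding Ck_on_def v_def by (auto dest: spec[of _ 1])
  have near: "\<exists>d>0. \<forall>y\<in>F. \<bar>y - x\<bar> < d \<longrightarrow> y = x" for x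
    using finite_set_avoid[OF finite_F, of x] by (metis dist_real_def linorder_not_less abs_minus_commute)
  \<comment> \<open>Transfers a closed condition on (V z, z) from the points z of I - D to an
    exceptional point y where V is continuous. This works because I - D accumulates at every point
    of I.\<close>
  have pass: "P y" if P: "closed {r. P' r}" and yI: "y \<in> I" and Vy: "continuous (at y within I) V"
      and ev: "\<forall>\<^sub>F z in at y within (I - D). P' (h (V z) z)" and h: "continuous_on UNIV (\<lambda>(a, z). h a z)"
      and conc: "P' (h (V y) y) \<Longrightarrow> P y" for P P' y and h :: "real \<Rightarrow> real \<Rightarrow> real"
  proof -
    have "(V \<longlongrightarrow> V y) (at y within (I - D))"
      using Vy unfolding continuous_within by (rule tendsto_within_subset) auto
    moreover have "((\<lambda>z. z) \<longlongrightarrow> y) (at y within (I - D))" by (rule tendsto_ident_at)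
    ultimately have "((\<lambda>z. (V z, z)) \<longlongrightarrow> (V y, y)) (at y within (I - D))" by (rule tendsto_Pair)
    then have "((\<lambda>z. (\<lambda>(a, z). h a z) (V z, z)) \<longlongrightarrow> (\<lambda>(a, z). h a z) (V y, y)) (at y within (I - D))"
      using h by (intro isCont_tendsto_compose[of _ "\<lambda>(a, z). h a z"]) (auto simp: continuous_on_eq_continuous_at)
    then have "P' (h (V y) y)"
      using Lim_in_closed_set[OF P _ nt[OF yI], of "\<lambda>z. h (V z) z" "h (V y) y"] ev by simp
    then show ?thesis by (rule conc)
  qed
  have notF: "x \<notin> F" if x: "x \<in> I - D" for x
  proof -
    obtain d0 where d0: "0 < d0" "\<And>y. y \<in> F \<Longrightarrow> \<bar>y - x\<bar> < d0 \<Longrightarrow> y = x" using near by blast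
    have "continuous (at x within (I - D)) V" using Vd[OF x] by (rule DERIV_continuous)
    have "(V \<longlongrightarrow> V x) (at x within I)"
    proof (rule tendstoI)
      fix e :: real assume e: "0 < e"
      have "\<forall>\<^sub>F y in at x within (I - D). dist (V y) (V x) < e / 2"
        using \<open>continuous (at x within (I - D)) V\<close> e unfolding continuous_within
        by (intro tendstoD) auto
      then obtain d where d: "0 < d" "\<And>y. y \<in> I - D \<Longrightarrow> \<bar>y - x\<bar> < d \<Longrightarrow> \<bar>V y - V x\<bar> < e / 2"
        unfolding eventually_at using e by (metis abs_zero diff_self dist_real_def half_gt_zero)
      have "\<bar>V y - V x\<bar> < e" if y: "y \<in> I" "y \<noteq> x" "\<bar>y - x\<bar> < min d d0" for y
      proof (cases "y \<in> D")
        case False then show ?thesis using d(2)[of y] y e by auto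
      next
        case True
        have yF: "y \<notin> F" using d0(2)[of y] y by auto
        have "\<bar>V y - V x\<bar> \<le> e / 2"
        proof (rule pass[of "\<lambda>r. r \<le> e / 2" y "\<lambda>a z. \<bar>a - V x\<bar>"])
          have "\<forall>\<^sub>F z in at y within (I - D). \<bar>z - y\<bar> < d - \<bar>y - x\<bar>"
            unfolding eventually_at by (intro exI[of _ "d - \<bar>y - x\<bar>"]) (use y in \<open>auto simp: dist_real_def\<close>)
          moreover have "\<forall>\<^sub>F z in at y within (I - D). z \<in> I - D" by (simp add: eventually_at_filter)
          ultimately show "\<forall>\<^sub>F z in at y within (I - D). \<bar>V z - V x\<bar> \<le> e / 2"
            by eventually_elim (use d(2) in \<open>fastforce intro: less_imp_le\<close>)
        qed (use y yF in \<open>auto intro!: V_continuous closed_Collect_le continuous_intros simp: split_beta\<close>)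
        then show ?thesis using e by linarith
      qed
      then show "\<forall>\<^sub>F y in at x within I. dist (V y) (V x) < e"
        unfolding eventually_at by (intro exI[of _ "min d d0"]) (use d(1) d0(1) in \<open>auto simp: dist_real_def\<close>)
    qed
    then show ?thesis unfolding F_def discont_def by (simp add: continuous_within)
  qed
  have VdI: "(V has_real_derivative v x) (at x within I)" if x: "x \<in> I - D" for x
    unfolding has_field_derivative_def has_derivative_within_alt2
  proof (intro conjI allI impI)
    show "bounded_linear ((*) (v x))" by (rule bounded_linear_mult_right)
    fix e :: real assume e: "0 < e"
    obtain d0 where d0: "0 < d0" "\<And>y. y \<in> F \<Longrightarrow> \<bar>y - x\<bar> < d0 \<Longrightarrow> y = x" using near by blast
    have "\<forall>\<^sub>F y in at x within (I - D). norm (V y - V x - v x * (y - x)) \<le> e * norm (y - x)"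
      using Vd[OF x] e unfolding has_field_derivative_def has_derivative_within_alt2 by blast
    then obtain d where d: "0 < d" "\<And>y. y \<in> I - D \<Longrightarrow> y \<noteq> x \<Longrightarrow> \<bar>y - x\<bar> < d \<Longrightarrow> \<bar>V y - V x - v x * (y - x)\<bar> \<le> e * \<bar>y - x\<bar>"
      unfolding eventually_at by (auto simp: dist_real_def)
    have "\<bar>V y - V x - v x * (y - x)\<bar> \<le> e * \<bar>y - x\<bar>" if y: "y \<in> I" "y \<noteq> x" "\<bar>y - x\<bar> < min d d0" for y
    proof (cases "y \<in> D")
      case False then show ?thesis using d(2)[of y] y e by auto
    next
      case True
      have yF: "y \<notin> F" using d0(2)[of y] y by auto
      have "\<bar>V y - V x - v x * (y - x)\<bar> - e * \<bar>y - x\<bar> \<le> 0"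
      proof (rule pass[of "\<lambda>r. r \<le> 0" y "\<lambda>a z. \<bar>a - V x - v x * (z - x)\<bar> - e * \<bar>z - x\<bar>"])
        have "0 < min (d - \<bar>y - x\<bar>) \<bar>y - x\<bar>" using y by auto
        then have "\<forall>\<^sub>F z in at y within (I - D). \<bar>z - y\<bar> < min (d - \<bar>y - x\<bar>) \<bar>y - x\<bar>"
          unfolding eventually_at by (intro exI[of _ "min (d - \<bar>y - x\<bar>) \<bar>y - x\<bar>"]) (auto simp: dist_real_def)
        moreover have "\<forall>\<^sub>F z in at y within (I - D). z \<in> I - D" by (simp add: eventually_at_filter)
        ultimately show "\<forall>\<^sub>F z in at y within (I - D). \<bar>V z - V x - v x * (z - x)\<bar> - e * \<bar>z - x\<bar> \<le> 0"
        proof eventually_elim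
          case (elim z)
          then have "z \<noteq> x" "\<bar>z - x\<bar> < d" by auto
          then show ?case using d(2)[of z] elim by simp
        qed
      qed (use y yF in \<open>auto intro!: V_continuous closed_Collect_le continuous_intros simp: split_beta\<close>)
      then show ?thesis by simp
    qed
    then show "\<forall>\<^sub>F y in at x within I. norm (V y - V x - v x * (y - x)) \<le> e * norm (y - x)"
      unfolding eventually_at by (intro exI[of _ "min d d0"]) (use d(1) d0(1) in \<open>auto simp: dist_real_def\<close>)
  qed
  have v_eq: "deriv_on I V x = v x" if "x \<in> I - D" for x
    by (rule deriv_on_eqI[OF nontrivial VdI[OF that]]) (use that in simp)
  have lim: "(deriv_on I V \<longlongrightarrow> deriv_on I V x) (at x within {y \<in> I. V differentiable (at y within I)})"
    if x: "x \<in> I - D" for x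
  proof (rule tendstoI)
    fix e :: real assume e: "0 < e"
    have "\<exists>d>0. \<forall>y\<in>I - D. dist y x < d \<longrightarrow> dist (v y) (v x) < e / 2"
      using vc x e unfolding continuous_on_iff by (meson half_gt_zero)
    then obtain d where d: "0 < d" "\<And>y. y \<in> I - D \<Longrightarrow> \<bar>y - x\<bar> < d \<Longrightarrow> \<bar>v y - v x\<bar> < e / 2"
      by (auto simp: dist_real_def)
    have "\<bar>deriv_on I V y - v x\<bar> < e" if y: "y \<in> I" "V differentiable (at y within I)" "\<bar>y - x\<bar> < d" for y
    proof (cases "y \<in> D")
      case False then show ?thesis using d(2)[of y] y v_eq[of y] e by auto
    next
      case True
      \<comment> \<open>Within I the function V may happen to be differentiable at an exceptional
        point y, where v says nothing. As y is isolated in D, the mean value theorem writes the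
        difference quotients at y as values of v at nearby points outside D, so the derivative at y
        is close to v x as well.\<close>
      obtain r where r: "0 < r" "\<And>z. z \<in> D \<Longrightarrow> \<bar>z - y\<bar> < r \<Longrightarrow> z = y" using discrete_real_nbhd[OF D(2) True] by blast
      have der: "(V has_real_derivative deriv_on I V y) (at y within I)" by (rule deriv_on_works[OF y(2)])
      then have q: "((\<lambda>z. (V z - V y) / (z - y)) \<longlongrightarrow> deriv_on I V y) (at y within I)"
        by (simp add: has_field_derivative_iff)
      have "\<forall>\<^sub>F z in at y within I. \<bar>z - y\<bar> < min r (d - \<bar>y - x\<bar>)"
        unfolding eventually_at by (intro exI[of _ "min r (d - \<bar>y - x\<bar>)"]) (use y r in \<open>auto simp: dist_real_def\<close>)
      moreover have "\<forall>\<^sub>F z in at y within I. z \<in> I \<and> z \<noteq> y" by (simp add: eventually_at_filter)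
      ultimately have "\<forall>\<^sub>F z in at y within I. (V z - V y) / (z - y) \<in> {v x - e / 2..v x + e / 2}"
      proof eventually_elim
        case (elim z)
        define a b where "a = min y z" and "b = max y z"
        have ab: "a < b" unfolding a_def b_def using elim by auto
        have inI: "{a..b} \<subseteq> I" using elim y(1) unfolding a_def b_def I_def by auto
        have near_y: "\<bar>\<xi> - y\<bar> \<le> \<bar>z - y\<bar>" if "\<xi> \<in> {a..b}" for \<xi>
          using that unfolding a_def b_def by (auto simp: min_def max_def split: if_splits)
        have notD: "\<xi> \<in> I - D" if "\<xi> \<in> {a..b}" "\<xi> \<noteq> y" for \<xi>
          using r(2)[of \<xi>] near_y[OF that(1)] elim that inI by auto
        have "\<exists>\<xi>. a < \<xi> \<and> \<xi> < b \<and> V b - V a = (b - a) * v \<xi>"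
        proof (rule MVT2_open)
          show "a < b" by (rule ab)
          show "continuous_on {a..b} V" unfolding continuous_on_eq_continuous_within
          proof
            fix \<xi> assume \<xi>: "\<xi> \<in> {a..b}"
            have "continuous (at \<xi> within I) V"
              using DERIV_continuous[OF der] DERIV_continuous[OF VdI[OF notD[OF \<xi>]]] by (cases "\<xi> = y") auto
            then show "continuous (at \<xi> within {a..b}) V" using inI by (rule continuous_within_subset)
          qed
          fix \<xi> assume \<xi>: "a < \<xi>" "\<xi> < b"
          then have "\<xi> \<noteq> y" unfolding a_def b_def by auto
          moreover have "at \<xi> within I = at \<xi>" by (rule at_within_open_subset[of _ "{a<..<b}"]) (use \<xi> inI in auto)
          ultimately show "(V has_real_derivative v \<xi>) (at \<xi>)" using VdI[OF notD[of \<xi>]] \<xi> by simp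
        qed
        then obtain \<xi> where \<xi>: "a < \<xi>" "\<xi> < b" "V b - V a = (b - a) * v \<xi>" by blast
        have "(V z - V y) / (z - y) = v \<xi>"
          using \<xi>(3) elim unfolding a_def b_def by (cases "y \<le> z") (auto simp: min_def max_def field_simps)
        moreover have "\<xi> \<noteq> y" using \<xi> unfolding a_def b_def by auto
        then have "\<xi> \<in> I - D" using notD[of \<xi>] \<xi> by simp
        then have "\<bar>v \<xi> - v x\<bar> < e / 2" by (rule d(2)) (use near_y[of \<xi>] \<xi> elim in auto)
        then have "v x - e / 2 \<le> v \<xi>" "v \<xi> \<le> v x + e / 2" by linarith+
        ultimately show ?case by simp
      qed
      from Lim_in_closed_set[OF closed_real_atLeastAtMost this nontrivial[OF y(1)] q]
      show ?thesis using e by auto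
    qed
    then show "\<forall>\<^sub>F y in at x within {y \<in> I. V differentiable (at y within I)}. dist (deriv_on I V y) (deriv_on I V x) < e"
      unfolding eventually_at by (intro exI[of _ d]) (use d(1) v_eq[OF x] in \<open>auto simp: dist_real_def\<close>)
  qed
  show thesis
    by (rule that[OF cD]) (use notF VdI lim real_derivative_differentiable in blast)
qed

end

lemma finite_set_partition:
  fixes L :: real
  assumes L: "0 < L" and F: "finite F" "F \<subseteq> {0..L}"
  shows "\<exists>N node. 0 < N \<and> node 0 = 0 \<and> node N = L \<and> (\<forall>k<N. node k < node (Suc k)) \<and>
     (\<forall>k<N. \<forall>x. node k < x \<longrightarrow> x < node (Suc k) \<longrightarrow> x \<notin> F) \<and>
     (\<forall>k\<le>N. node k \<in> F \<union> {0, L})"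
proof -
  define xs where "xs = sorted_list_of_set (F \<union> {0, L})"
  have fin: "finite (F \<union> {0, L})" using F by simp
  have set: "set xs = F \<union> {0, L}" unfolding xs_def by (rule set_sorted_list_of_set[OF fin])
  have sw: "sorted_wrt (<) xs" unfolding xs_def by (rule strict_sorted_list_of_set)
  have lt: "i < j \<Longrightarrow> j < length xs \<Longrightarrow> xs ! i < xs ! j" for i j using sorted_wrt_nth_less[OF sw] by blast
  have rng: "i < length xs \<Longrightarrow> 0 \<le> xs ! i \<and> xs ! i \<le> L" for i using nth_mem[of i xs] set F L by auto
  obtain i where i: "i < length xs" "xs ! i = 0" using set by (metis Un_iff in_set_conv_nth insertI1)
  obtain j where j: "j < length xs" "xs ! j = L" using set by (metis Un_iff in_set_conv_nth insertCI)
  have i0: "i = 0"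
  proof (rule ccontr)
    assume "i \<noteq> 0"
    then have "xs ! 0 < xs ! i" "0 < length xs" using lt[of 0 i] i by auto
    then show False using i rng[of 0] by auto
  qed
  have jl: "j = length xs - 1"
  proof (rule ccontr)
    assume "j \<noteq> length xs - 1"
    then have "j < length xs - 1" "length xs - 1 < length xs" using j(1) by auto
    then show False using lt[of j "length xs - 1"] j(2) rng[of "length xs - 1"] by auto
  qed
  have ij: "i \<noteq> j" using i j L by auto
  show ?thesis
  proof (intro exI[of _ "length xs - 1"] exI[of _ "\<lambda>k. xs ! k"] conjI allI impI)
    show "0 < length xs - 1" using ij i0 jl by simp
    show "xs ! 0 = 0" "xs ! (length xs - 1) = L" using i i0 j jl by auto
    show "xs ! k < xs ! Suc k" if "k < length xs - 1" for k using lt[of k "Suc k"] that by simp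
    show "xs ! k \<in> F \<union> {0, L}" if "k \<le> length xs - 1" for k
    proof -
      have "k < length xs" using that ij i0 jl by simp
      then show ?thesis using nth_mem[of k xs] set by simp
    qed
    fix k x assume k: "k < length xs - 1" and x: "xs ! k < x" "x < xs ! Suc k"
    show "x \<notin> F"
    proof
      assume "x \<in> F"
      then obtain l where l: "l < length xs" "xs ! l = x" using set by (metis UnI1 in_set_conv_nth)
      have kl: "k < length xs" "Suc k < length xs" using k by auto
      have "\<not> l \<le> k" using lt[of l k] l x kl by (cases "l = k") auto
      moreover have "\<not> Suc k \<le> l" using lt[of "Suc k" l] l x kl by (cases "l = Suc k") auto
      ultimately show False by simp
    qed
  qed
qed

context coefficient
begin

definition "Dom = {y \<in> I. c differentiable (at y within I)}"

lemma G_props: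
  assumes x: "x \<in> G"
  shows "x \<in> I" "x \<notin> F" "(c has_real_derivative c' x) (at x within I)" "(c' \<longlongrightarrow> c' x) (at x within Dom)" "x \<in> Dom"
proof -
  show xI: "x \<in> I" using x unfolding G_def by simp
  have cc: "continuous (at x within I) c" using x unfolding G_def discont_def by blast
  have cd: "c differentiable (at x within I)" using x unfolding G_def discont_deriv_def by blast
  show "x \<in> Dom" using xI cd unfolding Dom_def by simp
  show "(c has_real_derivative c' x) (at x within I)" unfolding c'_def by (rule deriv_on_works[OF cd])
  show "(c' \<longlongrightarrow> c' x) (at x within Dom)"
    using x unfolding G_def discont_deriv_def c'_def Dom_def continuous_within by blast
  have "continuous (at x within I) (\<lambda>x. 1 / (c x)\<^sup>2)" using cc c_pos[OF xI] by (intro continuous_intros) auto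
  then have "continuous (at x within I) V"
    by (rule continuous_transform_within[OF _ zero_less_one xI]) (simp add: V_c)
  then show "x \<notin> F" unfolding F_def discont_def by simp
qed

lemma c'_formula: "y \<in> Dom \<Longrightarrow> c' y = - deriv_on I V y / (2 * V y * sqrt (V y))"
  unfolding c'_def Dom_def using deriv_on_eqI[OF nontrivial V_diff_iff(1)] V_diff_iff(2) by blast

lemma Dom_eq: "Dom = {y \<in> I. V differentiable (at y within I)}"
  unfolding Dom_def using V_diff_iff real_derivative_differentiable by blast

lemma countable_bad: "countable (I - G)"
proof -
  obtain D where D: "countable D" "\<And>x. x \<in> I - D \<Longrightarrow> x \<notin> F \<and> V differentiable (at x within I) \<and>
     (deriv_on I V \<longlongrightarrow> deriv_on I V x) (at x within {y \<in> I. V differentiable (at y within I)})"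
    using V_regular by blast
  have "I - D \<subseteq> G"
  proof
    fix x assume x: "x \<in> I - D"
    then have xI: "x \<in> I" by simp
    note Dx = D(2)[OF x]
    have xD: "x \<in> Dom" using Dx xI unfolding Dom_eq by simp
    have Vx: "(V \<longlongrightarrow> V x) (at x within Dom)"
      using V_continuous[OF xI] Dx unfolding continuous_within Dom_def by (auto elim: tendsto_within_subset)
    have "((\<lambda>y. - deriv_on I V y / (2 * V y * sqrt (V y))) \<longlongrightarrow> - deriv_on I V x / (2 * V x * sqrt (V x))) (at x within Dom)"
      using Dx V_pos[OF xI] unfolding Dom_eq[symmetric] by (intro tendsto_intros Vx) auto
    moreover have "\<forall>\<^sub>F y in at x within Dom. - deriv_on I V y / (2 * V y * sqrt (V y)) = c' y"
      using c'_formula by (auto simp: eventually_at_filter)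
    ultimately have "(c' \<longlongrightarrow> c' x) (at x within Dom)" unfolding c'_formula[OF xD] by (rule Lim_transform_eventually)
    then have "x \<notin> discont_deriv I c"
      using xD unfolding discont_deriv_def c'_def Dom_def continuous_within by simp
    moreover have "x \<notin> discont I c" using c_continuous[OF xI] Dx unfolding discont_def by simp
    ultimately show "x \<in> G" using xI unfolding G_def by simp
  qed
  then have "I - G \<subseteq> D" by blast
  then show ?thesis using D(1) countable_subset by blast
qed

text \<open>The essential bound holds at every point of continuity, and the finitely many jumps are
  bounded separately.\<close>

lemma V_upper: obtains M where "\<And>x. x \<in> I \<Longrightarrow> V x \<le> M"
proof -
  obtain M where M: "AE y in lebesgue_on {0..L}. \<bar>V y\<bar> \<le> M"
    using A1 unfolding A1_def Linf_on_def by blast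
  have 1: "\<bar>V x\<bar> \<le> M" if "x \<in> I" "x \<notin> F" for x
    by (rule AE_bound_at[OF L _ _ M, of x I]) (use V_continuous[OF that] that in \<open>auto simp: I_def continuous_within\<close>)
  have "bdd_above (V ` F)" using finite_F by (intro bdd_above_finite) simp
  then obtain M' where M': "\<And>x. x \<in> F \<Longrightarrow> V x \<le> M'" unfolding bdd_above_def by blast
  show thesis by (rule that[of "max M M'"]) (use 1 M' in fastforce)
qed

lemma c_bounds: obtains lo hi where "0 < lo" "\<And>x. x \<in> I \<Longrightarrow> lo \<le> c x" "\<And>x. x \<in> I \<Longrightarrow> c x \<le> hi"
proof -
  obtain \<mu> where \<mu>: "0 < \<mu>" "\<And>x. x \<in> I \<Longrightarrow> \<mu> \<le> V x" using V_lower by blast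
  obtain M where M: "\<And>x. x \<in> I \<Longrightarrow> V x \<le> M" using V_upper by blast
  have "0 \<in> I" unfolding I_def using L by simp
  then have Mp: "0 < M" using M V_pos by (meson less_le_trans)
  show thesis
  proof (rule that[of "1 / sqrt M" "1 / sqrt \<mu>"])
    show "0 < 1 / sqrt M" using Mp by simp
    show "1 / sqrt M \<le> c x" "c x \<le> 1 / sqrt \<mu>" if "x \<in> I" for x
      unfolding c_def speed_def using M[OF that] \<mu>(2)[OF that] \<mu>(1) V_pos[OF that] by (auto intro!: divide_left_mono)
  qed
qed

lemma c'_bounded: obtains M where "\<And>x. x \<in> G \<Longrightarrow> \<bar>c' x\<bar> \<le> M"
proof -
  obtain \<mu> where \<mu>: "0 < \<mu>" "\<And>x. x \<in> I \<Longrightarrow> \<mu> \<le> V x" using V_lower by blast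
  obtain M where M: "AE y in lebesgue_on {0..L}. \<bar>deriv_on {0..L} V y\<bar> \<le> M"
    using A1 unfolding A1_def Linf_on_def by blast
  define g where "g y = (if y \<in> Dom then c' y else 0)" for y
  have bd: "\<bar>g y\<bar> \<le> \<bar>M\<bar> / (2 * \<mu> * sqrt \<mu>)" if "\<bar>deriv_on {0..L} V y\<bar> \<le> M" for y
  proof (cases "y \<in> Dom")
    case True
    then have y: "y \<in> I" unfolding Dom_def by simp
    have "\<bar>c' y\<bar> = \<bar>deriv_on I V y\<bar> / (2 * V y * sqrt (V y))"
      unfolding c'_formula[OF True] using V_pos[OF y] by simp
    also have "\<dots> \<le> \<bar>M\<bar> / (2 * \<mu> * sqrt \<mu>)"
    proof (rule frac_le)
      show "\<bar>deriv_on I V y\<bar> \<le> \<bar>M\<bar>" using that unfolding I_def by simp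
      show "2 * \<mu> * sqrt \<mu> \<le> 2 * V y * sqrt (V y)" using \<mu>(1) \<mu>(2)[OF y] by (intro mult_mono) auto
    qed (use \<mu> in auto)
    finally show ?thesis using True by (simp add: g_def)
  qed (use \<mu> in \<open>simp add: g_def\<close>)
  have ae: "AE y in lebesgue_on {0..L}. \<bar>g y\<bar> \<le> \<bar>M\<bar> / (2 * \<mu> * sqrt \<mu>)" using M by eventually_elim (rule bd)
  show thesis
  proof (rule that)
    fix x assume x: "x \<in> G"
    have "\<bar>g x\<bar> \<le> \<bar>M\<bar> / (2 * \<mu> * sqrt \<mu>)"
    proof (rule AE_bound_at[OF L _ _ ae, of x Dom])
      show "x \<in> {0..L}" using G_props(1)[OF x] unfolding I_def .
      show "countable ({0..L} - Dom)"
        by (rule countable_subset[OF _ countable_bad]) (use G_props(5) in \<open>auto simp: I_def\<close>)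
      have "\<forall>\<^sub>F y in at x within Dom. c' y = g y" by (auto simp: eventually_at_filter g_def)
      then show "(g \<longlongrightarrow> g x) (at x within Dom)"
        using Lim_transform_eventually[OF G_props(4)[OF x]] G_props(5)[OF x] by (simp add: g_def)
    qed
    then show "\<bar>c' x\<bar> \<le> \<bar>M\<bar> / (2 * \<mu> * sqrt \<mu>)" using G_props(5)[OF x] by (simp add: g_def)
  qed
qed

text \<open>Between two jumps c is continuous with c' bounded off a countable set, hence Lipschitz,
  hence uniformly continuous. The extension to the closed layer supplies the one-sided limits of c
  at the jumps.\<close>

lemma c_extends:
  assumes ab: "a < b" and in_I: "{a..b} \<subseteq> I" and F: "{a<..<b} \<inter> F = {}"
  obtains g where "continuous_on {a..b} g" "\<And>x. x \<in> {a<..<b} \<Longrightarrow> g x = c x"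
proof -
  obtain M where M: "\<And>x. x \<in> G \<Longrightarrow> \<bar>c' x\<bar> \<le> M" using c'_bounded by blast
  have M0: "\<bar>c x - c y\<bar> \<le> \<bar>M\<bar> * \<bar>x - y\<bar>" if xy: "x \<in> {a<..<b}" "y \<in> {a<..<b}" "x \<le> y" for x y
  proof -
    have "\<bar>c y - c x\<bar> \<le> \<bar>M\<bar> * (y - x)"
    proof (rule lipschitz_off_countable[OF xy(3) countable_bad])
      have "\<forall>w\<in>{x..y}. continuous (at w within {x..y}) c"
      proof
        fix w assume w: "w \<in> {x..y}"
        then have "w \<in> {a<..<b}" using xy by auto
        then have "w \<in> I" "w \<notin> F" using in_I F by auto
        then show "continuous (at w within {x..y}) c"
          by (rule continuous_within_subset[OF c_continuous]) (use in_I xy in auto)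
      qed
      then show "continuous_on {x..y} c" unfolding continuous_on_eq_continuous_within .
      fix w assume w: "w \<in> {x<..<y} - (I - G)"
      have "w \<in> {a..b}" using w xy by auto
      then have wG: "w \<in> G" using w in_I by blast
      have "at w within I = at w" by (rule at_within_open_subset[of _ "{a<..<b}"]) (use w xy in_I in auto)
      then show "(c has_real_derivative c' w) (at w) \<and> \<bar>c' w\<bar> \<le> \<bar>M\<bar>"
        using G_props(3)[OF wG] M[OF wG] by auto
    qed
    then show ?thesis using xy(3) by (simp add: abs_minus_commute)
  qed
  have "\<bar>M\<bar>-lipschitz_on {a<..<b} c"
  proof (rule lipschitz_onI)
    fix x y assume "x \<in> {a<..<b}" "y \<in> {a<..<b}"
    then show "dist (c x) (c y) \<le> \<bar>M\<bar> * dist x y"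
      using M0[of x y] M0[of y x] by (cases "x \<le> y") (auto simp: dist_real_def abs_minus_commute)
  qed simp
  then have "uniformly_continuous_on {a<..<b} c" by (rule lipschitz_on_uniformly_continuous)
  from uniformly_continuous_on_extension_on_closure[OF this]
  obtain g where "uniformly_continuous_on (closure {a<..<b}) g" "\<And>x. x \<in> {a<..<b} \<Longrightarrow> c x = g x" by metis
  then show thesis using that[of g] uniformly_continuous_imp_continuous closure_greaterThanLessThan[OF ab] by metis
qed

section \<open>Travel time and its inverse\<close>

definition "\<tau> x = integral {0..x} (\<lambda>y. 1 / c y)"

lemma inverse_c_integrable: "(\<lambda>y. 1 / c y) integrable_on {0..L}"
proof -
  obtain lo hi where lo: "0 < lo" "\<And>x. x \<in> I \<Longrightarrow> lo \<le> c x" using c_bounds by metis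
  show ?thesis
  proof (rule measurable_bounded_by_integrable_imp_integrable_real)
    have "V \<in> borel_measurable (lebesgue_on {0..L})" using A1 unfolding A1_def Linf_on_def by blast
    then show "(\<lambda>y. 1 / c y) \<in> borel_measurable (lebesgue_on {0..L})" unfolding c_def speed_def by measurable
    show "(\<lambda>_. 1 / lo) integrable_on {0..L}" by (rule integrable_const_ivl)
    show "\<bar>1 / c y\<bar> \<le> 1 / lo" if "y \<in> {0..L}" for y
      using lo(1) lo(2)[of y] that unfolding I_def by (auto simp: frac_le)
  qed simp
qed

lemma \<tau>_cont: "continuous_on I \<tau>"
  unfolding \<tau>_def I_def by (rule indefinite_integral_continuous_1[OF inverse_c_integrable])

lemma \<tau>_0: "\<tau> 0 = 0" unfolding \<tau>_def by simp

lemma \<tau>_less: assumes "x \<in> I" "y \<in> I" "x < y" shows "\<tau> x < \<tau> y"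
proof -
  obtain lo hi where hi: "0 < lo" "\<And>x. x \<in> I \<Longrightarrow> lo \<le> c x" "\<And>x. x \<in> I \<Longrightarrow> c x \<le> hi" using c_bounds by metis
  have hp: "0 < hi" using hi(1) hi(2)[OF assms(1)] hi(3)[OF assms(1)] by linarith
  have i: "(\<lambda>y. 1 / c y) integrable_on {0..y}" "(\<lambda>y. 1 / c y) integrable_on {x..y}"
    by (rule integrable_on_subinterval[OF inverse_c_integrable], use assms in \<open>auto simp: I_def\<close>)+
  have "\<tau> y - \<tau> x = integral {x..y} (\<lambda>y. 1 / c y)"
    using Henstock_Kurzweil_Integration.integral_combine[OF _ _ i(1), of x] assms unfolding \<tau>_def I_def by simp
  moreover have "integral {x..y} (\<lambda>_. 1 / hi) \<le> integral {x..y} (\<lambda>y. 1 / c y)"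
  proof (rule integral_le)
    show "1 / hi \<le> 1 / c w" if "w \<in> {x..y}" for w
      using hi(3)[of w] c_pos[of w] that assms unfolding I_def by (intro divide_left_mono) auto
  qed (use i in auto)
  moreover have "0 < integral {x..y} (\<lambda>_. 1 / hi)" using assms hp by simp
  ultimately show ?thesis by linarith
qed

lemma \<tau>_deriv: assumes "x \<in> I" "x \<notin> F" shows "(\<tau> has_real_derivative 1 / c x) (at x within I)"
proof -
  have "continuous (at x within I) (\<lambda>y. 1 / c y)"
    using c_continuous[OF assms] c_pos[OF assms(1)] by (intro continuous_intros) auto
  from integral_has_vector_derivative_continuous_at[OF inverse_c_integrable _ finite.emptyI, of x] this assms
  show ?thesis unfolding \<tau>_def has_real_derivative_iff_has_vector_derivative I_def by simp
qed

definition "\<xi> = the_inv_into I \<tau>"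

lemma \<tau>_inj: "inj_on \<tau> I" by (rule inj_onI) (metis \<tau>_less less_irrefl linorder_neqE)

lemma \<xi>_\<tau>: "x \<in> I \<Longrightarrow> \<xi> (\<tau> x) = x" unfolding \<xi>_def by (rule the_inv_into_f_f[OF \<tau>_inj])

lemma \<tau>_image: "\<tau> ` I = {0..\<tau> L}"
proof
  have "\<tau> x \<le> \<tau> y" if "x \<in> I" "y \<in> I" "x \<le> y" for x y using \<tau>_less[OF that(1,2)] that(3) by (cases "x = y") auto
  then show "\<tau> ` I \<subseteq> {0..\<tau> L}" using \<tau>_0 L unfolding I_def by (auto, metis atLeastAtMost_iff less_imp_le order_refl)
  show "{0..\<tau> L} \<subseteq> \<tau> ` I"
  proof
    fix z assume "z \<in> {0..\<tau> L}"
    then have "\<exists>x\<ge>0. x \<le> L \<and> \<tau> x = z" using \<tau>_cont \<tau>_0 L unfolding I_def by (intro IVT') auto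
    then show "z \<in> \<tau> ` I" unfolding I_def by auto
  qed
qed

lemma \<xi>_in: "z \<in> {0..\<tau> L} \<Longrightarrow> \<xi> z \<in> I" unfolding \<tau>_image[symmetric] by (auto simp: \<xi>_\<tau>)
lemma \<tau>_\<xi>: "z \<in> {0..\<tau> L} \<Longrightarrow> \<tau> (\<xi> z) = z" unfolding \<tau>_image[symmetric] by (auto simp: \<xi>_\<tau>)
lemma \<tau>_in: "x \<in> I \<Longrightarrow> \<tau> x \<in> {0..\<tau> L}" unfolding \<tau>_image[symmetric] by simp

lemma \<xi>_cont: "continuous_on {0..\<tau> L} \<xi>"
  unfolding \<tau>_image[symmetric] \<xi>_def by (rule continuous_on_inv_into[OF \<tau>_cont _ \<tau>_inj]) (simp add: I_def)

lemma \<xi>_less: "z \<in> {0..\<tau> L} \<Longrightarrow> z' \<in> {0..\<tau> L} \<Longrightarrow> z < z' \<Longrightarrow> \<xi> z < \<xi> z'"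
  by (metis \<tau>_\<xi> \<tau>_less \<xi>_in less_asym less_irrefl linorder_neqE)

lemma \<xi>_ends: "\<xi> 0 = 0" "\<xi> (\<tau> L) = L"
  using \<xi>_\<tau>[of 0] \<xi>_\<tau>[of L] \<tau>_0 L unfolding I_def by auto

lemma \<xi>_interior: "z \<in> {0<..<\<tau> L} \<Longrightarrow> \<xi> z \<in> {0<..<L}"
  using \<xi>_less[of 0 z] \<xi>_less[of z "\<tau> L"] \<xi>_ends by auto

lemma \<xi>_deriv:
  assumes z: "z \<in> {0<..<\<tau> L}" "\<xi> z \<notin> F"
  shows "(\<xi> has_real_derivative c (\<xi> z)) (at z)"
proof -
  have x: "\<xi> z \<in> I" using \<xi>_in[of z] z by auto
  have at: "at (\<xi> z) within I = at (\<xi> z)"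
    by (rule at_within_open_subset[of _ "{0<..<L}"]) (use \<xi>_interior[OF z(1)] in \<open>auto simp: I_def\<close>)
  have "(\<xi> has_real_derivative inverse (1 / c (\<xi> z))) (at z)"
  proof (rule DERIV_inverse_function[where f = \<tau> and a = 0 and b = "\<tau> L"])
    show "(\<tau> has_real_derivative 1 / c (\<xi> z)) (at (\<xi> z))" using \<tau>_deriv[OF x z(2)] at by simp
    show "isCont \<xi> z" using continuous_on_interior[OF \<xi>_cont, of z] z by simp
  qed (use z c_pos[OF x] \<tau>_\<xi> in auto)
  then show ?thesis by simp
qed

end

text \<open>In the travel time coordinate \<open>z = \<tau> x\<close> all characteristics have slope one.\<close>

locale medium = coefficient +
  fixes N :: nat and node :: "nat \<Rightarrow> real" and g :: "nat \<Rightarrow> real \<Rightarrow> real"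
  assumes N_pos: "0 < N" and node0: "node 0 = 0" and nodeN: "node N = L"
    and node_less: "\<And>k. k < N \<Longrightarrow> node k < node (Suc k)"
    and node_F: "\<And>k. k < N \<Longrightarrow> {node k<..<node (Suc k)} \<inter> F = {}"
    and node_sub: "\<And>k. k \<le> N \<Longrightarrow> node k \<in> F \<union> {0, L}"
    and g_cont: "\<And>k. k < N \<Longrightarrow> continuous_on {node k..node (Suc k)} (g k)"
    and g_c: "\<And>k x. k < N \<Longrightarrow> x \<in> {node k<..<node (Suc k)} \<Longrightarrow> g k x = c x"

lemma (in coefficient) medium_exists: "\<exists>N node g. medium L V N node g"
proof -
  have "F \<subseteq> {0..L}" unfolding F_def discont_def I_def by auto
  from finite_set_partition[OF L finite_F this]
  obtain N node where N: "0 < N" "node 0 = 0" "node N = L" "\<And>k. k < N \<Longrightarrow> node k < node (Suc k)"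
    "\<And>k x. k < N \<Longrightarrow> node k < x \<Longrightarrow> x < node (Suc k) \<Longrightarrow> x \<notin> F"
    "\<And>k. k \<le> N \<Longrightarrow> node k \<in> F \<union> {0, L}" by metis
  have mono: "i \<le> j \<Longrightarrow> j \<le> N \<Longrightarrow> node i \<le> node j" for i j
  proof (induction j)
    case (Suc j)
    then show ?case using N(4)[of j] by (cases "i = Suc j") force+
  qed simp
  have "\<exists>gk. continuous_on {node k..node (Suc k)} gk \<and> (\<forall>x\<in>{node k<..<node (Suc k)}. gk x = c x)" if k: "k < N" for k
  proof (rule c_extends[OF N(4)[OF k]])
    show "{node k..node (Suc k)} \<subseteq> I" using mono[of 0 k] mono[of "Suc k" N] k N(2,3) unfolding I_def by auto
    show "{node k<..<node (Suc k)} \<inter> F = {}" using N(5)[OF k] by auto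
  qed auto
  then obtain g where "\<And>k. k < N \<Longrightarrow> continuous_on {node k..node (Suc k)} (g k) \<and> (\<forall>x\<in>{node k<..<node (Suc k)}. g k x = c x)"
    by metis
  then have "medium L V N node g"
    by unfold_locales (use N in \<open>auto\<close>)
  then show ?thesis by blast
qed

section \<open>The layered system in the travel time coordinate\<close>

context medium
begin

definition "\<zeta> k = \<tau> (node k)"
definition "\<gamma> k z = g k (\<xi> z)"
definition "E = {z \<in> {0..\<tau> L}. \<xi> z \<notin> G}"
text \<open>Since \<xi>' = c, the derivative of c (\<xi> z) in z is c c'. The value 0 elsewhere
  makes b a bounded Borel function on the whole line.\<close>

definition "b z = (if z \<in> {0..\<tau> L} - E then c (\<xi> z) * c' (\<xi> z) else 0)"

lemma node_mono: "i \<le> j \<Longrightarrow> j \<le> N \<Longrightarrow> node i \<le> node j"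
proof (induction j)
  case (Suc j)
  then show ?case using node_less[of j] by (cases "i = Suc j") force+
qed simp

lemma node_I: "k \<le> N \<Longrightarrow> node k \<in> I"
  using node_mono[of 0 k] node_mono[of k N] node0 nodeN unfolding I_def by auto

lemma \<zeta>_N: "\<zeta> N = \<tau> L" unfolding \<zeta>_def nodeN ..

lemma \<zeta>_lt: "k < N \<Longrightarrow> \<zeta> k < \<zeta> (Suc k)" unfolding \<zeta>_def by (rule \<tau>_less) (use node_I node_less in auto)

lemma \<zeta>_in: "k \<le> N \<Longrightarrow> \<zeta> k \<in> {0..\<tau> L}" unfolding \<zeta>_def by (rule \<tau>_in[OF node_I])

lemma \<xi>_\<zeta>: "k \<le> N \<Longrightarrow> \<xi> (\<zeta> k) = node k" unfolding \<zeta>_def by (rule \<xi>_\<tau>[OF node_I])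

lemma \<xi>_piece: "k < N \<Longrightarrow> z \<in> {\<zeta> k..\<zeta> (Suc k)} \<Longrightarrow> \<xi> z \<in> {node k..node (Suc k)}"
  using \<xi>_less[of "\<zeta> k" z] \<xi>_less[of z "\<zeta> (Suc k)"] \<zeta>_in[of k] \<zeta>_in[of "Suc k"] \<xi>_\<zeta>[of k] \<xi>_\<zeta>[of "Suc k"]
  by (cases "z = \<zeta> k"; cases "z = \<zeta> (Suc k)") auto

lemma \<xi>_open_piece: "k < N \<Longrightarrow> z \<in> {\<zeta> k<..<\<zeta> (Suc k)} \<Longrightarrow> \<xi> z \<in> {node k<..<node (Suc k)}"
  using \<xi>_less[of "\<zeta> k" z] \<xi>_less[of z "\<zeta> (Suc k)"] \<zeta>_in[of k] \<zeta>_in[of "Suc k"] \<xi>_\<zeta>[of k] \<xi>_\<zeta>[of "Suc k"]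
  by auto

lemma open_piece_in: "k < N \<Longrightarrow> z \<in> {\<zeta> k<..<\<zeta> (Suc k)} \<Longrightarrow> z \<in> {0<..<\<tau> L}"
  using \<zeta>_in[of k] \<zeta>_in[of "Suc k"] by auto

lemma \<gamma>_c: "k < N \<Longrightarrow> z \<in> {\<zeta> k<..<\<zeta> (Suc k)} \<Longrightarrow> \<gamma> k z = c (\<xi> z)"
  unfolding \<gamma>_def by (rule g_c[OF _ \<xi>_open_piece])

lemma notE: "z \<in> {0..\<tau> L} - E \<Longrightarrow> \<xi> z \<in> G" unfolding E_def by auto

lemma b_continuous: "continuous_on ({0..\<tau> L} - E) b"
proof -
  have "continuous_on ({0..\<tau> L} - E) (\<lambda>z. c (\<xi> z) * c' (\<xi> z))"
  proof (rule continuous_on_mult)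
    have \<xi>c: "continuous_on ({0..\<tau> L} - E) \<xi>" by (rule continuous_on_subset[OF \<xi>_cont]) auto
    have "continuous_on G c"
      unfolding continuous_on_eq_continuous_within
      using c_continuous G_props(1,2) by (meson continuous_within_subset subsetI)
    then show "continuous_on ({0..\<tau> L} - E) (\<lambda>z. c (\<xi> z))"
      by (rule continuous_on_compose2[OF _ \<xi>c]) (use notE in auto)
    have "continuous_on G c'"
      unfolding continuous_on_def using G_props(4,5) by (meson subsetI tendsto_within_subset)
    then show "continuous_on ({0..\<tau> L} - E) (\<lambda>z. c' (\<xi> z))"
      by (rule continuous_on_compose2[OF _ \<xi>c]) (use notE in auto)
  qed
  then show ?thesis by (rule continuous_on_cong[THEN iffD1, rotated -1]) (auto simp: b_def)
qed

lemma countable_E: "countable E"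
proof (rule countable_image_inj_on)
  show "countable (\<xi> ` E)" by (rule countable_subset[OF _ countable_bad]) (auto simp: E_def \<xi>_in)
  show "inj_on \<xi> E" by (rule inj_on_inverseI[of _ \<tau>]) (auto simp: E_def \<tau>_\<xi>)
qed

lemma layered_exists: "\<exists>m \<beta>. layered N \<zeta> \<gamma> b E m \<beta>"
proof -
  obtain lo hi where lo: "0 < lo" "\<And>x. x \<in> I \<Longrightarrow> lo \<le> c x" "\<And>x. x \<in> I \<Longrightarrow> c x \<le> hi" using c_bounds by metis
  obtain M where M: "\<And>x. x \<in> G \<Longrightarrow> \<bar>c' x\<bar> \<le> M" using c'_bounded by blast
  have gm: "lo \<le> g k x" if k: "k < N" and x: "x \<in> {node k..node (Suc k)}" for k x
  proof -
    have "continuous_on (closure {node k<..<node (Suc k)}) (g k)"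
      using g_cont[OF k] closure_greaterThanLessThan[OF node_less[OF k]] by simp
    then show ?thesis
    proof (rule continuous_ge_on_closure)
      show "x \<in> closure {node k<..<node (Suc k)}" using x closure_greaterThanLessThan[OF node_less[OF k]] by simp
      fix y assume y: "y \<in> {node k<..<node (Suc k)}"
      then have "y \<in> I" using node_I[of k] node_I[of "Suc k"] k unfolding I_def by auto
      then show "lo \<le> g k y" using g_c[OF k y] lo(2) by simp
    qed
  qed
  have "layered N \<zeta> \<gamma> b E lo (hi * \<bar>M\<bar>)"
  proof
    show "0 < N" by (rule N_pos)
    show "\<zeta> 0 = 0" unfolding \<zeta>_def node0 by (rule \<tau>_0)
    show "\<zeta> k < \<zeta> (Suc k)" if "k < N" for k by (rule \<zeta>_lt[OF that])
    show "continuous_on {\<zeta> k..\<zeta> (Suc k)} (\<gamma> k)" if k: "k < N" for k unfolding \<gamma>_def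
    proof (rule continuous_on_compose2[OF g_cont[OF k]])
      show "continuous_on {\<zeta> k..\<zeta> (Suc k)} \<xi>"
        by (rule continuous_on_subset[OF \<xi>_cont]) (use \<zeta>_in[of k] \<zeta>_in[of "Suc k"] k in auto)
    qed (use \<xi>_piece[OF k] in auto)
    show "0 < lo" by (rule lo(1))
    show "lo \<le> \<gamma> k z" if "k < N" "z \<in> {\<zeta> k..\<zeta> (Suc k)}" for k z
      unfolding \<gamma>_def by (rule gm[OF that(1) \<xi>_piece[OF that]])
    have "{0..\<tau> L} - E \<in> sets borel" using countable_E by (intro sets.Diff) (auto intro: sets.countable)
    from borel_measurable_continuous_on_indicator[OF this b_continuous]
    show "b \<in> borel_measurable borel"
      by (rule measurable_cong[THEN iffD1, rotated]) (auto simp: b_def indicator_def)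
    show "\<bar>b z\<bar> \<le> hi * \<bar>M\<bar>" for z
    proof (cases "z \<in> {0..\<tau> L} - E")
      case True
      have x: "\<xi> z \<in> G" "\<xi> z \<in> I" using notE[OF True] G_props(1) by auto
      have "\<bar>c (\<xi> z)\<bar> * \<bar>c' (\<xi> z)\<bar> \<le> hi * \<bar>M\<bar>"
        using lo(3)[OF x(2)] M[OF x(1)] c_pos[OF x(2)] by (intro mult_mono) auto
      then show ?thesis using True by (simp add: b_def abs_mult)
    next
      case False
      have "0 \<in> I" unfolding I_def using L by simp
      then have "0 \<le> hi" using lo(1) lo(2)[of 0] lo(3)[of 0] by linarith
      then show ?thesis using False by (auto simp: b_def)
    qed
    show "countable E" by (rule countable_E)
    show "(\<gamma> k has_real_derivative b z) (at z)" if k: "k < N" and z: "z \<in> {\<zeta> k<..<\<zeta> (Suc k)} - E" for k z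
    proof -
      have zZ: "z \<in> {0<..<\<tau> L}" using open_piece_in[OF k] z by auto
      then have zG: "\<xi> z \<in> G" using notE[of z] z by auto
      have at: "at (\<xi> z) within I = at (\<xi> z)"
        by (rule at_within_open_subset[of _ "{0<..<L}"]) (use \<xi>_interior[OF zZ] in \<open>auto simp: I_def\<close>)
      have "(c has_real_derivative c' (\<xi> z)) (at (\<xi> z))" using G_props(3)[OF zG] at by simp
      from DERIV_chain2[OF this \<xi>_deriv[OF zZ G_props(2)[OF zG]]]
      have "((\<lambda>z. c (\<xi> z)) has_real_derivative b z) (at z)" using zZ z by (simp add: b_def mult.commute)
      then show ?thesis
        by (rule has_field_derivative_transform_within_open[of _ _ _ "{\<zeta> k<..<\<zeta> (Suc k)}"]) (use z \<gamma>_c[OF k] in auto)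
    qed
    show "(b \<longlongrightarrow> b z) (at z within {0..\<zeta> N} - E)" if "z \<in> {0..\<zeta> N} - E" for z
      using b_continuous that unfolding \<zeta>_N continuous_on_def by blast
  qed
  then show ?thesis by blast
qed

end

context medium
begin

text \<open>The bounds for \<gamma> and b are only known to exist. Choosing them as constants lets
  \<open>layered\<close> become a sublocale without adding parameters.\<close>

definition "m = (SOME m. \<exists>\<beta>. layered N \<zeta> \<gamma> b E m \<beta>)"
definition "\<beta> = (SOME \<beta>. layered N \<zeta> \<gamma> b E m \<beta>)"

end

sublocale medium \<subseteq> layered N \<zeta> \<gamma> b E m \<beta>
proof -
  have "\<exists>\<beta>. layered N \<zeta> \<gamma> b E m \<beta>" unfolding m_def using layered_exists by (rule someI_ex)
  then show "layered N \<zeta> \<gamma> b E m \<beta>" unfolding \<beta>_def by (rule someI_ex)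
qed

context medium
begin

lemma in_pieces: "x \<in> I \<Longrightarrow> \<exists>k<N. x \<in> {node k..node (Suc k)} \<and> \<tau> x \<in> {\<zeta> k..\<zeta> (Suc k)}"
proof -
  assume x: "x \<in> I"
  then have "\<tau> x \<in> {0..\<zeta> N}" using \<tau>_in \<zeta>_N by simp
  then obtain k where k: "k < N" "\<tau> x \<in> {\<zeta> k..\<zeta> (Suc k)}" using piece_ex by blast
  then show ?thesis using \<xi>_piece[OF k] \<xi>_\<tau>[OF x] by auto
qed

lemma at_I: "x \<in> {0<..<L} \<Longrightarrow> at x within I = at x"
  by (rule at_within_open_subset[of _ "{0<..<L}"]) (auto simp: I_def)

text \<open>The end points 0 and L need not be jumps. At an end of a layer where V is continuous,
  the limit of c from inside the layer is the value of c.\<close>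

lemma g_eq_c:
  assumes k: "k < N" and x: "x \<in> {node k..node (Suc k)}" "x \<notin> F"
  shows "g k x = c x"
proof (cases "x \<in> {node k<..<node (Suc k)}")
  case True then show ?thesis by (rule g_c[OF k])
next
  case False
  have sub: "{node k..node (Suc k)} \<subseteq> I" using node_I[of k] node_I[of "Suc k"] k unfolding I_def by auto
  let ?P = "{node k<..<node (Suc k)}"
  have "x \<in> closure ?P" using x closure_greaterThanLessThan[OF node_less[OF k]] by simp
  then have nt: "at x within ?P \<noteq> bot" using False by (simp add: at_within_eq_bot_iff)
  have xI: "x \<in> I" using sub x by blast
  have 1: "(g k \<longlongrightarrow> g k x) (at x within ?P)"
  proof (rule tendsto_within_subset)
    show "(g k \<longlongrightarrow> g k x) (at x within {node k..node (Suc k)})"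
      using g_cont[OF k] x unfolding continuous_on_def by blast
  qed auto
  have "(c \<longlongrightarrow> c x) (at x within ?P)"
  proof (rule tendsto_within_subset)
    show "(c \<longlongrightarrow> c x) (at x within I)" using c_continuous[OF xI x(2)] unfolding continuous_within .
  qed (use sub in auto)
  moreover have "\<forall>\<^sub>F y in at x within ?P. c y = g k y" using g_c[OF k] by (auto simp: eventually_at_filter)
  ultimately have 2: "(g k \<longlongrightarrow> c x) (at x within ?P)" by (rule Lim_transform_eventually)
  show ?thesis by (rule tendsto_unique[OF nt 1 2])
qed

text \<open>Nothing is assumed about V outside I; cut off there, it becomes a bounded Borel weight
  on the whole line.\<close>

definition "W y = (if y \<in> I then V y else 0)"

lemma W_bounded: obtains M where "\<And>y. \<bar>W y\<bar> \<le> M"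
proof -
  obtain M where M: "\<And>x. x \<in> I \<Longrightarrow> V x \<le> M" using V_upper by blast
  show thesis by (rule that[of "\<bar>M\<bar>"]) (use M V_pos in \<open>force simp: W_def\<close>)
qed

lemma W_measurable: "W \<in> borel_measurable borel"
proof -
  have FI: "F \<subseteq> I" unfolding F_def discont_def by auto
  have s: "I - F \<in> sets borel" using borel_closed[OF finite_imp_closed[OF finite_F]] unfolding I_def by (intro sets.Diff) auto
  have "continuous_on (I - F) V" unfolding continuous_on_eq_continuous_within
    using V_continuous by (meson DiffE Diff_subset continuous_within_subset)
  from borel_measurable_continuous_on_indicator[OF s this]
  have "(\<lambda>y. indicator (I - F) y *\<^sub>R V y + (\<Sum>a\<in>F. V a * indicator {a} y)) \<in> borel_measurable borel"
    by (intro borel_measurable_add borel_measurable_sum) auto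
  moreover have "indicator (I - F) y *\<^sub>R V y + (\<Sum>a\<in>F. V a * indicator {a} y) = W y" for y
  proof -
    have "(\<Sum>a\<in>F. V a * indicator {a} y) = (\<Sum>a\<in>F. if a = y then V a else 0)"
      by (rule sum.cong) (auto simp: indicator_def)
    also have "\<dots> = (if y \<in> F then V y else 0)" using finite_F by simp
    finally show ?thesis using FI by (auto simp: W_def indicator_def)
  qed
  ultimately show ?thesis by simp
qed

section \<open>Integrated balance laws in the original coordinate\<close>

lemma V_mult_integrable:
  assumes f: "continuous_on {a..d} f" and "{a..d} \<subseteq> I"
  shows "(\<lambda>y. V y * f y) integrable_on {a..d}"
proof -
  obtain M where M: "\<And>y. \<bar>W y\<bar> \<le> M" using W_bounded by blast
  have "(\<lambda>y. W y * f y) integrable_on {a..d}" by (rule integrable_mult_bounded_borel[OF W_measurable M f])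
  then show ?thesis by (rule integrable_eq) (use assms(2) in \<open>auto simp: W_def\<close>)
qed

lemma x_ftc:
  assumes H: "continuous_on I H" and x: "x1 \<in> I" "x2 \<in> I" "x1 \<le> x2"
    and d: "\<And>x. x \<in> {0<..<L} \<Longrightarrow> x \<in> G \<Longrightarrow> (H has_real_derivative r x) (at x)"
    and r: "\<And>x. x \<in> G \<Longrightarrow> (r \<longlongrightarrow> r x) (at x within I)" and i: "r integrable_on {x1..x2}"
  shows "(r has_integral H x2 - H x1) {x1..x2}"
proof (rule ftc_off_countable[OF x(3) countable_bad _ _ _ i])
  have sub: "{x1..x2} \<subseteq> I" using x unfolding I_def by auto
  show "continuous_on {x1..x2} H" by (rule continuous_on_subset[OF H sub])
  fix y assume y: "y \<in> {x1<..<x2} - (I - G)"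
  have "y \<in> {x1..x2}" using y by auto
  then have yG: "y \<in> G" "y \<in> {0<..<L}" using y sub x unfolding I_def by auto
  show "(H has_real_derivative r y) (at y)" by (rule d[OF yG(2,1)])
  show "(r \<longlongrightarrow> r y) (at y within {x1..x2} - (I - G))"
    by (rule tendsto_within_subset[OF r[OF yG(1)]]) (use sub in auto)
qed

lemma V_tendsto: "x \<in> G \<Longrightarrow> (V \<longlongrightarrow> V x) (at x within I)"
  using V_continuous[OF G_props(1,2)] unfolding continuous_within by blast

text \<open>Inner nodes are jumps of V, hence never good points, so a good point inside (0, L) lies
  in an open layer.\<close>

lemma open_piece_ex:
  assumes "x \<in> {0<..<L}" "x \<in> G"
  shows "\<exists>k<N. x \<in> {node k<..<node (Suc k)} \<and> \<tau> x \<in> {\<zeta> k<..<\<zeta> (Suc k)}"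
proof -
  obtain k where k: "k < N" "x \<in> {node k..node (Suc k)}" "\<tau> x \<in> {\<zeta> k..\<zeta> (Suc k)}"
    using in_pieces[OF G_props(1)[OF assms(2)]] by blast
  have "x \<noteq> node k" "x \<noteq> node (Suc k)"
    using node_sub[of k] node_sub[of "Suc k"] k(1) assms G_props(2)[OF assms(2)] by auto
  then have x: "x \<in> {node k<..<node (Suc k)}" using k by auto
  have "\<tau> x \<in> {\<zeta> k<..<\<zeta> (Suc k)}" unfolding \<zeta>_def
    using \<tau>_less[of "node k" x] \<tau>_less[of x "node (Suc k)"] x node_I[of k] node_I[of "Suc k"] k(1) G_props(1)[OF assms(2)] by auto
  then show ?thesis using k(1) x by blast
qed

lemma \<tau>_deriv_at: "x \<in> {0<..<L} \<Longrightarrow> x \<in> G \<Longrightarrow> (\<tau> has_real_derivative 1 / c x) (at x)"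
  using \<tau>_deriv[OF G_props(1,2)] at_I by metis

lemma \<tau>_notE: "x \<in> G \<Longrightarrow> \<tau> x \<notin> E"
  unfolding E_def using \<xi>_\<tau> G_props(1) by simp

lemma \<tau>_rect_cont:
  assumes "continuous_on ({0..\<zeta> N} \<times> S) (\<lambda>(z, t). P z t)"
  shows "continuous_on (I \<times> S) (\<lambda>(x, t). P (\<tau> x) t)"
proof -
  have t: "continuous_on (I \<times> S) (\<lambda>x. \<tau> (fst x))"
    by (rule continuous_on_compose2[OF \<tau>_cont]) (auto intro!: continuous_intros)
  show ?thesis unfolding split_beta
    by (rule continuous_on_compose2[OF assms, of _ "\<lambda>x. (\<tau> (fst x), snd x)", simplified])
       (use \<tau>_in \<zeta>_N in \<open>auto intro!: continuous_intros t\<close>)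
qed

lemma \<xi>_rect_cont:
  assumes "continuous_on (I \<times> S) (\<lambda>(x, t). p x t)"
  shows "continuous_on ({0..\<zeta> N} \<times> S) (\<lambda>(z, t). p (\<xi> z) t)"
proof -
  have t: "continuous_on ({0..\<tau> L} \<times> S) (\<lambda>x. \<xi> (fst x))"
    by (rule continuous_on_compose2[OF \<xi>_cont]) (auto intro!: continuous_intros)
  show ?thesis unfolding split_beta \<zeta>_N
    by (rule continuous_on_compose2[OF assms, of _ "\<lambda>x. (\<xi> (fst x), snd x)", simplified])
       (use \<xi>_in in \<open>auto intro!: continuous_intros t\<close>)
qed

lemma x_slice: 
  assumes "continuous_on (I \<times> S) (\<lambda>(x, t). p x t)" "x \<in> I"
  shows "continuous_on S (p x)"
  by (rule continuous_on_compose2[OF assms(1), of _ "\<lambda>t. (x, t)", simplified]) (use assms(2) in \<open>auto intro!: continuous_intros\<close>)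

lemma t_slice: 
  assumes "continuous_on (I \<times> S) (\<lambda>(x, t). p x t)" "t \<in> S"
  shows "continuous_on I (\<lambda>x. p x t)"
  by (rule continuous_on_compose2[OF assms(1), of _ "\<lambda>x. (x, t)", simplified]) (use assms(2) in \<open>auto intro!: continuous_intros\<close>)

lemma time_integral_cont:
  fixes p :: "real \<Rightarrow> real \<Rightarrow> real"
  assumes p: "continuous_on (I \<times> {0..T}) (\<lambda>(x, t). p x t)" and t: "0 \<le> t1" "t2 \<le> T"
  shows "continuous_on I (\<lambda>x. integral {t1..t2} (p x))"
proof -
  have "continuous_on (I \<times> cbox t1 t2) (\<lambda>(x, t). p x t)"
    by (rule continuous_on_subset[OF p]) (use t in \<open>auto simp: cbox_interval\<close>)
  from integral_continuous_on_param[OF this] show ?thesis by (simp add: cbox_interval)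
qed

text \<open>The balance laws come from \<open>time_integral_deriv\<close>, which needs room for time
  shifts and so excludes the times 0 and T. Continuity of both sides extends them to the closed
  interval.\<close>

lemma balance_closure:
  fixes \<phi> r :: "real \<Rightarrow> real"
  assumes \<phi>: "continuous_on {0..T} \<phi>" and r: "continuous_on {0..T} r"
    and bal: "\<And>t1 t2. 0 < t1 \<Longrightarrow> t1 \<le> t2 \<Longrightarrow> t2 < T \<Longrightarrow> integral {t1..t2} \<phi> = r t2 - r t1"
    and t: "t \<in> {0..T}"
  shows "integral {0..t} \<phi> = r t - r 0"
proof (cases "0 < T")
  case False
  then have "t = 0" using t by auto
  then show ?thesis by simp
next
  case True
  define h where "h s = integral {0..s} \<phi> - r s" for s
  have \<phi>i: "\<phi> integrable_on {0..T}" by (rule integrable_continuous_real[OF \<phi>])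
  have hc: "continuous_on {0..T} h" unfolding h_def
    by (intro continuous_intros r indefinite_integral_continuous_1[OF \<phi>i])
  have "h s = h (T / 2)" if s: "s \<in> {0<..<T}" for s
  proof -
    have eq: "h t1 = h t2" if "0 < t1" "t1 \<le> t2" "t2 < T" for t1 t2
    proof -
      have "\<phi> integrable_on {0..t2}" by (rule integrable_on_subinterval[OF \<phi>i]) (use that in auto)
      from Henstock_Kurzweil_Integration.integral_combine[OF _ that(2) this] bal[OF that] that
      show ?thesis unfolding h_def by simp
    qed
    show ?thesis using eq[of s "T / 2"] eq[of "T / 2" s] s True by (cases "s \<le> T / 2") auto
  qed
  then have const: "\<And>s. s \<in> {0<..<T} \<Longrightarrow> h s = h (T / 2)" .
  have cl: "closure {0<..<T} = {0..T}" by (rule closure_greaterThanLessThan[OF True])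
  have const': "h s = h (T / 2)" if "s \<in> {0..T}" for s
    using continuous_constant_on_closure[OF hc[folded cl] const] that unfolding cl by blast
  have "0 \<in> {0..T}" using True by simp
  from trans[OF const'[OF t] const'[OF this, symmetric]] have "h t = h 0" .
  then show ?thesis unfolding h_def by simp
qed

lemma V_param_cont:
  assumes p: "continuous_on (I \<times> S) (\<lambda>(x, t). p x t)" and x: "x1 \<in> I" "x2 \<in> I" "x1 \<le> x2"
  shows "continuous_on S (\<lambda>t :: real. integral {x1..x2} (\<lambda>y. V y * p y t))"
proof -
  obtain M where M: "\<And>y. \<bar>W y\<bar> \<le> M" using W_bounded by blast
  have sub: "{x1..x2} \<subseteq> I" using x unfolding I_def by auto
  have "continuous_on S (\<lambda>t. integral {x1..x2} (\<lambda>y. W y * p y t))"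
  proof (rule continuous_on_param_integral[OF W_measurable M, of _ x1 x2])
    show "continuous_on (S \<times> {x1..x2}) (\<lambda>(t, y). p y t)" unfolding split_beta
      by (rule continuous_on_compose2[OF p, of _ "\<lambda>v. (snd v, fst v)", simplified]) (use sub in \<open>auto intro!: continuous_intros\<close>)
  qed (use x in auto)
  moreover have "integral {x1..x2} (\<lambda>y. W y * p y t) = integral {x1..x2} (\<lambda>y. V y * p y t)" for t
    by (rule integral_cong) (use sub in \<open>auto simp: W_def\<close>)
  ultimately show ?thesis by simp
qed

text \<open>The wave equation integrated over a rectangle: with p = u_t and q = u_x, the time
  integral of the flux difference equals the gain of momentum with density V p. The strain law
  \<open>pd\<close> is a hypothesis because it is obtained differently for a given solution (from u)
  and for a constructed one (from both mild equations).\<close>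

lemma flux_balance:
  assumes mild: "mildP T (\<lambda>z. p (\<xi> z)) (\<lambda>z. q (\<xi> z))"
    and p: "continuous_on (I \<times> {0..T}) (\<lambda>(x, t). p x t)" and q: "continuous_on (I \<times> {0..T}) (\<lambda>(x, t). q x t)"
    and pd: "\<And>k z t1 t2. k < N \<Longrightarrow> z \<in> {\<zeta> k<..<\<zeta> (Suc k)} \<Longrightarrow> z \<notin> E \<Longrightarrow> 0 < t1 \<Longrightarrow> t1 \<le> t2 \<Longrightarrow> t2 < T \<Longrightarrow>
       ((\<lambda>y. integral {t1..t2} (p (\<xi> y))) has_real_derivative \<gamma> k z * (q (\<xi> z) t2 - q (\<xi> z) t1)) (at z)"
    and x: "x1 \<in> I" "x2 \<in> I" "x1 \<le> x2" and t: "t \<in> {0..T}"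
  shows "integral {0..t} (\<lambda>s. q x2 s - q x1 s) = integral {x1..x2} (\<lambda>y. V y * p y t) - integral {x1..x2} (\<lambda>y. V y * p y 0)"
proof (rule balance_closure[OF _ _ _ t])
  have sub: "{x1..x2} \<subseteq> I" using x unfolding I_def by auto
  show "continuous_on {0..T} (\<lambda>s. q x2 s - q x1 s)" by (intro continuous_intros x_slice[OF q] x)
  show "continuous_on {0..T} (\<lambda>t. integral {x1..x2} (\<lambda>y. V y * p y t))" by (rule V_param_cont[OF p x])
  fix t1 t2 assume t: "0 < t1" "t1 \<le> t2" "t2 < T"
  then have tT: "t1 \<in> {0..T}" "t2 \<in> {0..T}" by auto
  note px = continuous_on_subset[OF t_slice[OF p tT(1)] sub] continuous_on_subset[OF t_slice[OF p tT(2)] sub]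
  have i: "(\<lambda>y. V y * p y t1) integrable_on {x1..x2}" "(\<lambda>y. V y * p y t2) integrable_on {x1..x2}"
    by (rule V_mult_integrable[OF px(1) sub], rule V_mult_integrable[OF px(2) sub])
  let ?H = "\<lambda>x. integral {t1..t2} (q x)"
  have "((\<lambda>y. V y * p y t2 - V y * p y t1) has_integral ?H x2 - ?H x1) {x1..x2}"
  proof (rule x_ftc[OF _ x])
    show "continuous_on I ?H" by (rule time_integral_cont[OF q]) (use t in auto)
    show "(\<lambda>y. V y * p y t2 - V y * p y t1) integrable_on {x1..x2}" by (rule integrable_diff[OF i(2,1)])
    show "((\<lambda>y. V y * p y t2 - V y * p y t1) \<longlongrightarrow> V y * p y t2 - V y * p y t1) (at y within I)" if "y \<in> G" for y
      using t_slice[OF p tT(1)] t_slice[OF p tT(2)] G_props(1)[OF that] unfolding continuous_on_def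
      by (intro tendsto_intros V_tendsto[OF that]) auto
    fix y assume y: "y \<in> {0<..<L}" "y \<in> G"
    obtain k where k: "k < N" "y \<in> {node k<..<node (Suc k)}" "\<tau> y \<in> {\<zeta> k<..<\<zeta> (Suc k)}" using open_piece_ex[OF y] by blast
    have yI: "y \<in> I" using G_props(1)[OF y(2)] .
    have "((\<lambda>z. integral {t1..t2} (q (\<xi> z))) has_real_derivative (p (\<xi> (\<tau> y)) t2 - p (\<xi> (\<tau> y)) t1) / \<gamma> k (\<tau> y)) (at (\<tau> y))"
      by (rule flux_integral_deriv[OF mild \<xi>_rect_cont[OF p] \<xi>_rect_cont[OF q] k(1,3) \<tau>_notE[OF y(2)] t pd[OF k(1,3) \<tau>_notE[OF y(2)] t]])
    from DERIV_chain2[OF this \<tau>_deriv_at[OF y]]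
    have "((\<lambda>x. integral {t1..t2} (q (\<xi> (\<tau> x)))) has_real_derivative (p y t2 - p y t1) / c y * (1 / c y)) (at y)"
      using \<gamma>_c[OF k(1,3)] \<xi>_\<tau>[OF yI] by simp
    moreover have "(p y t2 - p y t1) / c y * (1 / c y) = V y * p y t2 - V y * p y t1"
      unfolding V_c[OF yI] by (simp add: power2_eq_square diff_divide_distrib)
    ultimately have "((\<lambda>x. integral {t1..t2} (q (\<xi> (\<tau> x)))) has_real_derivative V y * p y t2 - V y * p y t1) (at y)" by simp
    then show "(?H has_real_derivative V y * p y t2 - V y * p y t1) (at y)"
      by (rule has_field_derivative_transform_within_open[of _ _ _ "{0<..<L}"]) (use y \<xi>_\<tau> in \<open>auto simp: I_def\<close>)
  qed
  moreover have "integral {t1..t2} (\<lambda>s. q x2 s - q x1 s) = ?H x2 - ?H x1"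
    by (rule integral_diff; rule integrable_continuous_real, rule continuous_on_subset[OF x_slice[OF q]])
       (use x t in auto)
  ultimately show "integral {t1..t2} (\<lambda>s. q x2 s - q x1 s) = integral {x1..x2} (\<lambda>y. V y * p y t2) - integral {x1..x2} (\<lambda>y. V y * p y t1)"
    using integral_diff[OF i(2,1)] integral_unique by metis
qed

text \<open>The integrated symmetry of mixed derivatives, p_x = q_t. It makes a constructed pair (p,
  q) the derivatives of a single function u.\<close>

lemma strain_balance:
  assumes mild: "mildP T (\<lambda>z. p (\<xi> z)) (\<lambda>z. q (\<xi> z))" "mildM T (\<lambda>z. p (\<xi> z)) (\<lambda>z. q (\<xi> z))"
    and p: "continuous_on (I \<times> {0..T}) (\<lambda>(x, t). p x t)" and q: "continuous_on (I \<times> {0..T}) (\<lambda>(x, t). q x t)"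
    and x: "x1 \<in> I" "x2 \<in> I" "x1 \<le> x2" and t: "t \<in> {0..T}"
  shows "integral {0..t} (\<lambda>s. p x2 s - p x1 s) = integral {x1..x2} (\<lambda>y. q y t) - integral {x1..x2} (\<lambda>y. q y 0)"
proof (rule balance_closure[OF _ _ _ t])
  have sub: "{x1..x2} \<subseteq> I" using x unfolding I_def by auto
  show "continuous_on {0..T} (\<lambda>s. p x2 s - p x1 s)" by (intro continuous_intros x_slice[OF p] x)
  have "continuous_on ({0..T} \<times> cbox x1 x2) (\<lambda>(t, y). q y t)" unfolding split_beta
    by (rule continuous_on_compose2[OF q, of _ "\<lambda>v. (snd v, fst v)", simplified]) (use sub in \<open>auto intro!: continuous_intros\<close>)
  from integral_continuous_on_param[OF this]
  show "continuous_on {0..T} (\<lambda>t. integral {x1..x2} (\<lambda>y. q y t))" by (simp add: cbox_interval)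
  fix t1 t2 assume t: "0 < t1" "t1 \<le> t2" "t2 < T"
  then have tT: "t1 \<in> {0..T}" "t2 \<in> {0..T}" by auto
  note qx = continuous_on_subset[OF t_slice[OF q tT(1)] sub] continuous_on_subset[OF t_slice[OF q tT(2)] sub]
  note i = integrable_continuous_real[OF qx(1)] integrable_continuous_real[OF qx(2)]
  let ?H = "\<lambda>x. integral {t1..t2} (p x)"
  have "((\<lambda>y. q y t2 - q y t1) has_integral ?H x2 - ?H x1) {x1..x2}"
  proof (rule x_ftc[OF _ x])
    show "continuous_on I ?H" by (rule time_integral_cont[OF p]) (use t in auto)
    show "(\<lambda>y. q y t2 - q y t1) integrable_on {x1..x2}" by (rule integrable_diff[OF i(2,1)])
    show "((\<lambda>y. q y t2 - q y t1) \<longlongrightarrow> q y t2 - q y t1) (at y within I)" if "y \<in> G" for y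
      using t_slice[OF q tT(1)] t_slice[OF q tT(2)] G_props(1)[OF that] unfolding continuous_on_def
      by (intro tendsto_intros) auto
    fix y assume y: "y \<in> {0<..<L}" "y \<in> G"
    obtain k where k: "k < N" "y \<in> {node k<..<node (Suc k)}" "\<tau> y \<in> {\<zeta> k<..<\<zeta> (Suc k)}" using open_piece_ex[OF y] by blast
    have yI: "y \<in> I" using G_props(1)[OF y(2)] .
    have "((\<lambda>z. integral {t1..t2} (p (\<xi> z))) has_real_derivative \<gamma> k (\<tau> y) * (q (\<xi> (\<tau> y)) t2 - q (\<xi> (\<tau> y)) t1)) (at (\<tau> y))"
      by (rule mild_integral_deriv(1)[OF mild \<xi>_rect_cont[OF p] \<xi>_rect_cont[OF q] k(1,3) \<tau>_notE[OF y(2)] t])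
    from DERIV_chain2[OF this \<tau>_deriv_at[OF y]]
    have "((\<lambda>x. integral {t1..t2} (p (\<xi> (\<tau> x)))) has_real_derivative c y * (q y t2 - q y t1) * (1 / c y)) (at y)"
      using \<gamma>_c[OF k(1,3)] \<xi>_\<tau>[OF yI] by simp
    then have "((\<lambda>x. integral {t1..t2} (p (\<xi> (\<tau> x)))) has_real_derivative q y t2 - q y t1) (at y)" using c_pos[OF yI] by simp
    then show "(?H has_real_derivative q y t2 - q y t1) (at y)"
      by (rule has_field_derivative_transform_within_open[of _ _ _ "{0<..<L}"]) (use y \<xi>_\<tau> in \<open>auto simp: I_def\<close>)
  qed
  moreover have "integral {t1..t2} (\<lambda>s. p x2 s - p x1 s) = ?H x2 - ?H x1"
    by (rule integral_diff; rule integrable_continuous_real, rule continuous_on_subset[OF x_slice[OF p]])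
       (use x t in auto)
  ultimately show "integral {t1..t2} (\<lambda>s. p x2 s - p x1 s) = integral {x1..x2} (\<lambda>y. q y t2) - integral {x1..x2} (\<lambda>y. q y t1)"
    using integral_diff[OF i(2,1)] integral_unique by metis
qed

end

section \<open>The boundary value problem\<close>

context layered
begin

lemma mild_cong:
  assumes "\<And>z t. z \<in> {0..\<zeta> N} \<Longrightarrow> t \<in> {0..T} \<Longrightarrow> P z t = P' z t \<and> Q z t = Q' z t"
  shows "mildP T P Q \<Longrightarrow> mildP T P' Q'" and "mildM T P Q \<Longrightarrow> mildM T P' Q'"
proof -
  have pin: "z \<in> {0..\<zeta> N}" if "k < N" "\<zeta> k \<le> z" "z \<le> \<zeta> (Suc k)" for k z using piece_in[OF that(1), of z] that by auto
  show "mildP T P' Q'" if mild: "mildP T P Q" unfolding mildP_def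
  proof (intro allI impI)
    fix k z z' t assume *: "k < N" "\<zeta> k \<le> z" "z \<le> z'" "z' \<le> \<zeta> (Suc k)" "0 \<le> t" "t + (z' - z) \<le> T"
    have "integral {z..z'} (\<lambda>y. b y * Q y (t + z' - y)) = integral {z..z'} (\<lambda>y. b y * Q' y (t + z' - y))"
      by (rule integral_cong) (use assms pin[OF *(1)] * in auto)
    moreover have "P z (t + (z' - z)) = P' z (t + (z' - z)) \<and> Q z (t + (z' - z)) = Q' z (t + (z' - z))" "P z' t = P' z' t \<and> Q z' t = Q' z' t"
      using assms pin[OF *(1)] * by auto
    ultimately show "P' z (t + (z' - z)) + \<gamma> k z * Q' z (t + (z' - z)) =
       P' z' t + \<gamma> k z' * Q' z' t - integral {z..z'} (\<lambda>y. b y * Q' y (t + z' - y))"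
      using mildPD[OF mild *] by simp
  qed
  show "mildM T P' Q'" if mild: "mildM T P Q" unfolding mildM_def
  proof (intro allI impI)
    fix k z z' t assume *: "k < N" "\<zeta> k \<le> z" "z \<le> z'" "z' \<le> \<zeta> (Suc k)" "0 \<le> t" "t + (z' - z) \<le> T"
    have "integral {z..z'} (\<lambda>y. b y * Q y (t - z + y)) = integral {z..z'} (\<lambda>y. b y * Q' y (t - z + y))"
      by (rule integral_cong) (use assms pin[OF *(1)] * in auto)
    moreover have "P z' (t + (z' - z)) = P' z' (t + (z' - z)) \<and> Q z' (t + (z' - z)) = Q' z' (t + (z' - z))" "P z t = P' z t \<and> Q z t = Q' z t"
      using assms pin[OF *(1)] * by auto
    ultimately show "P' z' (t + (z' - z)) - \<gamma> k z' * Q' z' (t + (z' - z)) =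
       P' z t - \<gamma> k z * Q' z t - integral {z..z'} (\<lambda>y. b y * Q' y (t - z + y))"
      using mildMD[OF mild *] by simp
  qed
qed

end

lemma integral_of_derivative_within:
  fixes u p :: "real \<Rightarrow> real"
  assumes "\<And>s. s \<in> {0..T} \<Longrightarrow> (u has_real_derivative p s) (at s within {0..T})" "0 \<le> a" "a \<le> d" "d \<le> T"
  shows "(p has_integral u d - u a) {a..d}"
proof (rule fundamental_theorem_of_calculus[OF assms(3)])
  fix s assume s: "s \<in> {a..d}"
  then have "s \<in> {0..T}" using assms by auto
  from DERIV_subset[OF assms(1)[OF this], of "{a..d}"] assms
  show "(u has_vector_derivative p s) (at s within {a..d})"
    by (simp add: has_real_derivative_iff_has_vector_derivative[symmetric])
qed

lemma (in medium) integral_rect_cont: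
  fixes p :: "real \<Rightarrow> real \<Rightarrow> real"
  assumes p: "continuous_on (I \<times> {0..T}) (\<lambda>(x, t). p x t)"
  shows "continuous_on (I \<times> {0..T}) (\<lambda>(x, t). integral {0..t} (p x))"
proof -
  have "continuous_on (I \<times> {0..T}) (\<lambda>xt. integral {0..snd xt} (\<lambda>s. 1 * p (fst xt) s))"
  proof (rule continuous_on_param_integral[where b = "\<lambda>_. 1" and \<beta> = 1 and lo = 0 and hi = T])
    show "continuous_on ((I \<times> {0..T}) \<times> {0..T}) (\<lambda>(xt, s). p (fst xt) s)" unfolding split_beta
      by (rule continuous_on_compose2[OF p, of _ "\<lambda>v. (fst (fst v), snd v)", simplified]) (auto intro!: continuous_intros)
  qed (auto intro!: continuous_intros)
  then show ?thesis by (simp add: split_beta)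
qed

locale problem = medium +
  fixes f u0 u1 :: "real \<Rightarrow> real"
  assumes A0: "A0 L u0 u1" and A3: "A3 f" and compat0: "u0 L = 0" and compat1: "u1 L = 0"
begin

definition "fi = inv f"
definition "du0 = deriv_on I u0"
text \<open>Initial value of the potential, fixed by \<psi>_x = V u_t and \<psi>(0, 0) = f (u_t(0,
  0)).\<close>

definition "\<psi>0 x = f (u1 0) + integral {0..x} (\<lambda>y. V y * u1 y)"

lemma f_props: "strict_mono f" "continuous_on UNIV f" "continuous_on UNIV fi" "\<And>s. fi (f s) = s" "\<And>v. f (fi v) = v" "mono fi"
proof -
  obtain g where g: "strict_mono f" "homeomorphism UNIV UNIV f g" using A3 unfolding A3_def by blast
  have "fi = g" unfolding fi_def using g(2) unfolding homeomorphism_def by (metis UNIV_I inj_onI inv_unique_comp o_def surj_f_inv_f surjI inj_imp_inv_eq eq_id_iff)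
  then show "strict_mono f" "continuous_on UNIV f" "continuous_on UNIV fi" and 1: "\<And>s. fi (f s) = s" and 2: "\<And>v. f (fi v) = v"
    using g unfolding homeomorphism_def by auto
  show "mono fi"
  proof (rule monoI)
    fix x y :: real assume "x \<le> y"
    then show "fi x \<le> fi y" using strict_mono_less_eq[OF g(1), of "fi x" "fi y"] 2 by simp
  qed
qed

lemma u1_cont: "continuous_on I u1" and du0: "\<And>x. x \<in> I \<Longrightarrow> (u0 has_real_derivative du0 x) (at x within I)"
  and du0_cont: "continuous_on I du0" and u0_cont: "continuous_on I u0"
proof -
  have C: "Ck_on 1 I u0" "continuous_on I u1" using A0 unfolding A0_def I_def by auto
  show "continuous_on I u1" by (rule C(2))
  show 1: "(u0 has_real_derivative du0 x) (at x within I)" if "x \<in> I" for x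
    unfolding du0_def by (rule deriv_on_works) (use C(1) that in \<open>auto simp: Ck_on_def\<close>)
  show "continuous_on I du0" unfolding du0_def using C(1) unfolding Ck_on_def by (auto dest: spec[of _ 1])
  show "continuous_on I u0" using 1 DERIV_continuous continuous_on_eq_continuous_within by blast
qed

lemma \<psi>0_cont: "continuous_on I \<psi>0"
  unfolding \<psi>0_def I_def by (intro continuous_intros indefinite_integral_continuous_1 V_mult_integrable) (use u1_cont in \<open>auto simp: I_def\<close>)

lemma zero_I: "0 \<in> I" and L_I: "L \<in> I" unfolding I_def using L by auto

text \<open>A solution up to time T with its derivatives p = u_t and q = u_x named. The wave
  equation appears only as \<open>mildP\<close>, the counterpart of the single equation for u_t + c
  u_x in \<open>global_C1_solution\<close>.\<close>

definition strip where
  "strip T u p q \<longleftrightarrow> continuous_on (I \<times> {0..T}) (\<lambda>(x, t). u x t) \<and> continuous_on (I \<times> {0..T}) (\<lambda>(x, t). p x t) \<and>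
     continuous_on (I \<times> {0..T}) (\<lambda>(x, t). q x t) \<and>
     (\<forall>x\<in>I. \<forall>t\<in>{0..T}. (u x has_real_derivative p x t) (at t within {0..T}) \<and>
        ((\<lambda>y. u y t) has_real_derivative q x t) (at x within I)) \<and>
     mildP T (\<lambda>z. p (\<xi> z)) (\<lambda>z. q (\<xi> z)) \<and>
     (\<forall>t\<in>{0..T}. ((\<lambda>s. f (p 0 s)) has_real_derivative q 0 t) (at t within {0..T}) \<and> u L t = 0) \<and>
     (\<forall>x\<in>I. u x 0 = u0 x \<and> p x 0 = u1 x)"

lemma stripD:
  assumes "strip T u p q"
  shows "continuous_on (I \<times> {0..T}) (\<lambda>(x, t). u x t)" "continuous_on (I \<times> {0..T}) (\<lambda>(x, t). p x t)"
     "continuous_on (I \<times> {0..T}) (\<lambda>(x, t). q x t)"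
     "\<And>x t. x \<in> I \<Longrightarrow> t \<in> {0..T} \<Longrightarrow> (u x has_real_derivative p x t) (at t within {0..T})"
     "\<And>x t. x \<in> I \<Longrightarrow> t \<in> {0..T} \<Longrightarrow> ((\<lambda>y. u y t) has_real_derivative q x t) (at x within I)"
     "mildP T (\<lambda>z. p (\<xi> z)) (\<lambda>z. q (\<xi> z))"
     "\<And>t. t \<in> {0..T} \<Longrightarrow> ((\<lambda>s. f (p 0 s)) has_real_derivative q 0 t) (at t within {0..T})"
     "\<And>t. t \<in> {0..T} \<Longrightarrow> u L t = 0" "\<And>x. x \<in> I \<Longrightarrow> u x 0 = u0 x" "\<And>x. x \<in> I \<Longrightarrow> p x 0 = u1 x"
  using assms unfolding strip_def by auto

definition pot :: "(real \<Rightarrow> real \<Rightarrow> real) \<Rightarrow> real \<Rightarrow> real \<Rightarrow> real" where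
  "pot q x t = \<psi>0 x + integral {0..t} (q x)"

lemma pot_0: "pot q x 0 = \<psi>0 x" unfolding pot_def by simp

lemma pot_props:
  assumes q: "continuous_on (I \<times> {0..T}) (\<lambda>(x, t). q x t)"
  shows "continuous_on (I \<times> {0..T}) (\<lambda>(x, t). pot q x t)"
    and "\<And>x t. x \<in> I \<Longrightarrow> t \<in> {0..T} \<Longrightarrow> (pot q x has_real_derivative q x t) (at t within {0..T})"
proof -
  have 1: "continuous_on (I \<times> {0..T}) (\<lambda>x. \<psi>0 (fst x))"
    by (rule continuous_on_compose2[OF \<psi>0_cont]) (auto intro!: continuous_intros)
  show "continuous_on (I \<times> {0..T}) (\<lambda>(x, t). pot q x t)"
    using integral_rect_cont[OF q] 1 unfolding pot_def split_beta by (intro continuous_intros) auto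
  fix x t assume "x \<in> I" "t \<in> {0..T}"
  then have "((\<lambda>t. \<psi>0 x + integral {0..t} (q x)) has_real_derivative 0 + q x t) (at t within {0..T})"
    by (intro derivative_intros integral_has_real_derivative x_slice[OF q])
  then show "(pot q x has_real_derivative q x t) (at t within {0..T})" unfolding pot_def[abs_def] by simp
qed

lemma pot_balance:
  assumes mild: "mildP T (\<lambda>z. p (\<xi> z)) (\<lambda>z. q (\<xi> z))"
    and p: "continuous_on (I \<times> {0..T}) (\<lambda>(x, t). p x t)" and q: "continuous_on (I \<times> {0..T}) (\<lambda>(x, t). q x t)"
    and pd: "\<And>k z t1 t2. k < N \<Longrightarrow> z \<in> {\<zeta> k<..<\<zeta> (Suc k)} \<Longrightarrow> z \<notin> E \<Longrightarrow> 0 < t1 \<Longrightarrow> t1 \<le> t2 \<Longrightarrow> t2 < T \<Longrightarrow>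
       ((\<lambda>y. integral {t1..t2} (p (\<xi> y))) has_real_derivative \<gamma> k z * (q (\<xi> z) t2 - q (\<xi> z) t1)) (at z)"
    and init: "\<And>x. x \<in> I \<Longrightarrow> p x 0 = u1 x" and x: "x \<in> I" and t: "t \<in> {0..T}"
  shows "pot q x t = pot q 0 t + integral {0..x} (\<lambda>y. V y * p y t)"
proof -
  have x0: "0 \<le> x" using x unfolding I_def by simp
  have qi: "q y integrable_on {0..t}" if "y \<in> I" for y
    by (rule integrable_continuous_real, rule continuous_on_subset[OF x_slice[OF q that]]) (use t in auto)
  have "integral {0..t} (\<lambda>s. q x s - q 0 s) = integral {0..x} (\<lambda>y. V y * p y t) - integral {0..x} (\<lambda>y. V y * p y 0)"
    by (rule flux_balance[OF mild p q pd zero_I x x0 t])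
  moreover have "integral {0..t} (\<lambda>s. q x s - q 0 s) = integral {0..t} (q x) - integral {0..t} (q 0)"
    by (rule integral_diff[OF qi[OF x] qi[OF zero_I]])
  moreover have "integral {0..x} (\<lambda>y. V y * p y 0) = integral {0..x} (\<lambda>y. V y * u1 y)"
    by (rule integral_cong) (use init x in \<open>auto simp: I_def\<close>)
  ultimately show ?thesis unfolding pot_def \<psi>0_def by simp
qed

lemma pot_x_deriv:
  assumes p: "continuous_on (I \<times> {0..T}) (\<lambda>(x, t). p x t)"
    and bal: "\<And>x t. x \<in> I \<Longrightarrow> t \<in> {0..T} \<Longrightarrow> pot q x t = pot q 0 t + integral {0..x} (\<lambda>y. V y * p y t)"
    and t: "t \<in> {0..T}" and x: "x \<in> I" "x \<notin> F"
  shows "((\<lambda>x. pot q x t) has_real_derivative V x * p x t) (at x within I)"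
proof -
  have pc: "continuous_on {0..L} (\<lambda>y. p y t)" using t_slice[OF p t] unfolding I_def .
  have i: "(\<lambda>y. V y * p y t) integrable_on {0..L}" by (rule V_mult_integrable[OF pc]) (simp add: I_def)
  have "continuous (at x within {0..L}) V" using V_continuous[OF x] unfolding I_def .
  moreover have "continuous (at x within {0..L}) (\<lambda>y. p y t)"
    using pc x unfolding I_def continuous_on_eq_continuous_within by blast
  ultimately have "continuous (at x within {0..L} - {}) (\<lambda>y. V y * p y t)" by (simp add: continuous_mult)
  from integral_has_vector_derivative_continuous_at[OF i _ finite.emptyI this]
  have "((\<lambda>x. integral {0..x} (\<lambda>y. V y * p y t)) has_real_derivative V x * p x t) (at x within I)"
    using x unfolding has_real_derivative_iff_has_vector_derivative I_def by simp
  then have "((\<lambda>x. pot q 0 t + integral {0..x} (\<lambda>y. V y * p y t)) has_real_derivative V x * p x t) (at x within I)"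
    by (auto intro!: derivative_eq_intros)
  then show ?thesis
    by (rule has_field_derivative_transform_within[OF _ zero_less_one x(1)]) (use bal t in simp)
qed

text \<open>The potentials are differentiable in both variables inside the layers, with derivatives
  expressed by p and q, so they satisfy the system classically. Hence both mild equations hold for
  them, including the one that is not part of \<open>strip\<close>.\<close>

lemma pair_mild:
  assumes u: "continuous_on (I \<times> {0..T}) (\<lambda>(x, t). u x t)" and p: "continuous_on (I \<times> {0..T}) (\<lambda>(x, t). p x t)"
    and q: "continuous_on (I \<times> {0..T}) (\<lambda>(x, t). q x t)"
    and ut: "\<And>x t. x \<in> I \<Longrightarrow> t \<in> {0..T} \<Longrightarrow> (u x has_real_derivative p x t) (at t within {0..T})"
    and ux: "\<And>x t. x \<in> I \<Longrightarrow> t \<in> {0..T} \<Longrightarrow> ((\<lambda>y. u y t) has_real_derivative q x t) (at x within I)"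
    and bal: "\<And>x t. x \<in> I \<Longrightarrow> t \<in> {0..T} \<Longrightarrow> pot q x t = pot q 0 t + integral {0..x} (\<lambda>y. V y * p y t)"
  shows "mildP T (\<lambda>z. u (\<xi> z)) (\<lambda>z. pot q (\<xi> z))" and "mildM T (\<lambda>z. u (\<xi> z)) (\<lambda>z. pot q (\<xi> z))"
proof -
  have zI: "\<xi> z \<in> I" if "z \<in> {0..\<zeta> N}" for z using \<xi>_in that \<zeta>_N by simp
  have open_z: "\<xi> z \<in> {0<..<L}" "\<xi> z \<notin> F" "(\<xi> has_real_derivative \<gamma> k z) (at z)" "\<xi> z \<in> I" if kz: "k < N" "z \<in> {\<zeta> k<..<\<zeta> (Suc k)}" for k z
  proof -
    have z: "z \<in> {0<..<\<tau> L}" by (rule open_piece_in[OF kz])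
    show x: "\<xi> z \<in> {0<..<L}" by (rule \<xi>_interior[OF z])
    then show "\<xi> z \<in> I" by (auto simp: I_def)
    show "\<xi> z \<notin> F" using \<xi>_open_piece[OF kz] node_F[OF kz(1)] by blast
    then show "(\<xi> has_real_derivative \<gamma> k z) (at z)" using \<xi>_deriv[OF z] \<gamma>_c[OF kz] by simp
  qed
  have uz: "((\<lambda>y. u (\<xi> y) t) has_real_derivative \<gamma> k z * q (\<xi> z) t) (at z)"
    if kz: "k < N" "z \<in> {\<zeta> k<..<\<zeta> (Suc k)}" and t: "t \<in> {0..T}" for k z t
  proof -
    have "((\<lambda>y. u y t) has_real_derivative q (\<xi> z) t) (at (\<xi> z))"
      using ux[OF open_z(4)[OF kz] t] at_I[OF open_z(1)[OF kz]] by simp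
    from DERIV_chain2[OF this open_z(3)[OF kz]] show ?thesis by (simp add: mult.commute)
  qed
  have \<psi>z: "((\<lambda>y. pot q (\<xi> y) t) has_real_derivative p (\<xi> z) t / \<gamma> k z) (at z)"
    if kz: "k < N" "z \<in> {\<zeta> k<..<\<zeta> (Suc k)}" and t: "t \<in> {0..T}" for k z t
  proof -
    let ?x = "\<xi> z"
    have "((\<lambda>x. pot q x t) has_real_derivative V ?x * p ?x t) (at ?x within I)"
      by (rule pot_x_deriv[OF p bal t open_z(4,2)[OF kz]])
    then have "((\<lambda>x. pot q x t) has_real_derivative V ?x * p ?x t) (at ?x)" using at_I[OF open_z(1)[OF kz]] by simp
    from DERIV_chain2[OF this open_z(3)[OF kz]]
    have "((\<lambda>y. pot q (\<xi> y) t) has_real_derivative V ?x * p ?x t * \<gamma> k z) (at z)" .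
    moreover have "V ?x * p ?x t * \<gamma> k z = p ?x t / \<gamma> k z"
      using c_pos[OF open_z(4)[OF kz]] unfolding V_c[OF open_z(4)[OF kz]] \<gamma>_c[OF kz] by (simp add: power2_eq_square)
    ultimately show ?thesis by simp
  qed
  note cm = classical_imp_mild[where u = "\<lambda>z. u (\<xi> z)" and \<psi> = "\<lambda>z. pot q (\<xi> z)" and p = "\<lambda>z. p (\<xi> z)" and q = "\<lambda>z. q (\<xi> z)" and T = T,
      OF \<xi>_rect_cont[OF u] \<xi>_rect_cont[OF pot_props(1)[OF q]] \<xi>_rect_cont[OF p] \<xi>_rect_cont[OF q] ut[OF zI] pot_props(2)[OF q zI] uz \<psi>z]
  show "mildP T (\<lambda>z. u (\<xi> z)) (\<lambda>z. pot q (\<xi> z))" "mildM T (\<lambda>z. u (\<xi> z)) (\<lambda>z. pot q (\<xi> z))"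
    by (rule cm; assumption)+
qed

text \<open>The strain law required by \<open>pot_balance\<close> comes from u itself: the time
  integral of p is a difference of values of u, whose derivative in z is \<gamma> times the
  difference of q, by the chain rule.\<close>

lemma strip_balance:
  assumes s: "strip T u p q" and x: "x \<in> I" and t: "t \<in> {0..T}"
  shows "pot q x t = pot q 0 t + integral {0..x} (\<lambda>y. V y * p y t)"
proof (rule pot_balance[OF stripD(6)[OF s] stripD(2,3)[OF s] _ stripD(10)[OF s] x t])
  fix k z t1 t2 assume kz: "k < N" "z \<in> {\<zeta> k<..<\<zeta> (Suc k)}" and "z \<notin> E" and t: "0 < t1" "t1 \<le> t2" "t2 < T"
  have z: "z \<in> {0<..<\<tau> L}" by (rule open_piece_in[OF kz])
  have x: "\<xi> z \<in> {0<..<L}" "\<xi> z \<in> I" using \<xi>_interior[OF z] by (auto simp: I_def)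
  have "\<xi> z \<notin> F" using \<xi>_open_piece[OF kz] node_F[OF kz(1)] by blast
  then have \<xi>d: "(\<xi> has_real_derivative \<gamma> k z) (at z)" using \<xi>_deriv[OF z] \<gamma>_c[OF kz] by simp
  have tT: "t1 \<in> {0..T}" "t2 \<in> {0..T}" using t by auto
  have d: "((\<lambda>y. u y s) has_real_derivative q (\<xi> z) s) (at (\<xi> z))" if "s \<in> {0..T}" for s
    using stripD(5)[OF assms(1) x(2) that] at_I[OF x(1)] by simp
  have "((\<lambda>y. u (\<xi> y) t2 - u (\<xi> y) t1) has_real_derivative q (\<xi> z) t2 * \<gamma> k z - q (\<xi> z) t1 * \<gamma> k z) (at z)"
    by (intro DERIV_diff DERIV_chain2[OF d[OF tT(1)] \<xi>d] DERIV_chain2[OF d[OF tT(2)] \<xi>d])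
  then have "((\<lambda>y. u (\<xi> y) t2 - u (\<xi> y) t1) has_real_derivative \<gamma> k z * (q (\<xi> z) t2 - q (\<xi> z) t1)) (at z)"
    by (simp add: algebra_simps)
  then show "((\<lambda>y. integral {t1..t2} (p (\<xi> y))) has_real_derivative \<gamma> k z * (q (\<xi> z) t2 - q (\<xi> z) t1)) (at z)"
  proof (rule has_field_derivative_transform_within_open[of _ _ _ "{0<..<\<tau> L}"])
    fix y assume "y \<in> {0<..<\<tau> L}"
    then have y: "\<xi> y \<in> I" using \<xi>_in by auto
    have "(p (\<xi> y) has_integral u (\<xi> y) t2 - u (\<xi> y) t1) {t1..t2}"
      by (rule integral_of_derivative_within[OF stripD(4)[OF s y]]) (use t in auto)
    then show "u (\<xi> y) t2 - u (\<xi> y) t1 = integral {t1..t2} (p (\<xi> y))" by (simp add: integral_unique)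
  qed (use z in auto)
qed

section \<open>The nonlinear boundary operator\<close>

definition "h_bc v = fi (v / \<gamma> 0 0)"

text \<open>Solves v' = \<open>h_bc (A - v)\<close> with v 0 = u0 0, which is the boundary equation
  after the elimination \<psi> = (A - v) / \<open>\<gamma> 0 0\<close>. The case d = 0 of
  \<open>Bnl_stable\<close> shows that the choice is unique on [0, T].\<close>

definition Bnl :: "real \<Rightarrow> (real \<Rightarrow> real) \<Rightarrow> real \<Rightarrow> real" where
  "Bnl T A = (SOME U. continuous_on {0..T} U \<and> (\<forall>t\<in>{0..T}. U t = u0 0 + integral {0..t} (\<lambda>s. h_bc (A s - U s))))"

lemma \<gamma>00: "0 < \<gamma> 0 0" using \<gamma>_pos[OF N_pos, of 0] \<zeta>0 \<zeta>_less[OF N_pos] by simp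

lemma h_bc: "mono h_bc" "continuous_on UNIV h_bc"
proof -
  show "mono h_bc" unfolding h_bc_def
    by (intro monoI monoD[OF f_props(6)] divide_right_mono) (use \<gamma>00 in auto)
  show "continuous_on UNIV h_bc" unfolding h_bc_def[abs_def]
    by (rule continuous_on_compose2[OF f_props(3)]) (use \<gamma>00 in \<open>auto intro!: continuous_intros\<close>)
qed

lemma Bnl_eq:
  fixes A :: "real \<Rightarrow> real"
  assumes "0 \<le> T" "continuous_on {0..T} A"
  shows "continuous_on {0..T} (Bnl T A)" "\<And>t. t \<in> {0..T} \<Longrightarrow> Bnl T A t = u0 0 + integral {0..t} (\<lambda>s. h_bc (A s - Bnl T A s))"
  using someI_ex[OF monotone_ode[OF assms(1) h_bc assms(2), of "u0 0"]] unfolding Bnl_def by blast+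

text \<open>Stated for arbitrary solutions U and U' instead of values of \<open>Bnl\<close>, so that
  d = 0 also gives uniqueness and identifies the trace of a given solution. Working on [0, t] alone
  gives causality.\<close>

lemma Bnl_stable:
  fixes A A' U U' :: "real \<Rightarrow> real" and d t T :: real
  assumes A: "continuous_on {0..T} A" and A': "continuous_on {0..T} A'"
    and U: "continuous_on {0..T} U" "\<forall>t\<in>{0..T}. U t = u0 0 + integral {0..t} (\<lambda>s. h_bc (A s - U s))"
    and U': "continuous_on {0..T} U'" "\<forall>t\<in>{0..T}. U' t = u0 0 + integral {0..t} (\<lambda>s. h_bc (A' s - U' s))"
    and t: "t \<in> {0..T}" and d: "\<forall>s\<in>{0..t}. \<bar>A s - A' s\<bar> \<le> d"
  shows "\<bar>U t - U' t\<bar> \<le> d"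
proof -
  have sub: "{0..t} \<subseteq> {0..T}" using t by auto
  have D: "(U has_real_derivative h_bc (A s - U s)) (at s within {0..t})" "(U' has_real_derivative h_bc (A' s - U' s)) (at s within {0..t})"
    if "s \<in> {0..t}" for s
  proof -
    have "s \<in> {0..T}" using that sub by blast
    then show "(U has_real_derivative h_bc (A s - U s)) (at s within {0..t})" "(U' has_real_derivative h_bc (A' s - U' s)) (at s within {0..t})"
      using DERIV_subset[OF integral_equation_has_derivative[OF h_bc(2) A U] sub]
        DERIV_subset[OF integral_equation_has_derivative[OF h_bc(2) A' U'] sub] by blast+
  qed
  have i: "U 0 = u0 0" "U' 0 = u0 0" using U(2) U'(2) t by auto
  have d0: "0 \<le> d" using d t by (auto intro: order_trans[OF abs_ge_zero])
  have "U t \<le> U' t + d" by (rule monotone_ode_stable[OF h_bc(1) D]) (use d t i d0 in \<open>auto simp: abs_le_iff algebra_simps\<close>)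
  moreover have "U' t \<le> U t + d" by (rule monotone_ode_stable[OF h_bc(1) D(2,1)]) (use d t i d0 in \<open>auto simp: abs_le_iff algebra_simps\<close>)
  ultimately show ?thesis by linarith
qed

lemma Bnl_causal: assumes T: "0 \<le> T" shows "causal (Bnl T) T"
  unfolding causal_def
proof (intro conjI allI impI)
  show "continuous_on {0..T} (Bnl T A)" if "continuous_on {0..T} A" for A :: "real \<Rightarrow> real" by (rule Bnl_eq(1)[OF T that])
  fix A A' :: "real \<Rightarrow> real" and t d :: real assume *: "continuous_on {0..T} A" "continuous_on {0..T} A'" "t \<in> {0..T}" "\<forall>s\<in>{0..t}. \<bar>A s - A' s\<bar> \<le> d"
  show "\<bar>Bnl T A t - Bnl T A' t\<bar> \<le> d"
    by (rule Bnl_stable[OF *(1,2) Bnl_eq(1)[OF T *(1)] _ Bnl_eq(1)[OF T *(2)] _ *(3,4)])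
       (use Bnl_eq(2)[OF T *(1)] Bnl_eq(2)[OF T *(2)] in auto)
qed

lemma data_cont: "continuous_on {0..\<zeta> N} (\<lambda>z. u0 (\<xi> z))" "continuous_on {0..\<zeta> N} (\<lambda>z. \<psi>0 (\<xi> z))"
   "continuous_on {0..\<zeta> N} (\<lambda>z. u1 (\<xi> z))" "continuous_on {0..\<zeta> N} (\<lambda>z. du0 (\<xi> z))"
  unfolding \<zeta>_N using \<xi>_in
  by (auto intro!: continuous_on_compose2[OF _ \<xi>_cont] u0_cont \<psi>0_cont u1_cont du0_cont)

lemma nl_data:
  assumes T: "0 \<le> T" shows "layered_data N \<zeta> \<gamma> b E m \<beta> (\<lambda>z. u0 (\<xi> z)) (\<lambda>z. \<psi>0 (\<xi> z)) T (Bnl T)"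
proof (unfold_locales)
  show "Bnl T A 0 = u0 (\<xi> 0)" if "continuous_on {0..T} A" for A :: "real \<Rightarrow> real" using Bnl_eq(2)[OF T that, of 0] T \<xi>_ends by simp
qed (use T data_cont Bnl_causal[OF T] \<xi>_ends compat0 in \<open>auto simp: \<zeta>_N\<close>)

lemma strip_solves:
  assumes T: "0 \<le> T" and s: "strip T u p q"
  shows "layered_data.solves N \<zeta> \<gamma> b (\<lambda>z. u0 (\<xi> z)) (\<lambda>z. \<psi>0 (\<xi> z)) T (Bnl T) (\<lambda>z. u (\<xi> z)) (\<lambda>z. pot q (\<xi> z))"
proof -
  interpret D: layered_data N \<zeta> \<gamma> b E m \<beta> "\<lambda>z. u0 (\<xi> z)" "\<lambda>z. \<psi>0 (\<xi> z)" T "Bnl T" by (rule nl_data[OF T])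
  note pc = pot_props[OF stripD(3)[OF s]]
  note m = pair_mild[OF stripD(1,2,3,4,5)[OF s] strip_balance[OF s]]
  \<comment> \<open>By the boundary condition both sides have the time derivative q 0, and they
    agree at time 0 because \<psi>0 0 = f (u1 0).\<close>
  have f_pot: "f (p 0 t) = pot q 0 t" if t: "t \<in> {0..T}" for t
  proof -
    have d: "((\<lambda>t. f (p 0 t) - pot q 0 t) has_real_derivative 0) (at s within {0..T})" if "s \<in> {0..T}" for s
      using DERIV_diff[OF stripD(7)[OF assms(2) that] pc(2)[OF zero_I that]] by simp
    obtain a where "\<And>s. s \<in> {0..T} \<Longrightarrow> f (p 0 s) - pot q 0 s = a"
      using has_field_derivative_zero_constant[OF convex_real_interval(5) d] by blast
    from this[OF t] this[of 0] T have "f (p 0 t) - pot q 0 t = f (p 0 0) - pot q 0 0" by simp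
    then show ?thesis using stripD(10)[OF s zero_I] by (simp add: pot_def \<psi>0_def)
  qed
  have bc: "u 0 t = Bnl T (\<lambda>s. u 0 s + \<gamma> 0 0 * pot q 0 s) t" if t: "t \<in> {0..T}" for t
  proof -
    let ?A = "\<lambda>s. u 0 s + \<gamma> 0 0 * pot q 0 s"
    have uc: "continuous_on {0..T} (u 0)" by (rule x_slice[OF stripD(1)[OF s] zero_I])
    have Ac: "continuous_on {0..T} ?A" by (intro continuous_intros uc x_slice[OF pc(1) zero_I])
    have "\<forall>t\<in>{0..T}. u 0 t = u0 0 + integral {0..t} (\<lambda>s. h_bc (?A s - u 0 s))"
    proof
      fix t assume t: "t \<in> {0..T}"
      have "(p 0 has_integral u 0 t - u 0 0) {0..t}"
        by (rule integral_of_derivative_within[OF stripD(4)[OF s zero_I]]) (use t in auto)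
      then have "u 0 t = u 0 0 + integral {0..t} (p 0)" by (simp add: integral_unique)
      moreover have "integral {0..t} (p 0) = integral {0..t} (\<lambda>s. h_bc (?A s - u 0 s))"
      proof (rule integral_cong)
        fix r assume "r \<in> {0..t}"
        then have "f (p 0 r) = pot q 0 r" using f_pot t by auto
        then have "p 0 r = fi (pot q 0 r)" using f_props(4)[of "p 0 r"] by simp
        then show "p 0 r = h_bc (?A r - u 0 r)" unfolding h_bc_def using \<gamma>00 by simp
      qed
      ultimately show "u 0 t = u0 0 + integral {0..t} (\<lambda>s. h_bc (?A s - u 0 s))" using stripD(9)[OF s zero_I] by simp
    qed
    from Bnl_stable[OF Ac Ac uc this Bnl_eq(1)[OF T Ac] _ t, of 0] Bnl_eq(2)[OF T Ac]
    have "\<bar>u 0 t - Bnl T ?A t\<bar> \<le> 0" by auto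
    then show ?thesis by simp
  qed
  show ?thesis unfolding D.solves_def
    using m \<xi>_rect_cont[OF stripD(1)[OF s]] \<xi>_rect_cont[OF pc(1)] bc stripD(8,9)[OF s] \<xi>_ends \<xi>_in
    by (auto simp: \<zeta>_N pot_0)
qed

lemma strip_unique:
  assumes T: "0 < T" and s: "strip T u p q" and s': "strip T u' p' q'" and x: "x \<in> I" and t: "t \<in> {0..T}"
  shows "u x t = u' x t" "p x t = p' x t" "q x t = q' x t"
proof -
  have T0: "0 \<le> T" using T by simp
  interpret D: layered_data N \<zeta> \<gamma> b E m \<beta> "\<lambda>z. u0 (\<xi> z)" "\<lambda>z. \<psi>0 (\<xi> z)" T "Bnl T" by (rule nl_data[OF T0])
  have u: "u y s = u' y s" if "y \<in> I" "s \<in> {0..T}" for y s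
    using D.solution_unique(1)[OF strip_solves[OF T0 assms(2)] strip_solves[OF T0 s'], of "\<tau> y" s] \<tau>_in[OF that(1)] \<xi>_\<tau>[OF that(1)] that \<zeta>_N by simp
  show "u x t = u' x t" by (rule u[OF x t])
  have "(u' x has_real_derivative p x t) (at t within {0..T})"
    by (rule has_field_derivative_transform_within[OF stripD(4)[OF s x t] zero_less_one t]) (use u x in auto)
  then show "p x t = p' x t"
    using stripD(4)[OF s' x t] at_within_Icc_minus_countable[OF T, of "{}" t] t deriv_on_eqI by (metis Diff_empty countable_empty)
  have "((\<lambda>y. u' y t) has_real_derivative q x t) (at x within I)"
    by (rule has_field_derivative_transform_within[OF stripD(5)[OF s x t] zero_less_one x]) (use u t in auto)
  then show "q x t = q' x t" using stripD(5)[OF s' x t] deriv_on_eqI[OF nontrivial[OF x]] by metis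
qed

end

section \<open>Existence on finite and infinite time intervals\<close>

context problem
begin

text \<open>The fixed point for the potentials yields a pair (U, \<Psi>) that is only known to be
  continuous, so U cannot simply be differentiated. Instead the trace \<beta>0 = fi (\<Psi> 0) is
  prescribed for a second, linear system in (u_t, u_x), and u is built from its solution by
  integration in time.\<close>

lemma strip_exists:
  assumes T: "0 < T" shows "\<exists>u p q. strip T u p q"
proof -
  have T0: "0 \<le> T" and T00: "0 \<in> {0..T}" using T by auto
  have zeroZ: "0 \<in> {0..\<zeta> N}" using Z_pos by simp
  interpret D: layered_data N \<zeta> \<gamma> b E m \<beta> "\<lambda>z. u0 (\<xi> z)" "\<lambda>z. \<psi>0 (\<xi> z)" T "Bnl T" by (rule nl_data[OF T0])
  obtain U \<Psi> where U: "D.solves U \<Psi>" using D.solution_exists by blast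
  then have Uc: "continuous_on ({0..\<zeta> N} \<times> {0..T}) (\<lambda>(z, t). U z t)" "continuous_on ({0..\<zeta> N} \<times> {0..T}) (\<lambda>(z, t). \<Psi> z t)"
    and Ui: "\<And>z. z \<in> {0..\<zeta> N} \<Longrightarrow> U z 0 = u0 (\<xi> z)" "\<And>z. z \<in> {0..\<zeta> N} \<Longrightarrow> \<Psi> z 0 = \<psi>0 (\<xi> z)"
    and Um: "mildP T U \<Psi>" "mildM T U \<Psi>"
    and Ub: "\<And>t. t \<in> {0..T} \<Longrightarrow> U (\<zeta> N) t = 0" "\<And>t. t \<in> {0..T} \<Longrightarrow> U 0 t = Bnl T (\<lambda>s. U 0 s + \<gamma> 0 0 * \<Psi> 0 s) t"
    unfolding D.solves_def by auto
  define \<beta>0 where "\<beta>0 t = fi (\<Psi> 0 t)" for t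
  have U0c: "continuous_on {0..T} (U 0)" "continuous_on {0..T} (\<Psi> 0)" by (rule slice_cont[OF Uc(1) zeroZ], rule slice_cont[OF Uc(2) zeroZ])
  have \<beta>0c: "continuous_on {0..T} \<beta>0" unfolding \<beta>0_def by (rule continuous_on_compose2[OF f_props(3) U0c(2)]) simp
  have \<beta>00: "\<beta>0 0 = u1 0" unfolding \<beta>0_def using Ui(2)[OF zeroZ] \<xi>_ends f_props(4) by (simp add: \<psi>0_def)
  \<comment> \<open>The fixed point relation for \<open>Bnl\<close> says that \<beta>0 is the time
    derivative of the trace of U, in integrated form.\<close>
  have U0: "U 0 t = u0 0 + integral {0..t} \<beta>0" if t: "t \<in> {0..T}" for t
  proof -
    let ?A = "\<lambda>s. U 0 s + \<gamma> 0 0 * \<Psi> 0 s"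
    have Ac: "continuous_on {0..T} ?A" by (intro continuous_intros U0c)
    have "U 0 t = u0 0 + integral {0..t} (\<lambda>s. h_bc (?A s - Bnl T ?A s))" using Ub(2)[OF t] Bnl_eq(2)[OF T0 Ac t] by simp
    also have "integral {0..t} (\<lambda>s. h_bc (?A s - Bnl T ?A s)) = integral {0..t} \<beta>0"
    proof (rule integral_cong)
      fix s assume "s \<in> {0..t}"
      then have "Bnl T ?A s = U 0 s" using Ub(2)[of s] t by simp
      then show "h_bc (?A s - Bnl T ?A s) = \<beta>0 s" unfolding h_bc_def \<beta>0_def using \<gamma>00 by simp
    qed
    finally show ?thesis .
  qed
  have cc: "causal (\<lambda>A. \<phi>) T" if "continuous_on {0..T} \<phi>" for \<phi>
    unfolding causal_def using that by (auto intro: order_trans[OF abs_ge_zero])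
  interpret D2: layered_data N \<zeta> \<gamma> b E m \<beta> "\<lambda>z. u1 (\<xi> z)" "\<lambda>z. du0 (\<xi> z)" T "\<lambda>A. \<beta>0"
    by unfold_locales (use T0 data_cont cc[OF \<beta>0c] \<beta>00 \<xi>_ends compat1 in \<open>auto simp: \<zeta>_N\<close>)
  obtain P Q where PQ: "D2.solves P Q" using D2.solution_exists by blast
  then have Pc: "continuous_on ({0..\<zeta> N} \<times> {0..T}) (\<lambda>(z, t). P z t)" "continuous_on ({0..\<zeta> N} \<times> {0..T}) (\<lambda>(z, t). Q z t)"
    and Pi: "\<And>z. z \<in> {0..\<zeta> N} \<Longrightarrow> P z 0 = u1 (\<xi> z)" "\<And>z. z \<in> {0..\<zeta> N} \<Longrightarrow> Q z 0 = du0 (\<xi> z)"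
    and Pm: "mildP T P Q" "mildM T P Q"
    and Pb: "\<And>t. t \<in> {0..T} \<Longrightarrow> P (\<zeta> N) t = 0" "\<And>t. t \<in> {0..T} \<Longrightarrow> P 0 t = \<beta>0 t"
    unfolding D2.solves_def by auto
  define p where "p x t = P (\<tau> x) t" for x t
  define q where "q x t = Q (\<tau> x) t" for x t
  define u where "u x t = u0 x + integral {0..t} (p x)" for x and t :: real
  have u_0: "u x 0 = u0 x" for x unfolding u_def by simp
  have pc: "continuous_on (I \<times> {0..T}) (\<lambda>(x, t). p x t)" and qc: "continuous_on (I \<times> {0..T}) (\<lambda>(x, t). q x t)"
    unfolding p_def q_def by (rule \<tau>_rect_cont[OF Pc(1)], rule \<tau>_rect_cont[OF Pc(2)])
  have m: "mildP T (\<lambda>z. p (\<xi> z)) (\<lambda>z. q (\<xi> z))" "mildM T (\<lambda>z. p (\<xi> z)) (\<lambda>z. q (\<xi> z))"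
    using mild_cong(1)[OF _ Pm(1)] mild_cong(2)[OF _ Pm(2)] \<tau>_\<xi> unfolding p_def q_def \<zeta>_N by simp_all
  have uc: "continuous_on (I \<times> {0..T}) (\<lambda>(x, t). u x t)"
  proof -
    have "continuous_on (I \<times> {0..T}) (\<lambda>x. u0 (fst x))"
      by (rule continuous_on_compose2[OF u0_cont]) (auto intro!: continuous_intros)
    then show ?thesis using integral_rect_cont[OF pc] unfolding u_def split_beta by (intro continuous_intros) auto
  qed
  have ut: "(u x has_real_derivative p x t) (at t within {0..T})" if x: "x \<in> I" and t: "t \<in> {0..T}" for x t
  proof -
    have "((\<lambda>t. u0 x + integral {0..t} (p x)) has_real_derivative 0 + p x t) (at t within {0..T})"
      by (intro derivative_intros integral_has_real_derivative x_slice[OF pc x] t)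
    then show ?thesis unfolding u_def[abs_def] by simp
  qed
  have init: "p x 0 = u1 x" "q x 0 = du0 x" if "x \<in> I" for x
    using Pi[of "\<tau> x"] \<tau>_in[OF that] \<xi>_\<tau>[OF that] \<zeta>_N unfolding p_def q_def by auto
  have ux_eq: "u x t = u 0 t + integral {0..x} (\<lambda>y. q y t)" if x: "x \<in> I" and t: "t \<in> {0..T}" for x t
  proof -
    have x0: "0 \<le> x" "{0..x} \<subseteq> I" using x unfolding I_def by auto
    have pi: "p y integrable_on {0..t}" if "y \<in> I" for y
      by (rule integrable_continuous_real, rule continuous_on_subset[OF x_slice[OF pc that]]) (use t in auto)
    have "integral {0..t} (\<lambda>s. p x s - p 0 s) = integral {0..x} (\<lambda>y. q y t) - integral {0..x} (\<lambda>y. q y 0)"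
      by (rule strain_balance[OF m pc qc zero_I x x0(1) t])
    moreover have "integral {0..t} (\<lambda>s. p x s - p 0 s) = integral {0..t} (p x) - integral {0..t} (p 0)"
      by (rule integral_diff[OF pi[OF x] pi[OF zero_I]])
    moreover have "integral {0..x} (\<lambda>y. q y 0) = integral {0..x} du0"
      by (rule integral_cong) (use init(2) x0 in auto)
    moreover have "(du0 has_integral u0 x - u0 0) {0..x}"
      by (rule integral_of_derivative_within[of L]) (use du0 x in \<open>auto simp: I_def\<close>)
    then have "integral {0..x} du0 = u0 x - u0 0" by (rule integral_unique)
    ultimately show ?thesis unfolding u_def by simp
  qed
  have ux: "((\<lambda>y. u y t) has_real_derivative q x t) (at x within I)" if x: "x \<in> I" and t: "t \<in> {0..T}" for x t
  proof -
    have "continuous_on {0..L} (\<lambda>y. q y t)" using t_slice[OF qc t] unfolding I_def .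
    then have "((\<lambda>x. u 0 t + integral {0..x} (\<lambda>y. q y t)) has_real_derivative 0 + q x t) (at x within {0..L})"
      by (intro derivative_intros integral_has_real_derivative) (use x in \<open>auto simp: I_def\<close>)
    then have "((\<lambda>x. u 0 t + integral {0..x} (\<lambda>y. q y t)) has_real_derivative q x t) (at x within I)" unfolding I_def by simp
    then show ?thesis
      by (rule has_field_derivative_transform_within[OF _ zero_less_one x]) (use ux_eq t in simp)
  qed
  have bal: "pot q x t = pot q 0 t + integral {0..x} (\<lambda>y. V y * p y t)" if "x \<in> I" "t \<in> {0..T}" for x t
  proof (rule pot_balance[OF m(1) pc qc _ init(1) that])
    fix k z t1 t2 assume kz: "k < N" "z \<in> {\<zeta> k<..<\<zeta> (Suc k)}" "z \<notin> E" "0 < t1" "t1 \<le> t2" "t2 < T"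
    show "((\<lambda>y. integral {t1..t2} (p (\<xi> y))) has_real_derivative \<gamma> k z * (q (\<xi> z) t2 - q (\<xi> z) t1)) (at z)"
      by (rule mild_integral_deriv(1)[OF m \<xi>_rect_cont[OF pc] \<xi>_rect_cont[OF qc] kz])
  qed
  note pm = pair_mild[OF uc pc qc ut ux bal]
  have uL: "u L t = 0" if t: "t \<in> {0..T}" for t
  proof -
    have "integral {0..t} (p L) = integral {0..t} (\<lambda>_. 0)"
      by (rule integral_cong) (use Pb(1) t in \<open>auto simp: p_def \<zeta>_N\<close>)
    then show ?thesis unfolding u_def using compat0 by simp
  qed
  have p0: "p 0 t = \<beta>0 t" if "t \<in> {0..T}" for t unfolding p_def \<tau>_0 by (rule Pb(2)[OF that])
  have u0t: "u 0 t = u0 0 + integral {0..t} \<beta>0" if t: "t \<in> {0..T}" for t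
    unfolding u_def using integral_cong[of "{0..t}" "p 0" \<beta>0] p0 t by simp
  let ?B = "\<lambda>t. u0 0 + integral {0..t} \<beta>0"
  have Bc: "continuous_on {0..T} ?B"
    by (intro continuous_intros indefinite_integral_continuous_1 integrable_continuous_real \<beta>0c)
  \<comment> \<open>A third system prescribes the trace of U. Both (U, \<Psi>) and the potentials
    (u, \<open>pot q\<close>) built from the second system solve it. Uniqueness identifies \<Psi> 0
    with \<open>pot q 0\<close>, which returns from the prescribed trace to the nonlinear boundary
    condition.\<close>
  interpret D3: layered_data N \<zeta> \<gamma> b E m \<beta> "\<lambda>z. u0 (\<xi> z)" "\<lambda>z. \<psi>0 (\<xi> z)" T "\<lambda>A. ?B"
    by unfold_locales (use T0 data_cont cc[OF Bc] \<xi>_ends compat0 in \<open>auto simp: \<zeta>_N\<close>)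
  have 1: "D3.solves U \<Psi>" unfolding D3.solves_def using Uc Um Ui Ub(1) U0 by auto
  have 2: "D3.solves (\<lambda>z. u (\<xi> z)) (\<lambda>z. pot q (\<xi> z))" unfolding D3.solves_def
    using \<xi>_rect_cont[OF uc] \<xi>_rect_cont[OF pot_props(1)[OF qc]] pm uL u0t \<xi>_ends
    by (auto simp: \<zeta>_N pot_0) (simp add: u_def)
  have pot0: "pot q 0 t = \<Psi> 0 t" if t: "t \<in> {0..T}" for t
    using D3.solution_unique(2)[OF 2 1 zeroZ t] \<xi>_ends by simp
  have fp: "f (p 0 t) = pot q 0 t" if t: "t \<in> {0..T}" for t
    using p0[OF t] pot0[OF t] f_props(5) unfolding \<beta>0_def by simp
  have "strip T u p q" unfolding strip_def
  proof (intro conjI ballI)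
    fix t assume t: "t \<in> {0..T}"
    show "((\<lambda>s. f (p 0 s)) has_real_derivative q 0 t) (at t within {0..T})"
      by (rule has_field_derivative_transform_within[OF pot_props(2)[OF qc zero_I t] zero_less_one t]) (use fp in simp)
  qed (use uc pc qc ut ux m uL init in \<open>auto simp: u_0\<close>)
  then show ?thesis by blast
qed

lemma strip_mono:
  assumes s: "strip T u p q" and T: "T' \<le> T" shows "strip T' u p q"
  unfolding strip_def
proof (intro conjI ballI)
  have sub: "{0..T'} \<subseteq> {0..T}" using T by auto
  then have sub2: "I \<times> {0..T'} \<subseteq> I \<times> {0..T}" by auto
  show "continuous_on (I \<times> {0..T'}) (\<lambda>(x, t). u x t)" "continuous_on (I \<times> {0..T'}) (\<lambda>(x, t). p x t)"
     "continuous_on (I \<times> {0..T'}) (\<lambda>(x, t). q x t)" using stripD(1,2,3)[OF s] continuous_on_subset[OF _ sub2] by blast+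
  show "mildP T' (\<lambda>z. p (\<xi> z)) (\<lambda>z. q (\<xi> z))"
    using stripD(6)[OF s] T unfolding mildP_def by (meson order_trans)
  show "u x 0 = u0 x" "p x 0 = u1 x" if "x \<in> I" for x using stripD(9,10)[OF s that] by auto
  fix t assume t: "t \<in> {0..T'}"
  then have t': "t \<in> {0..T}" using sub by blast
  show "((\<lambda>s. f (p 0 s)) has_real_derivative q 0 t) (at t within {0..T'})" "u L t = 0"
    using DERIV_subset[OF stripD(7)[OF s t'] sub] stripD(8)[OF s t'] by auto
  fix x assume x: "x \<in> I"
  show "(u x has_real_derivative p x t) (at t within {0..T'})" "((\<lambda>y. u y t) has_real_derivative q x t) (at x within I)"
    using DERIV_subset[OF stripD(4)[OF s x t'] sub] stripD(5)[OF s x t'] by auto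
qed

lemma strip_cong:
  assumes s: "strip T u p q" and T: "0 \<le> T"
    and eq: "\<And>x t. x \<in> I \<Longrightarrow> t \<in> {0..T} \<Longrightarrow> u x t = u' x t \<and> p x t = p' x t \<and> q x t = q' x t"
  shows "strip T u' p' q'"
  unfolding strip_def
proof (intro conjI ballI)
  show "continuous_on (I \<times> {0..T}) (\<lambda>(x, t). u' x t)"
    by (rule continuous_on_cong[THEN iffD1, rotated -1, OF stripD(1)[OF s]]) (use eq in auto)
  show "continuous_on (I \<times> {0..T}) (\<lambda>(x, t). p' x t)"
    by (rule continuous_on_cong[THEN iffD1, rotated -1, OF stripD(2)[OF s]]) (use eq in auto)
  show "continuous_on (I \<times> {0..T}) (\<lambda>(x, t). q' x t)"
    by (rule continuous_on_cong[THEN iffD1, rotated -1, OF stripD(3)[OF s]]) (use eq in auto)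
  show "mildP T (\<lambda>z. p' (\<xi> z)) (\<lambda>z. q' (\<xi> z))"
    by (rule mild_cong(1)[OF _ stripD(6)[OF s]]) (use eq \<xi>_in \<zeta>_N in auto)
  show "u' x 0 = u0 x" "p' x 0 = u1 x" if "x \<in> I" for x using stripD(9,10)[OF s that] eq[OF that, of 0] T by auto
  fix t assume t: "t \<in> {0..T}"
  show "((\<lambda>s. f (p' 0 s)) has_real_derivative q' 0 t) (at t within {0..T})"
    using has_field_derivative_transform_within[OF stripD(7)[OF s t] zero_less_one t, of "\<lambda>s. f (p' 0 s)"] eq[OF zero_I] t by auto
  show "u' L t = 0" using stripD(8)[OF s t] eq[OF L_I t] by simp
  fix x assume x: "x \<in> I"
  show "(u' x has_real_derivative p' x t) (at t within {0..T})"
    using has_field_derivative_transform_within[OF stripD(4)[OF s x t] zero_less_one t, of "u' x"] eq[OF x] t by auto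
  show "((\<lambda>y. u' y t) has_real_derivative q' x t) (at x within I)"
    using has_field_derivative_transform_within[OF stripD(5)[OF s x t] zero_less_one x, of "\<lambda>y. u' y t"] eq t x by auto
qed

lemma global_strip: "\<exists>u p q. \<forall>T>0. strip T u p q"
proof -
  have "\<forall>n. \<exists>u p q. strip (real (Suc n)) u p q" using strip_exists by simp
  then obtain U P Q where S: "\<And>n. strip (real (Suc n)) (U n) (P n) (Q n)" by metis
  \<comment> \<open>At time t the solution with horizon Suc (n t) is used. This horizon is at least
    t and positive even for t = 0, and uniqueness makes solutions with different horizons agree
    where both exist.\<close>
  define n where "n t = nat \<lceil>t\<rceil>" for t :: real
  define u where "u x t = U (n t) x t" for x t
  define p where "p x t = P (n t) x t" for x t
  define q where "q x t = Q (n t) x t" for x t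
  have "strip T u p q" if T: "0 < T" for T
  proof (rule strip_cong)
    have nt: "t \<le> real (Suc (n t))" for t unfolding n_def by linarith
    show "strip T (U (n T)) (P (n T)) (Q (n T))" by (rule strip_mono[OF S nt])
    show "0 \<le> T" using T by simp
    fix x t assume x: "x \<in> I" and t: "t \<in> {0..T}"
    have le: "n t \<le> n T" unfolding n_def using t by (intro nat_mono ceiling_mono) simp
    then have s1: "strip (real (Suc (n t))) (U (n T)) (P (n T)) (Q (n T))" by (intro strip_mono[OF S]) simp
    have tn: "t \<in> {0..real (Suc (n t))}" using nt[of t] t by simp
    show "U (n T) x t = u x t \<and> P (n T) x t = p x t \<and> Q (n T) x t = q x t"
      using strip_unique[OF _ s1 S x tn] unfolding u_def p_def q_def by simp
  qed
  then show ?thesis by blast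
qed

section \<open>Equivalence with the global notion of solution\<close>

lemma at_within_half_line: "0 \<le> t \<Longrightarrow> at t within {0..} = at t within {0..t + 1}" for t :: real
  by (rule at_within_nhd[of _ "{..<t + 1}"]) auto

lemma half_line_nontrivial: "0 \<le> t \<Longrightarrow> at t within {0..} \<noteq> bot" for t :: real
  using at_within_Icc_minus_countable[of "t + 1" "{}" t] unfolding at_within_half_line by simp

lemma continuous_on_half_strip:
  assumes "\<And>T. 0 < T \<Longrightarrow> continuous_on (I \<times> {0..T}) (\<lambda>(x, t). p x t)"
  shows "continuous_on (I \<times> {0..}) (\<lambda>(x, t :: real). p x t)"
  unfolding continuous_on_eq_continuous_within
proof
  fix y assume y: "y \<in> I \<times> {0 :: real..}"
  obtain x t where xt: "y = (x, t)" "x \<in> I" "0 \<le> t" using y by auto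
  have "continuous (at y within I \<times> {0..t + 1}) (\<lambda>(x, t). p x t)"
    using assms[of "t + 1"] xt unfolding continuous_on_eq_continuous_within by auto
  moreover have "at y within I \<times> {0..} = at y within I \<times> {0..t + 1}"
    by (rule at_within_nhd[of _ "UNIV \<times> {..<t + 1}"]) (use xt in \<open>auto intro: open_Times\<close>)
  ultimately show "continuous (at y within I \<times> {0..}) (\<lambda>(x, t). p x t)" by simp
qed

text \<open>A good point inside I is not a node, and at 0 or L the adjacent layer is a neighbourhood
  relative to the interval. Near a good point a single coefficient \<gamma> k therefore describes
  c.\<close>

lemma good_nbhd:
  assumes x: "x \<in> G"
  shows "\<exists>k d. k < N \<and> 0 < d \<and> \<tau> x \<in> {\<zeta> k..\<zeta> (Suc k)} \<and> (\<forall>z\<in>{0..\<zeta> N}. \<bar>z - \<tau> x\<bar> < d \<longrightarrow> z \<in> {\<zeta> k..\<zeta> (Suc k)})"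
proof -
  have xI: "x \<in> I" using G_props(1)[OF x] .
  consider "x = 0" | "x = L" | "x \<in> {0<..<L}" using xI unfolding I_def by fastforce
  then show ?thesis
  proof cases
    case 1
    have "0 < \<zeta> (Suc 0)" using \<zeta>_less[OF N_pos] \<zeta>0 by simp
    then show ?thesis using 1 \<tau>_0 \<zeta>0 N_pos by (intro exI[of _ 0] exI[of _ "\<zeta> (Suc 0)"]) auto
  next
    case 2
    obtain j where j: "N = Suc j" using N_pos by (cases N) auto
    then have l: "\<zeta> j < \<zeta> (Suc j)" by (intro \<zeta>_less) simp
    show ?thesis using 2 \<zeta>_N j l by (intro exI[of _ j] exI[of _ "\<zeta> (Suc j) - \<zeta> j"]) auto
  next
    case 3
    obtain k where k: "k < N" "\<tau> x \<in> {\<zeta> k<..<\<zeta> (Suc k)}" using open_piece_ex[OF 3 x] by blast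
    then show ?thesis by (intro exI[of _ k] exI[of _ "min (\<tau> x - \<zeta> k) (\<zeta> (Suc k) - \<tau> x)"]) auto
  qed
qed

text \<open>Every admissible curve is locally a characteristic: its time component is t0 + s, and s
  + \<tau> (X s) has derivative zero, so X s = \<xi> (\<tau> x0 - s). The derivative along it is
  then given by \<open>char_deriv_plus\<close>.\<close>

lemma strip_deriv_along:
  assumes s: "\<And>T. 0 < T \<Longrightarrow> strip T u p q" and x0: "x0 \<in> G" and t0: "0 \<le> t0"
    and w: "\<And>y t. y \<in> I \<Longrightarrow> 0 \<le> t \<Longrightarrow> w (y, t) = p y t + c y * q y t"
  shows "has_deriv_along (\<lambda>(y, s). (- c y, 1)) (I \<times> {0..}) w (- c x0 * c' x0 * q x0 t0) (x0, t0)"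
  unfolding has_deriv_along_def
proof (intro allI impI, elim conjE)
  fix \<kappa> :: "real \<Rightarrow> real \<times> real" and J
  assume J: "is_interval J" "0 \<in> J" "\<kappa> 0 = (x0, t0)"
    and \<kappa>: "\<forall>s\<in>J. \<kappa> s \<in> I \<times> {0..} \<and> (\<kappa> has_vector_derivative (case \<kappa> s of (y, s) \<Rightarrow> (- c y, 1))) (at s within J)"
  define X where "X s = fst (\<kappa> s)" for s
  define R where "R s = snd (\<kappa> s)" for s
  have kap: "\<kappa> s = (X s, R s)" for s unfolding X_def R_def by simp
  have XI: "X s \<in> I" "0 \<le> R s" if "s \<in> J" for s using \<kappa> that unfolding X_def R_def by (auto simp: mem_Times_iff)
  have Xd: "(X has_real_derivative - c (X s)) (at s within J)" and Rd: "(R has_real_derivative 1) (at s within J)" if "s \<in> J" for s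
  proof -
    have v: "(\<kappa> has_vector_derivative (- c (X s), 1)) (at s within J)" using \<kappa> that unfolding X_def by (auto simp: split_beta)
    show "(X has_real_derivative - c (X s)) (at s within J)" unfolding X_def[abs_def] has_real_derivative_iff_has_vector_derivative
      using bounded_linear.has_vector_derivative[OF bounded_linear_fst v] by (simp add: X_def)
    show "(R has_real_derivative 1) (at s within J)" unfolding R_def[abs_def] has_real_derivative_iff_has_vector_derivative
      using bounded_linear.has_vector_derivative[OF bounded_linear_snd v] by simp
  qed
  have X0: "X 0 = x0" "R 0 = t0" using J(3) unfolding X_def R_def by auto
  have cvx: "convex J" using J(1) is_interval_convex by blast
  have Rs: "R s = t0 + s" if sJ: "s \<in> J" for s
  proof -
    have "((\<lambda>s. R s - s) has_real_derivative 0) (at s within J)" if "s \<in> J" for s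
      using DERIV_diff[OF Rd[OF that] DERIV_ident] by simp
    from has_field_derivative_zero_constant[OF cvx this]
    obtain a where a: "\<And>s. s \<in> J \<Longrightarrow> R s - s = a" by blast
    from a[OF sJ] a[OF J(2)] X0 show ?thesis by simp
  qed
  let ?z0 = "\<tau> x0"
  have xI: "x0 \<in> I" "x0 \<notin> F" using G_props(1,2)[OF x0] by auto
  obtain r where r: "0 < r" "\<And>y. y \<in> F \<Longrightarrow> r \<le> \<bar>y - x0\<bar>"
  proof -
    obtain r where "0 < r" "\<forall>y\<in>F. y \<noteq> x0 \<longrightarrow> r \<le> dist x0 y" using finite_set_avoid[OF finite_F, of x0] by blast
    then show thesis using that[of r] xI by (metis dist_real_def abs_minus_commute)
  qed
  have "continuous (at 0 within J) X" using Xd[OF J(2)] by (rule DERIV_continuous)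
  then obtain d where d: "0 < d" "\<And>s. s \<in> J \<Longrightarrow> \<bar>s\<bar> < d \<Longrightarrow> \<bar>X s - x0\<bar> < r"
    using r(1) X0 unfolding continuous_within_eps_delta dist_real_def by (metis diff_zero)
  \<comment> \<open>The curve is restricted to parameters for which it avoids the jumps, where
    \<tau> is differentiable along it.\<close>
  define J' where "J' = J \<inter> {-d<..<d}"
  have J': "convex J'" "0 \<in> J'" "J' \<subseteq> J" unfolding J'_def using cvx J(2) d(1) by (auto intro: convex_Int)
  have XF: "X s \<notin> F" if "s \<in> J'" for s
    using r(2)[of "X s"] d(2)[of s] that unfolding J'_def by force
  have \<tau>X: "\<tau> (X s) = ?z0 - s" if sJ: "s \<in> J'" for s
  proof -
    have "((\<lambda>s. \<tau> (X s) + s) has_real_derivative 0) (at s within J')" if s: "s \<in> J'" for s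
    proof -
      have sJ: "s \<in> J" using s J'(3) by blast
      have "(\<tau> has_real_derivative 1 / c (X s)) (at (X s) within X ` J')"
        by (rule DERIV_subset[OF \<tau>_deriv[OF XI(1)[OF sJ] XF[OF s]]]) (use XI J'(3) in auto)
      from DERIV_image_chain[OF this DERIV_subset[OF Xd[OF sJ] J'(3)]]
      have "((\<lambda>s. \<tau> (X s)) has_real_derivative - 1) (at s within J')" using c_pos[OF XI(1)[OF sJ]] by (simp add: o_def)
      from DERIV_add[OF this DERIV_ident] show ?thesis by simp
    qed
    from has_field_derivative_zero_constant[OF J'(1) this]
    obtain a where a: "\<And>s. s \<in> J' \<Longrightarrow> \<tau> (X s) + s = a" by blast
    from a[OF sJ] a[OF J'(2)] X0 show ?thesis by simp
  qed
  have Xs: "X s = \<xi> (?z0 - s)" "?z0 - s \<in> {0..\<zeta> N}" if "s \<in> J'" for s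
    using \<xi>_\<tau>[of "X s"] \<tau>_in[of "X s"] \<tau>X[OF that] XI(1)[of s] that J'(3) \<zeta>_N by auto
  obtain k d2 where k: "k < N" "0 < d2" "?z0 \<in> {\<zeta> k..\<zeta> (Suc k)}"
      "\<And>z. z \<in> {0..\<zeta> N} \<Longrightarrow> \<bar>z - ?z0\<bar> < d2 \<Longrightarrow> z \<in> {\<zeta> k..\<zeta> (Suc k)}" using good_nbhd[OF x0] by blast
  have wk: "w (\<kappa> s) = p (\<xi> (?z0 - s)) (t0 + s) + \<gamma> k (?z0 - s) * q (\<xi> (?z0 - s)) (t0 + s)" "?z0 - s \<in> {\<zeta> k..\<zeta> (Suc k)}"
    if s: "s \<in> J'" "\<bar>s\<bar> < d2" for s
  proof -
    show z: "?z0 - s \<in> {\<zeta> k..\<zeta> (Suc k)}" by (rule k(4)[OF Xs(2)[OF s(1)]]) (use s in simp)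
    have sJ: "s \<in> J" using s J'(3) by blast
    have "\<gamma> k (?z0 - s) = c (X s)"
      using g_eq_c[OF k(1) \<xi>_piece[OF k(1) z]] XF[OF s(1)] Xs(1)[OF s(1)] unfolding \<gamma>_def by simp
    then show "w (\<kappa> s) = p (\<xi> (?z0 - s)) (t0 + s) + \<gamma> k (?z0 - s) * q (\<xi> (?z0 - s)) (t0 + s)"
      using w[OF XI[OF sJ]] Rs[OF sJ] Xs(1)[OF s(1)] unfolding kap by simp
  qed
  let ?T = "t0 + 1"
  have T: "0 < ?T" using t0 by simp
  have bz: "b ?z0 = c x0 * c' x0" using \<tau>_notE[OF x0] \<tau>_in[OF xI(1)] \<xi>_\<tau>[OF xI(1)] by (simp add: b_def)
  show "((\<lambda>s. w (\<kappa> s)) has_real_derivative - c x0 * c' x0 * q x0 t0) (at 0 within J)"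
    unfolding has_field_derivative_def has_derivative_within_alt2
  proof (intro conjI allI impI)
    show "bounded_linear ((*) (- c x0 * c' x0 * q x0 t0))" by (rule bounded_linear_mult_right)
    fix e :: real assume "0 < e"
    from char_deriv_plus[OF stripD(6)[OF s[OF T]] \<xi>_rect_cont[OF stripD(3)[OF s[OF T]]] k(1,3) \<tau>_notE[OF x0] this]
    obtain \<eta> where \<eta>: "0 < \<eta>" "\<And>s t. \<bar>s\<bar> < \<eta> \<Longrightarrow> ?z0 - s \<in> {\<zeta> k..\<zeta> (Suc k)} \<Longrightarrow> t \<in> {0..?T} \<Longrightarrow> t + s \<in> {0..?T} \<Longrightarrow>
       \<bar>(p (\<xi> (?z0 - s)) (t + s) + \<gamma> k (?z0 - s) * q (\<xi> (?z0 - s)) (t + s)) - (p (\<xi> ?z0) t + \<gamma> k ?z0 * q (\<xi> ?z0) t) + s * (b ?z0 * q (\<xi> ?z0) t)\<bar> \<le> e * \<bar>s\<bar>"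
      by blast
    define \<rho> where "\<rho> = Min {\<eta>, d, d2, 1}"
    have \<rho>: "0 < \<rho>" "\<rho> \<le> \<eta>" "\<rho> \<le> d" "\<rho> \<le> d2" "\<rho> \<le> 1" unfolding \<rho>_def using \<eta>(1) d(1) k(2) by auto
    have main: "\<bar>w (\<kappa> s) - w (\<kappa> 0) - - c x0 * c' x0 * q x0 t0 * (s - 0)\<bar> \<le> e * \<bar>s - 0\<bar>" if sJ: "s \<in> J" "\<bar>s\<bar> < \<rho>" for s
    proof -
      have s': "s \<in> J'" "\<bar>s\<bar> < d2" using sJ \<rho> unfolding J'_def by auto
      have "t0 + s \<in> {0..?T}" using XI(2)[OF sJ(1)] Rs[OF sJ(1)] sJ(2) \<rho>(5) by auto
      then have "\<bar>(p (\<xi> (?z0 - s)) (t0 + s) + \<gamma> k (?z0 - s) * q (\<xi> (?z0 - s)) (t0 + s)) - (p (\<xi> ?z0) t0 + \<gamma> k ?z0 * q (\<xi> ?z0) t0) + s * (b ?z0 * q (\<xi> ?z0) t0)\<bar> \<le> e * \<bar>s\<bar>"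
        by (intro \<eta>(2)) (use sJ \<rho> wk(2)[OF s'] t0 in auto)
      then show ?thesis using wk(1)[OF s'] wk(1)[OF J'(2)] k(2) \<xi>_\<tau>[OF xI(1)] bz by (simp add: algebra_simps)
    qed
    show "\<forall>\<^sub>F s in at 0 within J. norm (w (\<kappa> s) - w (\<kappa> 0) - - c x0 * c' x0 * q x0 t0 * (s - 0)) \<le> e * norm (s - 0)"
      unfolding eventually_at by (intro exI[of _ \<rho>]) (use main \<rho>(1) in \<open>auto simp: dist_real_def\<close>)
  qed
qed

lemma strip_imp_global:
  assumes s: "\<And>T. 0 < T \<Longrightarrow> strip T u p q"
  shows "global_C1_solution L V f u0 u1 u" and "\<And>x t. x \<in> I \<Longrightarrow> 0 \<le> t \<Longrightarrow> dt u x t = p x t \<and> dx L u x t = q x t"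
proof -
  have ut: "(u x has_real_derivative p x t) (at t within {0..})" if "x \<in> I" "0 \<le> t" for x t
    using stripD(4)[OF s[of "t + 1"] that(1), of t] that unfolding at_within_half_line[OF that(2)] by simp
  have ux: "((\<lambda>y. u y t) has_real_derivative q x t) (at x within I)" if "x \<in> I" "0 \<le> t" for x t
    using stripD(5)[OF s[of "t + 1"] that(1), of t] that by simp
  show d: "dt u x t = p x t \<and> dx L u x t = q x t" if "x \<in> I" "0 \<le> t" for x t
    unfolding dt_def dx_def I_def[symmetric]
    using deriv_on_eqI[OF half_line_nontrivial[OF that(2)] ut[OF that]] deriv_on_eqI[OF nontrivial[OF that(1)] ux[OF that]] by simp
  have "C1_strip L u" unfolding C1_strip_def I_def[symmetric]
  proof (intro conjI ballI)
    show "continuous_on (I \<times> {0..}) (\<lambda>(x, t). u x t)" by (rule continuous_on_half_strip[OF stripD(1)[OF s]])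
    have "continuous_on (I \<times> {0..}) (\<lambda>(x, t). q x t)" by (rule continuous_on_half_strip[OF stripD(3)[OF s]])
    then show "continuous_on (I \<times> {0..}) (\<lambda>(x, t). dx L u x t)"
      by (rule continuous_on_cong[THEN iffD1, rotated -1]) (use d in auto)
    have "continuous_on (I \<times> {0..}) (\<lambda>(x, t). p x t)" by (rule continuous_on_half_strip[OF stripD(2)[OF s]])
    then show "continuous_on (I \<times> {0..}) (\<lambda>(x, t). dt u x t)"
      by (rule continuous_on_cong[THEN iffD1, rotated -1]) (use d in auto)
    fix x t assume "x \<in> I" "t \<in> {0 :: real..}"
    then show "(\<lambda>y. u y t) differentiable (at x within I)" "(\<lambda>s. u x s) differentiable (at t within {0..})"
      using ut[of x t] ux[of x t] real_derivative_differentiable by auto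
  qed
  moreover have "has_deriv_along (\<lambda>(y, s). (- c y, 1)) (I \<times> {0..}) (\<lambda>(y, s). dt u y s + c y * dx L u y s)
     (- c x * c' x * dx L u x t) (x, t)" if "x \<in> G" "0 \<le> t" for x t
    using strip_deriv_along[OF s that, of "\<lambda>(y, s). dt u y s + c y * dx L u y s"] d G_props(1)[OF that(1)] that(2) by auto
  moreover have "((\<lambda>s. f (dt u 0 s)) has_real_derivative dx L u 0 t) (at t within {0..})" if t: "0 \<le> t" for t
  proof -
    have "((\<lambda>s. f (p 0 s)) has_real_derivative q 0 t) (at t within {0..})"
      using stripD(7)[OF s[of "t + 1"], of t] t unfolding at_within_half_line[OF t] by simp
    then have "((\<lambda>s. f (p 0 s)) has_real_derivative dx L u 0 t) (at t within {0..})" using d[OF zero_I t] by simp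
    then show ?thesis
      by (rule has_field_derivative_transform_within[OF _ zero_less_one]) (use t d[OF zero_I] in auto)
  qed
  moreover have "u x 0 = u0 x \<and> dt u x 0 = u1 x" if "x \<in> I" for x
    using stripD(9,10)[OF s[of 1] that] d[OF that, of 0] by simp
  moreover have "u L t = 0" if "0 \<le> t" for t using stripD(8)[OF s[of "t + 1"], of t] that by simp
  ultimately show "global_C1_solution L V f u0 u1 u"
    unfolding global_C1_solution_def Let_def c_def[symmetric] I_def[symmetric] c'_def[symmetric] G_def[symmetric] by auto
qed

text \<open>Conversely, the explicit characteristics s \<mapsto> (\<xi> (y - s), t + z' - y + s) are
  inserted into the definition of the directional derivative. This differentiates the invariant at
  every point of the line outside the countable set E, and integrating off E gives
  \<open>mildP\<close>.\<close>

lemma global_imp_strip: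
  assumes v: "global_C1_solution L V f u0 u1 v" and T: "0 < T"
  shows "strip T v (dt v) (dx L v)"
proof -
  have C1: "C1_strip L v" and along: "\<And>x t. x \<in> G \<Longrightarrow> 0 \<le> t \<Longrightarrow>
      has_deriv_along (\<lambda>(y, s). (- c y, 1)) (I \<times> {0..}) (\<lambda>(y, s). dt v y s + c y * dx L v y s) (- c x * c' x * dx L v x t) (x, t)"
    and bc: "\<And>t. 0 \<le> t \<Longrightarrow> ((\<lambda>s. f (dt v 0 s)) has_real_derivative dx L v 0 t) (at t within {0..})"
    and init: "\<And>x. x \<in> I \<Longrightarrow> v x 0 = u0 x \<and> dt v x 0 = u1 x" and vL: "\<And>t. 0 \<le> t \<Longrightarrow> v L t = 0"
    using v unfolding global_C1_solution_def Let_def c_def[symmetric] I_def[symmetric] c'_def[symmetric] G_def[symmetric] by auto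
  have vt: "(v x has_real_derivative dt v x t) (at t within {0..})" and vx: "((\<lambda>y. v y t) has_real_derivative dx L v x t) (at x within I)"
    if "x \<in> I" "0 \<le> t" for x t
    using C1 that unfolding C1_strip_def dt_def dx_def I_def[symmetric] by (auto intro!: deriv_on_works)
  have vc: "continuous_on (I \<times> {0..}) (\<lambda>(x, t). v x t)" "continuous_on (I \<times> {0..}) (\<lambda>(x, t). dt v x t)" "continuous_on (I \<times> {0..}) (\<lambda>(x, t). dx L v x t)"
    using C1 unfolding C1_strip_def I_def by auto
  have sub: "I \<times> {0..T} \<subseteq> I \<times> {0..}" "{0..T} \<subseteq> {0..}" by auto
  note cT = continuous_on_subset[OF vc(1) sub(1)] continuous_on_subset[OF vc(2) sub(1)] continuous_on_subset[OF vc(3) sub(1)]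
  have "mildP T (\<lambda>z. dt v (\<xi> z)) (\<lambda>z. dx L v (\<xi> z))" unfolding mildP_def
  proof (intro allI impI)
    fix k z z' t assume *: "k < N" "\<zeta> k \<le> z" "z \<le> z'" "z' \<le> \<zeta> (Suc k)" "0 \<le> t" "t + (z' - z) \<le> T"
    have pin: "y \<in> {0..\<zeta> N}" "y \<in> {\<zeta> k..\<zeta> (Suc k)}" if "y \<in> {z..z'}" for y using piece_in[OF *(1), of y] that * by auto
    have lc: "continuous_on {z..z'} (\<lambda>y. h (\<xi> y) (t + z' - y))" if "continuous_on (I \<times> {0..T}) (\<lambda>(x, t). h x t)" for h
      by (rule continuous_on_compose2[OF \<xi>_rect_cont[OF that], of _ "\<lambda>y. (y, t + z' - y)", simplified])
         (use pin * in \<open>auto intro!: continuous_intros\<close>)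
    have gc: "continuous_on {z..z'} (\<gamma> k)" by (rule continuous_on_subset[OF \<gamma>_cont[OF *(1)]]) (use * in auto)
    let ?f = "\<lambda>y. dt v (\<xi> y) (t + z' - y) + \<gamma> k y * dx L v (\<xi> y) (t + z' - y)"
    let ?b = "\<lambda>y. b y * dx L v (\<xi> y) (t + z' - y)"
    have "(?b has_integral ?f z' - ?f z) {z..z'}"
    proof (rule ftc_off_countable[OF *(3) countable_E])
      show "continuous_on {z..z'} ?f" by (intro continuous_intros lc cT gc)
      show "?b integrable_on {z..z'}" by (rule integrable_mult_bounded_borel[OF b_meas b_bd lc[OF cT(3)]])
      fix y assume y: "y \<in> {z<..<z'} - E"
      have yk: "y \<in> {\<zeta> k<..<\<zeta> (Suc k)}" and yZ: "y \<in> {0..\<zeta> N}" using y * pin[of y] by auto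
      have yG: "\<xi> y \<in> G" using notE[of y] yZ y \<zeta>_N by auto
      have "(b \<longlongrightarrow> b y) (at y within {z..z'} - E)"
        by (rule tendsto_within_subset[OF b_cont]) (use y yZ pin in auto)
      moreover have "((\<lambda>y. dx L v (\<xi> y) (t + z' - y)) \<longlongrightarrow> dx L v (\<xi> y) (t + z' - y)) (at y within {z..z'} - E)"
        by (rule tendsto_within_subset[of _ _ _ "{z..z'}"]) (use lc[OF cT(3)] y in \<open>auto simp: continuous_on_def\<close>)
      ultimately show "(?b \<longlongrightarrow> ?b y) (at y within {z..z'} - E)" by (intro tendsto_intros)
      \<comment> \<open>Half the distance to the ends keeps the test curve strictly inside the
        segment, hence inside one open layer, with 0 interior to its parameter interval.\<close>
      define r where "r = min (y - z) (z' - y) / 2"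
      have r: "0 < r" using y unfolding r_def by simp
      define J where "J = {-r..r}"
      have at0: "at 0 within J = at 0" by (rule at_within_interior) (use r in \<open>simp add: J_def\<close>)
      have line: "y - s \<in> {z<..<z'}" if "s \<in> J" for s
      proof -
        have "r \<le> (y - z) / 2" "r \<le> (z' - y) / 2" unfolding r_def by simp_all
        moreover have "- r \<le> s" "s \<le> r" "z < y" "y < z'" using that y unfolding J_def by auto
        ultimately have "z < y - s" "y - s < z'" by (simp_all add: field_simps)
        then show ?thesis by simp
      qed
      define \<kappa> where "\<kappa> s = (\<xi> (y - s), t + z' - y + s)" for s
      have \<kappa>d: "\<kappa> s \<in> I \<times> {0..} \<and> (\<kappa> has_vector_derivative (case \<kappa> s of (y, s) \<Rightarrow> (- c y, 1))) (at s within J)" if s: "s \<in> J" for s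
      proof
        have ysk: "y - s \<in> {\<zeta> k<..<\<zeta> (Suc k)}" using line[OF s] * by auto
        have ysZ: "y - s \<in> {0<..<\<tau> L}" by (rule open_piece_in[OF *(1) ysk])
        show "\<kappa> s \<in> I \<times> {0..}" unfolding \<kappa>_def using \<xi>_in[of "y - s"] ysZ line[OF s] * by auto
        have "\<xi> (y - s) \<notin> F" using \<xi>_open_piece[OF *(1) ysk] node_F[OF *(1)] by blast
        then have "(\<xi> has_real_derivative c (\<xi> (y - s))) (at (y - s))" by (rule \<xi>_deriv[OF ysZ])
        moreover have "((\<lambda>s. y - s) has_real_derivative - 1) (at s within J)" by (auto intro!: derivative_eq_intros)
        ultimately have "((\<lambda>s. \<xi> (y - s)) has_real_derivative c (\<xi> (y - s)) * - 1) (at s within J)"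
          by (rule DERIV_chain2)
        then have 1: "((\<lambda>s. \<xi> (y - s)) has_vector_derivative - c (\<xi> (y - s))) (at s within J)"
          by (simp add: has_real_derivative_iff_has_vector_derivative)
        have "((\<lambda>s. t + z' - y + s) has_real_derivative 1) (at s within J)" by (auto intro!: derivative_eq_intros)
        then have 2: "((\<lambda>s. t + z' - y + s) has_vector_derivative 1) (at s within J)"
          by (simp add: has_real_derivative_iff_has_vector_derivative)
        show "(\<kappa> has_vector_derivative (case \<kappa> s of (y, s) \<Rightarrow> (- c y, 1))) (at s within J)"
          unfolding \<kappa>_def using has_vector_derivative_Pair[OF 1 2] by simp
      qed
      have "0 \<le> t + z' - y" using y * by auto
      from along[OF yG this, unfolded has_deriv_along_def, rule_format, of J \<kappa>] \<kappa>d r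
      have "((\<lambda>s. (\<lambda>(y, s). dt v y s + c y * dx L v y s) (\<kappa> s)) has_real_derivative - c (\<xi> y) * c' (\<xi> y) * dx L v (\<xi> y) (t + z' - y)) (at 0 within J)"
        unfolding J_def by (auto simp: \<kappa>_def is_interval_cc)
      then have "((\<lambda>s. ?f (y - s)) has_real_derivative - c (\<xi> y) * c' (\<xi> y) * dx L v (\<xi> y) (t + z' - y)) (at 0 within J)"
      proof (rule has_field_derivative_transform_within[OF _ zero_less_one])
        show "0 \<in> J" unfolding J_def using r by simp
        fix s assume s: "s \<in> J"
        have "y - s \<in> {\<zeta> k<..<\<zeta> (Suc k)}" using line[OF s] * by auto
        then have "\<gamma> k (y - s) = c (\<xi> (y - s))" by (rule \<gamma>_c[OF *(1)])
        then show "(\<lambda>(y, s). dt v y s + c y * dx L v y s) (\<kappa> s) = ?f (y - s)"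
          unfolding \<kappa>_def by (simp add: algebra_simps)
      qed
      then have D: "((\<lambda>s. ?f (y - s)) has_real_derivative - ?b y) (at (y - y))"
        unfolding at0 using yZ y \<zeta>_N by (simp add: b_def)
      have "((\<lambda>y'. y - y') has_real_derivative - 1) (at y)" by (auto intro!: derivative_eq_intros)
      from DERIV_chain2[OF D this] show "(?f has_real_derivative ?b y) (at y)" by simp
    qed
    then have "integral {z..z'} ?b = ?f z' - ?f z" by (rule integral_unique)
    then show "dt v (\<xi> z) (t + (z' - z)) + \<gamma> k z * dx L v (\<xi> z) (t + (z' - z)) =
      dt v (\<xi> z') t + \<gamma> k z' * dx L v (\<xi> z') t - integral {z..z'} (\<lambda>y. b y * dx L v (\<xi> y) (t + z' - y))"
      by (simp add: add_diff_eq)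
  qed
  then show ?thesis unfolding strip_def
    using cT vx init vL DERIV_subset[OF vt sub(2)] DERIV_subset[OF bc sub(2)] by auto
qed

end

section \<open>Conservation of energy\<close>

text \<open>Differentiation under the integral with a weight that is only bounded and Borel: the
  mean value theorem gives an error of at most \<epsilon> \<bar>s - t\<bar> uniformly in x, and the
  weight multiplies it by at most M.\<close>

lemma weighted_leibniz:
  fixes w :: "real \<Rightarrow> real" and a a' :: "real \<Rightarrow> real \<Rightarrow> real"
  assumes w: "w \<in> borel_measurable borel" "\<And>y. \<bar>w y\<bar> \<le> M" and L: "0 \<le> L"
    and a: "continuous_on ({0..L} \<times> {0..T}) (\<lambda>(x, t). a x t)" and a': "continuous_on ({0..L} \<times> {0..T}) (\<lambda>(x, t). a' x t)"
    and d: "\<And>x t. x \<in> {0..L} \<Longrightarrow> t \<in> {0..T} \<Longrightarrow> (a x has_real_derivative a' x t) (at t within {0..T})"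
    and t: "t \<in> {0..T}"
  shows "((\<lambda>s. integral {0..L} (\<lambda>x. w x * a x s)) has_real_derivative integral {0..L} (\<lambda>x. w x * a' x t)) (at t within {0..T})"
  unfolding has_field_derivative_def has_derivative_within_alt2
proof (intro conjI allI impI)
  show "bounded_linear ((*) (integral {0..L} (\<lambda>x. w x * a' x t)))" by (rule bounded_linear_mult_right)
  fix e :: real assume e: "0 < e"
  have M0: "0 \<le> M" using w(2)[of 0] by simp
  define \<epsilon> where "\<epsilon> = e / ((M + 1) * (L + 1))"
  have pos: "0 < (M + 1) * (L + 1)" using M0 L by simp
  have \<epsilon>: "0 < \<epsilon>" "\<epsilon> * ((M + 1) * (L + 1)) = e" unfolding \<epsilon>_def using e pos by auto
  obtain d where dd: "0 < d" "\<And>y z s t. y \<in> {0..L} \<Longrightarrow> z \<in> {0..L} \<Longrightarrow> s \<in> {0..T} \<Longrightarrow> t \<in> {0..T} \<Longrightarrow>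
           \<bar>y - z\<bar> < d \<Longrightarrow> \<bar>s - t\<bar> < d \<Longrightarrow> \<bar>a' y s - a' z t\<bar> \<le> \<epsilon>"
    using uniform_on_rect[OF a' \<epsilon>(1)] by blast
  have sl: "continuous_on {0..L} (\<lambda>x. h x s)" if "continuous_on ({0..L} \<times> {0..T}) (\<lambda>(x, t). h x t)" "s \<in> {0..T}"
    for h :: "real \<Rightarrow> real \<Rightarrow> real" and s
    by (rule continuous_on_compose2[OF that(1), of _ "\<lambda>x. (x, s)", simplified]) (use that(2) in \<open>auto intro!: continuous_intros\<close>)
  have main: "\<bar>integral {0..L} (\<lambda>x. w x * a x s) - integral {0..L} (\<lambda>x. w x * a x t) - integral {0..L} (\<lambda>x. w x * a' x t) * (s - t)\<bar> \<le> e * \<bar>s - t\<bar>"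
    if s: "s \<in> {0..T}" "\<bar>s - t\<bar> < d" for s
  proof -
    let ?\<phi> = "\<lambda>x. a x s - a x t - (s - t) * a' x t"
    have \<phi>: "\<bar>?\<phi> x\<bar> \<le> \<epsilon> * \<bar>s - t\<bar>" if x: "x \<in> {0..L}" for x
    proof -
      let ?J = "{min s t..max s t}"
      have sub: "?J \<subseteq> {0..T}" using s t by auto
      have "norm ((a x s - s * a' x t) - (a x t - t * a' x t)) \<le> \<epsilon> * norm (s - t)"
      proof (rule field_differentiable_bound[of ?J "\<lambda>r. a x r - r * a' x t" "\<lambda>r. a' x r - a' x t"])
        fix r assume r: "r \<in> ?J"
        then have rT: "r \<in> {0..T}" using sub by blast
        show "((\<lambda>r. a x r - r * a' x t) has_field_derivative a' x r - a' x t) (at r within ?J)"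
          using DERIV_subset[OF d[OF x rT] sub] by (auto intro!: derivative_eq_intros)
        have "\<bar>r - t\<bar> < d" using r s(2) by (auto simp: min_def max_def split: if_splits)
        then show "norm (a' x r - a' x t) \<le> \<epsilon>" using dd(2)[OF x x rT t] dd(1) by simp
      qed auto
      then show ?thesis by (simp add: algebra_simps)
    qed
    have \<phi>c: "continuous_on {0..L} ?\<phi>" by (intro continuous_intros sl a a' s t)
    note i = integrable_mult_bounded_borel[OF w sl[OF a s(1)]] integrable_mult_bounded_borel[OF w sl[OF a t]]
      integrable_mult_bounded_borel[OF w sl[OF a' t]]
    have "(\<lambda>x. w x * ?\<phi> x) = (\<lambda>x. (w x * a x s - w x * a x t) - (w x * a' x t) * (s - t))"
      by (simp add: fun_eq_iff algebra_simps)
    moreover have "((\<lambda>x. (w x * a x s - w x * a x t) - (w x * a' x t) * (s - t)) has_integral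
       (integral {0..L} (\<lambda>x. w x * a x s) - integral {0..L} (\<lambda>x. w x * a x t)) - integral {0..L} (\<lambda>x. w x * a' x t) * (s - t)) {0..L}"
      by (intro has_integral_diff has_integral_mult_left integrable_integral i)
    ultimately have "integral {0..L} (\<lambda>x. w x * ?\<phi> x) =
       integral {0..L} (\<lambda>x. w x * a x s) - integral {0..L} (\<lambda>x. w x * a x t) - integral {0..L} (\<lambda>x. w x * a' x t) * (s - t)"
      by (simp add: integral_unique)
    moreover have "\<bar>integral {0..L} (\<lambda>x. w x * ?\<phi> x)\<bar> \<le> M * integral {0..L} (\<lambda>_. \<epsilon> * \<bar>s - t\<bar>)"
      by (rule integral_mult_bounded_borel_bound[OF w \<phi>c]) (use \<phi> in auto)
    moreover have "M * integral {0..L} (\<lambda>_. \<epsilon> * \<bar>s - t\<bar>) \<le> e * \<bar>s - t\<bar>"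
    proof -
      have "M * L \<le> (M + 1) * (L + 1)" using M0 L by (intro mult_mono) auto
      then have "(M * L) * (\<epsilon> * \<bar>s - t\<bar>) \<le> ((M + 1) * (L + 1)) * (\<epsilon> * \<bar>s - t\<bar>)" using \<epsilon>(1) by (intro mult_right_mono) auto
      also have "\<dots> = (\<epsilon> * ((M + 1) * (L + 1))) * \<bar>s - t\<bar>" by (simp only: mult_ac)
      finally have "(M * L) * (\<epsilon> * \<bar>s - t\<bar>) \<le> e * \<bar>s - t\<bar>" by (simp only: \<epsilon>(2))
      then show ?thesis using L by (simp add: mult_ac)
    qed
    ultimately show ?thesis by linarith
  qed
  show "\<forall>\<^sub>F s in at t within {0..T}. norm (integral {0..L} (\<lambda>x. w x * a x s) - integral {0..L} (\<lambda>x. w x * a x t) - integral {0..L} (\<lambda>x. w x * a' x t) * (s - t)) \<le> e * norm (s - t)"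
    unfolding eventually_at by (intro exI[of _ d]) (use main dd(1) in \<open>auto simp: dist_real_def\<close>)
qed

text \<open>Formally the boundary energy is the Stieltjes integral of \<sigma> with respect to f, so
  its increment from a to b lies between a (f b - f a) and b (f b - f a). As f may lack a
  derivative, this is shown by the mean value theorem for an antiderivative of f.\<close>

lemma boundary_energy_diff:
  assumes f: "continuous_on UNIV f" "mono f"
  shows "\<bar>boundary_energy f b - boundary_energy f a - a * (f b - f a)\<bar> \<le> \<bar>b - a\<bar> * \<bar>f b - f a\<bar>"
proof -
  have fc: "isCont f x" for x using f(1) by (simp add: continuous_on_eq_continuous_at)
  obtain H where "\<forall>x. - \<infinity> < ereal x \<longrightarrow> ereal x < \<infinity> \<longrightarrow> (H has_vector_derivative f x) (at x)"
    using einterval_antiderivative[of "-\<infinity>" "\<infinity>" f] fc by auto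
  then have H: "(H has_vector_derivative f x) (at x)" for x by simp
  have LB: "(LBINT \<sigma>=0..s. f \<sigma>) = H s - H 0" for s :: real
    using interval_integral_FTC_finite[of 0 s f H] f(1) H
    by (simp add: zero_ereal_def has_vector_derivative_at_within continuous_on_subset)
  have eq: "boundary_energy f b - boundary_energy f a - a * (f b - f a) = (b - a) * f b - (H b - H a)"
    unfolding boundary_energy_def LB by (simp add: algebra_simps)
  have Hd: "(H has_real_derivative f x) (at x)" for x using H by (simp add: has_real_derivative_iff_has_vector_derivative)
  have "\<exists>\<xi>. \<bar>f b - f \<xi>\<bar> \<le> \<bar>f b - f a\<bar> \<and> H b - H a = (b - a) * f \<xi>"
  proof (cases a b rule: linorder_cases)
    case less
    obtain \<xi> where "a < \<xi>" "\<xi> < b" "H b - H a = (b - a) * f \<xi>" using MVT2[OF less, of H f] Hd by blast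
    then show ?thesis using monoD[OF f(2), of a \<xi>] monoD[OF f(2), of \<xi> b] by (intro exI[of _ \<xi>]) auto
  next
    case greater
    obtain \<xi> where "b < \<xi>" "\<xi> < a" "H a - H b = (a - b) * f \<xi>" using MVT2[OF greater, of H f] Hd by blast
    then show ?thesis using monoD[OF f(2), of b \<xi>] monoD[OF f(2), of \<xi> a] by (intro exI[of _ \<xi>]) (auto simp: algebra_simps)
  qed auto
  then obtain \<xi> where \<xi>: "\<bar>f b - f \<xi>\<bar> \<le> \<bar>f b - f a\<bar>" "H b - H a = (b - a) * f \<xi>" by blast
  have "(b - a) * f b - (H b - H a) = (b - a) * (f b - f \<xi>)" unfolding \<xi>(2) by (simp add: algebra_simps)
  then show ?thesis unfolding eq using mult_left_mono[OF \<xi>(1), of "\<bar>b - a\<bar>"] by (simp add: abs_mult)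
qed

text \<open>The chain rule dF = s df, where neither f nor p is assumed differentiable, only their
  composition: the error in the difference quotient is \<bar>p s - p t\<bar> times a convergent
  quotient.\<close>

lemma boundary_energy_deriv:
  assumes f: "continuous_on UNIV f" "mono f" and p: "continuous (at t within S) p"
    and d: "((\<lambda>s. f (p s)) has_real_derivative q) (at t within S)"
  shows "((\<lambda>s. boundary_energy f (p s)) has_real_derivative p t * q) (at t within S)"
proof -
  let ?B = "\<lambda>s. boundary_energy f (p s)" and ?Q = "\<lambda>s. (f (p s) - f (p t)) / (s - t)"
  have Q: "(?Q \<longlongrightarrow> q) (at t within S)" using d by (simp add: has_field_derivative_iff)
  have "((\<lambda>s. \<bar>p s - p t\<bar> * \<bar>?Q s\<bar>) \<longlongrightarrow> \<bar>p t - p t\<bar> * \<bar>q\<bar>) (at t within S)"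
    by (intro tendsto_intros Q) (use p in \<open>simp add: continuous_within\<close>)
  then have z: "((\<lambda>s. \<bar>p s - p t\<bar> * \<bar>?Q s\<bar>) \<longlongrightarrow> 0) (at t within S)" by simp
  have "((\<lambda>s. (?B s - ?B t) / (s - t) - p t * ?Q s) \<longlongrightarrow> 0) (at t within S)"
  proof (rule Lim_null_comparison[OF _ z], rule always_eventually, rule allI)
    fix s
    have "(?B s - ?B t) / (s - t) - p t * ?Q s = (?B s - ?B t - p t * (f (p s) - f (p t))) / (s - t)"
      by (simp add: diff_divide_distrib right_diff_distrib)
    then show "norm ((?B s - ?B t) / (s - t) - p t * ?Q s) \<le> \<bar>p s - p t\<bar> * \<bar>?Q s\<bar>"
      using divide_right_mono[OF boundary_energy_diff[OF f, of "p s" "p t"], of "\<bar>s - t\<bar>"] by simp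
  qed
  from tendsto_add[OF this tendsto_mult[OF tendsto_const Q, of "p t"]]
  show ?thesis unfolding has_field_derivative_iff by simp
qed

context problem
begin

definition "kin p q t = 1 / 2 * integral {0..L} (\<lambda>x. V x * (p x t)\<^sup>2 + (q x t)\<^sup>2)"

lemma kin_split:
  assumes "continuous_on I (\<lambda>x. p x t)" "continuous_on I (\<lambda>x. q x t)"
  shows "kin p q t = 1 / 2 * (integral {0..L} (\<lambda>x. W x * (p x t)\<^sup>2) + integral {0..L} (\<lambda>x. 1 * (q x t)\<^sup>2))"
proof -
  have c: "continuous_on {0..L} (\<lambda>x. (p x t)\<^sup>2)" "continuous_on {0..L} (\<lambda>x. (q x t)\<^sup>2)"
    using assms unfolding I_def by (intro continuous_intros; simp)+
  have i: "(\<lambda>x. V x * (p x t)\<^sup>2) integrable_on {0..L}" by (rule V_mult_integrable[OF c(1)]) (simp add: I_def)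
  have "integral {0..L} (\<lambda>x. V x * (p x t)\<^sup>2) = integral {0..L} (\<lambda>x. W x * (p x t)\<^sup>2)"
    by (rule integral_cong) (simp add: W_def I_def)
  then show ?thesis unfolding kin_def using integral_add[OF i integrable_continuous_real[OF c(2)]] by simp
qed

text \<open>Time differences of the potentials are classical solutions, so that their energy balance can be computed directly.\<close>

lemma difference_energy:
  assumes s: "strip T u p q" and h: "0 < h" and t: "0 \<le> t" "t + h \<le> T"
  defines "P \<equiv> \<lambda>x s. (u x (s + h) - u x s) / h" and "Q \<equiv> \<lambda>x s. (pot q x (s + h) - pot q x s) / h"
  shows "kin P Q t - kin P Q 0 = - integral {0..t} (\<lambda>s. P 0 s * Q 0 s)"
proof -
  define dp where "dp = (\<lambda>x s. (p x (s + h) - p x s) / h)"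
  define dq where "dq = (\<lambda>x s. (q x (s + h) - q x s) / h)"
  note pp = pot_props[OF stripD(3)[OF s]]
  have bal: "\<And>x t. x \<in> I \<Longrightarrow> t \<in> {0..T} \<Longrightarrow> pot q x t = pot q 0 t + integral {0..x} (\<lambda>y. V y * p y t)" by (rule strip_balance[OF s])
  have sT: "r \<in> {0..T}" "r + h \<in> {0..T}" if "r \<in> {0..t}" for r using that t h by auto
  have shift: "continuous_on (I \<times> {0..t}) (\<lambda>(x, s). (g x (s + h) - g x s) / h)" if g: "continuous_on (I \<times> {0..T}) (\<lambda>(x, t). g x t)" for g
  proof -
    have "continuous_on (I \<times> {0..t}) (\<lambda>x. g (fst x) (snd x + h))"
      by (rule continuous_on_compose2[OF g, of _ "\<lambda>x. (fst x, snd x + h)", simplified]) (use sT in \<open>auto intro!: continuous_intros\<close>)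
    moreover have "continuous_on (I \<times> {0..t}) (\<lambda>x. g (fst x) (snd x))"
      using continuous_on_subset[OF g[unfolded split_beta]] sT(1) by (meson Sigma_mono order_refl subsetI)
    ultimately show ?thesis unfolding split_beta using h by (intro continuous_intros) auto
  qed
  have Pc: "continuous_on (I \<times> {0..t}) (\<lambda>(x, s). P x s)" unfolding P_def by (rule shift[OF stripD(1)[OF s]])
  have Qc: "continuous_on (I \<times> {0..t}) (\<lambda>(x, s). Q x s)" unfolding Q_def by (rule shift[OF pp(1)])
  have dpc: "continuous_on (I \<times> {0..t}) (\<lambda>(x, s). dp x s)" unfolding dp_def by (rule shift[OF stripD(2)[OF s]])
  have dqc: "continuous_on (I \<times> {0..t}) (\<lambda>(x, s). dq x s)" unfolding dq_def by (rule shift[OF stripD(3)[OF s]])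
  have td: "((\<lambda>s. (g (s + h) - g s) / h) has_real_derivative (g' (r + h) - g' r) / h) (at r within {0..t})"
    if g: "\<And>s. s \<in> {0..T} \<Longrightarrow> (g has_real_derivative g' s) (at s within {0..T})" and r: "r \<in> {0..t}" for g g' r
  proof -
    have "(g has_real_derivative g' (r + h)) (at (r + h) within (\<lambda>s. s + h) ` {0..t})"
      by (rule DERIV_subset[OF g[OF sT(2)[OF r]]]) (use sT(2) in blast)
    moreover have "((\<lambda>s. s + h) has_real_derivative 1) (at r within {0..t})" by (auto intro!: derivative_eq_intros)
    ultimately have 1: "((\<lambda>s. g (s + h)) has_real_derivative g' (r + h)) (at r within {0..t})"
      using DERIV_image_chain[of g _ "\<lambda>s. s + h" r "{0..t}" 1] by (simp add: o_def)
    have 2: "(g has_real_derivative g' r) (at r within {0..t})"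
      by (rule DERIV_subset[OF g[OF sT(1)[OF r]]]) (use t h in auto)
    show ?thesis by (rule DERIV_cdivide[OF DERIV_diff[OF 1 2]])
  qed
  \<comment> \<open>The partial derivatives that u_t and u_x may lack exist for the difference
    quotients: P_t = dp, P_x = dq, Q_t = dq and, off the jumps, Q_x = V dp.\<close>
  have Pt: "(P x has_real_derivative dp x r) (at r within {0..t})" and Qt: "(Q x has_real_derivative dq x r) (at r within {0..t})"
    if "x \<in> I" "r \<in> {0..t}" for x r
    unfolding P_def Q_def dp_def dq_def using td[OF stripD(4)[OF s that(1)] that(2)] td[OF pp(2)[OF that(1)] that(2)] by auto
  have Px: "((\<lambda>x. P x r) has_real_derivative dq x r) (at x within I)" if "x \<in> I" "r \<in> {0..t}" for x r
    unfolding P_def dq_def using sT[OF that(2)] stripD(5)[OF s that(1)] by (intro DERIV_cdivide DERIV_diff) auto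
  have Qx: "((\<lambda>x. Q x r) has_real_derivative V x * dp x r) (at x within I)" if "x \<in> I" "x \<notin> F" "r \<in> {0..t}" for x r
  proof -
    have px: "((\<lambda>x. pot q x r') has_real_derivative V x * p x r') (at x within I)" if "r' \<in> {0..T}" for r'
      by (rule pot_x_deriv[OF stripD(2)[OF s] bal]) (use \<open>x \<in> I\<close> \<open>x \<notin> F\<close> that in auto)
    have "((\<lambda>x. Q x r) has_real_derivative (V x * p x (r + h) - V x * p x r) / h) (at x within I)"
      unfolding Q_def by (intro DERIV_cdivide DERIV_diff px sT that)
    then show ?thesis by (simp add: dp_def right_diff_distrib)
  qed
  have sq: "continuous_on ({0..L} \<times> {0..t}) (\<lambda>(x, s). (g x s)\<^sup>2)"
     "continuous_on ({0..L} \<times> {0..t}) (\<lambda>(x, s). 2 * g x s * g' x s)"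
    if "continuous_on (I \<times> {0..t}) (\<lambda>(x, s). g x s)" "continuous_on (I \<times> {0..t}) (\<lambda>(x, s). g' x s)" for g g' :: "real \<Rightarrow> real \<Rightarrow> real"
    using that unfolding I_def split_beta by (intro continuous_intros; simp)+
  have sqd: "((\<lambda>s. (g x s)\<^sup>2) has_real_derivative 2 * g x r * g' x r) (at r within {0..t})"
    if "(g x has_real_derivative g' x r) (at r within {0..t})" for g g' :: "real \<Rightarrow> real \<Rightarrow> real" and x r
    using that by (auto intro!: derivative_eq_intros)
  obtain M where M: "\<And>y. \<bar>W y\<bar> \<le> M" using W_bounded by blast
  have Kd: "((\<lambda>s. 1 / 2 * (integral {0..L} (\<lambda>x. W x * (P x s)\<^sup>2) + integral {0..L} (\<lambda>x. 1 * (Q x s)\<^sup>2))) has_real_derivative - (P 0 r * Q 0 r)) (at r within {0..t})"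
    if r: "r \<in> {0..t}" for r
  proof -
    have d1: "((\<lambda>s. integral {0..L} (\<lambda>x. W x * (P x s)\<^sup>2)) has_real_derivative integral {0..L} (\<lambda>x. W x * (2 * P x r * dp x r))) (at r within {0..t})"
      by (rule weighted_leibniz[OF W_measurable M _ sq[OF Pc dpc] _ r]) (use L Pt sqd in \<open>auto simp: I_def\<close>)
    have d2: "((\<lambda>s. integral {0..L} (\<lambda>x. 1 * (Q x s)\<^sup>2)) has_real_derivative integral {0..L} (\<lambda>x. 1 * (2 * Q x r * dq x r))) (at r within {0..t})"
      by (rule weighted_leibniz[where w = "\<lambda>_. 1" and M = 1, OF _ _ _ sq[OF Qc dqc] _ r]) (use L Qt sqd in \<open>auto simp: I_def\<close>)
    note sl = t_slice[OF Pc r] t_slice[OF Qc r] t_slice[OF dpc r] t_slice[OF dqc r]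
    have i1: "(\<lambda>x. V x * (dp x r * P x r)) integrable_on {0..L}"
      by (rule V_mult_integrable) (use sl in \<open>auto intro!: continuous_intros simp: I_def\<close>)
    have i2: "(\<lambda>x. dq x r * Q x r) integrable_on {0..L}"
      by (rule integrable_continuous_real) (use sl in \<open>auto intro!: continuous_intros simp: I_def\<close>)
    \<comment> \<open>The energy density changes at the rate (P Q)_x = Q dq + V P dp. As P Q is
      continuous across the jumps only the end points contribute, and P L = 0 leaves the flux at
      0.\<close>
    have "((\<lambda>x. dq x r * Q x r + V x * (dp x r * P x r)) has_integral P L r * Q L r - P 0 r * Q 0 r) {0..L}"
    proof (rule x_ftc[where H = "\<lambda>x. P x r * Q x r", OF _ zero_I L_I])
      show "continuous_on I (\<lambda>x. P x r * Q x r)" by (intro continuous_intros sl)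
      show "(\<lambda>x. dq x r * Q x r + V x * (dp x r * P x r)) integrable_on {0..L}" by (rule integrable_add[OF i2 i1])
      fix x assume x: "x \<in> G"
      show "((\<lambda>x. dq x r * Q x r + V x * (dp x r * P x r)) \<longlongrightarrow> dq x r * Q x r + V x * (dp x r * P x r)) (at x within I)"
        using sl G_props(1)[OF x] unfolding continuous_on_def by (intro tendsto_intros V_tendsto[OF x]) auto
      assume x': "x \<in> {0<..<L}"
      have "((\<lambda>x. P x r * Q x r) has_real_derivative dq x r * Q x r + V x * dp x r * P x r) (at x)"
        using DERIV_mult[OF Px[OF G_props(1)[OF x] r] Qx[OF G_props(1,2)[OF x] r]] at_I[OF x'] by simp
      then show "((\<lambda>x. P x r * Q x r) has_real_derivative dq x r * Q x r + V x * (dp x r * P x r)) (at x)" by (simp add: mult.assoc)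
    qed (use L in auto)
    moreover have "P L r = 0" unfolding P_def using stripD(8)[OF s] sT[OF r] by simp
    ultimately have H: "integral {0..L} (\<lambda>x. dq x r * Q x r) + integral {0..L} (\<lambda>x. V x * (dp x r * P x r)) = - (P 0 r * Q 0 r)"
      using integral_add[OF i2 i1] by (simp add: integral_unique)
    have e1: "integral {0..L} (\<lambda>x. W x * (2 * P x r * dp x r)) = 2 * integral {0..L} (\<lambda>x. V x * (dp x r * P x r))"
    proof -
      have "integral {0..L} (\<lambda>x. W x * (2 * P x r * dp x r)) = integral {0..L} (\<lambda>x. 2 * (V x * (dp x r * P x r)))"
        by (rule integral_cong) (simp add: W_def I_def)
      then show ?thesis by simp
    qed
    have e2: "integral {0..L} (\<lambda>x. 1 * (2 * Q x r * dq x r)) = 2 * integral {0..L} (\<lambda>x. dq x r * Q x r)"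
    proof -
      have "integral {0..L} (\<lambda>x. 1 * (2 * Q x r * dq x r)) = integral {0..L} (\<lambda>x. 2 * (dq x r * Q x r))"
        by (rule integral_cong) simp
      then show ?thesis by simp
    qed
    have "1 / 2 * (integral {0..L} (\<lambda>x. W x * (2 * P x r * dp x r)) + integral {0..L} (\<lambda>x. 1 * (2 * Q x r * dq x r))) = - (P 0 r * Q 0 r)"
      unfolding e1 e2 using H by simp
    then show ?thesis using DERIV_cmult[OF DERIV_add[OF d1 d2], of "1 / 2"] by (simp only:)
  qed
  have k: "kin P Q r = 1 / 2 * (integral {0..L} (\<lambda>x. W x * (P x r)\<^sup>2) + integral {0..L} (\<lambda>x. 1 * (Q x r)\<^sup>2))" if "r \<in> {0..t}" for r
    by (rule kin_split) (rule t_slice[OF Pc that] t_slice[OF Qc that])+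
  have "((\<lambda>r. - (P 0 r * Q 0 r)) has_integral kin P Q t - kin P Q 0) {0..t}"
  proof -
    have mem: "t \<in> {0..t}" "0 \<in> {0..t}" using t(1) by auto
    show ?thesis unfolding k[OF mem(1)] k[OF mem(2)]
      by (rule integral_of_derivative_within[OF Kd]) (use t(1) in auto)
  qed
  from has_integral_neg[OF this] show ?thesis by (simp add: integral_unique)
qed

lemma difference_quotient_close:
  assumes p: "continuous_on (I \<times> {0..T}) (\<lambda>(x, t). p x t)"
    and u: "\<And>x t. x \<in> I \<Longrightarrow> t \<in> {0..T} \<Longrightarrow> (u x has_real_derivative p x t) (at t within {0..T})" and \<epsilon>: "0 < \<epsilon>"
  shows "\<exists>d>0. \<forall>h x s. 0 < h \<longrightarrow> h < d \<longrightarrow> x \<in> I \<longrightarrow> 0 \<le> s \<longrightarrow> s + h \<le> T \<longrightarrow> \<bar>(u x (s + h) - u x s) / h - p x s\<bar> \<le> \<epsilon>"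
proof -
  obtain d where d: "0 < d" "\<And>y z s t. y \<in> I \<Longrightarrow> z \<in> I \<Longrightarrow> s \<in> {0..T} \<Longrightarrow> t \<in> {0..T} \<Longrightarrow>
           \<bar>y - z\<bar> < d \<Longrightarrow> \<bar>s - t\<bar> < d \<Longrightarrow> \<bar>p y s - p z t\<bar> \<le> \<epsilon>"
    using uniform_on_rect[of L T p \<epsilon>] p \<epsilon> unfolding I_def by blast
  show ?thesis
  proof (intro exI[of _ d] conjI allI impI)
    fix h x s assume *: "0 < h" "h < d" "x \<in> I" "0 \<le> s" "s + h \<le> T"
    let ?J = "{s..s + h}"
    have sub: "?J \<subseteq> {0..T}" using * by auto
    have "norm ((u x (s + h) - (s + h) * p x s) - (u x s - s * p x s)) \<le> \<epsilon> * norm ((s + h) - s)"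
    proof (rule field_differentiable_bound[of ?J "\<lambda>r. u x r - r * p x s" "\<lambda>r. p x r - p x s"])
      fix r assume r: "r \<in> ?J"
      then have rT: "r \<in> {0..T}" using sub by blast
      show "((\<lambda>r. u x r - r * p x s) has_field_derivative p x r - p x s) (at r within ?J)"
        using DERIV_subset[OF u[OF *(3) rT] sub] by (auto intro!: derivative_eq_intros)
      show "norm (p x r - p x s) \<le> \<epsilon>" using d(2)[OF *(3,3) rT, of s] d(1) r * by auto
    qed (use * in auto)
    then have "\<bar>u x (s + h) - u x s - h * p x s\<bar> \<le> \<epsilon> * h" using * by (simp add: algebra_simps)
    moreover have "(u x (s + h) - u x s) / h - p x s = (u x (s + h) - u x s - h * p x s) / h" using * by (simp add: field_simps)
    ultimately show "\<bar>(u x (s + h) - u x s) / h - p x s\<bar> \<le> \<epsilon>" using * by (simp add: pos_divide_le_eq)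
  qed (rule d(1))
qed

text \<open>The balance holds for difference quotients of u and of its potential, which converge
  uniformly to p and q as the step h tends to 0. Every error is linear in the uniform distance
  \<epsilon>. The strict inequality t < T leaves room for t + h.\<close>

lemma kin_balance:
  assumes s: "strip T u p q" and t: "0 \<le> t" "t < T"
  shows "kin p q t - kin p q 0 = - integral {0..t} (\<lambda>s. p 0 s * q 0 s)"
proof -
  note pp = pot_props[OF stripD(3)[OF s]]
  obtain K1 where K1: "\<And>x s. x \<in> I \<Longrightarrow> s \<in> {0..T} \<Longrightarrow> \<bar>p x s\<bar> \<le> K1" using bounded_on_rect[of L T p] stripD(2)[OF s] unfolding I_def by blast
  obtain K2 where K2: "\<And>x s. x \<in> I \<Longrightarrow> s \<in> {0..T} \<Longrightarrow> \<bar>q x s\<bar> \<le> K2" using bounded_on_rect[of L T q] stripD(3)[OF s] unfolding I_def by blast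
  define K where "K = max K1 K2"
  have K: "\<bar>p x s\<bar> \<le> K" "\<bar>q x s\<bar> \<le> K" if "x \<in> I" "s \<in> {0..T}" for x s
    using K1[OF that] K2[OF that] unfolding K_def by auto
  have K0: "0 \<le> K" using K(1)[OF zero_I, of 0] t by auto
  obtain M where M: "\<And>y. \<bar>W y\<bar> \<le> M" using W_bounded by blast
  have M0: "0 \<le> M" using M[of 0] by simp
  \<comment> \<open>Replacing difference quotients by p and q changes squares and products by at
    most \<epsilon> (2 K + 1). The first summand collects the interior energies at the times t and
    0, half each, and the second the boundary flux over [0, t].\<close>
  define C where "C = (M + 1) * (L * (2 * K + 1)) + t * (2 * K + 1)"
  have C0: "0 \<le> C" unfolding C_def using M0 L K0 t by simp
  define A where "A = kin p q t - kin p q 0 + integral {0..t} (\<lambda>s. p 0 s * q 0 s)"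
  have "\<bar>A\<bar> \<le> C * \<epsilon>" if \<epsilon>: "0 < \<epsilon>" "\<epsilon> \<le> 1" for \<epsilon>
  proof -
    obtain d1 where d1: "0 < d1" "\<And>h x s. 0 < h \<Longrightarrow> h < d1 \<Longrightarrow> x \<in> I \<Longrightarrow> 0 \<le> s \<Longrightarrow> s + h \<le> T \<Longrightarrow> \<bar>(u x (s + h) - u x s) / h - p x s\<bar> \<le> \<epsilon>"
      using difference_quotient_close[OF stripD(2,4)[OF s] \<epsilon>(1)] by blast
    obtain d2 where d2: "0 < d2" "\<And>h x s. 0 < h \<Longrightarrow> h < d2 \<Longrightarrow> x \<in> I \<Longrightarrow> 0 \<le> s \<Longrightarrow> s + h \<le> T \<Longrightarrow> \<bar>(pot q x (s + h) - pot q x s) / h - q x s\<bar> \<le> \<epsilon>"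
      using difference_quotient_close[OF stripD(3)[OF s] pp(2) \<epsilon>(1)] by blast
    define h where "h = min (min d1 d2) (T - t) / 2"
    have h: "0 < h" "h < d1" "h < d2" "t + h \<le> T" unfolding h_def using d1(1) d2(1) t by (auto simp: min_def field_simps)
    define P where "P = (\<lambda>x s. (u x (s + h) - u x s) / h)"
    define Q where "Q = (\<lambda>x s. (pot q x (s + h) - pot q x s) / h)"
    have PQ: "\<bar>P x r - p x r\<bar> \<le> \<epsilon>" "\<bar>Q x r - q x r\<bar> \<le> \<epsilon>" if "x \<in> I" "r \<in> {0..t}" for x r
      unfolding P_def Q_def using d1(2)[OF h(1,2) that(1), of r] d2(2)[OF h(1,3) that(1), of r] h(4) that(2) by auto
    have sq: "\<bar>a\<^sup>2 - b\<^sup>2\<bar> \<le> \<epsilon> * (2 * K + 1)" if "\<bar>a - b\<bar> \<le> \<epsilon>" "\<bar>b\<bar> \<le> K" for a b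
    proof -
      have "a\<^sup>2 - b\<^sup>2 = (a - b) * (a + b)" by (simp add: power2_eq_square algebra_simps)
      moreover have "\<bar>a + b\<bar> \<le> 2 * K + 1" using that \<epsilon> by linarith
      ultimately show ?thesis using that \<epsilon> by (simp add: abs_mult mult_mono)
    qed
    have slice: "continuous_on {0..L} (\<lambda>x. p x r)" "continuous_on {0..L} (\<lambda>x. q x r)"
       "continuous_on {0..L} (\<lambda>x. P x r)" "continuous_on {0..L} (\<lambda>x. Q x r)" if r: "r \<in> {0..t}" for r
    proof -
      have rT: "r \<in> {0..T}" "r + h \<in> {0..T}" using r t h by auto
      show "continuous_on {0..L} (\<lambda>x. p x r)" "continuous_on {0..L} (\<lambda>x. q x r)"
        using t_slice[OF stripD(2)[OF s] rT(1)] t_slice[OF stripD(3)[OF s] rT(1)] unfolding I_def by auto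
      show "continuous_on {0..L} (\<lambda>x. P x r)" "continuous_on {0..L} (\<lambda>x. Q x r)" unfolding P_def Q_def
        using t_slice[OF stripD(1)[OF s] rT(1)] t_slice[OF stripD(1)[OF s] rT(2)] t_slice[OF pp(1) rT(1)] t_slice[OF pp(1) rT(2)] h(1)
        unfolding I_def by (intro continuous_intros; simp)+
    qed
    have kc: "\<bar>kin P Q r - kin p q r\<bar> \<le> \<epsilon> * ((M + 1) * (L * (2 * K + 1))) / 2" if r: "r \<in> {0..t}" for r
    proof -
      note c = slice[OF r]
      have rT: "r \<in> {0..T}" using r t by auto
      have diff: "\<bar>integral {0..L} (\<lambda>x. w x * (g x)\<^sup>2) - integral {0..L} (\<lambda>x. w x * (g' x)\<^sup>2)\<bar> \<le> M' * (L * (\<epsilon> * (2 * K + 1)))"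
        if w: "w \<in> borel_measurable borel" "\<And>y. \<bar>w y\<bar> \<le> M'" and g: "continuous_on {0..L} g" "continuous_on {0..L} g'"
          and cl: "\<And>x. x \<in> {0..L} \<Longrightarrow> \<bar>g x - g' x\<bar> \<le> \<epsilon> \<and> \<bar>g' x\<bar> \<le> K" for w M' and g g' :: "real \<Rightarrow> real"
      proof -
        have gc: "continuous_on {0..L} (\<lambda>x. (g x)\<^sup>2)" "continuous_on {0..L} (\<lambda>x. (g' x)\<^sup>2)" by (intro continuous_intros g)+
        have "integral {0..L} (\<lambda>x. w x * (g x)\<^sup>2) - integral {0..L} (\<lambda>x. w x * (g' x)\<^sup>2) = integral {0..L} (\<lambda>x. w x * ((g x)\<^sup>2 - (g' x)\<^sup>2))"
          using integral_diff[OF integrable_mult_bounded_borel[OF w gc(1)] integrable_mult_bounded_borel[OF w gc(2)]] by (simp add: right_diff_distrib)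
        also have "\<bar>\<dots>\<bar> \<le> M' * integral {0..L} (\<lambda>_. \<epsilon> * (2 * K + 1))"
          by (rule integral_mult_bounded_borel_bound[OF w]) (use gc cl sq in \<open>auto intro!: continuous_intros\<close>)
        finally show ?thesis using L by (simp add: mult_ac)
      qed
      have "\<bar>integral {0..L} (\<lambda>x. W x * (P x r)\<^sup>2) - integral {0..L} (\<lambda>x. W x * (p x r)\<^sup>2)\<bar> \<le> M * (L * (\<epsilon> * (2 * K + 1)))"
        by (rule diff[OF W_measurable M c(3,1)]) (use PQ(1) K(1) r rT in \<open>auto simp: I_def\<close>)
      moreover have "\<bar>integral {0..L} (\<lambda>x. 1 * (Q x r)\<^sup>2) - integral {0..L} (\<lambda>x. 1 * (q x r)\<^sup>2)\<bar> \<le> 1 * (L * (\<epsilon> * (2 * K + 1)))"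
        by (rule diff[OF borel_measurable_const _ c(4,2)]) (use PQ(2) K(2) r rT in \<open>auto simp: I_def\<close>)
      moreover have "kin P Q r = 1 / 2 * (integral {0..L} (\<lambda>x. W x * (P x r)\<^sup>2) + integral {0..L} (\<lambda>x. 1 * (Q x r)\<^sup>2))"
         "kin p q r = 1 / 2 * (integral {0..L} (\<lambda>x. W x * (p x r)\<^sup>2) + integral {0..L} (\<lambda>x. 1 * (q x r)\<^sup>2))"
        using kin_split[of P r Q] kin_split[of p r q] c unfolding I_def by auto
      moreover have "M * (L * (\<epsilon> * (2 * K + 1))) + 1 * (L * (\<epsilon> * (2 * K + 1))) = \<epsilon> * ((M + 1) * (L * (2 * K + 1)))"
        by (simp add: algebra_simps)
      moreover have "\<bar>k - k'\<bar> \<le> z / 2" if "\<bar>a - b\<bar> \<le> x" "\<bar>c - d\<bar> \<le> y" "k = 1 / 2 * (a + c)" "k' = 1 / 2 * (b + d)" "x + y = z"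
        for a b c d x y z k k' :: real
        using that(1,2,5) unfolding that(3,4) by (auto simp: abs_le_iff field_simps)
      ultimately show ?thesis by blast
    qed
    have bnd: "\<bar>integral {0..t} (\<lambda>s. P 0 s * Q 0 s) - integral {0..t} (\<lambda>s. p 0 s * q 0 s)\<bar> \<le> t * (\<epsilon> * (2 * K + 1))"
    proof -
      have sub: "{0..t} \<subseteq> {0..T}" using t by auto
      have base: "continuous_on {0..t} (\<lambda>s. g 0 s)" "continuous_on {0..t} (\<lambda>s. g 0 (s + h))" if "continuous_on (I \<times> {0..T}) (\<lambda>(x, t). g x t)" for g :: "real \<Rightarrow> real \<Rightarrow> real"
        by (rule continuous_on_subset[OF x_slice[OF that zero_I] sub],
            rule continuous_on_compose2[OF x_slice[OF that zero_I]]) (use h t in \<open>auto intro!: continuous_intros\<close>)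
      have c0: "continuous_on {0..t} (\<lambda>s. p 0 s)" "continuous_on {0..t} (\<lambda>s. q 0 s)" "continuous_on {0..t} (\<lambda>s. P 0 s)" "continuous_on {0..t} (\<lambda>s. Q 0 s)"
        unfolding P_def Q_def using h(1) by (intro continuous_intros base stripD(1,2,3)[OF s] pp(1); simp)+
      have i: "(\<lambda>s. P 0 s * Q 0 s) integrable_on {0..t}" "(\<lambda>s. p 0 s * q 0 s) integrable_on {0..t}"
        by (intro integrable_continuous_real continuous_intros c0)+
      have "\<bar>integral {0..t} (\<lambda>s. P 0 s * Q 0 s) - integral {0..t} (\<lambda>s. p 0 s * q 0 s)\<bar> = norm (integral {0..t} (\<lambda>s. P 0 s * Q 0 s - p 0 s * q 0 s))"
        using integral_diff[OF i] by simp
      also have "\<dots> \<le> integral {0..t} (\<lambda>_. \<epsilon> * (2 * K + 1))"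
      proof (rule integral_norm_bound_integral[OF integrable_diff[OF i]])
        fix r assume r: "r \<in> {0..t}"
        have rT: "r \<in> {0..T}" using r sub by blast
        have "P 0 r * Q 0 r - p 0 r * q 0 r = (P 0 r - p 0 r) * Q 0 r + p 0 r * (Q 0 r - q 0 r)" by (simp add: algebra_simps)
        also have "\<bar>\<dots>\<bar> \<le> \<bar>P 0 r - p 0 r\<bar> * \<bar>Q 0 r\<bar> + \<bar>p 0 r\<bar> * \<bar>Q 0 r - q 0 r\<bar>" by (metis abs_mult abs_triangle_ineq)
        also have "\<dots> \<le> \<epsilon> * (K + 1) + K * \<epsilon>"
          using PQ[OF zero_I r] K[OF zero_I rT] \<epsilon> K0 by (intro add_mono mult_mono) auto
        finally show "norm (P 0 r * Q 0 r - p 0 r * q 0 r) \<le> \<epsilon> * (2 * K + 1)" by (simp add: algebra_simps)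
      qed auto
      also have "\<dots> = t * (\<epsilon> * (2 * K + 1))" using t by simp
      finally show ?thesis .
    qed
    have de: "kin P Q t - kin P Q 0 = - integral {0..t} (\<lambda>s. P 0 s * Q 0 s)"
      unfolding P_def Q_def by (rule difference_energy[OF s h(1) t(1) h(4)])
    have "\<bar>A\<bar> \<le> \<epsilon> * ((M + 1) * (L * (2 * K + 1))) + t * (\<epsilon> * (2 * K + 1))"
    proof -
      have "\<bar>a0 - b0 + i\<bar> \<le> x + y" if "\<bar>a - a0\<bar> \<le> x / 2" "\<bar>b - b0\<bar> \<le> x / 2" "\<bar>j - i\<bar> \<le> y" "a - b = - j" for a a0 b b0 i j x y :: real
        using that unfolding abs_le_iff by linarith
      from this[OF kc kc bnd de] show ?thesis using t(1) unfolding A_def by simp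
    qed
    also have "\<dots> = C * \<epsilon>" unfolding C_def by (simp add: algebra_simps)
    finally show ?thesis .
  qed
  then have small: "\<bar>A\<bar> \<le> C * \<epsilon>" if "0 < \<epsilon>" "\<epsilon> \<le> 1" for \<epsilon> using that by blast
  have "\<bar>A\<bar> \<le> 0"
  proof (rule field_le_epsilon)
    fix e :: real assume e: "0 < e"
    define \<epsilon> where "\<epsilon> = min 1 (e / (C + 1))"
    have "0 < \<epsilon>" "\<epsilon> \<le> 1" "\<epsilon> \<le> e / (C + 1)" unfolding \<epsilon>_def using e C0 by auto
    moreover have "C * \<epsilon> \<le> (C + 1) * (e / (C + 1))" using C0 calculation by (intro mult_mono) auto
    ultimately show "\<bar>A\<bar> \<le> 0 + e" using small[of \<epsilon>] C0 by (simp add: add_nonneg_eq_0_iff)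
  qed
  then show ?thesis unfolding A_def by simp
qed

text \<open>The energy is a Lebesgue integral, whereas the computations use the gauge integral. They
  agree once the integrand is Lebesgue integrable, which follows by bounding the Borel weight
  W.\<close>

lemma energy_eq:
  assumes u: "\<And>x. x \<in> I \<Longrightarrow> dt u x t = p x t \<and> dx L u x t = q x t"
    and c: "continuous_on I (\<lambda>x. p x t)" "continuous_on I (\<lambda>x. q x t)"
  shows "energy L V f u t = kin p q t + boundary_energy f (p 0 t)"
proof -
  let ?g = "\<lambda>x. V x * (p x t)\<^sup>2 + (q x t)\<^sup>2"
  obtain M where M: "\<And>y. \<bar>W y\<bar> \<le> M" using W_bounded by blast
  have cc: "continuous_on {0..L} (\<lambda>x. (p x t)\<^sup>2)" "continuous_on {0..L} (\<lambda>x. (q x t)\<^sup>2)"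
    using c unfolding I_def by (intro continuous_intros; simp)+
  note b = borel_integrable_atLeastAtMost'[OF cc(1), unfolded set_integrable_def]
  have "integrable lborel (\<lambda>x. W x * (indicator {0..L} x *\<^sub>R (p x t)\<^sup>2))"
  proof (rule Bochner_Integration.integrable_bound[OF integrable_mult_right[OF b, of M]])
    show "(\<lambda>x. W x * (indicator {0..L} x *\<^sub>R (p x t)\<^sup>2)) \<in> borel_measurable lborel"
      using W_measurable borel_measurable_integrable[OF b] by simp
    have "norm (W x * (indicator {0..L} x *\<^sub>R (p x t)\<^sup>2)) \<le> norm (M * (indicator {0..L} x *\<^sub>R (p x t)\<^sup>2))" for x
      using M[of x] by (simp add: abs_mult mult_right_mono)
    then show "AE x in lborel. norm (W x * (indicator {0..L} x *\<^sub>R (p x t)\<^sup>2)) \<le> norm (M * (indicator {0..L} x *\<^sub>R (p x t)\<^sup>2))" by simp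
  qed
  then have "set_integrable lborel {0..L} (\<lambda>x. V x * (p x t)\<^sup>2)" unfolding set_integrable_def
    by (rule Bochner_Integration.integrable_cong[THEN iffD1, rotated -1]) (auto simp: W_def I_def indicator_def)
  from set_integral_add(1)[OF this borel_integrable_atLeastAtMost'[OF cc(2)]]
  have gi: "set_integrable lborel {0..L} ?g" .
  have "(LBINT x=0..L. V x * (dt u x t)\<^sup>2 + (dx L u x t)\<^sup>2) = (LBINT x:{0..L}. V x * (dt u x t)\<^sup>2 + (dx L u x t)\<^sup>2)"
    using interval_integral_Icc[of 0 L] L by (simp add: zero_ereal_def)
  also have "\<dots> = (LBINT x:{0..L}. ?g x)"
    by (rule set_lebesgue_integral_cong) (use u in \<open>auto simp: I_def\<close>)
  also have "\<dots> = integral {0..L} ?g" by (rule set_borel_integral_eq_integral(2)[OF gi])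
  finally show ?thesis unfolding energy_def kin_def using u[OF zero_I] by simp
qed

text \<open>The interior energy loses the time integral of u_t u_x at x = 0, and the boundary energy
  gains the same amount, since its rate is u_t times the derivative u_x of f(u_t).\<close>

lemma energy_conserved:
  assumes s: "\<And>T. 0 < T \<Longrightarrow> strip T u p q" and t: "0 \<le> t"
  shows "energy L V f u t = energy L V f u 0"
proof -
  define T where "T = t + 1"
  have T: "0 < T" "t < T" using t unfolding T_def by auto
  note sT = s[OF T(1)]
  have e: "energy L V f u r = kin p q r + boundary_energy f (p 0 r)" if "r \<in> {0..T}" for r
  proof (rule energy_eq)
    show "dt u x r = p x r \<and> dx L u x r = q x r" if "x \<in> I" for x
      by (rule strip_imp_global(2)[OF s]) (use that \<open>r \<in> {0..T}\<close> in auto)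
  qed (rule t_slice[OF stripD(2)[OF sT] that] t_slice[OF stripD(3)[OF sT] that])+
  have "((\<lambda>s. boundary_energy f (p 0 s)) has_real_derivative p 0 r * q 0 r) (at r within {0..T})" if r: "r \<in> {0..T}" for r
    using x_slice[OF stripD(2)[OF sT] zero_I] r strict_mono_mono[OF f_props(1)]
    by (intro boundary_energy_deriv[OF f_props(2) _ _ stripD(7)[OF sT r]]) (auto simp: continuous_on_eq_continuous_within)
  from integral_of_derivative_within[OF this, of 0 t] T t
  have "boundary_energy f (p 0 t) - boundary_energy f (p 0 0) = integral {0..t} (\<lambda>s. p 0 s * q 0 s)"
    by (simp add: integral_unique)
  moreover have "kin p q t - kin p q 0 = - integral {0..t} (\<lambda>s. p 0 s * q 0 s)" by (rule kin_balance[OF sT t T(2)])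
  ultimately show ?thesis using e[of t] e[of 0] T t by simp
qed

lemma well_posed:
  "\<exists>u. global_C1_solution L V f u0 u1 u \<and>
     (\<forall>v. global_C1_solution L V f u0 u1 v \<longrightarrow> (\<forall>x\<in>{0..L}. \<forall>t\<in>{0..}. v x t = u x t)) \<and>
     (\<forall>t\<in>{0..}. energy L V f u t = energy L V f u 0)"
proof -
  obtain u p q where s: "\<And>T. 0 < T \<Longrightarrow> strip T u p q" using global_strip by blast
  show ?thesis
  proof (intro exI[of _ u] conjI allI impI ballI)
    show "global_C1_solution L V f u0 u1 u" by (rule strip_imp_global(1)[OF s])
    show "energy L V f u t = energy L V f u 0" if "t \<in> {0..}" for t
      by (rule energy_conserved[OF s]) (use that in auto)
    fix v x t assume v: "global_C1_solution L V f u0 u1 v" and x: "x \<in> {0..L}" and t: "t \<in> {0 :: real..}"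
    then have T: "0 < t + 1" by simp
    show "v x t = u x t"
      by (rule strip_unique(1)[OF T global_imp_strip[OF v T] s[OF T]]) (use x t in \<open>auto simp: I_def\<close>)
  qed
qed

end

theorem theorem1p8:
  fixes L :: real and V f u0 u1 :: "real \<Rightarrow> real"
  assumes "L > 0"
    and "A0 L u0 u1" and "A1 L V" and "A2 L V" and "A3 f"
    and compatible: "u0 L = 0" "u1 L = 0"
  shows "\<exists>u. global_C1_solution L V f u0 u1 u \<and>
           (\<forall>v. global_C1_solution L V f u0 u1 v \<longrightarrow> (\<forall>x\<in>{0..L}. \<forall>t\<in>{0..}. v x t = u x t)) \<and>
           (\<forall>t\<in>{0..}. energy L V f u t = energy L V f u 0)"
proof -
  interpret coefficient L V by unfold_locales (use assms in auto)
  obtain N node g where "medium L V N node g" using medium_exists by blast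
  then interpret medium L V N node g .
  interpret problem L V N node g f u0 u1 by unfold_locales (use assms in auto)
  show ?thesis by (rule well_posed)
qed

end
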